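(* Let $\mathcal{A}(t)$, $t\in I$, satisfy the standing assumptions given in the context, let $\{\mu_t:t\in I\}$ be the measures described there, and let $p\in(1,+\infty)$. Assume the following. (a) The first order spatial derivatives of $q_{ij}$ and $b_i$ ($i,j=1,\dots,d$) belong to $C^{\alpha/2,\alpha}_{\rm loc}(I\times\mathbb{R}^d)$; there exists a continuous $k:I\to[0,+\infty)$ with $|\nabla_xq_{ij}(t,x)|\le k(t)\eta(t,x)$ for all $(t,x)\in I\times\mathbb{R}^d$, $i,j=1,\dots,d$; there exists a continuous $m:I\to\mathbb{R}$ with $\langle\nabla_xb(t,x)\xi,\xi\rangle\le m(t)|\xi|^2$ for all $\xi\in\mathbb{R}^d$, $(t,x)\in I\times\mathbb{R}^d$. (b) $\psi:I\times\mathbb{R}\to\mathbb{R}$ is a given function such that $t\mapsto\psi(t,0)$ is in $L^1_{\rm loc}(I)$, and for any $s\in I$, $\tau>s$ there exists $L>0$ with $|\psi(t,\xi)-\psi(t,\eta)|\le L|\xi-\eta|$ for all $t\in[s,\tau]$, $\xi,\eta\in\mathbb{R}$. (c) For any $s\in I$ and $\tau>s$ there exist positive constants $C_i=C_i(s,\tau)$, $i=0,1,2$, such that for any $t\in[s,\tau]$, $x\in\mathbb{R}^d$ $$|Q(t,x)x|\le C_0|x|\varphi(x),\qquad \mathrm{Tr}(Q(t,x))\le C_1(1+|x|)\varphi(x),\qquad\langle b(t,x),x\rangle\le C_2|x|\varphi(x),$$ where $\varphi$ is the Lyapunov function of the standing assumption (iii). (d) There exists $\psi_0\in\mathbb{R}$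 such that $\xi\,\psi(t,\xi)\le\psi_0\,\xi^2$ for all $t\in I$, $\xi\in\mathbb{R}$. Then for every $s\in I$ and every $f\in L^p(\mathbb{R}^d,\mu_s)$, the mild solution $u_f$ of $$D_tu(t,x)=(\mathcal{A}(t)u)(t,x)+\psi(t,u(t,x)),\ t>s,\ x\in\mathbb{R}^d,\qquad u(s,x)=f(x),\ x\in\mathbb{R}^d,$$ satisfies $$\|u_f(t,\cdot)\|_{L^p(\mathbb{R}^d,\mu_t)}\le e^{\psi_0(t-s)}\|f\|_{L^p(\mathbb{R}^d,\mu_s)},\qquad t\ge s.$$ In particular, if $\psi_0<0$ the null solution of $D_tu=\mathcal{A}(t)u+\psi(t,u)$ is exponentially asymptotically stable in $L^p(\mathbb{R}^d,\mu_t)$.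
   Context: Let $d\ge1$ and let $I$ be either an open right half-line or $I=\mathbb{R}$. For $t\in I$ let $(\mathcal{A}(t)\zeta)(x)=\sum_{i,j=1}^d q_{ij}(t,x)D_{ij}\zeta(x)+\sum_{i=1}^d b_i(t,x)D_i\zeta(x)$, $x\in\mathbb{R}^d$, with real, possibly unbounded coefficients; $Q=[q_{ij}]$, $b=(b_1,\dots,b_d)$. Standing assumptions on $\mathcal{A}(t)$: (i) $q_{ij},b_i\in C^{\alpha/2,\alpha}_{\rm loc}(I\times\mathbb{R}^d)$ for some $\alpha\in(0,1)$ (parabolic Hölder continuity on compact sets: exponent $\alpha/2$ in $t$, $\alpha$ in $x$); (ii) $Q(t,x)$ is symmetric and $\langle Q(t,x)\xi,\xi\rangle\ge\eta(t,x)|\xi|^2$ for all $(t,x)\in I\times\mathbb{R}^d$, $\xi\in\mathbb{R}^d$, for some $\eta:I\times\mathbb{R}^d\to\mathbb{R}$ with $\inf\eta=\eta_0>0$; (iii) there exist a nonnegative $\varphi\in C^2(\mathbb{R}^d)$ and constants $a,c>0$ with $\lim_{|x|\to+\infty}\varphi(x)=+\infty$ and $(\mathcal{A}(t)\varphi)(x)\le a-c\,\varphi(x)$ for all $(t,x)\in I\times\mathbb{R}^d$. Evolution operator (known to be well defined under these assumptions): for $s\in I$ and $f\in C_b(\mathbb{R}^d)$ (bounded continuous real functions), $(t,x)\mapsto(G(t,s)f)(x)$ is the unique function in $C_b([s,+\infty)\times\mathbb{R}^d)\cap C^{1,2}((s,+\infty)\times\mathbb{R}^d)$ with $D_tu=\mathcal{A}(t)u$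 in $(s,+\infty)\times\mathbb{R}^d$, $u(s,\cdot)=f$. Measures: $\{\mu_t:t\in I\}$ is a fixed tight evolution system of measures (known to exist), i.e. a tight family of Borel probability measures on $\mathbb{R}^d$ with $\int_{\mathbb{R}^d}G(t,s)f\,d\mu_t=\int_{\mathbb{R}^d}f\,d\mu_s$ for $t>s\in I$, $f\in C_b(\mathbb{R}^d)$, and with $\sup_{t\in I}\int_{\mathbb{R}^d}\varphi\,d\mu_t<+\infty$. For $1\le p<\infty$ and $t>s$, $G(t,s)$ extends uniquely to a contraction (same notation) from $L^p(\mathbb{R}^d,\mu_s)$ to $L^p(\mathbb{R}^d,\mu_t)$. $\nu$ is the Borel measure on $I\times\mathbb{R}^d$ determined by $\nu(J\times\mathcal{O})=\int_J\mu_t(\mathcal{O})\,dt$ for Borel $J\subset I$, $\mathcal{O}\subset\mathbb{R}^d$. Mild solution in $[s,\tau]$: a function $u:[s,\tau]\times\mathbb{R}^d\to\mathbb{R}$ such that for a.e. $x\in\mathbb{R}^d$ and any $t\in(s,\tau]$ the function $r\mapsto(G(t,r)\psi(r,u(r,\cdot)))(x)$ is integrable in $(s,t)$, and $u(t,x)=(G(t,s)f)(x)+\int_s^t(G(t,r)\psi(r,u(r,\cdot)))(x)\,dr$ for any $t\in[s,\tau]$ and a.e. $x\in\mathbb{R}^d$. Under the standing assumptions and (b), the paper proves that for every $s\in I$ and $f\in L^p(\mathbb{R}^d,\mu_s)$ there is, for every $\tau>s$, a unique mild solution in $[s,\tau]$ belonging to $L^p([s,\tau]\times\mathbb{R}^d,\nu)$;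 $u_f$ denotes this solution, defined on $[s,+\infty)\times\mathbb{R}^d$. The null solution is asymptotically stable in $L^p(\mathbb{R}^d,\mu_t)$ if for any $\varepsilon>0$ and $s\in I$ there exists $\delta>0$ such that $\|f\|_{L^p(\mathbb{R}^d,\mu_s)}\le\delta$ implies $\|u_f(t,\cdot)\|_{L^p(\mathbb{R}^d,\mu_t)}\le\varepsilon$ for any $t\ge s$, and moreover there exists $\delta>0$ such that $\|f\|_{L^p(\mathbb{R}^d,\mu_s)}\le\delta$ implies $\|u_f(t,\cdot)\|_{L^p(\mathbb{R}^d,\mu_t)}\to0$ as $t\to+\infty$; "exponentially" means that this convergence is at an exponential rate. The standing assumption, made in this part of the paper, that $\psi(t,0)=0$ for all $t\in I$ is implied by (b) and (d). *)

theory Defs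
  imports "HOL-Analysis.Analysis"
begin

section \<open>Function spaces\<close>

definition pD :: "'n::finite \<Rightarrow> (real ^ 'n \<Rightarrow> real) \<Rightarrow> real ^ 'n \<Rightarrow> real" where
  "pD i f x = deriv (\<lambda>h. f (x + h *\<^sub>R axis i 1)) 0"

definition has_pD :: "'n::finite \<Rightarrow> (real ^ 'n \<Rightarrow> real) \<Rightarrow> real ^ 'n \<Rightarrow> bool" where
  "has_pD i f x \<longleftrightarrow> (\<lambda>h. f (x + h *\<^sub>R axis i 1)) field_differentiable (at 0)"

definition grad :: "(real ^ 'n::finite \<Rightarrow> real) \<Rightarrow> real ^ 'n \<Rightarrow> real ^ 'n" where
  "grad f x = (\<chi> i. pD i f x)"

definition jacobi :: "(real ^ 'n::finite \<Rightarrow> real ^ 'n) \<Rightarrow> real ^ 'n \<Rightarrow> real ^ 'n ^ 'n" where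
  "jacobi b x = (\<chi> i j. pD j (\<lambda>y. b y $ i) x)"

definition C2_space :: "(real ^ 'n::finite \<Rightarrow> real) set" where
  "C2_space = {f. continuous_on UNIV f \<and>
     (\<forall>i. (\<forall>x. has_pD i f x) \<and> continuous_on UNIV (pD i f)) \<and>
     (\<forall>i j. (\<forall>x. has_pD i (pD j f) x) \<and> continuous_on UNIV (pD i (pD j f)))}"

text \<open>Functions of time and space are curried. The next two sets are
  C^{1,2}((s,+oo) x R^d) and C_b([s,+oo) x R^d); the values at earlier times are irrelevant.\<close>

definition C12_after :: "real \<Rightarrow> (real \<Rightarrow> real ^ 'n::finite \<Rightarrow> real) set" where
  "C12_after s = {u.
     continuous_on ({s<..} \<times> UNIV) (\<lambda>(t, x). u t x) \<and>
     (\<forall>t>s. \<forall>x. (\<lambda>r. u r x) field_differentiable (at t)) \<and>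
     continuous_on ({s<..} \<times> UNIV) (\<lambda>(t, x). deriv (\<lambda>r. u r x) t) \<and>
     (\<forall>i. (\<forall>t>s. \<forall>x. has_pD i (u t) x) \<and>
          continuous_on ({s<..} \<times> UNIV) (\<lambda>(t, x). pD i (u t) x)) \<and>
     (\<forall>i j. (\<forall>t>s. \<forall>x. has_pD i (pD j (u t)) x) \<and>
          continuous_on ({s<..} \<times> UNIV) (\<lambda>(t, x). pD i (pD j (u t)) x))}"

definition Cb_from :: "real \<Rightarrow> (real \<Rightarrow> real ^ 'n::finite \<Rightarrow> real) set" where
  "Cb_from s = {u. continuous_on ({s..} \<times> UNIV) (\<lambda>(t, x). u t x) \<and>
     bounded ((\<lambda>(t, x). u t x) ` ({s..} \<times> UNIV))}"

text \<open>Parabolic Hoelder continuity on every compact subset of I x R^d.\<close>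

definition holder_loc :: "real \<Rightarrow> real set \<Rightarrow> (real \<Rightarrow> real ^ 'n::finite \<Rightarrow> real) \<Rightarrow> bool" where
  "holder_loc \<alpha> I f \<longleftrightarrow> (\<forall>K. compact K \<and> K \<subseteq> I \<times> UNIV \<longrightarrow>
     (\<exists>C. \<forall>(t, x)\<in>K. \<forall>(s, y)\<in>K.
        \<bar>f t x - f s y\<bar> \<le> C * (\<bar>t - s\<bar> powr (\<alpha> / 2) + norm (x - y) powr \<alpha>)))"

text \<open>Functions, not classes. Measurability with respect to the completion means being almost
  everywhere equal to a measurable function, so that membership and norm depend only on the
  almost-everywhere class.\<close>

definition Lp_space :: "real \<Rightarrow> 'a measure \<Rightarrow> ('a \<Rightarrow> real) set" where
  "Lp_space p M = {f. f \<in> borel_measurable (completion M) \<and>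
     integrable (completion M) (\<lambda>x. \<bar>f x\<bar> powr p)}"

definition Lp_norm :: "real \<Rightarrow> 'a measure \<Rightarrow> ('a \<Rightarrow> real) \<Rightarrow> real" where
  "Lp_norm p M f = (\<integral>x. \<bar>f x\<bar> powr p \<partial>completion M) powr (1 / p)"


section \<open>The operators and the evolution operator\<close>

definition ell_op :: "(real \<Rightarrow> real ^ 'n \<Rightarrow> real ^ 'n ^ 'n) \<Rightarrow> (real \<Rightarrow> real ^ 'n \<Rightarrow> real ^ 'n)
    \<Rightarrow> real \<Rightarrow> (real ^ 'n \<Rightarrow> real) \<Rightarrow> real ^ 'n::finite \<Rightarrow> real" where
  "ell_op q b t \<zeta> x =
     (\<Sum>i\<in>UNIV. \<Sum>j\<in>UNIV. q t x $ i $ j * pD i (pD j \<zeta>) x) + (\<Sum>i\<in>UNIV. b t x $ i * pD i \<zeta> x)"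

definition standing_assumptions :: "real set \<Rightarrow> (real \<Rightarrow> real ^ 'n \<Rightarrow> real ^ 'n ^ 'n)
    \<Rightarrow> (real \<Rightarrow> real ^ 'n \<Rightarrow> real ^ 'n) \<Rightarrow> real \<Rightarrow> (real \<Rightarrow> real ^ 'n \<Rightarrow> real)
    \<Rightarrow> (real ^ 'n::finite \<Rightarrow> real) \<Rightarrow> bool" where
  "standing_assumptions I q b \<alpha> \<eta> \<phi> \<longleftrightarrow>
     (I = UNIV \<or> (\<exists>t\<^sub>0. I = {t\<^sub>0<..})) \<and>
     0 < \<alpha> \<and> \<alpha> < 1 \<and>
     (\<forall>i j. holder_loc \<alpha> I (\<lambda>t x. q t x $ i $ j)) \<and>
     (\<forall>i. holder_loc \<alpha> I (\<lambda>t x. b t x $ i)) \<and>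
     (\<forall>t\<in>I. \<forall>x. transpose (q t x) = q t x) \<and>
     (\<forall>t\<in>I. \<forall>x \<xi>. (q t x *v \<xi>) \<bullet> \<xi> \<ge> \<eta> t x * (norm \<xi>)\<^sup>2) \<and>
     (\<exists>\<eta>\<^sub>0>0. \<forall>t\<in>I. \<forall>x. \<eta> t x \<ge> \<eta>\<^sub>0) \<and>
     \<phi> \<in> C2_space \<and> (\<forall>x. \<phi> x \<ge> 0) \<and> filterlim \<phi> at_top at_infinity \<and>
     (\<exists>a>0. \<exists>c>0. \<forall>t\<in>I. \<forall>x. ell_op q b t \<phi> x \<le> a - c * \<phi> x)"

definition bounded_classical_solution :: "(real \<Rightarrow> real ^ 'n \<Rightarrow> real ^ 'n ^ 'n)
    \<Rightarrow> (real \<Rightarrow> real ^ 'n \<Rightarrow> real ^ 'n) \<Rightarrow> real \<Rightarrow> (real ^ 'n \<Rightarrow> real)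
    \<Rightarrow> (real \<Rightarrow> real ^ 'n::finite \<Rightarrow> real) \<Rightarrow> bool" where
  "bounded_classical_solution q b s f u \<longleftrightarrow>
     u \<in> Cb_from s \<and> u \<in> C12_after s \<and>
     (\<forall>t>s. \<forall>x. deriv (\<lambda>r. u r x) t = ell_op q b t (u t) x) \<and>
     (\<forall>x. u s x = f x)"

text \<open>\<open>G t s f\<close> is G(t,s)f; only \<open>t \<ge> s\<close>, \<open>s \<in> I\<close> and bounded continuous \<open>f\<close> are relevant.\<close>

definition evolution_operator :: "real set \<Rightarrow> (real \<Rightarrow> real ^ 'n \<Rightarrow> real ^ 'n ^ 'n)
    \<Rightarrow> (real \<Rightarrow> real ^ 'n \<Rightarrow> real ^ 'n)
    \<Rightarrow> (real \<Rightarrow> real \<Rightarrow> (real ^ 'n \<Rightarrow> real) \<Rightarrow> real ^ 'n::finite \<Rightarrow> real) \<Rightarrow> bool" where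
  "evolution_operator I q b G \<longleftrightarrow> (\<forall>s\<in>I. \<forall>f\<in>bcontfun.
     bounded_classical_solution q b s f (\<lambda>t. G t s f) \<and>
     (\<forall>v. bounded_classical_solution q b s f v \<longrightarrow> (\<forall>t\<ge>s. v t = G t s f)))"


section \<open>Evolution systems of measures\<close>

definition tight_evolution_system :: "real set
    \<Rightarrow> (real \<Rightarrow> real \<Rightarrow> (real ^ 'n \<Rightarrow> real) \<Rightarrow> real ^ 'n \<Rightarrow> real)
    \<Rightarrow> (real ^ 'n \<Rightarrow> real) \<Rightarrow> (real \<Rightarrow> (real ^ 'n::finite) measure) \<Rightarrow> bool" where
  "tight_evolution_system I G \<phi> \<mu> \<longleftrightarrow>
     (\<forall>t\<in>I. emeasure (\<mu> t) (space (\<mu> t)) = 1 \<and> sets (\<mu> t) = sets borel) \<and>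
     (\<forall>\<epsilon>>0. \<exists>K. compact K \<and> (\<forall>t\<in>I. measure (\<mu> t) (- K) \<le> \<epsilon>)) \<and>
     (\<forall>s\<in>I. \<forall>t>s. \<forall>f\<in>bcontfun. (\<integral>x. G t s f x \<partial>\<mu> t) = (\<integral>x. f x \<partial>\<mu> s)) \<and>
     (SUP t\<in>I. \<integral>\<^sup>+ x. ennreal (\<phi> x) \<partial>\<mu> t) < \<infinity>"

definition space_time_measure :: "real set \<Rightarrow> (real \<Rightarrow> (real ^ 'n::finite) measure)
    \<Rightarrow> (real \<times> (real ^ 'n)) measure \<Rightarrow> bool" where
  "space_time_measure I \<mu> \<nu> \<longleftrightarrow>
     sets \<nu> = sets (restrict_space borel (I \<times> UNIV)) \<and>
     (\<forall>J\<in>sets borel. \<forall>A\<in>sets borel. J \<subseteq> I \<longrightarrow>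
        emeasure \<nu> (J \<times> A) = (\<integral>\<^sup>+ t\<in>J. emeasure (\<mu> t) A \<partial>lborel))"

text \<open>\<open>g\<close> is a version of G(t,s)f for the continuous extension of G(t,s) from bounded continuous
  functions to L^p(\<open>\<mu> s\<close>), with values in L^p(\<open>\<mu> t\<close>). Since G(t,s) is contractive in these norms and
  the bounded continuous functions are dense, the graph of the extension is the closure of the graph
  on bounded continuous functions.\<close>

definition Lp_extension :: "real \<Rightarrow> (real \<Rightarrow> real \<Rightarrow> (real ^ 'n \<Rightarrow> real) \<Rightarrow> real ^ 'n \<Rightarrow> real)
    \<Rightarrow> (real \<Rightarrow> (real ^ 'n::finite) measure) \<Rightarrow> real \<Rightarrow> real
    \<Rightarrow> (real ^ 'n \<Rightarrow> real) \<Rightarrow> (real ^ 'n \<Rightarrow> real) \<Rightarrow> bool" where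
  "Lp_extension p G \<mu> t s f g \<longleftrightarrow>
     f \<in> Lp_space p (\<mu> s) \<and> g \<in> Lp_space p (\<mu> t) \<and>
     (\<forall>\<epsilon>>0. \<exists>h\<in>bcontfun. Lp_norm p (\<mu> s) (\<lambda>x. f x - h x) \<le> \<epsilon> \<and>
        Lp_norm p (\<mu> t) (\<lambda>x. g x - G t s h x) \<le> \<epsilon>)"


section \<open>Mild solutions and stability\<close>

text \<open>\<open>g t\<close> stands for G(t,s)f and \<open>w t r\<close> for G(t,r)\<open>\<psi>\<close>(r,u(r,.)). These are classes of functions
  of x, so integrating in r for fixed x requires a version of \<open>w t\<close> that is measurable jointly in
  (r,x); by Fubini the resulting integral does not depend on the choice of such a version, up to
  null sets. \<open>w t r\<close> is needed for almost every r only, just as \<open>u r\<close> is in L^p(\<open>\<mu> r\<close>) for almost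
  every r when u is in L^p with respect to the space-time measure.\<close>

definition mild_solution :: "real \<Rightarrow> (real \<Rightarrow> real \<Rightarrow> (real ^ 'n \<Rightarrow> real) \<Rightarrow> real ^ 'n \<Rightarrow> real)
    \<Rightarrow> (real \<Rightarrow> (real ^ 'n::finite) measure) \<Rightarrow> (real \<Rightarrow> real \<Rightarrow> real) \<Rightarrow> real \<Rightarrow> real
    \<Rightarrow> (real ^ 'n \<Rightarrow> real) \<Rightarrow> (real \<Rightarrow> real ^ 'n \<Rightarrow> real) \<Rightarrow> bool" where
  "mild_solution p G \<mu> \<psi> s \<tau> f u \<longleftrightarrow> (\<exists>g w.
     (\<forall>t\<in>{s..\<tau>}. Lp_extension p G \<mu> t s f (g t)) \<and>
     (\<forall>t\<in>{s<..\<tau>}. (\<lambda>(r, x). w t r x) \<in> borel_measurable borel \<and>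
        (AE r in lborel. r \<in> {s<..<t} \<longrightarrow>
           Lp_extension p G \<mu> t r (\<lambda>x. \<psi> r (u r x)) (w t r))) \<and>
     (AE x in lborel. \<forall>t\<in>{s<..\<tau>}. set_integrable lborel {s<..<t} (\<lambda>r. w t r x)) \<and>
     (\<forall>t\<in>{s..\<tau>}. AE x in lborel. u t x = g t x + (LINT r:{s<..<t}|lborel. w t r x)))"

definition Lp_mild_solution :: "real \<Rightarrow> (real \<Rightarrow> real \<Rightarrow> (real ^ 'n \<Rightarrow> real) \<Rightarrow> real ^ 'n \<Rightarrow> real)
    \<Rightarrow> (real \<Rightarrow> (real ^ 'n::finite) measure) \<Rightarrow> (real \<times> (real ^ 'n)) measure
    \<Rightarrow> (real \<Rightarrow> real \<Rightarrow> real) \<Rightarrow> real \<Rightarrow> (real ^ 'n \<Rightarrow> real) \<Rightarrow> (real \<Rightarrow> real ^ 'n \<Rightarrow> real) \<Rightarrow> bool"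
  where
  "Lp_mild_solution p G \<mu> \<nu> \<psi> s f u \<longleftrightarrow> (\<forall>\<tau>>s. mild_solution p G \<mu> \<psi> s \<tau> f u \<and>
     (\<lambda>(t, x). u t x) \<in> Lp_space p (restrict_space \<nu> ({s..\<tau>} \<times> UNIV)))"

text \<open>\<open>u t \<in> Lp_space p (\<mu> t)\<close> is stated explicitly because \<^const>\<open>Lp_norm\<close> has no meaning outside
  \<^const>\<open>Lp_space\<close> (for a non-integrable \<open>p\<close>-th power it is \<open>0\<close>). Quantification over all mild
  solutions makes the notion independent of the representative chosen for the solution.\<close>

definition asymptotically_stable :: "real set \<Rightarrow> real
    \<Rightarrow> (real \<Rightarrow> real \<Rightarrow> (real ^ 'n \<Rightarrow> real) \<Rightarrow> real ^ 'n \<Rightarrow> real)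
    \<Rightarrow> (real \<Rightarrow> (real ^ 'n::finite) measure) \<Rightarrow> (real \<times> (real ^ 'n)) measure
    \<Rightarrow> (real \<Rightarrow> real \<Rightarrow> real) \<Rightarrow> bool" where
  "asymptotically_stable I p G \<mu> \<nu> \<psi> \<longleftrightarrow>
     (\<forall>\<epsilon>>0. \<forall>s\<in>I. \<exists>\<delta>>0. \<forall>f\<in>Lp_space p (\<mu> s). Lp_norm p (\<mu> s) f \<le> \<delta> \<longrightarrow>
        (\<forall>u. Lp_mild_solution p G \<mu> \<nu> \<psi> s f u \<longrightarrow>
           (\<forall>t\<ge>s. u t \<in> Lp_space p (\<mu> t) \<and> Lp_norm p (\<mu> t) (u t) \<le> \<epsilon>))) \<and>
     (\<forall>s\<in>I. \<exists>\<delta>>0. \<forall>f\<in>Lp_space p (\<mu> s). Lp_norm p (\<mu> s) f \<le> \<delta> \<longrightarrow>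
        (\<forall>u. Lp_mild_solution p G \<mu> \<nu> \<psi> s f u \<longrightarrow>
           (\<forall>t\<ge>s. u t \<in> Lp_space p (\<mu> t)) \<and>
           ((\<lambda>t. Lp_norm p (\<mu> t) (u t)) \<longlongrightarrow> 0) at_top))"

definition exponentially_asymptotically_stable :: "real set \<Rightarrow> real
    \<Rightarrow> (real \<Rightarrow> real \<Rightarrow> (real ^ 'n \<Rightarrow> real) \<Rightarrow> real ^ 'n \<Rightarrow> real)
    \<Rightarrow> (real \<Rightarrow> (real ^ 'n::finite) measure) \<Rightarrow> (real \<times> (real ^ 'n)) measure
    \<Rightarrow> (real \<Rightarrow> real \<Rightarrow> real) \<Rightarrow> bool" where
  "exponentially_asymptotically_stable I p G \<mu> \<nu> \<psi> \<longleftrightarrow>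
     asymptotically_stable I p G \<mu> \<nu> \<psi> \<and>
     (\<forall>s\<in>I. \<exists>\<delta>>0. \<exists>M>0. \<exists>\<omega>>0. \<forall>f\<in>Lp_space p (\<mu> s). Lp_norm p (\<mu> s) f \<le> \<delta> \<longrightarrow>
        (\<forall>u. Lp_mild_solution p G \<mu> \<nu> \<psi> s f u \<longrightarrow>
           (\<forall>t\<ge>s. u t \<in> Lp_space p (\<mu> t) \<and>
              Lp_norm p (\<mu> t) (u t) \<le> M * exp (- \<omega> * (t - s)))))"

end

theory Submission
  imports Defs "HOL-Probability.Probability"
begin

text \<open>The representation \<open>u t = G(t,s)f + (integral of G(t,r)\<psi>(r,u r))\<close> is rewritten with a shift \<open>\<kappa>\<close>
  as \<open>u t = exp (- \<kappa> (t - s)) G(t,s)f + (integral of exp (- \<kappa> (t - r)) G(t,r)(\<psi>(r,u r) + \<kappa> u r))\<close>.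
  For \<open>\<kappa>\<close> above the Lipschitz constant, dissipativity gives \<open>\<bar>\<psi>(r,\<xi>) + \<kappa> \<xi>\<bar> \<le> (\<kappa> + \<psi>\<^sub>0) \<bar>\<xi>\<bar>\<close>. Jensen's
  inequality for the weight \<open>\<kappa> exp (- \<kappa> (t - r))\<close>, the contractivity of \<open>G(t,r)\<close> and a Gronwall argument
  bound the \<open>p\<close>-th power of the norm by \<open>exp (\<beta> (t - s))\<close> times its initial value, where \<open>\<beta>\<close> is any number
  above \<open>\<kappa> (1 + \<psi>\<^sub>0/\<kappa>)\<^sup>p - \<kappa>\<close>; this tends to \<open>p \<psi>\<^sub>0\<close> as \<open>\<kappa>\<close> tends to infinity. No regularity of \<open>u\<close> or
  differentiability of its norm is needed.

  The mild formula holds almost everywhere for Lebesgue measure while the norms refer to \<open>\<mu> t\<close>, so one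
  needs \<open>\<mu> t\<close> to be absolutely continuous. By invariance this follows from a bound of \<open>G(\<tau>,t)\<close> on the
  indicator function of a small ball by a multiple of the volume of the ball, which the comparison
  principle yields from a barrier built of two Gaussians.\<close>

section \<open>Partial derivatives and elliptic operators\<close>

text \<open>Estimating the integral term by the Lipschitz constant would lose the sign of
  \<open>\<psi>\<close>; the shift turns the one-sided condition into a two-sided bound whose
  constant \<open>\<kappa> + \<psi>\<^sub>0\<close> still carries that sign. For a fixed \<kappa>
  the exponent reached is at least \<open>p * \<psi>\<^sub>0\<close> by Bernoulli's inequality, so
  the sharp rate appears only in the limit.

  The obstacle is that the version \<open>w t\<close> of G(t,r)\<psi>(r,u r) is chosen separately
  for each \<open>t\<close>. The shifted formula at time \<open>t\<close> needs G(t,r)u(r) for r <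
  t, and this has to be expressed through \<open>w t\<close>: it is \<open>g t\<close> plus the
  integral of \<open>w t\<close> over (s,r). That rests on the evolution law for the extended
  operator and on passing the extension under the time integral, which is done with step functions
  of time whose values are bounded continuous functions. Fubini's theorem moreover needs
  \<open>\<mu> r\<close> to depend measurably on \<open>r\<close>; this comes from weak right
  continuity, a consequence of invariance and tightness.\<close>

lemma has_pD_iff:
  "has_pD i f x \<longleftrightarrow> ((\<lambda>h. f (x + h *\<^sub>R axis i 1)) has_real_derivative pD i f x) (at 0)"
  unfolding has_pD_def pD_def by (simp add: DERIV_deriv_iff_field_differentiable)

lemma pD_I:
  assumes "((\<lambda>h. f (x + h *\<^sub>R axis i 1)) has_real_derivative D) (at 0)"
  shows "has_pD i f x" "pD i f x = D"
  using assms DERIV_imp_deriv unfolding has_pD_def pD_def field_differentiable_def by blast+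

lemma DERIV_along_axis:
  assumes "has_pD i f (x + t *\<^sub>R axis i 1)"
  shows "((\<lambda>h. f (x + h *\<^sub>R axis i 1)) has_real_derivative pD i f (x + t *\<^sub>R axis i 1)) (at t)"
proof -
  have "((\<lambda>h. f (x + t *\<^sub>R axis i 1 + h *\<^sub>R axis i 1)) has_real_derivative
      pD i f (x + t *\<^sub>R axis i 1)) (at 0)"
    using assms has_pD_iff by blast
  then have "((\<lambda>h. f (x + (h + t) *\<^sub>R axis i 1)) has_real_derivative
      pD i f (x + t *\<^sub>R axis i 1)) (at 0)"
    by (simp add: algebra_simps)
  then show ?thesis
    using DERIV_shift[of "\<lambda>h. f (x + h *\<^sub>R axis i 1)" _ 0 t] by simp
qed

lemma C2_spaceD:
  assumes "f \<in> C2_space"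
  shows "continuous_on UNIV f" "has_pD i f x" "continuous_on UNIV (pD i f)"
    "has_pD i (pD j f) x" "continuous_on UNIV (pD i (pD j f))"
  using assms unfolding C2_space_def by auto

text \<open>Candidates \<open>f1\<close>, \<open>f2\<close> for the derivatives turn the membership
  test with its nested \<open>pD\<close> into plain derivative computations.\<close>

lemma C2_spaceI:
  assumes "continuous_on UNIV f"
    and "\<And>i x. ((\<lambda>h. f (x + h *\<^sub>R axis i 1)) has_real_derivative f1 i x) (at 0)"
    and "\<And>i. continuous_on UNIV (f1 i)"
    and "\<And>i j x. ((\<lambda>h. f1 j (x + h *\<^sub>R axis i 1)) has_real_derivative f2 i j x) (at 0)"
    and "\<And>i j. continuous_on UNIV (f2 i j)"
  shows "f \<in> C2_space" "pD i f = f1 i" "pD i (pD j f) = f2 i j"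
proof -
  have 1: "pD i f = f1 i" for i
    using pD_I(2)[OF assms(2)] by blast
  have 2: "pD i (pD j f) = f2 i j" for i j
    unfolding 1 using pD_I(2)[OF assms(4)] by blast
  show "f \<in> C2_space"
    unfolding C2_space_def using assms(1,3,5) pD_I(1)[OF assms(2)] pD_I(1)[OF assms(4)]
    by (auto simp: 1 2[unfolded 1])
  show "pD i f = f1 i" "pD i (pD j f) = f2 i j" by (fact 1, fact 2)
qed

lemma C2_lincomb:
  assumes "f \<in> C2_space" "g \<in> C2_space"
  shows "(\<lambda>x. f x + c * g x) \<in> C2_space"
    and "pD i (\<lambda>x. f x + c * g x) = (\<lambda>x. pD i f x + c * pD i g x)"
    and "pD i (pD j (\<lambda>x. f x + c * g x)) = (\<lambda>x. pD i (pD j f) x + c * pD i (pD j g) x)"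
proof -
  note f = C2_spaceD[OF assms(1)] and g = C2_spaceD[OF assms(2)]
  have 1: "((\<lambda>h. f (x + h *\<^sub>R axis i 1) + c * g (x + h *\<^sub>R axis i 1)) has_real_derivative
      pD i f x + c * pD i g x) (at 0)" for i x
    using f(2)[of i x] g(2)[of i x] unfolding has_pD_iff by (intro DERIV_add DERIV_cmult)
  have 2: "((\<lambda>h. pD j f (x + h *\<^sub>R axis i 1) + c * pD j g (x + h *\<^sub>R axis i 1)) has_real_derivative
      pD i (pD j f) x + c * pD i (pD j g) x) (at 0)" for i j x
    using f(4)[of i j x] g(4)[of i j x] unfolding has_pD_iff by (intro DERIV_add DERIV_cmult)
  show "(\<lambda>x. f x + c * g x) \<in> C2_space"
    and "pD i (\<lambda>x. f x + c * g x) = (\<lambda>x. pD i f x + c * pD i g x)"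
    and "pD i (pD j (\<lambda>x. f x + c * g x)) = (\<lambda>x. pD i (pD j f) x + c * pD i (pD j g) x)"
    by (rule C2_spaceI[of _ "\<lambda>i x. pD i f x + c * pD i g x"
          "\<lambda>i j x. pD i (pD j f) x + c * pD i (pD j g) x"];
        auto intro!: continuous_intros f g 1 2)+
qed

lemma C2_const: "(\<lambda>x. c) \<in> C2_space" "pD i (\<lambda>x. c) = (\<lambda>x. 0)" "pD i (pD j (\<lambda>x. c)) = (\<lambda>x. 0)"
  by (rule C2_spaceI[of _ "\<lambda>i x. 0" "\<lambda>i j x. 0"]; auto)+

lemma ell_op_lincomb:
  assumes "f \<in> C2_space" "g \<in> C2_space"
  shows "ell_op q b t (\<lambda>x. f x + c * g x) x = ell_op q b t f x + c * ell_op q b t g x"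
  unfolding ell_op_def C2_lincomb(3)[OF assms] unfolding C2_lincomb(2)[OF assms]
  by (simp add: algebra_simps sum.distrib sum_distrib_left)

lemma ell_op_const: "ell_op q b t (\<lambda>x. c) x = 0"
  unfolding ell_op_def C2_const by simp

text \<open>The coordinates are moved one at a time, each step being controlled by the mean value
  theorem.\<close>

lemma partial_increment:
  fixes f :: "real ^ 'n::finite \<Rightarrow> real"
  assumes d: "\<And>i x. has_pD i f x" and c: "\<And>i. continuous_on UNIV (pD i f)"
  shows "finite S \<Longrightarrow> e > 0 \<Longrightarrow> \<exists>\<delta>>0. \<forall>v. norm v < \<delta> \<longrightarrow>
    \<bar>f (x + (\<Sum>i\<in>S. v $ i *\<^sub>R axis i 1)) - f x - (\<Sum>i\<in>S. v $ i * pD i f x)\<bar> \<le> e * norm v"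
proof (induction S arbitrary: e rule: finite_induct)
  case empty
  then show ?case by (auto intro!: exI[of _ 1])
next
  case (insert i S)
  obtain \<delta>1 where d1: "\<delta>1 > 0" "\<And>v. norm v < \<delta>1 \<Longrightarrow>
    \<bar>f (x + (\<Sum>i\<in>S. v $ i *\<^sub>R axis i 1)) - f x - (\<Sum>i\<in>S. v $ i * pD i f x)\<bar> \<le> e/2 * norm v"
    using insert.IH[of "e/2"] insert.prems by auto
  obtain \<delta>2 where d2: "\<delta>2 > 0" "\<And>y. norm (y - x) < \<delta>2 \<Longrightarrow> \<bar>pD i f y - pD i f x\<bar> < e/2"
    using c[of i] insert.prems unfolding continuous_on_iff dist_norm real_norm_def
    by (metis half_gt_zero UNIV_I)
  \<comment> \<open>The coordinates already moved contribute at most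
    \<open>CARD('n) * norm v\<close>, the current one at most \<open>norm v\<close>; so every
    intermediate point is within \<open>?n * norm v\<close> of \<open>x\<close>.\<close>
  let ?n = "real (CARD('n)) + 1"
  let ?d = "min \<delta>1 (\<delta>2 / (2 * ?n))"
  have "?d > 0" using d1 d2 by simp
  moreover have "\<bar>f (x + (\<Sum>i\<in>insert i S. v $ i *\<^sub>R axis i 1)) - f x - (\<Sum>i\<in>insert i S. v $ i * pD i f x)\<bar>
      \<le> e * norm v" if v: "norm v < ?d" for v
  proof -
    define z where "z = (\<Sum>i\<in>S. v $ i *\<^sub>R (axis i 1 :: real^'n))"
    have "norm z \<le> (\<Sum>i\<in>S. norm v)"
      unfolding z_def by (intro sum_norm_le) (simp add: component_le_norm_cart)
    also have "\<dots> \<le> CARD('n) * norm v"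
      by (simp add: card_mono mult_right_mono)
    finally have nz: "norm z \<le> CARD('n) * norm v" .
    have vi: "\<bar>v $ i\<bar> \<le> norm v" by (simp add: component_le_norm_cart)
    have close: "\<bar>pD i f (x + z + h *\<^sub>R axis i 1) - pD i f x\<bar> < e/2" if "\<bar>h\<bar> \<le> \<bar>v $ i\<bar>" for h
    proof (rule d2(2))
      have "norm (x + z + h *\<^sub>R axis i 1 - x) \<le> norm z + \<bar>h\<bar>"
        using norm_triangle_ineq[of z "h *\<^sub>R axis i 1"] by (simp add: norm_axis_1)
      also have "\<dots> \<le> ?n * norm v" using nz that vi by (simp add: algebra_simps)
      also have "\<dots> \<le> ?n * (\<delta>2 / (2 * ?n))" using v by (intro mult_left_mono) auto
      also have "\<dots> = \<delta>2 / 2"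
      proof -
        have "?n > 0" by (simp add: add_nonneg_pos)
        then show ?thesis by (simp add: field_simps)
      qed
      also have "\<dots> < \<delta>2" using d2(1) by simp
      finally show "norm (x + z + h *\<^sub>R axis i 1 - x) < \<delta>2" .
    qed
    have step: "\<bar>f (x + z + (v $ i) *\<^sub>R axis i 1) - f (x + z) - v $ i * pD i f x\<bar> \<le> e/2 * norm v"
    proof -
      let ?F = "\<lambda>h. f (x + z + h *\<^sub>R axis i 1) - h * pD i f x"
      have "norm (?F (v $ i) - ?F 0) \<le> e/2 * norm (v $ i - 0)"
      proof (rule field_differentiable_bound[of "cball 0 \<bar>v $ i\<bar>" ?F "\<lambda>h. pD i f (x + z + h *\<^sub>R axis i 1) - pD i f x"])
        fix h :: real assume "h \<in> cball 0 \<bar>v $ i\<bar>"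
        then have h: "\<bar>h\<bar> \<le> \<bar>v $ i\<bar>" by simp
        show "norm (pD i f (x + z + h *\<^sub>R axis i 1) - pD i f x) \<le> e/2"
          using close[OF h] by simp
        show "(?F has_field_derivative pD i f (x + z + h *\<^sub>R axis i 1) - pD i f x) (at h within cball 0 \<bar>v $ i\<bar>)"
          using DERIV_along_axis[OF d, where i=i and x="x + z" and t=h]
          by (auto intro!: derivative_eq_intros intro: has_field_derivative_at_within)
      qed auto
      moreover have "?F (v $ i) - ?F 0 = f (x + z + (v $ i) *\<^sub>R axis i 1) - f (x + z) - v $ i * pD i f x"
        by simp
      moreover have "e/2 * \<bar>v $ i\<bar> \<le> e/2 * norm v"
        using mult_left_mono[OF vi, of "e/2"] insert.prems by simp
      ultimately show ?thesis by (simp only: real_norm_def diff_zero)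
    qed
    have "x + (\<Sum>i\<in>insert i S. v $ i *\<^sub>R axis i 1) = x + z + (v $ i) *\<^sub>R axis i 1"
      using insert.hyps by (simp add: z_def)
    moreover have "(\<Sum>i\<in>insert i S. v $ i * pD i f x) = v $ i * pD i f x + (\<Sum>i\<in>S. v $ i * pD i f x)"
      using insert.hyps by simp
    moreover have "\<bar>f (x + z) - f x - (\<Sum>i\<in>S. v $ i * pD i f x)\<bar> \<le> e/2 * norm v"
      unfolding z_def using v by (intro d1(2)) auto
    moreover have "e * norm v = e/2 * norm v + e/2 * norm v" by simp
    ultimately show ?thesis using step by (simp only:)
  qed
  ultimately show ?case by blast
qed

text \<open>\<open>C2_space\<close> speaks of partial derivatives only. Derivatives along arbitrary
  directions, needed for the second-order condition at a minimum, come from the continuity of the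
  partials.\<close>

lemma has_derivative_partials:
  fixes f :: "real ^ 'n::finite \<Rightarrow> real"
  assumes "\<And>i x. has_pD i f x" "\<And>i. continuous_on UNIV (pD i f)"
  shows "(f has_derivative (\<lambda>v. \<Sum>i\<in>UNIV. v $ i * pD i f x)) (at x)"
  unfolding has_derivative_at_alt
proof (intro conjI allI impI)
  show "bounded_linear (\<lambda>v. \<Sum>i\<in>UNIV. v $ i * pD i f x)"
    by (intro bounded_linear_sum bounded_linear_mult_left bounded_linear_compose[OF bounded_linear_mult_left bounded_linear_vec_nth])
  fix e :: real assume "e > 0"
  from partial_increment[of f UNIV e x, OF assms finite this] obtain \<delta> where \<delta>: "\<delta> > 0"
    "\<And>v. norm v < \<delta> \<Longrightarrow> \<bar>f (x + (\<Sum>i\<in>UNIV. v $ i *\<^sub>R axis i 1)) - f x - (\<Sum>i\<in>UNIV. v $ i * pD i f x)\<bar> \<le> e * norm v"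
    by blast
  have *: "(\<Sum>i\<in>UNIV. v $ i *\<^sub>R axis i 1) = v" for v :: "real^'n"
    using basis_expansion[of v] by (simp add: scalar_mult_eq_scaleR)
  show "\<exists>d>0. \<forall>y. norm (y - x) < d \<longrightarrow>
      norm (f y - f x - (\<Sum>i\<in>UNIV. (y - x) $ i * pD i f x)) \<le> e * norm (y - x)"
  proof (intro exI[of _ \<delta>] conjI allI impI)
    fix y assume "norm (y - x) < \<delta>"
    from \<delta>(2)[OF this] show "norm (f y - f x - (\<Sum>i\<in>UNIV. (y - x) $ i * pD i f x)) \<le> e * norm (y - x)"
      unfolding * by simp
  qed fact
qed

lemma DERIV_along_line:
  fixes f :: "real ^ 'n::finite \<Rightarrow> real"
  assumes "\<And>i x. has_pD i f x" "\<And>i. continuous_on UNIV (pD i f)"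
  shows "((\<lambda>h. f (x + h *\<^sub>R \<xi>)) has_real_derivative (\<Sum>i\<in>UNIV. \<xi> $ i * pD i f (x + t *\<^sub>R \<xi>))) (at t)"
proof -
  have "((\<lambda>h. f (x + h *\<^sub>R \<xi>)) has_derivative
      (\<lambda>h. \<Sum>i\<in>UNIV. (h *\<^sub>R \<xi>) $ i * pD i f (x + t *\<^sub>R \<xi>))) (at t)"
    by (rule has_derivative_compose[OF _ has_derivative_partials[OF assms]])
      (auto intro!: derivative_eq_intros)
  then show ?thesis
    by (rule has_derivative_imp_has_field_derivative)
       (simp add: sum_distrib_left sum_distrib_right mult_ac)
qed

text \<open>Were \<open>l\<close> negative, \<open>g'\<close> would be negative just to the right of
  its zero, and the mean value theorem would take \<open>g\<close> below \<open>g 0\<close>.\<close>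

lemma local_min_second_derivative:
  fixes g :: "real \<Rightarrow> real"
  assumes g1: "\<And>t. (g has_real_derivative g' t) (at t)"
    and g2: "(g' has_real_derivative l) (at 0)"
    and e: "e > 0" and min: "\<And>t. \<bar>t\<bar> < e \<Longrightarrow> g 0 \<le> g t"
  shows "g' 0 = 0" "l \<ge> 0"
proof -
  show 0: "g' 0 = 0"
    using DERIV_local_min[OF g1 e] min by simp
  show "l \<ge> 0"
  proof (rule ccontr)
    assume "\<not> l \<ge> 0"
    then obtain d where d: "d > 0" "\<And>h. 0 < h \<Longrightarrow> h < d \<Longrightarrow> g' (0 + h) < g' 0"
      using DERIV_neg_dec_right[OF g2] by auto
    define h where "h = min d e / 2"
    have h: "0 < h" "h < d" "h < e" using d e by (auto simp: h_def)
    obtain z where z: "0 < z" "z < h" "g h - g 0 = (h - 0) * g' z"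
      using MVT2[OF h(1), of g g'] g1 by blast
    have "g' z < 0" using d(2)[of z] z h 0 by simp
    then have "g h < g 0" using z h by (smt (verit) mult_pos_neg)
    then show False using min[of h] h by simp
  qed
qed

text \<open>Restriction to the lines through \<open>x\<close> reduces to one variable; the double
  sum is the second derivative along \<open>\<xi>\<close>.\<close>

lemma C2_local_min:
  fixes f :: "real ^ 'n::finite \<Rightarrow> real"
  assumes f: "f \<in> C2_space" and e: "e > 0" and min: "\<And>y. dist y x < e \<Longrightarrow> f x \<le> f y"
  shows "pD i f x = 0" "0 \<le> (\<Sum>i\<in>UNIV. \<Sum>j\<in>UNIV. \<xi> $ i * \<xi> $ j * pD i (pD j f) x)"
proof -
  note C = C2_spaceD[OF f]
  have main: "(\<Sum>j\<in>UNIV. \<zeta> $ j * pD j f x) = 0 \<and>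
      0 \<le> (\<Sum>j\<in>UNIV. \<zeta> $ j * (\<Sum>i\<in>UNIV. \<zeta> $ i * pD i (pD j f) x))" for \<zeta>
  proof -
    let ?g' = "\<lambda>t. \<Sum>j\<in>UNIV. \<zeta> $ j * pD j f (x + t *\<^sub>R \<zeta>)"
    have 1: "((\<lambda>h. f (x + h *\<^sub>R \<zeta>)) has_real_derivative ?g' t) (at t)" for t
      by (rule DERIV_along_line) (auto intro: C)
    have 2: "(?g' has_real_derivative (\<Sum>j\<in>UNIV. \<zeta> $ j * (\<Sum>i\<in>UNIV. \<zeta> $ i * pD i (pD j f) (x + 0 *\<^sub>R \<zeta>)))) (at 0)"
      by (intro DERIV_sum DERIV_cmult DERIV_along_line) (auto intro: C)
    \<comment> \<open>The \<open>+ 1\<close> covers \<open>\<zeta> = 0\<close>; parameters below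
      this bound keep the line inside the ball where \<open>x\<close> is minimal.\<close>
    have 3: "e / (norm \<zeta> + 1) > 0" using e by (simp add: add_nonneg_pos)
    have 4: "f (x + 0 *\<^sub>R \<zeta>) \<le> f (x + t *\<^sub>R \<zeta>)" if "\<bar>t\<bar> < e / (norm \<zeta> + 1)" for t
    proof -
      have "\<bar>t\<bar> * (norm \<zeta> + 1) < e" using that by (simp add: pos_less_divide_eq add_nonneg_pos)
      then have "\<bar>t\<bar> * norm \<zeta> < e" by (smt (verit) mult_left_mono)
      then show ?thesis using min[of "x + t *\<^sub>R \<zeta>"] by (simp add: dist_norm)
    qed
    show ?thesis using local_min_second_derivative[OF 1 2 3 4] by simp
  qed
  have "(\<Sum>j\<in>UNIV. axis i 1 $ j * pD j f x) = pD i f x"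
    by (simp add: axis_def if_distrib[of "\<lambda>u. u * _"] cong: if_cong)
  then show "pD i f x = 0" using main[of "axis i 1"] by simp
  have "(\<Sum>i\<in>UNIV. \<Sum>j\<in>UNIV. \<xi> $ i * \<xi> $ j * pD i (pD j f) x) =
     (\<Sum>j\<in>UNIV. \<xi> $ j * (\<Sum>i\<in>UNIV. \<xi> $ i * pD i (pD j f) x))"
    by (subst sum.swap) (simp add: sum_distrib_left mult_ac)
  then show "0 \<le> (\<Sum>i\<in>UNIV. \<Sum>j\<in>UNIV. \<xi> $ i * \<xi> $ j * pD i (pD j f) x)"
    using main[of \<xi>] by simp
qed

text \<open>Induction on the number of nonzero diagonal entries; each step splits off a Schur
  complement.\<close>

lemma sum_psd_nonneg:
  fixes Q H :: "'n::finite \<Rightarrow> 'n \<Rightarrow> real"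
  assumes H: "\<And>\<xi>. 0 \<le> (\<Sum>i\<in>UNIV. \<Sum>j\<in>UNIV. \<xi> i * \<xi> j * H i j)"
  shows "(\<And>i j. Q i j = Q j i) \<Longrightarrow> (\<And>\<xi>. 0 \<le> (\<Sum>i\<in>UNIV. \<Sum>j\<in>UNIV. \<xi> i * \<xi> j * Q i j)) \<Longrightarrow>
    0 \<le> (\<Sum>i\<in>UNIV. \<Sum>j\<in>UNIV. Q i j * H i j)"
proof (induction "card {i. Q i i \<noteq> 0}" arbitrary: Q rule: less_induct)
  case less
  have quad2: "(\<Sum>i\<in>UNIV. \<Sum>j\<in>UNIV. (if i = k then a else if i = l then c else 0) *
      (if j = k then a else if j = l then c else 0) * Q i j) = a * a * Q k k + 2 * a * c * Q k l + c * c * Q l l"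
    if "k \<noteq> l" for k l a c
  proof -
    have 1: "(\<Sum>j\<in>UNIV. (if j = k then a else if j = l then c else 0) * F j) = a * F k + c * F l" for F
    proof -
      have "(\<Sum>j\<in>UNIV. (if j = k then a else if j = l then c else 0) * F j)
         = (\<Sum>j\<in>{k,l}. (if j = k then a else if j = l then c else 0) * F j)"
        by (rule sum.mono_neutral_right) auto
      then show ?thesis using that by simp
    qed
    have "(\<Sum>i\<in>UNIV. \<Sum>j\<in>UNIV. (if i = k then a else if i = l then c else 0) *
      (if j = k then a else if j = l then c else 0) * Q i j) =
      (\<Sum>i\<in>UNIV. (if i = k then a else if i = l then c else 0) * (\<Sum>j\<in>UNIV.
      (if j = k then a else if j = l then c else 0) * Q i j))"
      by (simp add: sum_distrib_left mult_ac)
    then show ?thesis unfolding 1 using less.prems(1)[of l k] by (simp add: algebra_simps)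
  qed
  have quad1: "(\<Sum>i\<in>UNIV. \<Sum>j\<in>UNIV. (if i = k then 1 else 0) * (if j = k then 1 else 0) * R i j) = R k k"
    for k and R :: "'n \<Rightarrow> 'n \<Rightarrow> real"
  proof -
    have "(\<Sum>i\<in>UNIV. \<Sum>j\<in>UNIV. (if i = k then 1 else 0) * (if j = k then 1 else 0) * R i j) =
        (\<Sum>i\<in>UNIV. (if i = k then 1 else 0) * (\<Sum>j\<in>UNIV. (if j = k then 1 else 0) * R i j))"
      by (simp only: sum_distrib_left mult.assoc)
    also have "\<dots> = R k k"
      by (simp add: if_distrib[of "\<lambda>u. u * _"] cong: if_cong)
    finally show ?thesis .
  qed
  have diag: "0 \<le> Q k k" for k
    using less.prems(2)[of "\<lambda>i. if i = k then 1 else 0"] unfolding quad1 .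
  show ?case
  proof (cases "{i. Q i i \<noteq> 0} = {}")
    case True
    then have z: "Q i i = 0" for i by auto
    have "Q k l = 0" for k l
    proof (cases "k = l")
      case False
      show ?thesis
        \<comment> \<open>On this vector the form equals \<open>- 2 * (Q k l)\<^sup>2\<close> once
          the diagonal vanishes, which forces \<open>Q k l = 0\<close>.\<close>
        using less.prems(2)[of "\<lambda>i. if i = k then 1 else if i = l then - Q k l else 0"]
        unfolding quad2[OF False] z by (auto simp: mult_le_0_iff)
    qed (simp add: z)
    then show ?thesis by simp
  next
    case False
    then obtain k where k: "Q k k \<noteq> 0" by blast
    then have kpos: "Q k k > 0" using diag[of k] by simp
    define Q' where "Q' i j = Q i j - Q i k * Q j k / Q k k" for i j
    have sym': "Q' i j = Q' j i" for i j
      unfolding Q'_def using less.prems(1)[of i j] by (simp add: mult.commute)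
    have factor: "(\<Sum>i\<in>UNIV. \<Sum>j\<in>UNIV. \<xi> i * \<xi> j * (Q i k * Q j k / Q k k)) = (\<Sum>i\<in>UNIV. \<xi> i * Q i k)\<^sup>2 / Q k k" for \<xi>
      unfolding power2_eq_square sum_product sum_divide_distrib
      by (intro sum.cong refl) (simp add: mult_ac)
    have psd': "0 \<le> (\<Sum>i\<in>UNIV. \<Sum>j\<in>UNIV. \<xi> i * \<xi> j * Q' i j)" for \<xi>
    proof -
      \<comment> \<open>Changing the component \<open>k\<close> of \<open>\<xi>\<close> by
        \<open>- s / Q k k\<close> minimises the form of \<open>Q\<close> in that component, and the
        minimal value is the form of \<open>Q'\<close> at \<open>\<xi>\<close>. Hence
        \<open>Q'\<close> is nonnegative.\<close>
      define s where "s = (\<Sum>i\<in>UNIV. \<xi> i * Q i k)"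
      define d where "d i = (if i = k then - s / Q k k else 0)" for i
      have dsum: "(\<Sum>j\<in>UNIV. d j * F j) = - s / Q k k * F k" for F
        by (simp add: d_def if_distrib[of "\<lambda>u. u * _"] cong: if_cong)
      have row: "(\<Sum>j\<in>UNIV. \<xi> j * Q k j) = s"
        unfolding s_def using less.prems(1)[of k] by simp
      define \<zeta> where "\<zeta> i = \<xi> i + d i" for i
      have "(\<Sum>i\<in>UNIV. \<Sum>j\<in>UNIV. \<zeta> i * \<zeta> j * Q i j) =
         (\<Sum>i\<in>UNIV. \<Sum>j\<in>UNIV. \<xi> i * \<xi> j * Q i j + \<xi> i * (d j * Q i j)
           + d i * (\<xi> j * Q i j) + d i * (d j * Q i j))"
        unfolding \<zeta>_def by (intro sum.cong refl) (simp add: algebra_simps)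
      also have "\<dots> = (\<Sum>i\<in>UNIV. \<Sum>j\<in>UNIV. \<xi> i * \<xi> j * Q i j) + (\<Sum>i\<in>UNIV. \<xi> i * (- s / Q k k * Q i k))
         + (- s / Q k k) * s + (- s / Q k k) * ((- s / Q k k) * Q k k)"
        by (simp only: sum.distrib sum_distrib_left[symmetric] dsum row)
      also have "(\<Sum>i\<in>UNIV. \<xi> i * (- s / Q k k * Q i k)) = (- s / Q k k) * s"
        unfolding s_def by (subst sum_distrib_left) (intro sum.cong refl, simp)
      also have "(\<Sum>i\<in>UNIV. \<Sum>j\<in>UNIV. \<xi> i * \<xi> j * Q i j) + (- s / Q k k) * s
         + (- s / Q k k) * s + (- s / Q k k) * ((- s / Q k k) * Q k k)
         = (\<Sum>i\<in>UNIV. \<Sum>j\<in>UNIV. \<xi> i * \<xi> j * Q i j) - s\<^sup>2 / Q k k"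
        using k by (simp add: field_simps power2_eq_square)
      also have "\<dots> = (\<Sum>i\<in>UNIV. \<Sum>j\<in>UNIV. \<xi> i * \<xi> j * Q' i j)"
        unfolding Q'_def right_diff_distrib sum_subtractf factor s_def by simp
      finally show ?thesis using less.prems(2)[of \<zeta>] by simp
    qed
    have "{i. Q' i i \<noteq> 0} \<subset> {i. Q i i \<noteq> 0}"
    proof
      show "{i. Q' i i \<noteq> 0} \<subseteq> {i. Q i i \<noteq> 0}"
      proof safe
        fix i assume "Q' i i \<noteq> 0" "Q i i = 0"
        have "0 \<le> Q' i i"
          using psd'[of "\<lambda>i'. if i' = i then 1 else 0"] unfolding quad1 .
        then have "0 \<le> - (Q i k * Q i k / Q k k)"
          unfolding Q'_def using \<open>Q i i = 0\<close> by simp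
        moreover have "0 \<le> Q i k * Q i k / Q k k" using kpos by simp
        ultimately have "Q' i i = 0" unfolding Q'_def using \<open>Q i i = 0\<close> by simp
        then show False using \<open>Q' i i \<noteq> 0\<close> by simp
      qed
      show "{i. Q' i i \<noteq> 0} \<noteq> {i. Q i i \<noteq> 0}" 
      proof
        assume "{i. Q' i i \<noteq> 0} = {i. Q i i \<noteq> 0}"
        then have "Q' k k \<noteq> 0" using k by blast
        then show False using k by (simp add: Q'_def)
      qed
    qed
    then have "card {i. Q' i i \<noteq> 0} < card {i. Q i i \<noteq> 0}"
      by (intro psubset_card_mono) auto
    from less.hyps[OF this sym' psd'] have "0 \<le> (\<Sum>i\<in>UNIV. \<Sum>j\<in>UNIV. Q' i j * H i j)" .
    moreover have "0 \<le> (\<Sum>i\<in>UNIV. \<Sum>j\<in>UNIV. Q i k * Q j k * H i j) / Q k k"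
      using H[of "\<lambda>i. Q i k"] kpos by simp
    moreover have "(\<Sum>i\<in>UNIV. \<Sum>j\<in>UNIV. Q i j * H i j) = (\<Sum>i\<in>UNIV. \<Sum>j\<in>UNIV. Q' i j * H i j) +
       (\<Sum>i\<in>UNIV. \<Sum>j\<in>UNIV. Q i k * Q j k * H i j) / Q k k"
      unfolding sum_divide_distrib sum.distrib[symmetric]
      by (intro sum.cong refl) (simp add: Q'_def algebra_simps)
    ultimately show ?thesis by simp
  qed
qed

lemma matrix_quadratic_form:
  fixes A :: "real ^ 'n::finite ^ 'n"
  shows "(A *v \<xi>) \<bullet> \<xi> = (\<Sum>i\<in>UNIV. \<Sum>j\<in>UNIV. \<xi> $ i * \<xi> $ j * A $ i $ j)"
proof -
  have "(A *v \<xi>) \<bullet> \<xi> = (\<Sum>i\<in>UNIV. (\<Sum>j\<in>UNIV. A $ i $ j * \<xi> $ j) * \<xi> $ i)"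
    unfolding inner_vec_def matrix_vector_mult_def by simp
  also have "\<dots> = (\<Sum>i\<in>UNIV. \<Sum>j\<in>UNIV. \<xi> $ i * \<xi> $ j * A $ i $ j)"
    unfolding sum_distrib_right by (intro sum.cong refl) (simp only: mult_ac)
  finally show ?thesis .
qed

text \<open>At the minimum the gradient vanishes, and the second-order part pairs two symmetric or
  nonnegative forms: the diffusion matrix and the Hessian.\<close>

lemma ell_op_local_min:
  assumes sym: "transpose (q t x) = q t x" and psd: "\<And>\<xi>. 0 \<le> (q t x *v \<xi>) \<bullet> \<xi>"
    and f: "f \<in> C2_space" and e: "e > 0" and min: "\<And>y. dist y x < e \<Longrightarrow> f x \<le> f y"
  shows "0 \<le> ell_op q b t f x"
proof -
  have "0 \<le> (\<Sum>i\<in>UNIV. \<Sum>j\<in>UNIV. q t x $ i $ j * pD i (pD j f) x)"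
  proof (rule sum_psd_nonneg)
    show "0 \<le> (\<Sum>i\<in>UNIV. \<Sum>j\<in>UNIV. \<xi> i * \<xi> j * pD i (pD j f) x)" for \<xi>
      using C2_local_min(2)[OF f e min, of "\<chi> i. \<xi> i"] by simp
    show "q t x $ i $ j = q t x $ j $ i" for i j
      using arg_cong[OF sym, of "\<lambda>A. A $ j $ i"] by (simp add: transpose_def)
    show "0 \<le> (\<Sum>i\<in>UNIV. \<Sum>j\<in>UNIV. \<xi> i * \<xi> j * q t x $ i $ j)" for \<xi>
      using psd[of "\<chi> i. \<xi> i"] unfolding matrix_quadratic_form by simp
  qed
  moreover have "pD i f x = 0" for i
    by (rule C2_local_min(1)[OF f e min])
  ultimately show ?thesis
    unfolding ell_op_def by simp
qed

section \<open>Bounded continuous functions and the tangent inequality for powers\<close>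

lemma bcontfun_iff:
  "f \<in> bcontfun \<longleftrightarrow> continuous_on UNIV f \<and> (\<exists>B. \<forall>x. \<bar>f x\<bar> \<le> B)" for f :: "'a::topological_space \<Rightarrow> real"
  unfolding bcontfun_def bounded_iff by auto

lemma bcontfun_lincomb:
  fixes f g :: "'a::topological_space \<Rightarrow> real"
  assumes "f \<in> bcontfun" "g \<in> bcontfun"
  shows "(\<lambda>x. f x + c * g x) \<in> bcontfun"
proof -
  obtain A B where AB: "\<And>x. \<bar>f x\<bar> \<le> A" "\<And>x. \<bar>g x\<bar> \<le> B"
    using assms unfolding bcontfun_iff by blast
  have "\<bar>f x + c * g x\<bar> \<le> A + \<bar>c\<bar> * B" for x
    using AB(1)[of x] mult_left_mono[OF AB(2)[of x], of "\<bar>c\<bar>"]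
      abs_triangle_ineq[of "f x" "c * g x"] by (simp add: abs_mult)
  then show ?thesis
    using assms unfolding bcontfun_iff by (auto intro!: continuous_on_add continuous_on_mult_left)
qed

lemma bcontfun_const: "(\<lambda>x. c) \<in> bcontfun" for c :: real
  unfolding bcontfun_iff by auto

lemma bcontfun_diff:
  fixes f g :: "'a::topological_space \<Rightarrow> real"
  assumes "f \<in> bcontfun" "g \<in> bcontfun"
  shows "(\<lambda>x. f x - g x) \<in> bcontfun"
  using bcontfun_lincomb[OF assms, of "-1"] by simp

lemma bcontfun_sum:
  fixes h :: "'i \<Rightarrow> 'a::topological_space \<Rightarrow> real"
  shows "(\<And>i. i \<in> F \<Longrightarrow> h i \<in> bcontfun) \<Longrightarrow> (\<lambda>x. \<Sum>i\<in>F. c i * h i x) \<in> bcontfun"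
proof (induction F rule: infinite_finite_induct)
  case (insert i F)
  then have "(\<lambda>x. (\<Sum>i\<in>F. c i * h i x) + c i * h i x) \<in> bcontfun"
    by (intro bcontfun_lincomb) auto
  then show ?case using insert.hyps by (simp add: add.commute)
qed (auto intro: bcontfun_const)

lemma bcontfun_powr:
  fixes h :: "'a::topological_space \<Rightarrow> real"
  assumes "h \<in> bcontfun" "p > 0"
  shows "(\<lambda>x. \<bar>h x\<bar> powr p) \<in> bcontfun"
proof -
  obtain B where B: "\<And>x. \<bar>h x\<bar> \<le> B" using assms(1) unfolding bcontfun_iff by blast
  have "\<bar>\<bar>h x\<bar> powr p\<bar> \<le> B powr p" for x
    using B[of x] assms(2) by (simp add: powr_mono2)
  moreover have "continuous_on UNIV (\<lambda>x. \<bar>h x\<bar> powr p)"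
    using assms unfolding bcontfun_iff
    by (intro continuous_on_powr' continuous_intros) auto
  ultimately show ?thesis unfolding bcontfun_iff by blast
qed

lemma continuous_on_slice:
  assumes "continuous_on (A \<times> B) (\<lambda>(t, x). u t x)" "t \<in> A"
  shows "continuous_on B (u t)"
proof -
  have "continuous_on B ((\<lambda>(t, x). u t x) \<circ> (\<lambda>x. (t, x)))"
    by (rule continuous_on_compose) (auto intro!: continuous_intros continuous_on_subset[OF assms(1)] simp: assms(2))
  then show ?thesis by (simp add: comp_def)
qed

text \<open>Such a tangent line gives Jensen's inequality for every positive normalised functional.\<close>

lemma powr_tangent:
  fixes p :: real
  assumes "p > 1"
  obtains l where "\<And>y. \<bar>y\<bar> powr p \<ge> \<bar>x\<bar> powr p + l * (y - x)"
proof (cases "x = 0")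
  case True
  then show ?thesis using that[of 0] by simp
next
  case False
  \<comment> \<open>The derivative of the power function at \<open>x\<close>. Since
    \<open>sgn x * y\<close> is at most \<open>\<bar>y\<bar>\<close>, the inequality for nonnegative
    arguments suffices.\<close>
  let ?l = "sgn x * (p * \<bar>x\<bar> powr (p - 1))"
  have pos: "u powr p \<ge> z powr p + p * z powr (p - 1) * (u - z)" if "z > 0" "u \<ge> 0" for u z :: real
  proof (cases "u = 0")
    case True
    have "z powr (p - 1) * z = z powr p" using that by (simp add: powr_diff)
    then show ?thesis using True assms that by (simp add: algebra_simps)
  next
    case False
    have *: "((\<lambda>x. x powr p) has_real_derivative p * w powr (p - 1)) (at w)" if "w > 0" for w
      using that by (rule has_real_derivative_powr)
    show ?thesis
    proof (cases u z rule: linorder_cases)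
      case less
      have "\<exists>w>u. w < z \<and> z powr p - u powr p = (z - u) * (p * w powr (p - 1))"
        by (rule MVT2[OF less *]) (use False that in linarith)
      then obtain w where w: "u < w" "w < z" "z powr p - u powr p = (z - u) * (p * w powr (p - 1))"
        by blast
      have "w powr (p - 1) \<le> z powr (p - 1)" using w False that assms by (intro powr_mono2) auto
      then have "(z - u) * (p * w powr (p - 1)) \<le> (z - u) * (p * z powr (p - 1))"
        using less assms by (intro mult_left_mono) auto
      then show ?thesis using w by (simp add: algebra_simps)
    next
      case greater
      have "\<exists>w>z. w < u \<and> u powr p - z powr p = (u - z) * (p * w powr (p - 1))"
        by (rule MVT2[OF greater *]) (use False that in linarith)
      then obtain w where w: "z < w" "w < u" "u powr p - z powr p = (u - z) * (p * w powr (p - 1))"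
        by blast
      have "z powr (p - 1) \<le> w powr (p - 1)" using w False that assms by (intro powr_mono2) auto
      then have "(u - z) * (p * z powr (p - 1)) \<le> (u - z) * (p * w powr (p - 1))"
        using greater assms by (intro mult_left_mono) auto
      then show ?thesis using w by (simp add: algebra_simps)
    qed simp
  qed
  have "\<bar>y\<bar> powr p \<ge> \<bar>x\<bar> powr p + ?l * (y - x)" for y
  proof -
    have "p * \<bar>x\<bar> powr (p - 1) * (sgn x * y - \<bar>x\<bar>) \<le> p * \<bar>x\<bar> powr (p - 1) * (\<bar>y\<bar> - \<bar>x\<bar>)"
      using assms by (intro mult_left_mono) (auto simp: sgn_if)
    moreover have "?l * (y - x) = p * \<bar>x\<bar> powr (p - 1) * (sgn x * y - \<bar>x\<bar>)"
      by (simp add: algebra_simps sgn_if)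
    moreover have "\<bar>x\<bar> powr p + p * \<bar>x\<bar> powr (p - 1) * (\<bar>y\<bar> - \<bar>x\<bar>) \<le> \<bar>y\<bar> powr p"
      using pos[of "\<bar>x\<bar>" "\<bar>y\<bar>"] False by simp
    ultimately show ?thesis by linarith
  qed
  then show ?thesis by (rule that)
qed

section \<open>The comparison principle\<close>

locale parabolic =
  fixes I :: "real set"
    and q :: "real \<Rightarrow> real ^ 'n::finite \<Rightarrow> real ^ 'n ^ 'n"
    and b :: "real \<Rightarrow> real ^ 'n \<Rightarrow> real ^ 'n"
    and \<alpha> :: real
    and \<eta> :: "real \<Rightarrow> real ^ 'n \<Rightarrow> real"
    and \<phi> :: "real ^ 'n \<Rightarrow> real"
  assumes standing: "standing_assumptions I q b \<alpha> \<eta> \<phi>"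
begin

lemma I_upward: "s \<in> I \<Longrightarrow> s \<le> t \<Longrightarrow> t \<in> I"
  using standing unfolding standing_assumptions_def by auto

lemma q_symmetric: "t \<in> I \<Longrightarrow> transpose (q t x) = q t x"
  using standing unfolding standing_assumptions_def by blast

lemma q_elliptic: "\<exists>\<eta>\<^sub>0>0. \<forall>t\<in>I. \<forall>x \<xi>. \<eta>\<^sub>0 * (norm \<xi>)\<^sup>2 \<le> (q t x *v \<xi>) \<bullet> \<xi>"
proof -
  obtain \<eta>\<^sub>0 where "\<eta>\<^sub>0 > 0" and 1: "\<And>t x. t \<in> I \<Longrightarrow> \<eta>\<^sub>0 \<le> \<eta> t x"
    using standing unfolding standing_assumptions_def by blast
  moreover have "\<eta>\<^sub>0 * (norm \<xi>)\<^sup>2 \<le> (q t x *v \<xi>) \<bullet> \<xi>" if "t \<in> I" for t x \<xi>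
  proof -
    have "\<eta>\<^sub>0 * (norm \<xi>)\<^sup>2 \<le> \<eta> t x * (norm \<xi>)\<^sup>2" by (intro mult_right_mono 1 that) simp
    also have "\<dots> \<le> (q t x *v \<xi>) \<bullet> \<xi>"
      using standing that unfolding standing_assumptions_def by blast
    finally show ?thesis .
  qed
  ultimately show ?thesis by blast
qed

lemma q_psd: "t \<in> I \<Longrightarrow> 0 \<le> (q t x *v \<xi>) \<bullet> \<xi>"
  using q_elliptic by (meson less_imp_le mult_nonneg_nonneg order_trans zero_le_power2)

lemma lyapunov:
  obtains a where "a > 0" "\<And>t x. t \<in> I \<Longrightarrow> ell_op q b t \<phi> x \<le> a"
proof -
  obtain a c where "a > 0" "c > 0" "\<And>t x. t \<in> I \<Longrightarrow> ell_op q b t \<phi> x \<le> a - c * \<phi> x"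
    using standing unfolding standing_assumptions_def by blast
  moreover have "\<phi> x \<ge> 0" for x
    using standing unfolding standing_assumptions_def by blast
  ultimately show ?thesis
    by (intro that[of a]) (simp, smt (verit) mult_nonneg_nonneg)
qed

lemma phi: "\<phi> \<in> C2_space" "0 \<le> \<phi> x" "filterlim \<phi> at_top at_infinity"
  using standing unfolding standing_assumptions_def by blast+

text \<open>The perturbation by a small multiple of the Lyapunov function makes the minimum attained
  and the supersolution strict.\<close>

lemma comparison:
  assumes s: "s \<in> I" and E: "open E"
    and cont: "continuous_on ({s..T} \<times> closure E) (\<lambda>(t, x). v t x)"
    and C2: "\<And>t. s < t \<Longrightarrow> t \<le> T \<Longrightarrow> v t \<in> C2_space"
    and dt: "\<And>t x. s < t \<Longrightarrow> t \<le> T \<Longrightarrow> x \<in> E \<Longrightarrow> ((\<lambda>r. v r x) has_real_derivative v' t x) (at t)"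
    and super: "\<And>t x. s < t \<Longrightarrow> t \<le> T \<Longrightarrow> x \<in> E \<Longrightarrow> ell_op q b t (v t) x \<le> v' t x"
    and init: "\<And>x. x \<in> closure E \<Longrightarrow> 0 \<le> v s x"
    and bdry: "\<And>t x. s \<le> t \<Longrightarrow> t \<le> T \<Longrightarrow> x \<in> frontier E \<Longrightarrow> 0 \<le> v t x"
    and bdd: "\<And>t x. s \<le> t \<Longrightarrow> t \<le> T \<Longrightarrow> x \<in> closure E \<Longrightarrow> - B \<le> v t x"
    and t: "s \<le> t" "t \<le> T" and x: "x \<in> closure E"
  shows "0 \<le> v t x"
proof -
  obtain a where a: "a > 0" "\<And>t x. t \<in> I \<Longrightarrow> ell_op q b t \<phi> x \<le> a"
    using lyapunov by blast
  have main: "0 \<le> v t x + \<epsilon> * (\<phi> x + (a + 1) * (t - s))" if eps: "\<epsilon> > 0" for \<epsilon>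
  proof (rule ccontr)
    assume neg: "\<not> 0 \<le> v t x + \<epsilon> * (\<phi> x + (a + 1) * (t - s))"
    \<comment> \<open>The slope \<open>a + 1\<close> in time exceeds the bound \<open>a\<close> for
      the generator on \<open>\<phi>\<close> by one; strictness of the supersolution comes from this
      excess.\<close>
    define w where "w t x = v t x + \<epsilon> * (\<phi> x + (a + 1) * (t - s))" for t x
    \<comment> \<open>Beyond this radius the Lyapunov term outweighs the lower bound
      \<open>- B\<close>, so negative values of \<open>w\<close> occur only in a compact
      set.\<close>
    obtain R where R: "\<And>x. norm x \<ge> R \<Longrightarrow> \<phi> x \<ge> (\<bar>B\<bar> + 1) / \<epsilon>"
      using phi(3) unfolding filterlim_at_top eventually_at_infinity by blast
    have big: "w t x > 0" if "s \<le> t" "t \<le> T" "x \<in> closure E" "norm x \<ge> R" for t x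
    proof -
      have "\<epsilon> * \<phi> x \<ge> \<bar>B\<bar> + 1" using R[OF that(4)] eps by (simp add: field_simps)
      moreover have "\<epsilon> * ((a + 1) * (t - s)) \<ge> 0" using eps a that by simp
      ultimately show ?thesis using bdd[OF that(1-3)] unfolding w_def by (simp add: distrib_left)
    qed
    let ?K = "{s..T} \<times> (closure E \<inter> cball 0 R)"
    have K: "compact ?K" by (intro compact_Times closed_Int_compact) auto
    have wneg: "w t x < 0" using neg unfolding w_def by simp
    have in_K: "(t, x) \<in> ?K" using big[OF t x] wneg t x by (cases "norm x \<ge> R") auto
    have contw: "continuous_on ?K (\<lambda>(t, x). w t x)"
    proof -
      have "continuous_on ?K (\<lambda>z. \<phi> (snd z))"
        by (rule continuous_on_compose2[OF C2_spaceD(1)[OF phi(1)]]) (auto intro: continuous_intros)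
      moreover have "continuous_on ?K (\<lambda>(t, x). v t x)"
        by (rule continuous_on_subset[OF cont]) auto
      ultimately show ?thesis
        unfolding w_def split_def by (intro continuous_intros)
    qed
    obtain z where z: "z \<in> ?K" "\<And>y. y \<in> ?K \<Longrightarrow> (\<lambda>(t, x). w t x) z \<le> (\<lambda>(t, x). w t x) y"
      using continuous_attains_inf[OF K _ contw] in_K by blast
    obtain t0 x0 where z0: "z = (t0, x0)" by (cases z)
    have min: "w t0 x0 \<le> w r y" if "s \<le> r" "r \<le> T" "y \<in> closure E" "norm y \<le> R" for r y
      using z(2)[of "(r, y)"] that unfolding z0 by auto
    have 0: "s \<le> t0" "t0 \<le> T" "x0 \<in> closure E" "norm x0 \<le> R" using z(1) unfolding z0 by auto
    have neg0: "w t0 x0 < 0" using z(2)[OF in_K] wneg unfolding z0 by auto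
    have nR: "norm x0 < R" using big[OF 0(1-3)] neg0 by (cases "norm x0 \<ge> R") auto
    have nonneg_extra: "0 \<le> \<epsilon> * (\<phi> x0 + (a + 1) * (t0 - s))" using eps a 0 phi(2) by simp
    have "t0 \<noteq> s" using init[OF 0(3)] neg0 nonneg_extra unfolding w_def by auto
    then have t0: "s < t0" using 0 by simp
    have "x0 \<notin> frontier E" using bdry[OF 0(1,2)] neg0 nonneg_extra unfolding w_def by force
    then have x0: "x0 \<in> E" using 0(3) E interior_open unfolding frontier_def by auto
    have t0I: "t0 \<in> I" using I_upward[OF s] 0 by simp
    note C2v = C2[OF t0 0(2)]
    have C2vp: "(\<lambda>x. v t0 x + \<epsilon> * \<phi> x) \<in> C2_space" by (intro C2_lincomb(1) C2v phi)
    have weq: "w t0 = (\<lambda>x. (v t0 x + \<epsilon> * \<phi> x) + (\<epsilon> * ((a + 1) * (t0 - s))) * 1)"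
      unfolding w_def by (simp add: distrib_left add.assoc)
    have C2w: "w t0 \<in> C2_space" unfolding weq by (intro C2_lincomb(1) C2vp C2_const(1))
    have ellw: "ell_op q b t0 (w t0) x0 = ell_op q b t0 (v t0) x0 + \<epsilon> * ell_op q b t0 \<phi> x0"
      unfolding weq ell_op_lincomb[OF C2vp C2_const(1)] ell_op_lincomb[OF C2v phi(1)] ell_op_const by simp
    obtain e where e: "e > 0" "ball x0 e \<subseteq> E \<inter> ball 0 R"
    proof -
      have "open (E \<inter> ball 0 R)" "x0 \<in> E \<inter> ball 0 R" using E x0 nR by auto
      then show ?thesis using that unfolding open_contains_ball by metis
    qed
    have "0 \<le> ell_op q b t0 (w t0) x0"
    proof (rule ell_op_local_min[where q=q and t=t0 and x=x0, OF q_symmetric[OF t0I] q_psd[OF t0I] C2w e(1)])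
      fix y assume "dist y x0 < e"
      then have "y \<in> E \<inter> ball 0 R" using e(2) by (auto simp: dist_commute)
      then show "w t0 x0 \<le> w t0 y" using 0 closure_subset by (intro min) auto
    qed
    \<comment> \<open>Only earlier times are compared with \<open>t0\<close>, which may be the final
      time \<open>T\<close>; so the time derivative is shown to be nonpositive rather than
      zero.\<close>
    moreover have "v' t0 x0 + \<epsilon> * (a + 1) \<le> 0"
    proof (rule ccontr)
      assume "\<not> ?thesis"
      moreover have "((\<lambda>r. w r x0) has_real_derivative v' t0 x0 + \<epsilon> * (a + 1)) (at t0)"
        unfolding w_def by (auto intro!: derivative_eq_intros dt[OF t0 0(2) x0])
      ultimately obtain d where d: "d > 0" "\<And>h. 0 < h \<Longrightarrow> h < d \<Longrightarrow> w (t0 - h) x0 < w t0 x0"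
        using DERIV_pos_inc_left[of "\<lambda>r. w r x0" _ t0] by (auto simp: not_le)
      define h where "h = min d (t0 - s) / 2"
      have "0 < h" "h < d" "h \<le> t0 - s" using d t0 by (auto simp: h_def min_def)
      then show False using d(2)[of h] min[of "t0 - h" x0] 0 by auto
    qed
    moreover have "\<epsilon> * ell_op q b t0 \<phi> x0 \<le> \<epsilon> * a" using a(2)[OF t0I] eps by simp
    ultimately show False
      using super[OF t0 0(2) x0] ellw eps by (simp add: distrib_left)
  qed
  show ?thesis
  proof (rule ccontr)
    assume neg: "\<not> 0 \<le> v t x"
    define K where "K = \<phi> x + (a + 1) * (t - s)"
    have K: "K \<ge> 0" unfolding K_def using phi(2) a t by simp
    \<comment> \<open>This choice of \<epsilon> keeps the perturbation at or below half of
      \<open>- v t x\<close>.\<close>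
    have "- v t x / (2 * (K + 1)) > 0" using neg K by (simp add: divide_neg_pos)
    from main[OF this] have "0 \<le> v t x + (- v t x / (2 * (K + 1))) * K" unfolding K_def .
    moreover have "(- v t x / (2 * (K + 1))) * K \<le> - v t x / 2"
    proof -
      have "(- v t x) * (K / (K + 1)) \<le> (- v t x) * 1" using neg K by (intro mult_left_mono) auto
      then show ?thesis using K by (simp add: field_simps)
    qed
    ultimately show False using neg by linarith
  qed
qed

text \<open>No initial value is prescribed, so the class is closed under linear combinations and
  under restriction to later initial times, and contains the constants.\<close>

definition solution :: "real \<Rightarrow> (real \<Rightarrow> real ^ 'n \<Rightarrow> real) \<Rightarrow> bool" where
  "solution s u \<longleftrightarrow> u \<in> Cb_from s \<and> (\<forall>t>s. u t \<in> C2_space \<and>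
     (\<forall>x. ((\<lambda>r. u r x) has_real_derivative ell_op q b t (u t) x) (at t)))"

lemma bounded_classical_solution_imp_solution:
  assumes "bounded_classical_solution q b s f u"
  shows "solution s u"
proof -
  have u: "u \<in> C12_after s" and eq: "\<And>t x. t > s \<Longrightarrow> deriv (\<lambda>r. u r x) t = ell_op q b t (u t) x"
    using assms unfolding bounded_classical_solution_def by auto
  have "u t \<in> C2_space" if "t > s" for t
    using u that unfolding C12_after_def C2_space_def
    by (auto intro: continuous_on_slice[where A="{s<..}" and t=t])
  moreover have "((\<lambda>r. u r x) has_real_derivative ell_op q b t (u t) x) (at t)" if "t > s" for t x
    using u that unfolding eq[OF that, symmetric] C12_after_def
    by (simp add: DERIV_deriv_iff_field_differentiable)
  ultimately show ?thesis
    using assms unfolding bounded_classical_solution_def solution_def by blast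
qed

lemma Cb_from_iff:
  "u \<in> Cb_from s \<longleftrightarrow> continuous_on ({s..} \<times> UNIV) (\<lambda>(t, x). u t x) \<and> (\<exists>B. \<forall>t\<ge>s. \<forall>x. \<bar>u t x\<bar> \<le> B)"
  unfolding Cb_from_def bounded_iff by force

lemma Cb_from_bcontfun:
  assumes "u \<in> Cb_from s" "t \<ge> s"
  shows "u t \<in> bcontfun"
  using assms continuous_on_slice[of "{s..}" UNIV u t] unfolding Cb_from_iff bcontfun_iff by auto

lemma solution_lincomb:
  assumes u: "solution s u" and w: "solution s w"
  shows "solution s (\<lambda>t x. u t x + c * w t x)"
proof -
  obtain A where A: "\<And>t x. t \<ge> s \<Longrightarrow> \<bar>u t x\<bar> \<le> A"
    using u unfolding solution_def Cb_from_iff by blast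
  obtain B where B: "\<And>t x. t \<ge> s \<Longrightarrow> \<bar>w t x\<bar> \<le> B"
    using w unfolding solution_def Cb_from_iff by blast
  have "\<bar>u t x + c * w t x\<bar> \<le> A + \<bar>c\<bar> * B" if "t \<ge> s" for t x
    using A[OF that, of x] mult_left_mono[OF B[OF that, of x], of "\<bar>c\<bar>"]
      abs_triangle_ineq[of "u t x" "c * w t x"] by (simp add: abs_mult)
  moreover have "continuous_on ({s..} \<times> UNIV) (\<lambda>(t, x). u t x + c * w t x)"
    using u w unfolding solution_def Cb_from_iff split_def by (intro continuous_intros) auto
  ultimately have "(\<lambda>t x. u t x + c * w t x) \<in> Cb_from s" unfolding Cb_from_iff by blast
  moreover have "(\<lambda>x. u t x + c * w t x) \<in> C2_space \<and>
     (\<forall>x. ((\<lambda>r. u r x + c * w r x) has_real_derivative ell_op q b t (\<lambda>x. u t x + c * w t x) x) (at t))"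
    if "t > s" for t
    using u w that unfolding solution_def
    by (auto simp: ell_op_lincomb intro!: C2_lincomb(1) DERIV_add DERIV_cmult)
  ultimately show ?thesis unfolding solution_def by blast
qed

lemma solution_const: "solution s (\<lambda>t x. c)"
  unfolding solution_def Cb_from_iff by (auto simp: ell_op_const C2_const(1) split_def)

lemma solution_restrict:
  assumes "solution s u" "s \<le> r"
  shows "solution r u"
proof -
  have "continuous_on ({r..} \<times> UNIV) (\<lambda>(t, x). u t x)"
    using assms unfolding solution_def Cb_from_iff by (auto elim!: continuous_on_subset)
  then show ?thesis using assms unfolding solution_def Cb_from_iff
    by (meson le_less_trans order_trans)
qed

text \<open>The comparison principle on the whole space: the frontier is empty, and boundedness
  together with the Lyapunov function takes the place of boundary values.\<close>

lemma solution_nonneg: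
  assumes s: "s \<in> I" and u: "solution s u" and init: "\<And>x. 0 \<le> u s x" and t: "s \<le> t"
  shows "0 \<le> u t x"
proof -
  obtain B where B: "\<And>t x. t \<ge> s \<Longrightarrow> \<bar>u t x\<bar> \<le> B"
    using u unfolding solution_def Cb_from_iff by blast
  show ?thesis
  proof (rule comparison[where s=s and E=UNIV and T=t and v=u and v'="\<lambda>t. ell_op q b t (u t)" and B=B])
    show "continuous_on ({s..t} \<times> closure UNIV) (\<lambda>(t, x). u t x)"
      using u unfolding solution_def Cb_from_iff by (auto elim!: continuous_on_subset)
    show "- B \<le> u r x" if "s \<le> r" for r x using B[OF that, of x] by simp
  qed (use s u init t in \<open>auto simp: solution_def\<close>)
qed

lemma solution_le:
  assumes s: "s \<in> I" and u: "solution s u" and w: "solution s w" and init: "\<And>x. u s x \<le> w s x" and t: "s \<le> t"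
  shows "u t x \<le> w t x"
  using solution_nonneg[OF s solution_lincomb[OF w u, of "-1"] _ t] init by simp

lemma solution_unique:
  assumes "s \<in> I" "solution s u" "solution s w" "\<And>x. u s x = w s x" "s \<le> t"
  shows "u t x = w t x"
  by (rule antisym; rule solution_le[of s]) (use assms in auto)

end

section \<open>The evolution operator on bounded continuous functions\<close>

locale evolution = parabolic I q b \<alpha> \<eta> \<phi>
  for I :: "real set"
    and q :: "real \<Rightarrow> real ^ 'n::finite \<Rightarrow> real ^ 'n ^ 'n"
    and b :: "real \<Rightarrow> real ^ 'n \<Rightarrow> real ^ 'n"
    and \<alpha> :: real
    and \<eta> :: "real \<Rightarrow> real ^ 'n \<Rightarrow> real"
    and \<phi> :: "real ^ 'n \<Rightarrow> real" +
  fixes G :: "real \<Rightarrow> real \<Rightarrow> (real ^ 'n \<Rightarrow> real) \<Rightarrow> real ^ 'n \<Rightarrow> real"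
    and \<mu> :: "real \<Rightarrow> (real ^ 'n) measure"
  assumes evol: "evolution_operator I q b G"
    and meas: "tight_evolution_system I G \<phi> \<mu>"
begin

lemma G_solution:
  assumes "s \<in> I" "f \<in> bcontfun"
  shows "solution s (\<lambda>t. G t s f)" and "G s s f = f"
proof -
  have *: "bounded_classical_solution q b s f (\<lambda>t. G t s f)"
    using evol assms unfolding evolution_operator_def by blast
  show "solution s (\<lambda>t. G t s f)" by (rule bounded_classical_solution_imp_solution[OF *])
  show "G s s f = f" using * unfolding bounded_classical_solution_def by blast
qed

lemma G_bcontfun:
  assumes "s \<in> I" "f \<in> bcontfun" "s \<le> t"
  shows "G t s f \<in> bcontfun"
  using Cb_from_bcontfun[of "\<lambda>t. G t s f" s t] G_solution(1)[OF assms(1,2)] assms(3)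
  unfolding solution_def by blast

lemma G_mono:
  assumes "s \<in> I" "f \<in> bcontfun" "g \<in> bcontfun" "\<And>x. f x \<le> g x" "s \<le> t"
  shows "G t s f x \<le> G t s g x"
  by (rule solution_le[OF assms(1) G_solution(1)[OF assms(1,2)] G_solution(1)[OF assms(1,3)] _ assms(5)])
    (simp add: G_solution(2) assms)

lemma G_lincomb:
  assumes "s \<in> I" "f \<in> bcontfun" "g \<in> bcontfun" "s \<le> t"
  shows "G t s (\<lambda>x. f x + c * g x) = (\<lambda>x. G t s f x + c * G t s g x)"
proof
  fix x
  have *: "(\<lambda>x. f x + c * g x) \<in> bcontfun" by (intro bcontfun_lincomb assms)
  note f = G_solution[OF assms(1,2)] and g = G_solution[OF assms(1,3)] and fg = G_solution[OF assms(1) *]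
  show "G t s (\<lambda>x. f x + c * g x) x = G t s f x + c * G t s g x"
    by (rule solution_unique[OF assms(1) fg(1) solution_lincomb[OF f(1) g(1), of c] _ assms(4)])
      (simp add: f(2) g(2) fg(2))
qed

lemma G_diff:
  assumes "s \<in> I" "f \<in> bcontfun" "g \<in> bcontfun" "s \<le> t"
  shows "G t s (\<lambda>x. f x - g x) = (\<lambda>x. G t s f x - G t s g x)"
  using G_lincomb[OF assms, of "-1"] by simp

lemma G_const:
  assumes "s \<in> I" "s \<le> t"
  shows "G t s (\<lambda>x. c) = (\<lambda>x. c)"
proof
  fix x
  note G = G_solution[OF assms(1) bcontfun_const[of c]]
  show "G t s (\<lambda>x. c) x = c"
    by (rule solution_unique[OF assms(1) G(1) solution_const _ assms(2)]) (simp add: G(2))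
qed

lemma G_sum:
  assumes "s \<in> I" "s \<le> t"
  shows "(\<And>i. i \<in> F \<Longrightarrow> h i \<in> bcontfun) \<Longrightarrow>
    G t s (\<lambda>x. \<Sum>i\<in>F. c i * h i x) = (\<lambda>x. \<Sum>i\<in>F. c i * G t s (h i) x)"
proof (induction F rule: infinite_finite_induct)
  case (insert i F)
  have "G t s (\<lambda>x. (\<Sum>i\<in>F. c i * h i x) + c i * h i x) = (\<lambda>x. (\<Sum>i\<in>F. c i * G t s (h i) x) + c i * G t s (h i) x)"
    using insert by (subst G_lincomb) (auto intro: assms bcontfun_sum)
  then show ?case using insert.hyps by (simp add: add.commute)
qed (auto simp: G_const assms)

text \<open>Both sides solve the equation from time \<open>r\<close> on with the initial value
  \<open>G r s f\<close>.\<close>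

lemma G_semigroup:
  assumes "s \<in> I" "f \<in> bcontfun" "s \<le> r" "r \<le> t"
  shows "G t r (G r s f) = G t s f"
proof
  fix x
  have r: "r \<in> I" using I_upward assms by blast
  have g: "G r s f \<in> bcontfun" by (intro G_bcontfun assms)
  show "G t r (G r s f) x = G t s f x"
    by (rule solution_unique[OF r G_solution(1)[OF r g]
          solution_restrict[OF G_solution(1)[OF assms(1,2)] assms(3)] _ assms(4)])
      (simp add: G_solution(2)[OF r g])
qed

text \<open>Evaluation of \<open>G t s\<close> at \<open>x\<close> is a positive linear functional
  that preserves constants; the tangent is taken at the value of this functional on
  \<open>h\<close>.\<close>

lemma G_Jensen:
  assumes s: "s \<in> I" and h: "h \<in> bcontfun" and t: "s \<le> t" and p: "1 < p"
  shows "\<bar>G t s h x\<bar> powr p \<le> G t s (\<lambda>x. \<bar>h x\<bar> powr p) x"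
proof -
  obtain l where l: "\<And>y. \<bar>y\<bar> powr p \<ge> \<bar>G t s h x\<bar> powr p + l * (y - G t s h x)"
    using powr_tangent[OF p] by blast
  have 1: "(\<lambda>y. (\<bar>G t s h x\<bar> powr p - l * G t s h x) + l * h y) \<in> bcontfun"
    by (intro bcontfun_lincomb bcontfun_const h)
  have 2: "(\<lambda>x. \<bar>h x\<bar> powr p) \<in> bcontfun" using bcontfun_powr[OF h] p by simp
  have "G t s (\<lambda>y. (\<bar>G t s h x\<bar> powr p - l * G t s h x) + l * h y) x \<le> G t s (\<lambda>x. \<bar>h x\<bar> powr p) x"
  proof (rule G_mono[OF s 1 2 _ t])
    fix y show "(\<bar>G t s h x\<bar> powr p - l * G t s h x) + l * h y \<le> \<bar>h y\<bar> powr p"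
      using l[of "h y"] by (simp add: algebra_simps)
  qed
  moreover have "G t s (\<lambda>y. (\<bar>G t s h x\<bar> powr p - l * G t s h x) + l * h y) x =
      (\<bar>G t s h x\<bar> powr p - l * G t s h x) + l * G t s h x"
    by (simp add: G_lincomb[OF s bcontfun_const h t] G_const[OF s t])
  ultimately show ?thesis by simp
qed

lemma mu:
  assumes "t \<in> I"
  shows "prob_space (\<mu> t)" "sets (\<mu> t) = sets borel" "space (\<mu> t) = UNIV"
proof -
  show 1: "sets (\<mu> t) = sets borel" and "prob_space (\<mu> t)"
    using meas assms unfolding tight_evolution_system_def by (auto intro: prob_spaceI)
  show "space (\<mu> t) = UNIV" using sets_eq_imp_space_eq[OF 1] by simp
qed

lemma G_invariant:
  assumes "s \<in> I" "f \<in> bcontfun" "s \<le> t"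
  shows "(\<integral>x. G t s f x \<partial>\<mu> t) = (\<integral>x. f x \<partial>\<mu> s)"
proof (cases "s = t")
  case True
  then show ?thesis using G_solution(2) assms by simp
next
  case False
  then show ?thesis using meas assms unfolding tight_evolution_system_def by auto
qed

lemma bcontfun_integrable:
  fixes f :: "real ^ 'n \<Rightarrow> real"
  assumes "t \<in> I" "f \<in> bcontfun"
  shows "integrable (\<mu> t) f"
proof -
  interpret prob_space "\<mu> t" by (rule mu[OF assms(1)])
  obtain B where "\<And>x. \<bar>f x\<bar> \<le> B" using assms(2) unfolding bcontfun_iff by blast
  moreover have "f \<in> borel_measurable (\<mu> t)"
    using assms unfolding bcontfun_iff
    by (simp add: borel_measurable_continuous_onI measurable_cong_sets[OF mu(2)[OF assms(1)] refl])
  ultimately show ?thesis by (intro integrable_const_bound[where B=B]) auto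
qed

end

section \<open>Gaussian barriers\<close>

definition quad :: "real ^ 'n ^ 'n \<Rightarrow> real ^ 'n::finite \<Rightarrow> real" where
  "quad M z = (M *v z) \<bullet> z"

text \<open>If \<open>M\<close> is the inverse of a constant matrix and
  \<open>c = 1 / (4 * s)\<close>, this is the heat kernel at time \<open>s\<close> of the operator
  with that leading matrix, up to a power of \<open>s\<close> and a constant factor.\<close>

definition gauss :: "real ^ 'n ^ 'n \<Rightarrow> real \<Rightarrow> real ^ 'n::finite \<Rightarrow> real ^ 'n \<Rightarrow> real" where
  "gauss M c y x = exp (- c * quad M (x - y))"

lemma symmetric_inner:
  assumes "transpose M = M"
  shows "(M *v x) \<bullet> y = (M *v y) \<bullet> (x :: real ^ 'n::finite)"
  using dot_lmul_matrix[of y M x] assms by (metis inner_commute transpose_matrix_vector)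

lemma matrix_mult_axis_component: "(M *v axis i 1) $ j = M $ j $ i" for M :: "real ^ 'n::finite ^ 'n"
  by (simp add: matrix_vector_mult_basis column_def)

lemma quad_DERIV:
  assumes "transpose M = M"
  shows "((\<lambda>h. quad M (x + h *\<^sub>R axis i 1 - y)) has_real_derivative 2 * (M *v (x - y)) $ i) (at 0)"
proof -
  have "quad M (x + h *\<^sub>R axis i 1 - y) = quad M (x - y) + h * (2 * (M *v (x - y)) $ i) + h * h * M $ i $ i" for h
  proof -
    have 1: "x + h *\<^sub>R axis i 1 - y = (x - y) + h *\<^sub>R axis i 1" by simp
    have 2: "(M *v (h *\<^sub>R axis i 1)) \<bullet> (x - y) = h * (M *v (x - y)) $ i"
      unfolding symmetric_inner[OF assms, of "h *\<^sub>R axis i 1"] by (simp add: inner_axis)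
    have 3: "(M *v (h *\<^sub>R axis i 1)) \<bullet> (h *\<^sub>R axis i 1) = h * h * M $ i $ i"
      by (simp add: matrix_vector_mult_scaleR inner_axis matrix_mult_axis_component)
    show ?thesis unfolding quad_def 1
      unfolding matrix_vector_right_distrib inner_add_left inner_add_right 2 3
      by (simp add: inner_axis)
  qed
  then show ?thesis by (auto intro!: derivative_eq_intros)
qed

lemma matrix_DERIV:
  "((\<lambda>h. (M *v (x + h *\<^sub>R axis i 1 - y)) $ j) has_real_derivative M $ j $ i) (at 0)"
  for M :: "real ^ 'n::finite ^ 'n"
proof -
  have 1: "x + h *\<^sub>R axis i 1 - y = (x - y) + h *\<^sub>R axis i 1" for h by simp
  have "(M *v (x + h *\<^sub>R axis i 1 - y)) $ j = (M *v (x - y)) $ j + h * M $ j $ i" for h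
    unfolding 1 by (simp add: matrix_vector_right_distrib matrix_vector_mult_scaleR matrix_mult_axis_component)
  then show ?thesis by (auto intro!: derivative_eq_intros)
qed

lemma continuous_on_matrix_component: "continuous_on S (\<lambda>x. (M *v (x - y)) $ j)"
  for M :: "real ^ 'n::finite ^ 'n"
  by (intro continuous_intros matrix_vector_mult_linear_continuous_on
      continuous_on_compose2[OF matrix_vector_mult_linear_continuous_on, of S _ UNIV]) auto

lemma continuous_on_quad: "continuous_on S (\<lambda>x. quad M (x - y))"
  for M :: "real ^ 'n::finite ^ 'n"
  unfolding quad_def
  by (intro continuous_intros
      continuous_on_compose2[OF matrix_vector_mult_linear_continuous_on, of S _ UNIV]) auto

lemma gauss_C2:
  fixes M :: "real ^ 'n::finite ^ 'n"
  assumes M: "transpose M = M"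
  shows "gauss M c y \<in> C2_space"
    and "pD i (gauss M c y) = (\<lambda>x. - 2 * c * (M *v (x - y)) $ i * gauss M c y x)"
    and "pD i (pD j (gauss M c y)) =
      (\<lambda>x. (4 * c\<^sup>2 * (M *v (x - y)) $ i * (M *v (x - y)) $ j - 2 * c * M $ j $ i) * gauss M c y x)"
proof -
  have 1: "((\<lambda>h. gauss M c y (x + h *\<^sub>R axis i 1)) has_real_derivative
      - 2 * c * (M *v (x - y)) $ i * gauss M c y x) (at 0)" for i x
    unfolding gauss_def
    by (auto intro!: derivative_eq_intros quad_DERIV[OF M, of x i y, THEN DERIV_cong])
  have 2: "((\<lambda>h. - 2 * c * (M *v (x + h *\<^sub>R axis i 1 - y)) $ j * gauss M c y (x + h *\<^sub>R axis i 1)) has_real_derivative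
      (4 * c\<^sup>2 * (M *v (x - y)) $ i * (M *v (x - y)) $ j - 2 * c * M $ j $ i) * gauss M c y x) (at 0)" for i j x
    by (rule DERIV_cong[OF DERIV_mult[OF DERIV_cmult[OF matrix_DERIV] 1]])
      (simp add: algebra_simps power2_eq_square)
  have cont: "continuous_on UNIV (gauss M c y)"
    unfolding gauss_def by (intro continuous_on_exp continuous_on_mult_left continuous_on_quad)
  show "gauss M c y \<in> C2_space"
    and "pD i (gauss M c y) = (\<lambda>x. - 2 * c * (M *v (x - y)) $ i * gauss M c y x)"
    and "pD i (pD j (gauss M c y)) =
      (\<lambda>x. (4 * c\<^sup>2 * (M *v (x - y)) $ i * (M *v (x - y)) $ j - 2 * c * M $ j $ i) * gauss M c y x)"
    by (rule C2_spaceI[OF cont 1 _ 2];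
        intro continuous_on_mult continuous_on_diff continuous_on_const continuous_on_matrix_component cont)+
qed

lemma ell_op_gauss:
  fixes M :: "real ^ 'n::finite ^ 'n"
  assumes M: "transpose M = M"
  shows "ell_op q b t (gauss M c y) x = gauss M c y x *
    (4 * c\<^sup>2 * quad (q t x) (M *v (x - y)) - 2 * c * (\<Sum>i\<in>UNIV. \<Sum>j\<in>UNIV. q t x $ i $ j * M $ j $ i)
      - 2 * c * (b t x \<bullet> (M *v (x - y))))"
proof -
  let ?z = "M *v (x - y)" and ?E = "gauss M c y x"
  have "(\<Sum>i\<in>UNIV. \<Sum>j\<in>UNIV. q t x $ i $ j * pD i (pD j (gauss M c y)) x) =
    (\<Sum>i\<in>UNIV. \<Sum>j\<in>UNIV. ?E * (4 * c\<^sup>2) * (?z $ i * ?z $ j * q t x $ i $ j) - ?E * (2 * c) * (q t x $ i $ j * M $ j $ i))"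
    unfolding gauss_C2(3)[OF M] by (intro sum.cong refl) (simp add: algebra_simps)
  also have "\<dots> = ?E * (4 * c\<^sup>2) * quad (q t x) ?z - ?E * (2 * c) * (\<Sum>i\<in>UNIV. \<Sum>j\<in>UNIV. q t x $ i $ j * M $ j $ i)"
    unfolding quad_def matrix_quadratic_form by (simp only: sum_subtractf sum_distrib_left)
  finally have 1: "(\<Sum>i\<in>UNIV. \<Sum>j\<in>UNIV. q t x $ i $ j * pD i (pD j (gauss M c y)) x) =
     ?E * (4 * c\<^sup>2) * quad (q t x) ?z - ?E * (2 * c) * (\<Sum>i\<in>UNIV. \<Sum>j\<in>UNIV. q t x $ i $ j * M $ j $ i)" .
  have "(\<Sum>i\<in>UNIV. b t x $ i * pD i (gauss M c y) x) = (\<Sum>i\<in>UNIV. - (?E * (2 * c)) * (b t x $ i * ?z $ i))"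
    unfolding gauss_C2(2)[OF M] by (intro sum.cong refl) (simp add: algebra_simps)
  also have "\<dots> = - (?E * (2 * c)) * (b t x \<bullet> ?z)"
    unfolding inner_vec_def by (simp add: sum_distrib_left)
  finally have 2: "(\<Sum>i\<in>UNIV. b t x $ i * pD i (gauss M c y) x) = - (?E * (2 * c)) * (b t x \<bullet> ?z)" .
  show ?thesis unfolding ell_op_def 1 2 by (simp add: algebra_simps)
qed

lemma norm_sq_C2:
  fixes y :: "real ^ 'n::finite"
  shows "(\<lambda>x. (norm (x - y))\<^sup>2) \<in> C2_space"
    and "ell_op q b t (\<lambda>x. (norm (x - y))\<^sup>2) x = 2 * trace (q t x) + 2 * (b t x \<bullet> (x - y))"
proof -
  have N: "(norm (x - y))\<^sup>2 = quad (mat 1) (x - y)" for x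
    by (simp add: quad_def power2_norm_eq_inner)
  have tr: "transpose (mat 1 :: real ^ 'n ^ 'n) = mat 1" by simp
  have 1: "((\<lambda>h. (norm (x + h *\<^sub>R axis i 1 - y))\<^sup>2) has_real_derivative 2 * (x - y) $ i) (at 0)" for i x
    using quad_DERIV[OF tr, of x i y] unfolding N by simp
  have 2: "((\<lambda>h. 2 * (x + h *\<^sub>R axis i 1 - y) $ j) has_real_derivative 2 * mat 1 $ j $ i) (at 0)" for i j x
    using matrix_DERIV[of "mat 1" x i y j] by (intro DERIV_cmult) simp
  note C = C2_spaceI[of "\<lambda>x. (norm (x - y))\<^sup>2" "\<lambda>i x. 2 * (x - y) $ i" "\<lambda>i j x. 2 * mat 1 $ j $ i", OF _ 1 _ 2]
  have cont: "continuous_on UNIV (\<lambda>x. (norm (x - y))\<^sup>2)" "continuous_on UNIV (\<lambda>x. 2 * (x - y) $ i)"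
    "continuous_on UNIV (\<lambda>x::real^'n. 2 * (mat 1 :: real^'n^'n) $ j $ i)" for i j
    by (intro continuous_intros)+
  show "(\<lambda>x. (norm (x - y))\<^sup>2) \<in> C2_space" by (rule C(1)[OF cont])
  have p: "pD i (\<lambda>x. (norm (x - y))\<^sup>2) = (\<lambda>x. 2 * (x - y) $ i)"
    "pD i (pD j (\<lambda>x. (norm (x - y))\<^sup>2)) = (\<lambda>x. 2 * mat 1 $ j $ i)" for i j
    by (rule C(2)[OF cont], rule C(3)[OF cont])
  have "(\<Sum>j\<in>UNIV. q t x $ i $ j * (2 * mat 1 $ j $ i)) = 2 * q t x $ i $ i" for i
    by (simp add: mat_def if_distrib[of "\<lambda>u. _ * u"] cong: if_cong)
  then show "ell_op q b t (\<lambda>x. (norm (x - y))\<^sup>2) x = 2 * trace (q t x) + 2 * (b t x \<bullet> (x - y))"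
    unfolding ell_op_def p(2) unfolding p(1) by (simp add: trace_def inner_vec_def sum_distrib_left algebra_simps)
qed

section \<open>Quantitative bounds for matrices and quadratic forms\<close>

lemma double_sum_bound:
  fixes F :: "'n::finite \<Rightarrow> 'n \<Rightarrow> real"
  assumes "\<And>i j. \<bar>F i j\<bar> \<le> B"
  shows "\<bar>\<Sum>i\<in>UNIV. \<Sum>j\<in>UNIV. F i j\<bar> \<le> (real CARD('n))\<^sup>2 * B"
proof -
  have "\<bar>\<Sum>i\<in>UNIV. \<Sum>j\<in>UNIV. F i j\<bar> \<le> (\<Sum>i\<in>(UNIV::'n set). \<Sum>j\<in>(UNIV::'n set). B)"
    by (intro order_trans[OF sum_abs] sum_mono) (rule assms)
  then show ?thesis by (simp add: power2_eq_square)
qed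

lemma quad_bound:
  fixes A :: "real ^ 'n::finite ^ 'n"
  assumes "\<And>i j. \<bar>A $ i $ j\<bar> \<le> B"
  shows "\<bar>quad A z\<bar> \<le> (real CARD('n))\<^sup>2 * (B * (norm z)\<^sup>2)"
  unfolding quad_def matrix_quadratic_form
proof (rule double_sum_bound)
  fix i j
  have "\<bar>z $ i * z $ j * A $ i $ j\<bar> = \<bar>z $ i\<bar> * \<bar>z $ j\<bar> * \<bar>A $ i $ j\<bar>" by (simp add: abs_mult)
  also have "\<dots> \<le> norm z * norm z * B"
    by (intro mult_mono component_le_norm_cart assms) auto
  finally show "\<bar>z $ i * z $ j * A $ i $ j\<bar> \<le> B * (norm z)\<^sup>2"
    by (simp add: power2_eq_square mult_ac)
qed

lemma inner_bound_l1:
  fixes v z :: "real ^ 'n::finite"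
  assumes "\<And>i. \<bar>v $ i\<bar> \<le> B"
  shows "\<bar>v \<bullet> z\<bar> \<le> real CARD('n) * (B * norm z)"
proof -
  have "\<bar>v \<bullet> z\<bar> \<le> (\<Sum>i\<in>(UNIV :: 'n set). B * norm z)"
    unfolding inner_vec_def
    by (intro order_trans[OF sum_abs] sum_mono)
      (use assms in \<open>auto simp: abs_mult intro!: mult_mono component_le_norm_cart order_trans[OF abs_ge_zero assms]\<close>)
  then show ?thesis by simp
qed

text \<open>Coercivity of \<open>Q\<close> bounds its inverse from above. Conversely, with
  \<open>w = M *v z\<close>, the entry bound gives \<open>norm z\<close> at most a multiple of
  \<open>norm w\<close>, while \<open>quad M z = quad Q w\<close> is at least
  \<open>e * (norm w)\<^sup>2\<close>; this is the coercivity of \<open>M\<close>. All constants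
  depend only on \<open>e\<close>, \<open>B\<close> and the dimension, so they are uniform in the
  point where the coefficients are frozen.\<close>

lemma elliptic_inverse:
  fixes Q :: "real ^ 'n::finite ^ 'n"
  assumes sym: "transpose Q = Q" and ell: "\<And>\<xi>. e * (norm \<xi>)\<^sup>2 \<le> quad Q \<xi>" and e: "e > 0"
    and B: "\<And>i j. \<bar>Q $ i $ j\<bar> \<le> B"
  obtains M where "transpose M = M" "\<And>z. quad Q (M *v z) = quad M z"
    "(\<Sum>i\<in>UNIV. \<Sum>j\<in>UNIV. Q $ i $ j * M $ j $ i) = CARD('n)"
    "\<And>z. norm (M *v z) \<le> norm z / e" "\<And>i j. \<bar>M $ i $ j\<bar> \<le> 1 / e"
    "\<And>z. e / ((real CARD('n))\<^sup>2 * (B + 1))\<^sup>2 * (norm z)\<^sup>2 \<le> quad M z" "\<And>z. quad M z \<le> (norm z)\<^sup>2 / e"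
proof -
  let ?n = "(real CARD('n))\<^sup>2"
  have "Q *v \<xi> = 0 \<Longrightarrow> \<xi> = 0" for \<xi>
  proof -
    assume "Q *v \<xi> = 0"
    then have "e * (norm \<xi>)\<^sup>2 \<le> 0" using ell[of \<xi>] by (simp add: quad_def)
    then show "\<xi> = 0" using e by (simp add: mult_le_0_iff)
  qed
  then obtain M where "M ** Q = mat 1"
    using matrix_left_invertible_ker[of Q] by blast
  then have QM: "Q ** M = mat 1" by (simp add: matrix_left_right_inverse)
  have tM: "transpose M = M"
  proof -
    have "transpose M ** Q = mat 1"
      using arg_cong[OF QM, of transpose] by (simp add: matrix_transpose_mul sym)
    then have "transpose M ** (Q ** M) = M" by (simp add: matrix_mul_assoc)
    then show ?thesis by (simp add: QM)
  qed
  have QMz: "Q *v (M *v z) = z" for z by (simp add: matrix_vector_mul_assoc QM)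
  have 1: "quad Q (M *v z) = quad M z" for z
    unfolding quad_def QMz by (simp add: inner_commute)
  have tr: "(\<Sum>i\<in>UNIV. \<Sum>j\<in>UNIV. Q $ i $ j * M $ j $ i) = CARD('n)"
  proof -
    have "(\<Sum>j\<in>UNIV. Q $ i $ j * M $ j $ i) = (Q ** M) $ i $ i" for i
      by (simp add: matrix_matrix_mult_def)
    then show ?thesis by (simp add: QM mat_def)
  qed
  have 2: "norm (M *v z) \<le> norm z / e" for z
  proof (cases "M *v z = 0")
    case False
    have "e * (norm (M *v z))\<^sup>2 \<le> quad M z" using ell[of "M *v z"] 1 by simp
    also have "\<dots> \<le> norm (M *v z) * norm z" unfolding quad_def by (rule norm_cauchy_schwarz)
    finally have "norm (M *v z) * (e * norm (M *v z)) \<le> norm (M *v z) * norm z"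
      by (simp add: power2_eq_square mult_ac)
    then have "e * norm (M *v z) \<le> norm z" using False by simp
    then show ?thesis using e by (simp add: field_simps)
  qed (use e in simp)
  have 3: "\<bar>M $ i $ j\<bar> \<le> 1 / e" for i j
  proof -
    have "\<bar>M $ i $ j\<bar> = \<bar>(M *v axis j 1) $ i\<bar>" by (simp add: matrix_mult_axis_component)
    also have "\<dots> \<le> norm (M *v axis j 1)" by (rule component_le_norm_cart)
    also have "\<dots> \<le> 1 / e" using 2[of "axis j 1"] by (simp add: norm_axis_1)
    finally show ?thesis .
  qed
  have B0: "0 \<le> B" using B order_trans[OF abs_ge_zero] by blast
  have n0: "?n > 0" by simp
  have 4: "e / (?n * (B + 1))\<^sup>2 * (norm z)\<^sup>2 \<le> quad M z" for z
  proof -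
    define w where "w = M *v z"
    have "norm z \<le> (\<Sum>i\<in>UNIV. \<bar>(Q *v w) $ i\<bar>)" unfolding w_def QMz by (rule norm_le_l1_cart)
    also have "\<dots> \<le> (\<Sum>i\<in>(UNIV::'n set). real CARD('n) * (B * norm w))"
    proof (intro sum_mono)
      fix i :: 'n
      have "(Q *v w) $ i = Q $ i \<bullet> w" by (simp add: matrix_vector_mult_def inner_vec_def)
      then show "\<bar>(Q *v w) $ i\<bar> \<le> real CARD('n) * (B * norm w)"
        using inner_bound_l1[of "Q $ i" B w] B by simp
    qed
    also have "\<dots> = ?n * B * norm w" by (simp add: power2_eq_square)
    also have "\<dots> \<le> ?n * (B + 1) * norm w" by (intro mult_right_mono mult_left_mono) auto
    finally have "(norm z)\<^sup>2 \<le> (?n * (B + 1) * norm w)\<^sup>2" by (intro power_mono) auto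
    then have "(norm z)\<^sup>2 \<le> (?n * (B + 1))\<^sup>2 * (norm w)\<^sup>2" by (simp add: power_mult_distrib)
    then have "e / (?n * (B + 1))\<^sup>2 * (norm z)\<^sup>2 \<le> e * (norm w)\<^sup>2"
      using e B0 n0 by (simp add: pos_divide_le_eq mult_ac)
    also have "\<dots> \<le> quad M z" using ell[of w] 1 unfolding w_def by simp
    finally show ?thesis .
  qed
  have 5: "quad M z \<le> (norm z)\<^sup>2 / e" for z
  proof -
    have "quad M z \<le> norm (M *v z) * norm z" unfolding quad_def by (rule norm_cauchy_schwarz)
    also have "\<dots> \<le> norm z / e * norm z" by (intro mult_right_mono 2) auto
    finally show ?thesis by (simp add: power2_eq_square)
  qed
  show ?thesis by (rule that[OF tM 1 tr 2 3 4 5])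
qed

text \<open>The scalar inequality behind the barrier \<open>S1 + K * S2\<close>: freezing the leading coefficients at
  the centre makes the heat kernel \<open>S1\<close> a solution up to an error which is smaller by the factor
  \<open>s powr (\<alpha> / 2)\<close>; the slightly wider and less singular Gaussian \<open>S2\<close> absorbs it.\<close>

lemma barrier_scalar:
  fixes n \<alpha> C1 C2 H m0 :: real
  assumes n: "n \<ge> 1" and \<alpha>: "0 < \<alpha>" "\<alpha> < 1" and C: "C1 \<ge> 0" "C2 \<ge> 0" "H \<ge> 0" and m0: "m0 > 0"
  defines "\<kappa> \<equiv> n / 2 - \<alpha> / 2" and "\<theta> \<equiv> 1 / 4 - \<alpha> / (8 * n)"
  shows "\<exists>K r0. K \<ge> 0 \<and> 0 < r0 \<and> r0 \<le> 1 \<and> (\<forall>s r P \<delta>. 0 < s \<and> s \<le> r0\<^sup>2 \<and> 0 \<le> r \<and> r \<le> r0 \<and> m0 * r\<^sup>2 \<le> P \<and>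
     0 \<le> \<delta> \<and> \<delta> \<le> H * (s powr (\<alpha> / 2) + r powr \<alpha>) \<longrightarrow>
     s powr (- n / 2) * exp (- (P / s) / 4) * (C1 * \<delta> * (1 + P / s) + C2 * r) \<le>
     K * (s powr (- \<kappa>) * exp (- \<theta> * (P / s)) *
       ((2 * \<theta> * n - \<kappa>) + \<theta> * (1 - 4 * \<theta>) * (P / s) - C1 * \<delta> * (1 + P / s) - C2 * r)))"
proof -
  define c0 where "c0 = \<alpha> / (16 * n)"
  \<comment> \<open>The gap \<open>1 / 4 - \<theta>\<close> between the two Gaussian exponents; its
    exponential pays for a quadratic polynomial in \<open>P / s\<close>, at the cost of the factor
    \<open>C4\<close>.\<close>
  define \<epsilon> where "\<epsilon> = \<alpha> / (8 * n)"
  define C3 where "C3 = C1 * H * (2 + 1 / m0) + C2 * (1 + 1 / m0)"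
  define C4 where "C4 = 4 / \<epsilon>\<^sup>2"
  define K where "K = 2 * C3 * C4 / c0"
  \<comment> \<open>Small enough that the errors from freezing and from the drift use up at most
    half of \<open>c0\<close>.\<close>
  define r0 where "r0 = min 1 ((c0 / (2 * (2 * C1 * H + C2 + 1))) powr (1 / \<alpha>))"
  have c0: "c0 > 0" and eps: "\<epsilon> > 0" "\<epsilon> \<le> 1 / 8" unfolding c0_def \<epsilon>_def using n \<alpha> by (auto simp: field_simps)
  have C3: "C3 \<ge> 0" unfolding C3_def using C m0 by simp
  have C4: "C4 > 0" unfolding C4_def using eps by simp
  have K: "K \<ge> 0" unfolding K_def using C3 C4 c0 by simp
  have den: "2 * C1 * H + C2 + 1 > 0" using C by (simp add: add_nonneg_pos)
  have r0: "0 < r0" "r0 \<le> 1" unfolding r0_def using c0 den by auto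
  have r0a: "(2 * C1 * H + C2) * r0 powr \<alpha> \<le> c0 / 2"
  proof -
    have "r0 powr \<alpha> \<le> ((c0 / (2 * (2 * C1 * H + C2 + 1))) powr (1 / \<alpha>)) powr \<alpha>"
      using r0 \<alpha> unfolding r0_def by (intro powr_mono2) auto
    also have "\<dots> = c0 / (2 * (2 * C1 * H + C2 + 1))" using \<alpha> c0 den by (simp add: powr_powr)
    finally have "(2 * C1 * H + C2) * r0 powr \<alpha> \<le> (2 * C1 * H + C2) * (c0 / (2 * (2 * C1 * H + C2 + 1)))"
      using C by (intro mult_left_mono) auto
    also have "\<dots> = ((2 * C1 * H + C2) / (2 * C1 * H + C2 + 1)) * (c0 / 2)" by simp
    also have "\<dots> \<le> 1 * (c0 / 2)" using c0 den by (intro mult_right_mono) auto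
    finally show ?thesis by simp
  qed
  have main: "s powr (- n / 2) * exp (- (P / s) / 4) * (C1 * \<delta> * (1 + P / s) + C2 * r) \<le>
     K * (s powr (- \<kappa>) * exp (- \<theta> * (P / s)) *
       ((2 * \<theta> * n - \<kappa>) + \<theta> * (1 - 4 * \<theta>) * (P / s) - C1 * \<delta> * (1 + P / s) - C2 * r))"
    if s: "0 < s" "s \<le> r0\<^sup>2" and r: "0 \<le> r" "r \<le> r0" and P: "m0 * r\<^sup>2 \<le> P"
      and \<delta>: "0 \<le> \<delta>" "\<delta> \<le> H * (s powr (\<alpha> / 2) + r powr \<alpha>)" for s r P \<delta>
  proof -
    define R where "R = P / s"
    have P0: "P \<ge> 0" using P m0 by (meson mult_nonneg_nonneg less_imp_le order_trans zero_le_power2)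
    have R: "R \<ge> 0" unfolding R_def using P0 s by simp
    have ra: "r \<le> r powr \<alpha>"
      using powr_mono'[of \<alpha> 1 r] r r0 \<alpha> by simp
    have sa: "s powr (\<alpha> / 2) \<le> r0 powr \<alpha>"
    proof -
      have "s powr (\<alpha> / 2) \<le> (r0\<^sup>2) powr (\<alpha> / 2)" using s \<alpha> by (intro powr_mono2) auto
      also have "\<dots> = r0 powr \<alpha>" using r0 by (simp add: powr_powr flip: powr_numeral)
      finally show ?thesis .
    qed
    have rr0: "r powr \<alpha> \<le> r0 powr \<alpha>" using r \<alpha> by (intro powr_mono2) auto
    have small: "C1 * \<delta> + C2 * r \<le> c0 / 2"
    proof -
      have "C1 * \<delta> \<le> C1 * (H * (r0 powr \<alpha> + r0 powr \<alpha>))"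
        using C \<delta> sa rr0 by (intro mult_left_mono order_trans[OF \<delta>(2)]) auto
      moreover have "C2 * r \<le> C2 * r0 powr \<alpha>" using C ra rr0 by (intro mult_left_mono) auto
      ultimately show ?thesis using r0a by (simp add: algebra_simps)
    qed
    have b2: "c0 / 2 \<le> (2 * \<theta> * n - \<kappa>) + \<theta> * (1 - 4 * \<theta>) * R - C1 * \<delta> * (1 + R) - C2 * r"
    proof -
      have "2 * \<theta> * n - \<kappa> = \<alpha> / 4" unfolding \<theta>_def \<kappa>_def using n by (simp add: field_simps)
      moreover have "c0 \<le> \<alpha> / 4" unfolding c0_def using n \<alpha> by (simp add: field_simps)
      moreover have "\<theta> * (1 - 4 * \<theta>) \<ge> c0"
      proof -
        have t: "1 - 4 * \<theta> = \<alpha> / (2 * n)" unfolding \<theta>_def using n by (simp add: field_simps)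
        have "\<theta> \<ge> 1 / 8" using eps unfolding \<theta>_def \<epsilon>_def by simp
        then have "(1 / 8) * (\<alpha> / (2 * n)) \<le> \<theta> * (\<alpha> / (2 * n))"
          using n \<alpha> by (intro mult_right_mono) auto
        then show ?thesis unfolding t c0_def using n by simp
      qed
      then have "c0 * R \<le> \<theta> * (1 - 4 * \<theta>) * R" using R by (intro mult_right_mono)
      moreover have "C2 * r \<le> C2 * r * (1 + R)" using C r R by (simp add: distrib_left)
      moreover have "(C1 * \<delta> + C2 * r) * (1 + R) \<le> c0 / 2 * (1 + R)" using small R by (intro mult_right_mono) auto
      moreover have "c0 / 2 \<le> c0 / 2 * (1 + R)" using c0 R by simp
      ultimately show ?thesis by (simp add: algebra_simps)
    qed
    \<comment> \<open>Parabolic scaling: \<open>m0 * r\<^sup>2 \<le> P\<close> trades the spatial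
      Hoelder modulus for the temporal one, at the price of a factor linear in
      \<open>R\<close>.\<close>
    have rs: "r powr \<alpha> \<le> s powr (\<alpha> / 2) * ((1 + 1 / m0) * (1 + R))"
    proof -
      have "r\<^sup>2 \<le> s * (R / m0)" using P m0 s unfolding R_def by (simp add: field_simps)
      then have "(r\<^sup>2) powr (\<alpha> / 2) \<le> (s * (R / m0)) powr (\<alpha> / 2)" using \<alpha> by (intro powr_mono2) auto
      moreover have "(r\<^sup>2) powr (\<alpha> / 2) = r powr \<alpha>"
        using r by (cases "r = 0") (auto simp: powr_powr simp flip: powr_numeral)
      moreover have "(s * (R / m0)) powr (\<alpha> / 2) = s powr (\<alpha> / 2) * (R / m0) powr (\<alpha> / 2)"
        using s R m0 by (intro powr_mult)
      moreover have "(R / m0) powr (\<alpha> / 2) \<le> (1 + R / m0) powr 1"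
      proof -
        have "(R / m0) powr (\<alpha> / 2) \<le> (1 + R / m0) powr (\<alpha> / 2)" using R m0 \<alpha> by (intro powr_mono2) auto
        also have "\<dots> \<le> (1 + R / m0) powr 1" using R m0 \<alpha> by (intro powr_mono) auto
        finally show ?thesis .
      qed
      moreover have "(1 + R / m0) powr 1 \<le> (1 + 1 / m0) * (1 + R)"
        using R m0 by (simp add: algebra_simps add_divide_distrib)
      ultimately have "r powr \<alpha> \<le> s powr (\<alpha> / 2) * (R / m0) powr (\<alpha> / 2)"
        "(R / m0) powr (\<alpha> / 2) \<le> (1 + 1 / m0) * (1 + R)" by linarith+
      then show ?thesis by (smt (verit) mult_left_mono powr_ge_zero)
    qed
    define X where "X = s powr (\<alpha> / 2)"
    have X: "X \<ge> 0" unfolding X_def by simp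
    have b1: "C1 * \<delta> * (1 + R) + C2 * r \<le> C3 * X * (1 + R)\<^sup>2"
    proof -
      have "X + r powr \<alpha> \<le> X * ((2 + 1 / m0) * (1 + R))"
      proof -
        have "X \<le> X * (1 + R)" using X R by (simp add: algebra_simps)
        then show ?thesis using rs unfolding X_def[symmetric] by (simp add: algebra_simps)
      qed
      then have "\<delta> \<le> H * (X * ((2 + 1 / m0) * (1 + R)))"
        using \<delta>(2) C unfolding X_def[symmetric] by (meson mult_left_mono order_trans)
      then have "C1 * \<delta> * (1 + R) \<le> C1 * (H * (X * ((2 + 1 / m0) * (1 + R)))) * (1 + R)"
        using C R by (intro mult_right_mono mult_left_mono) auto
      moreover have "C2 * r \<le> C2 * (X * ((1 + 1 / m0) * (1 + R))) * (1 + R)"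
      proof -
        have "C2 * r \<le> C2 * (X * ((1 + 1 / m0) * (1 + R)))"
          using C ra rs unfolding X_def[symmetric] by (intro mult_left_mono) auto
        also have "\<dots> \<le> \<dots> * (1 + R)"
        proof -
          have "0 \<le> C2 * (X * ((1 + 1 / m0) * (1 + R)))" using C X R m0 by (intro mult_nonneg_nonneg) auto
          from mult_left_mono[of 1 "1 + R", OF _ this] show ?thesis using R by simp
        qed
        finally show ?thesis .
      qed
      moreover have "C3 * X * (1 + R)\<^sup>2 = C1 * (H * (X * ((2 + 1 / m0) * (1 + R)))) * (1 + R)
          + C2 * (X * ((1 + 1 / m0) * (1 + R))) * (1 + R)"
        unfolding C3_def power2_eq_square by (simp add: algebra_simps add_divide_distrib)
      ultimately show ?thesis by linarith
    qed
    have ex: "(1 + R)\<^sup>2 * exp (- R / 4) \<le> C4 * exp (- \<theta> * R)"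
    proof -
      have "\<epsilon> / 2 * (1 + R) \<le> 1 + \<epsilon> * R / 2" using eps R by (simp add: algebra_simps)
      also have "\<dots> \<le> exp (\<epsilon> * R / 2)" by (rule exp_ge_add_one_self)
      finally have "(\<epsilon> / 2 * (1 + R))\<^sup>2 \<le> (exp (\<epsilon> * R / 2))\<^sup>2" using eps R by (intro power_mono) auto
      also have "\<dots> = exp (\<epsilon> * R)" by (simp add: power2_eq_square flip: exp_add)
      finally have "\<epsilon>\<^sup>2 / 4 * (1 + R)\<^sup>2 \<le> exp (\<epsilon> * R)" by (simp add: power_mult_distrib power_divide)
      then have "(1 + R)\<^sup>2 \<le> C4 * exp (\<epsilon> * R)" unfolding C4_def using eps by (simp add: field_simps)
      then have "(1 + R)\<^sup>2 * exp (- R / 4) \<le> C4 * exp (\<epsilon> * R) * exp (- R / 4)" by (intro mult_right_mono) auto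
      moreover have "exp (\<epsilon> * R) * exp (- R / 4) = exp (- \<theta> * R)"
        unfolding exp_add[symmetric] \<theta>_def \<epsilon>_def by (simp add: algebra_simps)
      ultimately show ?thesis by (simp only: mult.assoc)
    qed
    \<comment> \<open>The factor gained from Hoelder continuity turns the singularity of the first
      Gaussian into that of the second.\<close>
    have sk: "s powr (- n / 2) * X = s powr (- \<kappa>)"
      unfolding X_def \<kappa>_def powr_add[symmetric] by (simp add: algebra_simps)
    have "s powr (- n / 2) * exp (- R / 4) * (C1 * \<delta> * (1 + R) + C2 * r)
        \<le> s powr (- n / 2) * exp (- R / 4) * (C3 * X * (1 + R)\<^sup>2)"
      by (intro mult_left_mono b1) auto
    also have "\<dots> = C3 * s powr (- \<kappa>) * ((1 + R)\<^sup>2 * exp (- R / 4))" unfolding sk[symmetric] by simp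
    also have "\<dots> \<le> C3 * s powr (- \<kappa>) * (C4 * exp (- \<theta> * R))"
      using C3 by (intro mult_left_mono ex) auto
    also have "\<dots> = K * (s powr (- \<kappa>) * exp (- \<theta> * R) * (c0 / 2))" unfolding K_def using c0 by simp
    also have "\<dots> \<le> K * (s powr (- \<kappa>) * exp (- \<theta> * R) * ((2 * \<theta> * n - \<kappa>) + \<theta> * (1 - 4 * \<theta>) * R - C1 * \<delta> * (1 + R) - C2 * r))"
      using K by (intro mult_left_mono b2) auto
    finally show ?thesis unfolding R_def by simp
  qed
  show ?thesis using K r0 main by blast
qed

text \<open>One term of the exponential series suffices. The bound keeps a Gaussian bounded as
  \<open>s\<close> tends to 0 at a fixed positive distance from its centre.\<close>

lemma powr_exp_bound:
  fixes s a k :: real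
  assumes "0 < s" "s \<le> 1" "0 < a" "k \<le> real N"
  shows "s powr (- k) * exp (- a / s) \<le> fact N / a ^ N"
proof -
  have "(a / s) ^ N / fact N \<le> exp (a / s)"
  proof -
    have "(\<Sum>i\<in>{N}. (a / s) ^ i /\<^sub>R fact i) \<le> (\<Sum>i. (a / s) ^ i /\<^sub>R fact i)"
      using assms by (intro sum_le_suminf summable_exp_generic) auto
    then show ?thesis unfolding exp_def by (simp add: divide_inverse mult.commute)
  qed
  then have "exp (- a / s) \<le> fact N / (a / s) ^ N"
    using assms by (simp add: exp_minus field_simps)
  moreover have "s powr (- k) \<le> s powr (- real N)" using assms by (intro powr_mono') auto
  ultimately have "s powr (- k) * exp (- a / s) \<le> s powr (- real N) * (fact N / (a / s) ^ N)"
    by (intro mult_mono) auto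
  also have "\<dots> = fact N / a ^ N"
    using assms by (simp add: powr_minus powr_realpow power_divide field_simps)
  finally show ?thesis .
qed

lemma gauss_generator_bound:
  fixes M Q A :: "real ^ 'n::finite ^ 'n" and v z :: "real ^ 'n"
  assumes M: "quad Q (M *v z) = quad M z"
      "(\<Sum>i\<in>UNIV. \<Sum>j\<in>UNIV. Q $ i $ j * M $ j $ i) = CARD('n)"
      "norm (M *v z) \<le> norm z / e" "\<And>i j. \<bar>M $ i $ j\<bar> \<le> 1 / e" "m0 * (norm z)\<^sup>2 \<le> quad M z"
    and pos: "e > 0" "m0 > 0" "s > 0" and \<theta>: "0 \<le> \<theta>" "\<theta> \<le> 1 / 4"
    and \<delta>: "\<And>i j. \<bar>A $ i $ j - Q $ i $ j\<bar> \<le> \<delta>" and v: "\<And>i. \<bar>v $ i\<bar> \<le> \<Lambda>"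
  defines "n \<equiv> real CARD('n)"
  defines "C1 \<equiv> n\<^sup>2 / (e\<^sup>2 * m0) + n\<^sup>2 / e" and "C2 \<equiv> n * \<Lambda> / e"
  shows "4 * (\<theta> / s)\<^sup>2 * quad A (M *v z) - 2 * (\<theta> / s) * (\<Sum>i\<in>UNIV. \<Sum>j\<in>UNIV. A $ i $ j * M $ j $ i)
      - 2 * (\<theta> / s) * (v \<bullet> (M *v z))
    \<le> (1 / s) * (4 * \<theta>\<^sup>2 * (quad M z / s) - 2 * \<theta> * n + C1 * \<delta> * (1 + quad M z / s) + C2 * norm z)"
proof -
  define P where "P = quad M z"
  define R where "R = P / s"
  have P0: "P \<ge> 0" unfolding P_def using M(5) pos by (meson mult_nonneg_nonneg less_imp_le order_trans zero_le_power2)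
  have R0: "R \<ge> 0" unfolding R_def using P0 pos by simp
  have \<delta>0: "\<delta> \<ge> 0" using \<delta> order_trans[OF abs_ge_zero] by blast
  have \<Lambda>0: "\<Lambda> \<ge> 0" using v order_trans[OF abs_ge_zero] by blast
  have n0: "n \<ge> 0" unfolding n_def by simp
  have th2: "4 * \<theta>\<^sup>2 \<le> 1" "2 * \<theta> \<le> 1"
  proof -
    have "\<theta>\<^sup>2 \<le> (1 / 4)\<^sup>2" using \<theta> by (intro power_mono) auto
    then show "4 * \<theta>\<^sup>2 \<le> 1" by (simp add: power2_eq_square)
  qed (use \<theta> in simp)
  have zeta: "(norm (M *v z))\<^sup>2 \<le> P / (e\<^sup>2 * m0)"
  proof -
    have "(norm (M *v z))\<^sup>2 \<le> (norm z / e)\<^sup>2" by (intro power_mono M) auto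
    also have "\<dots> = (norm z)\<^sup>2 / e\<^sup>2" by (simp add: power_divide)
    also have "\<dots> \<le> (P / m0) / e\<^sup>2"
      using M(5) pos unfolding P_def by (intro divide_right_mono) (auto simp: field_simps)
    finally show ?thesis by (simp add: mult.commute)
  qed
  have quadA: "quad A (M *v z) \<le> P + n\<^sup>2 * (\<delta> * (P / (e\<^sup>2 * m0)))"
  proof -
    have "quad A (M *v z) = quad Q (M *v z) + quad (A - Q) (M *v z)"
      unfolding quad_def by (simp add: matrix_vector_mult_diff_rdistrib inner_diff_left)
    moreover have "quad (A - Q) (M *v z) \<le> n\<^sup>2 * (\<delta> * (norm (M *v z))\<^sup>2)"
      using quad_bound[of "A - Q" \<delta> "M *v z"] \<delta> unfolding n_def by (simp add: abs_le_iff)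
    moreover have "n\<^sup>2 * (\<delta> * (norm (M *v z))\<^sup>2) \<le> n\<^sup>2 * (\<delta> * (P / (e\<^sup>2 * m0)))"
      using \<delta>0 by (intro mult_left_mono zeta) auto
    ultimately show ?thesis using M(1) unfolding P_def by linarith
  qed
  have trA: "(\<Sum>i\<in>UNIV. \<Sum>j\<in>UNIV. A $ i $ j * M $ j $ i) \<ge> n - n\<^sup>2 * (\<delta> / e)"
  proof -
    have "(\<Sum>i\<in>UNIV. \<Sum>j\<in>UNIV. A $ i $ j * M $ j $ i) = (\<Sum>i\<in>UNIV. \<Sum>j\<in>UNIV. Q $ i $ j * M $ j $ i)
        + (\<Sum>i\<in>UNIV. \<Sum>j\<in>UNIV. (A $ i $ j - Q $ i $ j) * M $ j $ i)"
      by (simp add: sum.distrib[symmetric] left_diff_distrib)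
    moreover have "\<bar>\<Sum>i\<in>UNIV. \<Sum>j\<in>UNIV. (A $ i $ j - Q $ i $ j) * M $ j $ i\<bar> \<le> n\<^sup>2 * (\<delta> / e)"
      unfolding n_def
    proof (rule double_sum_bound)
      fix i j
      have "\<bar>(A $ i $ j - Q $ i $ j) * M $ j $ i\<bar> \<le> \<delta> * (1 / e)"
        unfolding abs_mult by (intro mult_mono \<delta> M \<delta>0) auto
      then show "\<bar>(A $ i $ j - Q $ i $ j) * M $ j $ i\<bar> \<le> \<delta> / e" by simp
    qed
    ultimately show ?thesis using M(2) unfolding n_def by linarith
  qed
  have vz: "\<bar>v \<bullet> (M *v z)\<bar> \<le> n * \<Lambda> * norm z / e"
  proof -
    have "\<bar>v \<bullet> (M *v z)\<bar> \<le> n * (\<Lambda> * norm (M *v z))" unfolding n_def by (rule inner_bound_l1[OF v])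
    also have "\<dots> \<le> n * (\<Lambda> * (norm z / e))" using n0 \<Lambda>0 by (intro mult_left_mono M) auto
    finally show ?thesis by (simp add: mult.assoc)
  qed
  have 1: "4 * (\<theta> / s)\<^sup>2 * quad A (M *v z) \<le> (1 / s) * (4 * \<theta>\<^sup>2 * R + n\<^sup>2 / (e\<^sup>2 * m0) * \<delta> * R)"
  proof -
    have "4 * (\<theta> / s)\<^sup>2 * quad A (M *v z) \<le> 4 * (\<theta> / s)\<^sup>2 * (P + n\<^sup>2 * (\<delta> * (P / (e\<^sup>2 * m0))))"
      by (intro mult_left_mono quadA) auto
    also have "\<dots> = (1 / s) * (4 * \<theta>\<^sup>2 * R + (4 * \<theta>\<^sup>2) * (n\<^sup>2 / (e\<^sup>2 * m0) * \<delta> * R))"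
      unfolding R_def by (simp add: power2_eq_square distrib_left mult_ac)
    also have "\<dots> \<le> (1 / s) * (4 * \<theta>\<^sup>2 * R + 1 * (n\<^sup>2 / (e\<^sup>2 * m0) * \<delta> * R))"
      using pos \<delta>0 R0 by (intro mult_left_mono add_left_mono mult_right_mono th2) auto
    finally show ?thesis by simp
  qed
  have 2: "- (2 * (\<theta> / s) * (\<Sum>i\<in>UNIV. \<Sum>j\<in>UNIV. A $ i $ j * M $ j $ i)) \<le> (1 / s) * (- (2 * \<theta> * n) + n\<^sup>2 / e * \<delta>)"
  proof -
    have "2 * (\<theta> / s) * (n - n\<^sup>2 * (\<delta> / e)) \<le> 2 * (\<theta> / s) * (\<Sum>i\<in>UNIV. \<Sum>j\<in>UNIV. A $ i $ j * M $ j $ i)"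
      using \<theta> pos by (intro mult_left_mono trA) auto
    moreover have "2 * \<theta> * (n\<^sup>2 / e * \<delta>) \<le> 1 * (n\<^sup>2 / e * \<delta>)"
      using \<delta>0 pos by (intro mult_right_mono th2) auto
    then have "(1 / s) * (2 * \<theta> * (n\<^sup>2 / e * \<delta>)) \<le> (1 / s) * (n\<^sup>2 / e * \<delta>)"
      using pos by (intro mult_left_mono) auto
    ultimately show ?thesis by (simp add: algebra_simps)
  qed
  have 3: "- (2 * (\<theta> / s) * (v \<bullet> (M *v z))) \<le> (1 / s) * (C2 * norm z)"
  proof -
    have "- (2 * (\<theta> / s) * (v \<bullet> (M *v z))) \<le> (1 / s) * (2 * \<theta> * \<bar>v \<bullet> (M *v z)\<bar>)"
    proof -
      have "2 * (\<theta> / s) * (- (v \<bullet> (M *v z))) \<le> 2 * (\<theta> / s) * \<bar>v \<bullet> (M *v z)\<bar>"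
        using \<theta> pos by (intro mult_left_mono) auto
      then show ?thesis by simp
    qed
    also have "\<dots> \<le> (1 / s) * (1 * \<bar>v \<bullet> (M *v z)\<bar>)"
      using pos by (intro mult_left_mono mult_right_mono th2) auto
    also have "\<dots> \<le> (1 / s) * (n * \<Lambda> * norm z / e)"
      using pos vz by (intro mult_left_mono) auto
    finally show ?thesis unfolding C2_def by simp
  qed
  have "n\<^sup>2 / (e\<^sup>2 * m0) * \<delta> * R + n\<^sup>2 / e * \<delta> \<le> C1 * \<delta> * (1 + R)"
  proof -
    have "0 \<le> n\<^sup>2 / (e\<^sup>2 * m0) * \<delta>" "0 \<le> n\<^sup>2 / e * \<delta> * R" using pos \<delta>0 R0 by auto
    moreover have "a * \<delta> * R + c * \<delta> \<le> (a + c) * \<delta> * (1 + R)" if "0 \<le> a * \<delta>" "0 \<le> c * \<delta> * R" for a c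
      using that by (simp add: algebra_simps)
    ultimately show ?thesis unfolding C1_def by blast
  qed
  then have 4: "(1 / s) * (n\<^sup>2 / (e\<^sup>2 * m0) * \<delta> * R + n\<^sup>2 / e * \<delta>) \<le> (1 / s) * (C1 * \<delta> * (1 + R))"
    using pos by (intro mult_left_mono) auto
  have comb: "x - y - w \<le> l * (a - c + f + d)"
    if "x \<le> l * (a + u)" "- y \<le> l * (- c + u')" "- w \<le> l * d" "l * (u + u') \<le> l * f"
    for x y w l a c d f u u' :: real
    using that by (simp add: algebra_simps)
  show ?thesis unfolding P_def[symmetric] R_def[symmetric] by (rule comb[OF 1 2 3 4])
qed

text \<open>Hoelder constants come one coefficient at a time; the sum of their absolute values
  serves all coefficients at once.\<close>

lemma uniform_constant:
  fixes F :: "'i::finite \<Rightarrow> 'z \<Rightarrow> real"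
  assumes "\<And>i. \<exists>C. \<forall>z. P z \<longrightarrow> F i z \<le> C * g z" and "\<And>z. P z \<Longrightarrow> 0 \<le> g z"
  shows "\<exists>C\<ge>0. \<forall>i z. P z \<longrightarrow> F i z \<le> C * g z"
proof -
  obtain c where c: "\<And>i z. P z \<Longrightarrow> F i z \<le> c i * g z" using assms(1) by metis
  have "F i z \<le> (\<Sum>i\<in>UNIV. \<bar>c i\<bar>) * g z" if "P z" for i z
  proof -
    have "c i \<le> (\<Sum>i\<in>UNIV. \<bar>c i\<bar>)"
      by (rule order_trans[OF abs_ge_self]) (rule member_le_sum, auto)
    from mult_right_mono[OF this assms(2)[OF that]] show ?thesis
      by (rule order_trans[OF c[OF that]])
  qed
  then show ?thesis by (intro exI[of _ "\<Sum>i\<in>UNIV. \<bar>c i\<bar>"]) (auto intro: sum_nonneg)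
qed

section \<open>Local bounds on the coefficients and construction of the barrier\<close>

context parabolic
begin

text \<open>The reference time is always \<open>t\<close>, since the barrier freezes the
  coefficients at the initial time. The second bound follows from the first by comparison with the
  values at \<open>(t, 0)\<close>.\<close>

lemma holder_local:
  fixes f :: "'i::finite \<Rightarrow> real \<Rightarrow> real ^ 'n \<Rightarrow> real"
  assumes "\<And>i. holder_loc \<alpha> I (f i)" and t: "t \<in> I"
  shows "\<exists>C\<ge>0. \<forall>i \<tau> x y. t \<le> \<tau> \<and> \<tau> \<le> t + 1 \<and> norm x \<le> R \<and> norm y \<le> R \<longrightarrow>
    \<bar>f i \<tau> x - f i t y\<bar> \<le> C * (\<bar>\<tau> - t\<bar> powr (\<alpha> / 2) + norm (x - y) powr \<alpha>)"
    and "\<exists>B\<ge>0. \<forall>i \<tau> x. t \<le> \<tau> \<and> \<tau> \<le> t + 1 \<and> norm x \<le> R \<longrightarrow> \<bar>f i \<tau> x\<bar> \<le> B"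
proof -
  let ?K = "{t..t+1} \<times> cball (0 :: real ^ 'n) R"
  have \<alpha>: "0 < \<alpha>" using standing unfolding standing_assumptions_def by blast
  have K: "compact ?K" "?K \<subseteq> I \<times> UNIV" using I_upward[OF t] by (auto intro: compact_Times)
  have "\<exists>C\<ge>0. \<forall>i z. (\<lambda>(\<tau>, x, y). t \<le> \<tau> \<and> \<tau> \<le> t + 1 \<and> norm x \<le> R \<and> norm y \<le> R) z \<longrightarrow>
    (\<lambda>(\<tau>, x, y). \<bar>f i \<tau> x - f i t y\<bar>) z \<le> C * (\<lambda>(\<tau>, x, y). \<bar>\<tau> - t\<bar> powr (\<alpha> / 2) + norm (x - y) powr \<alpha>) z"
  proof (rule uniform_constant)
    fix i
    obtain C where C: "\<forall>(\<tau>, x)\<in>?K. \<forall>(s, y)\<in>?K. \<bar>f i \<tau> x - f i s y\<bar> \<le> C * (\<bar>\<tau> - s\<bar> powr (\<alpha> / 2) + norm (x - y) powr \<alpha>)"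
      using assms(1)[of i] K unfolding holder_loc_def by blast
    show "\<exists>C. \<forall>z. (\<lambda>(\<tau>, x, y). t \<le> \<tau> \<and> \<tau> \<le> t + 1 \<and> norm x \<le> R \<and> norm y \<le> R) z \<longrightarrow>
    (\<lambda>(\<tau>, x, y). \<bar>f i \<tau> x - f i t y\<bar>) z \<le> C * (\<lambda>(\<tau>, x, y). \<bar>\<tau> - t\<bar> powr (\<alpha> / 2) + norm (x - y) powr \<alpha>) z"
    proof (intro exI[of _ C] allI impI)
      fix z :: "real \<times> (real ^ 'n) \<times> (real ^ 'n)"
      assume *: "(\<lambda>(\<tau>, x, y). t \<le> \<tau> \<and> \<tau> \<le> t + 1 \<and> norm x \<le> R \<and> norm y \<le> R) z"
      obtain \<tau> x y where z: "z = (\<tau>, x, y)" by (cases z)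
      have mem: "(\<tau>, x) \<in> ?K" "(t, y) \<in> ?K" using * z by auto
      from bspec[OF C mem(1)] have "\<forall>(s, y)\<in>?K. \<bar>f i \<tau> x - f i s y\<bar> \<le> C * (\<bar>\<tau> - s\<bar> powr (\<alpha> / 2) + norm (x - y) powr \<alpha>)"
        by simp
      from bspec[OF this mem(2)] show "(\<lambda>(\<tau>, x, y). \<bar>f i \<tau> x - f i t y\<bar>) z \<le>
          C * (\<lambda>(\<tau>, x, y). \<bar>\<tau> - t\<bar> powr (\<alpha> / 2) + norm (x - y) powr \<alpha>) z"
        unfolding z by simp
    qed
  qed auto
  then obtain C where C: "C \<ge> 0" "\<And>i \<tau> x y. t \<le> \<tau> \<Longrightarrow> \<tau> \<le> t + 1 \<Longrightarrow> norm x \<le> R \<Longrightarrow> norm y \<le> R \<Longrightarrow>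
    \<bar>f i \<tau> x - f i t y\<bar> \<le> C * (\<bar>\<tau> - t\<bar> powr (\<alpha> / 2) + norm (x - y) powr \<alpha>)"
    by auto
  then show "\<exists>C\<ge>0. \<forall>i \<tau> x y. t \<le> \<tau> \<and> \<tau> \<le> t + 1 \<and> norm x \<le> R \<and> norm y \<le> R \<longrightarrow>
    \<bar>f i \<tau> x - f i t y\<bar> \<le> C * (\<bar>\<tau> - t\<bar> powr (\<alpha> / 2) + norm (x - y) powr \<alpha>)" by blast
  let ?B = "(\<Sum>i\<in>UNIV. \<bar>f i t 0\<bar>) + C * (1 + \<bar>R\<bar> powr \<alpha>)"
  have "\<bar>f i \<tau> x\<bar> \<le> ?B" if "t \<le> \<tau>" "\<tau> \<le> t + 1" "norm x \<le> R" for i \<tau> x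
  proof -
    have R: "0 \<le> R" using that(3) norm_ge_zero order_trans by blast
    have "\<bar>f i \<tau> x - f i t 0\<bar> \<le> C * (\<bar>\<tau> - t\<bar> powr (\<alpha> / 2) + norm (x - 0) powr \<alpha>)"
      using that R by (intro C(2)) auto
    also have "\<dots> \<le> C * (1 + \<bar>R\<bar> powr \<alpha>)"
    proof (intro mult_left_mono add_mono C(1))
      have "\<bar>\<tau> - t\<bar> powr (\<alpha> / 2) \<le> 1 powr (\<alpha> / 2)" using that \<alpha> by (intro powr_mono2) auto
      then show "\<bar>\<tau> - t\<bar> powr (\<alpha> / 2) \<le> 1" by simp
      show "norm (x - 0) powr \<alpha> \<le> \<bar>R\<bar> powr \<alpha>" using that \<alpha> by (intro powr_mono2) auto
    qed
    moreover have "\<bar>f i t 0\<bar> \<le> (\<Sum>i\<in>UNIV. \<bar>f i t 0\<bar>)" by (rule member_le_sum) auto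
    ultimately show ?thesis by linarith
  qed
  moreover have "?B \<ge> 0" using C(1) by (intro add_nonneg_nonneg sum_nonneg mult_nonneg_nonneg) auto
  ultimately show "\<exists>B\<ge>0. \<forall>i \<tau> x. t \<le> \<tau> \<and> \<tau> \<le> t + 1 \<and> norm x \<le> R \<longrightarrow> \<bar>f i \<tau> x\<bar> \<le> B" by blast
qed

lemma coefficient_bounds:
  assumes t: "t \<in> I"
  obtains \<Lambda> H where "\<Lambda> \<ge> 0" "H \<ge> 0"
    "\<And>i j \<tau> x. t \<le> \<tau> \<Longrightarrow> \<tau> \<le> t + 1 \<Longrightarrow> norm x \<le> R \<Longrightarrow> \<bar>q \<tau> x $ i $ j\<bar> \<le> \<Lambda>"
    "\<And>i \<tau> x. t \<le> \<tau> \<Longrightarrow> \<tau> \<le> t + 1 \<Longrightarrow> norm x \<le> R \<Longrightarrow> \<bar>b \<tau> x $ i\<bar> \<le> \<Lambda>"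
    "\<And>i j \<tau> x y. t \<le> \<tau> \<Longrightarrow> \<tau> \<le> t + 1 \<Longrightarrow> norm x \<le> R \<Longrightarrow> norm y \<le> R \<Longrightarrow>
      \<bar>q \<tau> x $ i $ j - q t y $ i $ j\<bar> \<le> H * (\<bar>\<tau> - t\<bar> powr (\<alpha> / 2) + norm (x - y) powr \<alpha>)"
proof -
  define Q where "Q ij = (\<lambda>\<tau> x. q \<tau> x $ fst ij $ snd ij)" for ij
  have hq: "holder_loc \<alpha> I (Q ij)" for ij
    using standing unfolding standing_assumptions_def Q_def by blast
  have hb: "holder_loc \<alpha> I (\<lambda>\<tau> x. b \<tau> x $ i)" for i
    using standing unfolding standing_assumptions_def by blast
  obtain H where H: "H \<ge> 0 \<and> (\<forall>ij \<tau> x y. t \<le> \<tau> \<and> \<tau> \<le> t + 1 \<and> norm x \<le> R \<and> norm y \<le> R \<longrightarrow>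
    \<bar>Q ij \<tau> x - Q ij t y\<bar> \<le> H * (\<bar>\<tau> - t\<bar> powr (\<alpha> / 2) + norm (x - y) powr \<alpha>))"
    using holder_local(1)[OF hq t, of R] ..
  obtain B1 where B1: "B1 \<ge> 0 \<and> (\<forall>ij \<tau> x. t \<le> \<tau> \<and> \<tau> \<le> t + 1 \<and> norm x \<le> R \<longrightarrow> \<bar>Q ij \<tau> x\<bar> \<le> B1)"
    using holder_local(2)[OF hq t, of R] ..
  obtain B2 where B2: "B2 \<ge> 0 \<and> (\<forall>i \<tau> x. t \<le> \<tau> \<and> \<tau> \<le> t + 1 \<and> norm x \<le> R \<longrightarrow> \<bar>b \<tau> x $ i\<bar> \<le> B2)"
    using holder_local(2)[OF hb t, of R] ..
  show ?thesis
  proof (rule that[of "max B1 B2" H])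
    fix i j \<tau> and x :: "real ^ 'n" assume *: "t \<le> \<tau>" "\<tau> \<le> t + 1" "norm x \<le> R"
    show "\<bar>q \<tau> x $ i $ j\<bar> \<le> max B1 B2" using conjunct2[OF B1, rule_format, of \<tau> x "(i, j)"] * by (simp add: Q_def)
    show "\<bar>b \<tau> x $ i\<bar> \<le> max B1 B2" using conjunct2[OF B2, rule_format, of \<tau> x i] * by simp
    fix y :: "real ^ 'n" assume "norm y \<le> R"
    then show "\<bar>q \<tau> x $ i $ j - q t y $ i $ j\<bar> \<le> H * (\<bar>\<tau> - t\<bar> powr (\<alpha> / 2) + norm (x - y) powr \<alpha>)"
      using conjunct2[OF H, rule_format, of \<tau> x y "(i, j)"] * by (simp add: Q_def)
  qed (use H B1 in auto)
qed

text \<open>The variable \<open>s\<close> of a barrier is the time elapsed since \<open>t\<close>, advanced by the square of the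
  radius of the ball that carries the initial datum.\<close>

definition is_barrier :: "real \<Rightarrow> real \<Rightarrow> real \<Rightarrow> real ^ 'n \<Rightarrow> (real \<Rightarrow> real ^ 'n \<Rightarrow> real)
    \<Rightarrow> (real \<Rightarrow> real ^ 'n \<Rightarrow> real) \<Rightarrow> bool" where
  "is_barrier t r0 A y W W' \<longleftrightarrow> (\<forall>s>0. W s \<in> C2_space) \<and> continuous_on ({0<..} \<times> UNIV) (\<lambda>(s, x). W s x) \<and>
    (\<forall>s>0. \<forall>x. ((\<lambda>r. W r x) has_real_derivative W' s x) (at s)) \<and>
    (\<forall>s x. 0 \<le> W s x) \<and>
    (\<forall>\<tau> s x. t \<le> \<tau> \<and> \<tau> \<le> t + 1 \<and> \<tau> - t \<le> s \<and> 0 < s \<and> s \<le> r0\<^sup>2 \<and> norm (x - y) \<le> r0 \<longrightarrow>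
      ell_op q b \<tau> (W s) x \<le> W' s x) \<and>
    (\<forall>s x. 0 < s \<and> (norm (x - y))\<^sup>2 \<le> s \<longrightarrow> s powr (- real CARD('n) / 2) \<le> A * W s x) \<and>
    (\<forall>s x. 0 < s \<and> s \<le> 1 \<and> norm (x - y) = r0 / 2 \<longrightarrow> W s x \<le> A) \<and>
    (\<forall>s0 s x. 0 < s0 \<and> s0 \<le> s \<and> s \<le> 1 \<longrightarrow> W s x \<le> A * s0 powr (- real CARD('n)))"

lemma is_barrierD:
  assumes "is_barrier t r0 A y W W'"
  shows "0 < s \<Longrightarrow> W s \<in> C2_space"
    and "continuous_on ({0<..} \<times> UNIV) (\<lambda>(s, x). W s x)"
    and "0 < s \<Longrightarrow> ((\<lambda>r. W r x) has_real_derivative W' s x) (at s)"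
    and "0 \<le> W s x"
    and "t \<le> \<tau> \<Longrightarrow> \<tau> \<le> t + 1 \<Longrightarrow> \<tau> - t \<le> s \<Longrightarrow> 0 < s \<Longrightarrow> s \<le> r0\<^sup>2 \<Longrightarrow> norm (x - y) \<le> r0 \<Longrightarrow>
      ell_op q b \<tau> (W s) x \<le> W' s x"
    and "0 < s \<Longrightarrow> (norm (x - y))\<^sup>2 \<le> s \<Longrightarrow> s powr (- real CARD('n) / 2) \<le> A * W s x"
    and "0 < s \<Longrightarrow> s \<le> 1 \<Longrightarrow> norm (x - y) = r0 / 2 \<Longrightarrow> W s x \<le> A"
    and "0 < s0 \<Longrightarrow> s0 \<le> s \<Longrightarrow> s \<le> 1 \<Longrightarrow> W s x \<le> A * s0 powr (- real CARD('n))"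
  using assms unfolding is_barrier_def by blast+

text \<open>The radius \<open>r0\<close> and the constant \<open>A\<close> must not depend on the
  centre \<open>y\<close>. They depend only on bounds for the coefficients on the ball of radius
  \<open>R + 1\<close>, which contains every ball of radius \<open>r0\<close> around such a centre,
  and on the constants of \<open>elliptic_inverse\<close>.\<close>

lemma barrier:
  assumes t: "t \<in> I" and R: "0 \<le> R"
  shows "\<exists>r0 A. 0 < r0 \<and> r0 \<le> 1 \<and> 0 < A \<and> (\<forall>y. norm y \<le> R \<longrightarrow> (\<exists>W W'. is_barrier t r0 A y W W'))"
proof -
  define n where "n = real CARD('n)"
  have n1: "n \<ge> 1" unfolding n_def using card_gt_0_iff[of "UNIV::'n set"] by (simp add: Suc_leI)
  obtain e where e: "e > 0" "\<And>t x \<xi>. t \<in> I \<Longrightarrow> e * (norm \<xi>)\<^sup>2 \<le> quad (q t x) \<xi>"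
    using q_elliptic unfolding quad_def by blast
  have \<alpha>: "0 < \<alpha>" "\<alpha> < 1" using standing unfolding standing_assumptions_def by blast+
  obtain \<Lambda> H where bnd: "\<Lambda> \<ge> 0" "H \<ge> 0"
    "\<And>i j \<tau> x. t \<le> \<tau> \<Longrightarrow> \<tau> \<le> t + 1 \<Longrightarrow> norm x \<le> R + 1 \<Longrightarrow> \<bar>q \<tau> x $ i $ j\<bar> \<le> \<Lambda>"
    "\<And>i \<tau> x. t \<le> \<tau> \<Longrightarrow> \<tau> \<le> t + 1 \<Longrightarrow> norm x \<le> R + 1 \<Longrightarrow> \<bar>b \<tau> x $ i\<bar> \<le> \<Lambda>"
    "\<And>i j \<tau> x y. t \<le> \<tau> \<Longrightarrow> \<tau> \<le> t + 1 \<Longrightarrow> norm x \<le> R + 1 \<Longrightarrow> norm y \<le> R + 1 \<Longrightarrow>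
      \<bar>q \<tau> x $ i $ j - q t y $ i $ j\<bar> \<le> H * (\<bar>\<tau> - t\<bar> powr (\<alpha> / 2) + norm (x - y) powr \<alpha>)"
    by (rule coefficient_bounds[OF t, of "R + 1"]) blast
  define m0 where "m0 = e / (n\<^sup>2 * (\<Lambda> + 1))\<^sup>2"
  have m0: "m0 > 0" unfolding m0_def using e(1) n1 bnd(1) by simp
  define C1 where "C1 = n\<^sup>2 / (e\<^sup>2 * m0) + n\<^sup>2 / e"
  define C2 where "C2 = n * \<Lambda> / e"
  have C: "C1 \<ge> 0" "C2 \<ge> 0" unfolding C1_def C2_def using e m0 n1 bnd by auto
  define \<kappa> where "\<kappa> = n / 2 - \<alpha> / 2"
  define \<theta> where "\<theta> = 1 / 4 - \<alpha> / (8 * n)"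
  have \<kappa>: "0 \<le> \<kappa>" "\<kappa> \<le> n" unfolding \<kappa>_def using n1 \<alpha> by auto
  have \<theta>: "0 < \<theta>" "\<theta> \<le> 1 / 4" 
  proof -
    have "\<alpha> / (8 * n) \<le> 1 / 8" using n1 \<alpha> by (simp add: field_simps)
    then show "0 < \<theta>" unfolding \<theta>_def by linarith
    show "\<theta> \<le> 1 / 4" unfolding \<theta>_def using n1 \<alpha> by simp
  qed
  obtain K r0 where K: "K \<ge> 0" and r0: "0 < r0" "r0 \<le> 1" and scal: "\<forall>s r P \<delta>. 0 < s \<and> s \<le> r0\<^sup>2 \<and> 0 \<le> r \<and> r \<le> r0 \<and> m0 * r\<^sup>2 \<le> P \<and>
     0 \<le> \<delta> \<and> \<delta> \<le> H * (s powr (\<alpha> / 2) + r powr \<alpha>) \<longrightarrow>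
     s powr (- n / 2) * exp (- (P / s) / 4) * (C1 * \<delta> * (1 + P / s) + C2 * r) \<le>
     K * (s powr (- \<kappa>) * exp (- \<theta> * (P / s)) *
       ((2 * \<theta> * n - \<kappa>) + \<theta> * (1 - 4 * \<theta>) * (P / s) - C1 * \<delta> * (1 + P / s) - C2 * r))"
    using barrier_scalar[OF n1 \<alpha> C bnd(2) m0] unfolding \<kappa>_def \<theta>_def by blast
  define N where "N = CARD('n)"
  define c where "c = m0 * (r0 / 2)\<^sup>2"
  have c: "c > 0" unfolding c_def using m0 r0 by simp
  \<comment> \<open>\<open>A1\<close> serves the lower bound near the centre, \<open>A2\<close> the
    bound on the sphere of radius \<open>r0 / 2\<close>, and \<open>A3\<close> the bound on the
    whole space.\<close>
  define A1 where "A1 = exp (1 / (4 * e))"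
  define A2 where "A2 = fact N / (c / 4) ^ N + K * (fact N / (\<theta> * c) ^ N)"
  define A3 where "A3 = 1 + K"
  define A where "A = A1 + A2 + A3"
  have A23: "A2 \<ge> 0" "A3 > 0" unfolding A2_def A3_def using c \<theta> K by (auto intro!: add_nonneg_nonneg mult_nonneg_nonneg add_pos_nonneg)
  have A: "A > 0" "A1 \<le> A" "A2 \<le> A" "A3 \<le> A" "A1 > 0"
    unfolding A_def A1_def using A23 exp_gt_zero[of "1 / (4 * e)"] by linarith+
  have "\<exists>W W'. is_barrier t r0 A y W W'"
    if y: "norm y \<le> R" for y :: "real ^ 'n"
  proof -
    have Lam: "\<bar>q t y $ i $ j\<bar> \<le> \<Lambda>" for i j using bnd(3)[of t y i j] y by simp
    obtain M where M: "transpose M = M" "\<And>z. quad (q t y) (M *v z) = quad M z"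
      "(\<Sum>i\<in>UNIV. \<Sum>j\<in>UNIV. q t y $ i $ j * M $ j $ i) = CARD('n)"
      "\<And>z. norm (M *v z) \<le> norm z / e" "\<And>i j. \<bar>M $ i $ j\<bar> \<le> 1 / e"
      "\<And>z. m0 * (norm z)\<^sup>2 \<le> quad M z" "\<And>z. quad M z \<le> (norm z)\<^sup>2 / e"
      unfolding m0_def n_def by (rule elliptic_inverse[OF q_symmetric[OF t, of y] e(2)[OF t, of _ y] e(1) Lam]) blast
    \<comment> \<open>\<open>S (n / 2) (1 / 4)\<close> is the unnormalised heat kernel of the
      operator frozen at \<open>(t, y)\<close>, and \<open>S \<kappa> \<theta>\<close> is the
      correction that absorbs the error. \<open>L\<close> is the time derivative of
      \<open>S\<close>.\<close>
    define S where "S k h s x = s powr (- k) * gauss M (h / s) y x" for k h s x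
    define L where "L k h s x = S k h s x * (1 / s) * (- k + h * (quad M (x - y) / s))" for k h s x
    define W where "W s x = S (n / 2) (1 / 4) s x + K * S \<kappa> \<theta> s x" for s x
    define W' where "W' s x = L (n / 2) (1 / 4) s x + K * L \<kappa> \<theta> s x" for s x
    have q0: "quad M z \<ge> 0" for z using M(6)[of z] m0 by (meson mult_nonneg_nonneg less_imp_le order_trans zero_le_power2)
    have S0: "S k h s x \<ge> 0" for k h s x unfolding S_def gauss_def by simp
    have SC2: "S k h s \<in> C2_space" for k h s
      using C2_lincomb(1)[OF C2_const(1)[of 0] gauss_C2(1)[OF M(1)]] unfolding S_def by simp
    have Sell: "ell_op q b \<tau> (S k h s) x = s powr (- k) * ell_op q b \<tau> (gauss M (h / s) y) x" for k h s \<tau> x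
      using ell_op_lincomb[OF C2_const(1)[of 0] gauss_C2(1)[OF M(1)]] unfolding S_def by (simp add: ell_op_const)
    have WC2: "W s \<in> C2_space" for s unfolding W_def by (intro C2_lincomb(1) SC2)
    have Well: "ell_op q b \<tau> (W s) x = ell_op q b \<tau> (S (n / 2) (1 / 4) s) x + K * ell_op q b \<tau> (S \<kappa> \<theta> s) x" for \<tau> s x
      unfolding W_def by (rule ell_op_lincomb[OF SC2 SC2])
    have cS: "continuous_on ({0<..} \<times> UNIV) (\<lambda>z. S k h (fst z) (snd z))" for k h
    proof -
      have "continuous_on ({0::real<..} \<times> UNIV) (\<lambda>z. quad M (snd z - y))"
        by (rule continuous_on_compose2[OF continuous_on_quad[of UNIV]]) (auto intro: continuous_intros)
      then show ?thesis unfolding S_def gauss_def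
        by (intro continuous_on_mult continuous_on_exp continuous_on_powr continuous_on_const
          continuous_on_minus continuous_on_divide continuous_on_fst continuous_on_id) auto
    qed
    have cW: "continuous_on ({0<..} \<times> UNIV) (\<lambda>(s, x). W s x)"
      unfolding split_def W_def by (intro continuous_on_add continuous_on_mult continuous_on_const cS)
    have dS: "((\<lambda>r. S k h r x) has_real_derivative L k h s x) (at s)" if "s > 0" for k h s x
    proof -
      let ?P = "quad M (x - y)"
      have 1: "((\<lambda>r. r powr (- k)) has_real_derivative (- k) * s powr (- k - 1)) (at s)"
        using has_real_derivative_powr[OF that, of "- k"] by simp
      have 2: "((\<lambda>r. exp (- (h / r) * ?P)) has_real_derivative exp (- (h / s) * ?P) * (h * ?P / s\<^sup>2)) (at s)"
        using that by (auto intro!: derivative_eq_intros simp: power2_eq_square)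
      have 3: "s powr (- k - 1) = s powr (- k) / s"
        using that by (simp add: powr_diff)
      have 4: "(- k) * (a / s) * E + E * (h * P / s\<^sup>2) * a = a * E * (1 / s) * (- k + h * (P / s))" for a E P
        using that by (simp add: field_simps power2_eq_square)
      show ?thesis unfolding S_def gauss_def L_def
        by (rule DERIV_cong[OF DERIV_mult[OF 1 2]]) (simp only: 3 4)
    qed
    have dW: "((\<lambda>r. W r x) has_real_derivative W' s x) (at s)" if "s > 0" for s x
      unfolding W_def W'_def by (intro DERIV_add DERIV_cmult dS that)
    have super: "ell_op q b \<tau> (W s) x \<le> W' s x"
      if h: "t \<le> \<tau>" "\<tau> \<le> t + 1" "\<tau> - t \<le> s" "0 < s" "s \<le> r0\<^sup>2" "norm (x - y) \<le> r0" for \<tau> s x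
    proof -
      define z where "z = x - y"
      define P where "P = quad M z"
      define \<delta> where "\<delta> = H * ((\<tau> - t) powr (\<alpha> / 2) + norm z powr \<alpha>)"
      have nx: "norm x \<le> R + 1" using norm_triangle_ineq[of "x - y" y] h r0 y by simp
      have ny: "norm y \<le> R + 1" using y by simp
      have \<delta>0: "0 \<le> \<delta>" unfolding \<delta>_def using bnd(2) by (intro mult_nonneg_nonneg add_nonneg_nonneg) auto
      \<comment> \<open>The time variable of the barrier runs ahead,
        \<open>\<tau> - t \<le> s\<close>, so the temporal Hoelder modulus is controlled by a power
        of \<open>s\<close>.\<close>
      have \<delta>1: "\<delta> \<le> H * (s powr (\<alpha> / 2) + norm z powr \<alpha>)"
        unfolding \<delta>_def using bnd(2) h \<alpha> by (intro mult_left_mono add_right_mono powr_mono2) auto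
      have dq: "\<bar>q \<tau> x $ i $ j - q t y $ i $ j\<bar> \<le> \<delta>" for i j
        using bnd(5)[OF h(1,2) nx ny, of i j] h(1) unfolding \<delta>_def z_def by simp
      have db: "\<bar>b \<tau> x $ i\<bar> \<le> \<Lambda>" for i by (rule bnd(4)[OF h(1,2) nx])
      have gb: "ell_op q b \<tau> (S k h s) x \<le> S k h s x * ((1 / s) * (4 * h\<^sup>2 * (P / s) - 2 * h * n + C1 * \<delta> * (1 + P / s) + C2 * norm z))"
        if hh: "0 \<le> h" "h \<le> 1 / 4" for k h
      proof -
        have "4 * (h / s)\<^sup>2 * quad (q \<tau> x) (M *v z) - 2 * (h / s) * (\<Sum>i\<in>UNIV. \<Sum>j\<in>UNIV. q \<tau> x $ i $ j * M $ j $ i)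
          - 2 * (h / s) * (b \<tau> x \<bullet> (M *v z))
          \<le> (1 / s) * (4 * h\<^sup>2 * (P / s) - 2 * h * n + C1 * \<delta> * (1 + P / s) + C2 * norm z)"
          unfolding P_def C1_def C2_def n_def
          by (rule gauss_generator_bound[OF M(2,3,4,5,6) e(1) m0 h(4) hh dq db])
        then have "S k h s x * (4 * (h / s)\<^sup>2 * quad (q \<tau> x) (M *v z) - 2 * (h / s) * (\<Sum>i\<in>UNIV. \<Sum>j\<in>UNIV. q \<tau> x $ i $ j * M $ j $ i)
          - 2 * (h / s) * (b \<tau> x \<bullet> (M *v z))) \<le> S k h s x * ((1 / s) * (4 * h\<^sup>2 * (P / s) - 2 * h * n + C1 * \<delta> * (1 + P / s) + C2 * norm z))"
          by (intro mult_left_mono S0)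
        then show ?thesis unfolding Sell ell_op_gauss[OF M(1)] z_def[symmetric] unfolding S_def by (simp add: mult.assoc)
      qed
      have sc: "s powr (- n / 2) * exp (- (P / s) / 4) * (C1 * \<delta> * (1 + P / s) + C2 * norm z) \<le>
         K * (s powr (- \<kappa>) * exp (- \<theta> * (P / s)) *
           ((2 * \<theta> * n - \<kappa>) + \<theta> * (1 - 4 * \<theta>) * (P / s) - C1 * \<delta> * (1 + P / s) - C2 * norm z))"
        using h M(6)[of z] \<delta>0 \<delta>1 unfolding P_def z_def[symmetric]
        by (intro scal[rule_format]) (auto simp: z_def)
      have S1: "S (n / 2) (1 / 4) s x = s powr (- n / 2) * exp (- (P / s) / 4)"
        and S2: "S \<kappa> \<theta> s x = s powr (- \<kappa>) * exp (- \<theta> * (P / s))"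
        unfolding S_def gauss_def P_def z_def by simp_all
      note sc' = sc[folded S1 S2]
      \<comment> \<open>The leading terms of the first Gaussian cancel; the remainder is the
        difference of the two sides of the scalar inequality.\<close>
      have alg: "(X * r * (- (n / 2) + 1 / 4 * u) - X * (r * (4 * (1 / 4)\<^sup>2 * u - 2 * (1 / 4) * n + f + g)))
          + K * (Y * r * (- \<kappa> + \<theta> * u) - Y * (r * (4 * \<theta>\<^sup>2 * u - 2 * \<theta> * n + f + g)))
          = r * (K * (Y * ((2 * \<theta> * n - \<kappa>) + \<theta> * (1 - 4 * \<theta>) * u - f - g)) - X * (f + g))" for X Y r u f g
        by (simp add: algebra_simps power2_eq_square)
      have "W' s x - ell_op q b \<tau> (W s) x \<ge>
          (L (n / 2) (1 / 4) s x - S (n / 2) (1 / 4) s x * ((1 / s) * (4 * (1 / 4)\<^sup>2 * (P / s) - 2 * (1 / 4) * n + C1 * \<delta> * (1 + P / s) + C2 * norm z)))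
          + K * (L \<kappa> \<theta> s x - S \<kappa> \<theta> s x * ((1 / s) * (4 * \<theta>\<^sup>2 * (P / s) - 2 * \<theta> * n + C1 * \<delta> * (1 + P / s) + C2 * norm z)))"
      proof -
        have 1: "ell_op q b \<tau> (S (n / 2) (1 / 4) s) x \<le> S (n / 2) (1 / 4) s x * ((1 / s) * (4 * (1 / 4)\<^sup>2 * (P / s) - 2 * (1 / 4) * n + C1 * \<delta> * (1 + P / s) + C2 * norm z))"
          by (rule gb) auto
        have 2: "K * ell_op q b \<tau> (S \<kappa> \<theta> s) x \<le> K * (S \<kappa> \<theta> s x * ((1 / s) * (4 * \<theta>\<^sup>2 * (P / s) - 2 * \<theta> * n + C1 * \<delta> * (1 + P / s) + C2 * norm z)))"
          using \<theta> K by (intro mult_left_mono gb) auto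
        show ?thesis using 1 2 unfolding Well W'_def right_diff_distrib[of K] by linarith
      qed
      also have "(L (n / 2) (1 / 4) s x - S (n / 2) (1 / 4) s x * ((1 / s) * (4 * (1 / 4)\<^sup>2 * (P / s) - 2 * (1 / 4) * n + C1 * \<delta> * (1 + P / s) + C2 * norm z)))
          + K * (L \<kappa> \<theta> s x - S \<kappa> \<theta> s x * ((1 / s) * (4 * \<theta>\<^sup>2 * (P / s) - 2 * \<theta> * n + C1 * \<delta> * (1 + P / s) + C2 * norm z)))
          = (1 / s) * (K * (S \<kappa> \<theta> s x * ((2 * \<theta> * n - \<kappa>) + \<theta> * (1 - 4 * \<theta>) * (P / s) - C1 * \<delta> * (1 + P / s) - C2 * norm z))
              - S (n / 2) (1 / 4) s x * (C1 * \<delta> * (1 + P / s) + C2 * norm z))"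
        unfolding L_def P_def[symmetric] z_def[symmetric] by (rule alg)
      finally have "W' s x - ell_op q b \<tau> (W s) x \<ge> (1 / s) * (K * (S \<kappa> \<theta> s x * ((2 * \<theta> * n - \<kappa>) + \<theta> * (1 - 4 * \<theta>) * (P / s) - C1 * \<delta> * (1 + P / s) - C2 * norm z))
              - S (n / 2) (1 / 4) s x * (C1 * \<delta> * (1 + P / s) + C2 * norm z))" .
      moreover have "(1 / s) * (K * (S \<kappa> \<theta> s x * ((2 * \<theta> * n - \<kappa>) + \<theta> * (1 - 4 * \<theta>) * (P / s) - C1 * \<delta> * (1 + P / s) - C2 * norm z))
              - S (n / 2) (1 / 4) s x * (C1 * \<delta> * (1 + P / s) + C2 * norm z)) \<ge> 0"
        using sc' h(4) by (intro mult_nonneg_nonneg) auto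
      ultimately show ?thesis by linarith
    qed
    have W0: "0 \<le> W s x" for s x unfolding W_def using K S0 by simp
    have lower: "s powr (- real CARD('n) / 2) \<le> A * W s x" if h: "0 < s" "(norm (x - y))\<^sup>2 \<le> s" for s x
    proof -
      have "quad M (x - y) \<le> s / e" using M(7)[of "x - y"] h e(1) by (meson divide_right_mono less_imp_le order_trans)
      then have "(1 / 4 / s) * quad M (x - y) \<le> (1 / 4 / s) * (s / e)" using h by (intro mult_left_mono) auto
      also have "\<dots> = 1 / (4 * e)" using h by simp
      finally have "exp (- (1 / (4 * e))) \<le> gauss M (1 / 4 / s) y x" unfolding gauss_def by simp
      then have "s powr (- n / 2) * exp (- (1 / (4 * e))) \<le> S (n / 2) (1 / 4) s x"
        unfolding S_def by (simp add: mult_left_mono)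
      also have "\<dots> \<le> W s x" unfolding W_def using K S0 by simp
      finally have "A1 * (s powr (- n / 2) * exp (- (1 / (4 * e)))) \<le> A1 * W s x" using A by (intro mult_left_mono) auto
      moreover have "A1 * (s powr (- n / 2) * exp (- (1 / (4 * e)))) = s powr (- n / 2)"
        unfolding A1_def by (simp add: exp_minus)
      moreover have "A1 * W s x \<le> A * W s x" using A W0 by (intro mult_right_mono) auto
      ultimately show ?thesis unfolding n_def by linarith
    qed
    have sphere: "W s x \<le> A" if h: "0 < s" "s \<le> 1" "norm (x - y) = r0 / 2" for s x
    proof -
      have Pc: "c \<le> quad M (x - y)" using M(6)[of "x - y"] unfolding h(3) c_def .
      have Sb: "S k g s x \<le> fact N / (g * c) ^ N" if g: "0 < g" "k \<le> real N" for k g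
      proof -
        have "gauss M (g / s) y x \<le> exp (- (g * c) / s)"
          unfolding gauss_def using Pc g h by (auto simp: divide_right_mono)
        then have "S k g s x \<le> s powr (- k) * exp (- (g * c) / s)"
          unfolding S_def by (intro mult_left_mono) auto
        also have "\<dots> \<le> fact N / (g * c) ^ N" using h g c by (intro powr_exp_bound) auto
        finally show ?thesis .
      qed
      have "S (n / 2) (1 / 4) s x \<le> fact N / (1 / 4 * c) ^ N" by (rule Sb) (auto simp: n_def N_def)
      moreover have "K * S \<kappa> \<theta> s x \<le> K * (fact N / (\<theta> * c) ^ N)"
        using K \<theta> \<kappa> by (intro mult_left_mono Sb) (auto simp: n_def N_def)
      ultimately have "W s x \<le> A2" unfolding W_def A2_def by simp
      then show ?thesis using A by linarith
    qed
    have upper: "W s x \<le> A * s0 powr (- real CARD('n))" if h: "0 < s0" "s0 \<le> s" "s \<le> 1" for s0 s x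
    proof -
      have Sb: "S k g s x \<le> s0 powr (- n)" if g: "0 \<le> g" "0 \<le> k" "k \<le> n" for k g
      proof -
        have "gauss M (g / s) y x \<le> 1" unfolding gauss_def using g h q0 by simp
        then have "S k g s x \<le> s powr (- k) * 1" unfolding S_def by (intro mult_left_mono) auto
        also have "\<dots> \<le> s powr (- n)" using g h by (simp add: powr_mono')
        also have "\<dots> \<le> s0 powr (- n)" using h n1 by (intro powr_mono2') auto
        finally show ?thesis .
      qed
      have "S (n / 2) (1 / 4) s x \<le> s0 powr (- n)" using n1 by (intro Sb) auto
      moreover have "K * S \<kappa> \<theta> s x \<le> K * s0 powr (- n)" using K \<theta> \<kappa> by (intro mult_left_mono Sb) auto
      ultimately have "W s x \<le> A3 * s0 powr (- n)" unfolding W_def A3_def by (simp add: distrib_right)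
      also have "\<dots> \<le> A * s0 powr (- n)" using A by (intro mult_right_mono) auto
      finally show ?thesis unfolding n_def .
    qed
    have "is_barrier t r0 A y W W'"
      unfolding is_barrier_def
    proof (intro conjI allI impI, goal_cases)
      case (1 s) show ?case by (rule WC2)
    next
      case 2 show ?case by (rule cW)
    next
      case (3 s x) then show ?case by (rule dW)
    next
      case (4 s x) show ?case by (rule W0)
    next
      case (5 \<tau> s x) then show ?case by (intro super) auto
    next
      case (6 s x) then show ?case by (intro lower) auto
    next
      case (7 s x) then show ?case by (intro sphere) auto
    next
      case (8 s0 s x) then show ?case by (intro upper) auto
    qed
    then show ?thesis by blast
  qed
  then show ?thesis using r0 A(1) by blast
qed

end

section \<open>Estimates on small balls and absolute continuity of the measures\<close>

context evolution
begin

text \<open>The value \<open>m1\<close> of the solution on the sphere of radius \<open>r0 / 2\<close> controls it outside that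
  sphere, while the barrier on the ball of radius \<open>r0\<close> gives back at most half of \<open>m1\<close>.\<close>

lemma small_ball:
  assumes t: "t \<in> I" and R: "0 \<le> R"
  shows "\<exists>C \<rho>1 \<tau>. 0 < C \<and> 0 < \<rho>1 \<and> t < \<tau> \<and> (\<forall>\<rho> y h. 0 < \<rho> \<and> \<rho> \<le> \<rho>1 \<and> norm y \<le> R \<and> h \<in> bcontfun \<and>
    (\<forall>x. 0 \<le> h x \<and> h x \<le> 1) \<and> (\<forall>x. h x \<noteq> 0 \<longrightarrow> dist x y < \<rho>) \<longrightarrow> (\<forall>x. G \<tau> t h x \<le> C * \<rho> ^ CARD('n)))"
proof -
  let ?n = "real CARD('n)"
  obtain r0 A where r0: "0 < r0" "r0 \<le> 1" and A: "0 < A" and bar: "\<forall>y. norm y \<le> R \<longrightarrow> (\<exists>W W'. is_barrier t r0 A y W W')"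
    using barrier[OF t R] by blast
  obtain \<Lambda> H where bnd: "\<Lambda> \<ge> 0" "H \<ge> 0"
    "\<And>i j \<tau> x. t \<le> \<tau> \<Longrightarrow> \<tau> \<le> t + 1 \<Longrightarrow> norm x \<le> R + 1 \<Longrightarrow> \<bar>q \<tau> x $ i $ j\<bar> \<le> \<Lambda>"
    "\<And>i \<tau> x. t \<le> \<tau> \<Longrightarrow> \<tau> \<le> t + 1 \<Longrightarrow> norm x \<le> R + 1 \<Longrightarrow> \<bar>b \<tau> x $ i\<bar> \<le> \<Lambda>"
    "\<And>i j \<tau> x y. t \<le> \<tau> \<Longrightarrow> \<tau> \<le> t + 1 \<Longrightarrow> norm x \<le> R + 1 \<Longrightarrow> norm y \<le> R + 1 \<Longrightarrow>
      \<bar>q \<tau> x $ i $ j - q t y $ i $ j\<bar> \<le> H * (\<bar>\<tau> - t\<bar> powr (\<alpha> / 2) + norm (x - y) powr \<alpha>)"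
    by (rule coefficient_bounds[OF t, of "R + 1"]) blast
  define Cq where "Cq = 4 * ?n * \<Lambda> / r0\<^sup>2"
  have Cq: "Cq \<ge> 0" unfolding Cq_def using bnd by simp
  \<comment> \<open>The first bound, with \<open>\<sigma>\<close> at most
    \<open>r0\<^sup>2 / 4\<close>, keeps the advanced time of the barrier below
    \<open>r0\<^sup>2\<close>. The second lets the term growing in time contribute at most a quarter
    of \<open>m1\<close>.\<close>
  define \<tau>0 where "\<tau>0 = min (r0\<^sup>2 / 2) (1 / (4 * (Cq + 1)))"
  have r02: "0 < r0\<^sup>2" "r0\<^sup>2 \<le> 1" using r0 by (auto simp: power_le_one)
  have \<tau>0: "0 < \<tau>0" "\<tau>0 \<le> r0\<^sup>2 / 2" "Cq * \<tau>0 \<le> 1 / 4"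
  proof -
    show "0 < \<tau>0" "\<tau>0 \<le> r0\<^sup>2 / 2" unfolding \<tau>0_def using r02 Cq by auto
    have "Cq * \<tau>0 \<le> Cq * (1 / (4 * (Cq + 1)))" unfolding \<tau>0_def using Cq by (intro mult_left_mono) auto
    also have "\<dots> \<le> 1 / 4" using Cq by (simp add: field_simps)
    finally show "Cq * \<tau>0 \<le> 1 / 4" .
  qed
  define \<tau> where "\<tau> = t + \<tau>0"
  have \<tau>: "t < \<tau>" "\<tau> \<le> t + 1" unfolding \<tau>_def using \<tau>0 r02 by auto
  define \<rho>1 where "\<rho>1 = r0 / 2"
  \<comment> \<open>The final estimate contains \<open>m1 * (1 / 4 + 1)\<close> with
    \<open>m1\<close> at most \<open>2 * (a * A)\<close>; hence the \<open>5 / 2\<close>.\<close>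
  define C where "C = A\<^sup>2 * (\<tau>0 powr (- ?n) + 5 / 2)"
  have C: "C > 0" unfolding C_def using A by (intro mult_pos_pos add_nonneg_pos) auto
  have "G \<tau> t h x1 \<le> C * \<rho> ^ CARD('n)"
    if \<rho>: "0 < \<rho>" "\<rho> \<le> \<rho>1" and y: "norm y \<le> R" and h: "h \<in> bcontfun" and h01: "\<And>x. 0 \<le> h x" "\<And>x. h x \<le> 1"
      and supp: "\<And>x. h x \<noteq> 0 \<Longrightarrow> dist x y < \<rho>" for \<rho> y h x1
  proof -
    \<comment> \<open>Advancing the barrier by the square of the radius makes it at least
      \<open>\<rho> powr (- CARD('n)) / A\<close> on the ball of radius \<open>\<rho>\<close>
      already at time \<open>t\<close>, so that \<open>a * W\<close> dominates \<open>h\<close>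
      there.\<close>
    define \<sigma> where "\<sigma> = \<rho>\<^sup>2"
    have \<sigma>: "0 < \<sigma>" "\<sigma> \<le> r0\<^sup>2 / 4"
    proof -
      have "\<rho>\<^sup>2 \<le> (r0 / 2)\<^sup>2" using \<rho> unfolding \<rho>1_def by (intro power_mono) auto
      then show "\<sigma> \<le> r0\<^sup>2 / 4" unfolding \<sigma>_def by (simp add: power_divide)
    qed (use \<rho> in \<open>simp add: \<sigma>_def\<close>)
    obtain W W' where W: "is_barrier t r0 A y W W'" using bar y by blast
    note WC2 = is_barrierD(1)[OF W] and Wc = is_barrierD(2)[OF W] and Wd = is_barrierD(3)[OF W]
      and W0 = is_barrierD(4)[OF W] and Wsup = is_barrierD(5)[OF W] and Wlow = is_barrierD(6)[OF W]
      and Wsph = is_barrierD(7)[OF W] and Wup = is_barrierD(8)[OF W]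
    define u where "u r x = G r t h x" for r x
    have u: "solution t u" "\<And>x. u t x = h x" unfolding u_def using G_solution[OF t h] by auto
    have u0: "0 \<le> u r x" if "t \<le> r" for r x using solution_nonneg[OF t u(1) _ that] u(2) h01 by simp
    have u1: "u r x \<le> 1" if "t \<le> r" for r x using solution_le[OF t u(1) solution_const _ that] u(2) h01 by simp
    have uC2: "u r \<in> C2_space" if "t < r" for r using u(1) that unfolding solution_def by blast
    have ud: "((\<lambda>r. u r x) has_real_derivative ell_op q b r (u r) x) (at r)" if "t < r" for r x
      using u(1) that unfolding solution_def by blast
    have uc: "continuous_on ({t..} \<times> UNIV) (\<lambda>z. u (fst z) (snd z))"
      using u(1) unfolding solution_def Cb_from_iff split_def by blast
    \<comment> \<open>The maximum over this compact set is attained at a point \<open>z\<close>; the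
      interior estimate is later evaluated at exactly this point.\<close>
    let ?K = "{t..\<tau>} \<times> sphere y (r0 / 2)"
    have Kne: "?K \<noteq> {}" using \<tau> r0 by simp
    have Kc: "compact ?K" by (intro compact_Times) auto
    have uK: "continuous_on ?K (\<lambda>z. u (fst z) (snd z))" by (rule continuous_on_subset[OF uc]) auto
    obtain z where z: "z \<in> ?K" "\<And>w. w \<in> ?K \<Longrightarrow> u (fst w) (snd w) \<le> u (fst z) (snd z)"
      using continuous_attains_sup[OF Kc Kne uK] by blast
    define m1 where "m1 = u (fst z) (snd z)"
    have zt: "t \<le> fst z" "fst z \<le> \<tau>" and zs: "norm (snd z - y) = r0 / 2"
      using z(1) by (auto simp: dist_norm norm_minus_commute)
    have m1: "u r x \<le> m1" if "t \<le> r" "r \<le> \<tau>" "norm (x - y) = r0 / 2" for r x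
      using z(2)[of "(r, x)"] that unfolding m1_def by (auto simp: dist_norm norm_minus_commute)
    have m10: "0 \<le> m1" unfolding m1_def by (rule u0[OF zt(1)])
    have hz: "h x = 0" if "r0 / 2 \<le> norm (x - y)" for x
    proof (rule ccontr)
      assume "h x \<noteq> 0"
      then have "norm (x - y) < \<rho>" using supp by (simp add: dist_norm)
      then show False using that \<rho> unfolding \<rho>1_def by simp
    qed
    \<comment> \<open>Outside the sphere the initial datum vanishes, because \<open>\<rho>\<close>
      is at most \<open>r0 / 2\<close>; so the constant \<open>m1\<close> is a supersolution
      there.\<close>
    have ext: "u r x \<le> m1" if r: "t \<le> r" "r \<le> \<tau>" and x: "r0 / 2 \<le> norm (x - y)" for r x
    proof -
      let ?E = "- cball y (r0 / 2)"
      have clE: "closure ?E = - ball y (r0 / 2)" by (simp add: closure_complement)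
      have frE: "frontier ?E = sphere y (r0 / 2)" using r0 by (simp add: frontier_complement)
      have inE: "r0 / 2 \<le> norm (x - y)" if "x \<in> closure ?E" for x
        using that unfolding clE by (simp add: dist_norm norm_minus_commute)
      have "0 \<le> m1 + (-1) * u r x"
      proof (rule comparison[where s=t and E="?E" and T=\<tau> and v="\<lambda>r x. m1 + (-1) * u r x"
            and v'="\<lambda>r x. (-1) * ell_op q b r (u r) x" and B=1])
        show "continuous_on ({t..\<tau>} \<times> closure ?E) (\<lambda>(r, x). m1 + (-1) * u r x)"
          unfolding split_def by (intro continuous_intros continuous_on_subset[OF uc]) auto
        show "(\<lambda>x. m1 + (-1) * u r x) \<in> C2_space" if "t < r" for r by (intro C2_lincomb(1) C2_const(1) uC2 that)
        show "((\<lambda>r. m1 + (-1) * u r x) has_real_derivative (-1) * ell_op q b r (u r) x) (at r)" if "t < r" for r x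
          by (auto intro!: derivative_eq_intros ud[OF that])
        show "ell_op q b r (\<lambda>x. m1 + (-1) * u r x) x \<le> (-1) * ell_op q b r (u r) x" if "t < r" for r x
          unfolding ell_op_lincomb[OF C2_const(1) uC2[OF that]] ell_op_const by simp
        show "0 \<le> m1 + (-1) * u t x" if "x \<in> closure ?E" for x
          using hz[OF inE[OF that]] m10 u(2) by simp
        show "0 \<le> m1 + (-1) * u r x" if "t \<le> r" "r \<le> \<tau>" "x \<in> frontier ?E" for r x
          using m1[OF that(1,2)] that(3) unfolding frE by (simp add: dist_norm norm_minus_commute)
        show "- 1 \<le> m1 + (-1) * u r x" if "t \<le> r" for r x using u1[OF that, of x] m10 by simp
        show "x \<in> closure ?E" unfolding clE using x by (simp add: dist_norm norm_minus_commute)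
      qed (use t r in auto)
      then show ?thesis by simp
    qed
    define a where "a = A * \<rho> ^ CARD('n)"
    have a0: "a \<ge> 0" unfolding a_def using A \<rho> by simp
    \<comment> \<open>The comparison function \<open>f2\<close> has three parts:
      \<open>a * W\<close> dominates the initial datum, the multiple of the squared distance reaches
      \<open>m1\<close> on the lateral boundary, and the term growing in time compensates for the
      generator applied to the squared distance.\<close>
    define f1 where "f1 r x = m1 * (Cq * (r - t)) + a * W (r - t + \<sigma>) x" for r x
    define f2 where "f2 r x = f1 r x + m1 / r0\<^sup>2 * (norm (x - y))\<^sup>2" for r x
    have int: "u r x \<le> f2 r x" if r: "t \<le> r" "r \<le> \<tau>" and x: "norm (x - y) \<le> r0" for r x
    proof -
      let ?E = "ball y r0"
      have clE: "closure ?E = cball y r0" using r0 by simp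
      have frE: "frontier ?E = sphere y r0" using r0 by simp
      have spos: "0 < r - t + \<sigma>" if "t \<le> r" for r using that \<sigma> by simp
      have f1C2: "f1 r \<in> C2_space" if "t \<le> r" for r
        unfolding f1_def by (intro C2_lincomb(1) C2_const(1) WC2 spos that)
      have f2C2: "f2 r \<in> C2_space" if "t \<le> r" for r
        unfolding f2_def by (intro C2_lincomb(1) norm_sq_C2(1) f1C2 that)
      have "0 \<le> f2 r x + (-1) * u r x"
      proof (rule comparison[where s=t and E="?E" and T=\<tau> and v="\<lambda>r x. f2 r x + (-1) * u r x"
            and v'="\<lambda>r x. (m1 * Cq + a * W' (r - t + \<sigma>) x) + (-1) * ell_op q b r (u r) x" and B=1])
        have "continuous_on ({t..\<tau>} \<times> closure ?E) (\<lambda>z. (\<lambda>(s, x). W s x) (fst z - t + \<sigma>, snd z))"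
        proof (rule continuous_on_compose2[OF Wc])
          show "continuous_on ({t..\<tau>} \<times> closure ?E) (\<lambda>z. (fst z - t + \<sigma>, snd z))"
            by (intro continuous_intros)
          show "(\<lambda>z. (fst z - t + \<sigma>, snd z)) ` ({t..\<tau>} \<times> closure ?E) \<subseteq> {0<..} \<times> UNIV"
            using \<sigma> by auto
        qed
        then have "continuous_on ({t..\<tau>} \<times> closure ?E) (\<lambda>z. W (fst z - t + \<sigma>) (snd z))" by simp
        then show "continuous_on ({t..\<tau>} \<times> closure ?E) (\<lambda>(r, x). f2 r x + (-1) * u r x)"
          unfolding split_def f2_def f1_def by (intro continuous_intros continuous_on_subset[OF uc]) auto
        show "(\<lambda>x. f2 r x + (-1) * u r x) \<in> C2_space" if "t < r" for r
          using that by (intro C2_lincomb(1) f2C2 uC2) auto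
        show "((\<lambda>r. f2 r x + (-1) * u r x) has_real_derivative (m1 * Cq + a * W' (r - t + \<sigma>) x) + (-1) * ell_op q b r (u r) x) (at r)"
          if "t < r" for r x
        proof -
          have "((\<lambda>r. W (r - t + \<sigma>) x) has_real_derivative W' (r - t + \<sigma>) x * 1) (at r)"
            using spos[of r] that by (intro DERIV_chain2[OF Wd]) (auto intro!: derivative_eq_intros)
          then show ?thesis unfolding f2_def f1_def
            by (auto intro!: derivative_eq_intros ud[OF that])
        qed
        show "ell_op q b r (\<lambda>x. f2 r x + (-1) * u r x) x \<le> (m1 * Cq + a * W' (r - t + \<sigma>) x) + (-1) * ell_op q b r (u r) x"
          if r: "t < r" "r \<le> \<tau>" "x \<in> ?E" for r x
        proof -
          have r': "t \<le> r" "r \<le> t + 1" using r \<tau> by auto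
          have nz: "norm (x - y) \<le> r0" using r(3) by (simp add: dist_norm norm_minus_commute)
          have nx: "norm x \<le> R + 1" using norm_triangle_ineq[of "x - y" y] nz r0 y by simp
          have e1: "ell_op q b r (W (r - t + \<sigma>)) x \<le> W' (r - t + \<sigma>) x"
            using r r' nz \<sigma> \<tau>0 unfolding \<tau>_def by (intro Wsup) auto
          have tr: "trace (q r x) \<le> ?n * \<Lambda>"
          proof -
            have "trace (q r x) \<le> (\<Sum>i\<in>(UNIV::'n set). \<Lambda>)" unfolding trace_def
              by (intro sum_mono order_trans[OF abs_ge_self bnd(3)[OF r' nx]])
            then show ?thesis by simp
          qed
          have bz: "b r x \<bullet> (x - y) \<le> ?n * \<Lambda>"
          proof -
            have "b r x \<bullet> (x - y) \<le> ?n * (\<Lambda> * norm (x - y))"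
              using inner_bound_l1[OF bnd(4)[OF r' nx], of "x - y"] by linarith
            also have "\<dots> \<le> ?n * (\<Lambda> * 1)" using bnd nz r0 by (intro mult_left_mono) auto
            finally show ?thesis by simp
          qed
          have "m1 / r0\<^sup>2 * (2 * trace (q r x) + 2 * (b r x \<bullet> (x - y))) \<le> m1 / r0\<^sup>2 * (4 * ?n * \<Lambda>)"
            using tr bz m10 by (intro mult_left_mono) auto
          also have "\<dots> = m1 * Cq" unfolding Cq_def by simp
          finally have e2: "m1 / r0\<^sup>2 * (2 * trace (q r x) + 2 * (b r x \<bullet> (x - y))) \<le> m1 * Cq" .
          have ell2: "ell_op q b r (f2 r) x = a * ell_op q b r (W (r - t + \<sigma>)) x
             + m1 / r0\<^sup>2 * (2 * trace (q r x) + 2 * (b r x \<bullet> (x - y)))"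
          proof -
            have "ell_op q b r (f1 r) x = a * ell_op q b r (W (r - t + \<sigma>)) x"
              unfolding f1_def ell_op_lincomb[OF C2_const(1) WC2[OF spos[OF r'(1)]]] ell_op_const by simp
            then show ?thesis
              unfolding f2_def ell_op_lincomb[OF f1C2[OF r'(1)] norm_sq_C2(1)] norm_sq_C2(2) by simp
          qed
          have "a * ell_op q b r (W (r - t + \<sigma>)) x \<le> a * W' (r - t + \<sigma>) x" by (intro mult_left_mono e1 a0)
          then show ?thesis
            unfolding ell_op_lincomb[OF f2C2[OF r'(1)] uC2[OF r(1)]] ell2 using e2 by linarith
        qed
        have f1n: "0 \<le> f1 r x" if "t \<le> r" for r x
          unfolding f1_def using m10 Cq a0 W0 that by (intro add_nonneg_nonneg mult_nonneg_nonneg) auto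
        show "0 \<le> f2 t x + (-1) * u t x" for x
        proof (cases "h x = 0")
          case True
          then show ?thesis using f1n[of t x] m10 unfolding f2_def u(2) by simp
        next
          case False
          then have "norm (x - y) < \<rho>" using supp by (simp add: dist_norm)
          then have "(norm (x - y))\<^sup>2 \<le> \<sigma>" unfolding \<sigma>_def by (intro power_mono) auto
          from Wlow[OF \<sigma>(1) this] have "\<rho> ^ CARD('n) * \<sigma> powr (- ?n / 2) \<le> \<rho> ^ CARD('n) * (A * W \<sigma> x)"
            using \<rho> by (intro mult_left_mono) auto
          moreover have "\<rho> ^ CARD('n) * \<sigma> powr (- ?n / 2) = 1"
            unfolding \<sigma>_def using \<rho> by (simp add: powr_powr powr_minus powr_realpow flip: powr_numeral)
          ultimately have "1 \<le> a * W \<sigma> x" unfolding a_def by (simp add: mult_ac)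
          moreover have "0 \<le> m1 / r0\<^sup>2 * (norm (x - y))\<^sup>2" using m10 by simp
          ultimately have "1 \<le> f2 t x" unfolding f2_def f1_def by simp
          then show ?thesis using u(2) h01(2)[of x] by simp
        qed
        show "0 \<le> f2 r x + (-1) * u r x" if "t \<le> r" "r \<le> \<tau>" "x \<in> frontier ?E" for r x
        proof -
          have nx: "norm (x - y) = r0" using that(3) unfolding frE by (simp add: dist_norm norm_minus_commute)
          then have "m1 \<le> f2 r x" unfolding f2_def nx using f1n[OF that(1)] r0 by simp
          moreover have "u r x \<le> m1" using nx r0 by (intro ext that) auto
          ultimately show ?thesis by simp
        qed
        show "- 1 \<le> f2 r x + (-1) * u r x" if "t \<le> r" for r x
        proof -
          have "0 \<le> f2 r x" unfolding f2_def using f1n[OF that, of x] m10 by simp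
          then show ?thesis using u1[OF that, of x] by simp
        qed
        show "x \<in> closure ?E" unfolding clE using x by (simp add: dist_norm norm_minus_commute)
      qed (use t r in auto)
      then show ?thesis by simp
    qed
    have f2_le: "f2 r x \<le> a * W (r - t + \<sigma>) x + m1 * (1 / 4 + d)"
      if "t \<le> r" "r \<le> \<tau>" "(norm (x - y))\<^sup>2 \<le> d * r0\<^sup>2" for r x d
    proof -
      have "Cq * (r - t) \<le> Cq * \<tau>0" using that Cq unfolding \<tau>_def by (intro mult_left_mono) auto
      then have "m1 * (Cq * (r - t)) \<le> m1 * (1 / 4)" using \<tau>0 m10 by (intro mult_left_mono) auto
      moreover have "m1 / r0\<^sup>2 * (norm (x - y))\<^sup>2 \<le> m1 / r0\<^sup>2 * (d * r0\<^sup>2)"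
        using m10 that by (intro mult_left_mono) auto
      moreover have "m1 / r0\<^sup>2 * (d * r0\<^sup>2) = m1 * d" using r0 by simp
      ultimately show ?thesis unfolding f2_def f1_def distrib_left by linarith
    qed
    have s1: "r - t + \<sigma> \<le> 1" if "r \<le> \<tau>" for r using that \<tau>0 \<sigma> r02 unfolding \<tau>_def by simp
    \<comment> \<open>At the maximum point the distance to \<open>y\<close> is
      \<open>r0 / 2\<close>, so the two terms containing \<open>m1\<close> add up to at most half of
      \<open>m1\<close> and can be absorbed on the left.\<close>
    have m1_le: "m1 \<le> 2 * (a * A)"
    proof -
      have "m1 \<le> f2 (fst z) (snd z)" unfolding m1_def using zt zs r0 by (intro int) auto
      also have "\<dots> \<le> a * W (fst z - t + \<sigma>) (snd z) + m1 * (1 / 4 + 1 / 4)"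
        using zt zs by (intro f2_le) (auto simp: power_divide)
      also have "a * W (fst z - t + \<sigma>) (snd z) \<le> a * A"
        using zt zs s1 \<sigma> a0 by (intro mult_left_mono Wsph) auto
      finally show ?thesis by simp
    qed
    have fin: "C * \<rho> ^ CARD('n) = a * (A * \<tau>0 powr (- ?n)) + 5 / 2 * (a * A)"
      unfolding C_def a_def by (simp add: power2_eq_square algebra_simps)
    have aA: "0 \<le> a * A" "0 \<le> a * (A * \<tau>0 powr (- ?n))" using a0 A by auto
    have "u \<tau> x1 \<le> C * \<rho> ^ CARD('n)"
    proof (cases "norm (x1 - y) \<le> r0")
      case True
      have "u \<tau> x1 \<le> f2 \<tau> x1" using \<tau> True by (intro int) auto
      also have "\<dots> \<le> a * W (\<tau> - t + \<sigma>) x1 + m1 * (1 / 4 + 1)"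
        using \<tau> True by (intro f2_le) (auto intro: power_mono)
      also have "a * W (\<tau> - t + \<sigma>) x1 \<le> a * (A * \<tau>0 powr (- ?n))"
        using s1[of \<tau>] \<sigma> a0 \<tau>0 unfolding \<tau>_def by (intro mult_left_mono Wup) auto
      finally show ?thesis using m1_le unfolding fin by simp
    next
      case False
      have "u \<tau> x1 \<le> m1" using \<tau> False r0 by (intro ext) auto
      then show ?thesis using m1_le aA unfolding fin by linarith
    qed
    then show ?thesis unfolding u_def .
  qed
  note main = this
  have "0 < \<rho>1" unfolding \<rho>1_def using r0 by simp
  show ?thesis
  proof (rule exI[of _ C], rule exI[of _ \<rho>1], rule exI[of _ \<tau>], intro conjI allI impI, goal_cases)
    case (4 \<rho> y h x)
    then show ?case by (intro main) auto
  qed fact+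
qed

text \<open>Invariance transfers the bound for \<open>G \<tau> t\<close> to \<open>\<mu> t\<close>.
  The cutoff function is 1 on the ball and lives on the ball of twice the radius, which accounts for
  the factor \<open>2 ^ CARD('n)\<close> and the halved range of radii.\<close>

lemma mu_ball:
  assumes t: "t \<in> I" and R: "0 \<le> R"
  shows "\<exists>C \<rho>1. 0 < C \<and> 0 < \<rho>1 \<and> (\<forall>\<rho> y. 0 < \<rho> \<and> \<rho> \<le> \<rho>1 \<and> norm y \<le> R \<longrightarrow>
    measure (\<mu> t) (ball y \<rho>) \<le> C * \<rho> ^ CARD('n))"
proof -
  obtain C \<rho>1 \<tau> where C: "0 < C" "0 < \<rho>1" "t < \<tau>"
    and main: "\<And>\<rho> y h x. 0 < \<rho> \<Longrightarrow> \<rho> \<le> \<rho>1 \<Longrightarrow> norm y \<le> R \<Longrightarrow> h \<in> bcontfun \<Longrightarrow>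
      (\<And>x. 0 \<le> h x \<and> h x \<le> 1) \<Longrightarrow> (\<And>x. h x \<noteq> 0 \<Longrightarrow> dist x y < \<rho>) \<Longrightarrow> G \<tau> t h x \<le> C * \<rho> ^ CARD('n)"
    using small_ball[OF t R] by metis
  have \<tau>I: "\<tau> \<in> I" using I_upward[OF t] C by simp
  interpret Mt: prob_space "\<mu> t" by (rule mu[OF t])
  interpret M\<tau>: prob_space "\<mu> \<tau>" by (rule mu[OF \<tau>I])
  have "measure (\<mu> t) (ball y \<rho>) \<le> (C * 2 ^ CARD('n)) * \<rho> ^ CARD('n)"
    if \<rho>: "0 < \<rho>" "\<rho> \<le> \<rho>1 / 2" and y: "norm y \<le> R" for \<rho> y
  proof -
    define h where "h x = max 0 (min 1 (2 - dist x y / \<rho>))" for x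
    have h01: "0 \<le> h x \<and> h x \<le> 1" for x unfolding h_def by auto
    have hc: "h \<in> bcontfun" unfolding bcontfun_iff
    proof
      show "continuous_on UNIV h" unfolding h_def using \<rho> by (intro continuous_intros) auto
      show "\<exists>B. \<forall>x. \<bar>h x\<bar> \<le> B" using h01 by (intro exI[of _ 1]) auto
    qed
    have supp: "dist x y < 2 * \<rho>" if "h x \<noteq> 0" for x
    proof (rule ccontr)
      assume "\<not> ?thesis"
      then have "2 \<le> dist x y / \<rho>" using \<rho> by (simp add: field_simps)
      then show False using that unfolding h_def by simp
    qed
    have one: "h x = 1" if "x \<in> ball y \<rho>" for x
    proof -
      have "dist x y / \<rho> \<le> 1" using that \<rho> by (simp add: dist_commute)
      then show ?thesis unfolding h_def by simp
    qed
    have bs: "ball y \<rho> \<in> sets (\<mu> t)" unfolding mu(2)[OF t] by simp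
    have "measure (\<mu> t) (ball y \<rho>) = (\<integral>x. indicator (ball y \<rho>) x \<partial>\<mu> t)"
      using bs by simp
    also have "\<dots> \<le> (\<integral>x. h x \<partial>\<mu> t)"
    proof (rule integral_mono)
      show "integrable (\<mu> t) (indicator (ball y \<rho>) :: _ \<Rightarrow> real)"
        using bs by (intro integrable_real_indicator) (auto simp: Mt.emeasure_eq_measure)
      show "integrable (\<mu> t) h" by (rule bcontfun_integrable[OF t hc])
      show "indicator (ball y \<rho>) x \<le> h x" for x
        using one[of x] h01[of x] by (auto simp: indicator_def)
    qed
    also have "\<dots> = (\<integral>x. G \<tau> t h x \<partial>\<mu> \<tau>)" using G_invariant[OF t hc] C by simp
    also have "\<dots> \<le> (\<integral>x. C * (2 * \<rho>) ^ CARD('n) \<partial>\<mu> \<tau>)"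
    proof (rule integral_mono)
      show "integrable (\<mu> \<tau>) (G \<tau> t h)" using C by (intro bcontfun_integrable[OF \<tau>I] G_bcontfun t hc) auto
      show "G \<tau> t h x \<le> C * (2 * \<rho>) ^ CARD('n)" for x
        by (rule main[of "2 * \<rho>" y h x]) (use \<rho> y hc h01 supp in auto)
    qed simp
    also have "\<dots> = (C * 2 ^ CARD('n)) * \<rho> ^ CARD('n)"
      by (simp add: power_mult_distrib M\<tau>.prob_space)
    finally show ?thesis .
  qed
  then show ?thesis using C
    by - (rule exI[of _ "C * 2 ^ CARD('n)"], rule exI[of _ "\<rho>1 / 2"], auto)
qed

text \<open>Fubini's theorem bounds the average over \<open>x\<close> of the fraction of \<open>ball x r\<close> lying in \<open>U\<close>, and
  this fraction tends to 1 on the open set \<open>U\<close>.\<close>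

lemma mu_open:
  assumes t: "t \<in> I" and R: "0 \<le> R"
  shows "\<exists>K::real. 0 \<le> K \<and> (\<forall>U. open U \<and> U \<subseteq> ball 0 R \<longrightarrow> emeasure (\<mu> t) U \<le> ennreal K * emeasure lborel U)"
proof -
  let ?n = "CARD('n)"
  obtain C \<rho>1 where C: "0 < C" "0 < \<rho>1" and main: "\<And>\<rho> y. 0 < \<rho> \<Longrightarrow> \<rho> \<le> \<rho>1 \<Longrightarrow> norm y \<le> R \<Longrightarrow>
    measure (\<mu> t) (ball y \<rho>) \<le> C * \<rho> ^ ?n"
    using mu_ball[OF t R] by metis
  interpret Mt: prob_space "\<mu> t" by (rule mu[OF t])
  interpret P: pair_sigma_finite "\<mu> t" lborel ..
  define \<omega> where "\<omega> = unit_ball_vol (real ?n)"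
  have \<omega>: "\<omega> > 0" unfolding \<omega>_def by simp
  have "emeasure (\<mu> t) U \<le> ennreal (C / \<omega>) * emeasure lborel U" if U: "open U" "U \<subseteq> ball 0 R" for U
  proof -
    define r where "r k = \<rho>1 / (real k + 1)" for k
    have r: "0 < r k" "r k \<le> \<rho>1" for k unfolding r_def using C by (auto simp: field_simps)
    have r0: "r \<longlonglongrightarrow> 0" unfolding r_def using LIMSEQ_inverse_real_of_nat[THEN tendsto_mult_left, of \<rho>1]
      by (simp add: divide_inverse add.commute)
    define v where "v k = \<omega> * r k ^ ?n" for k
    have v: "v k > 0" for k unfolding v_def using \<omega> r by simp
    define f where "f k x = ennreal (1 / v k) * (\<integral>\<^sup>+ y. indicator {z. dist (fst z) (snd z) < r k \<and> snd z \<in> U} (x, y) \<partial>lborel)" for k x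
    have oz: "open {z :: (real ^ 'n) \<times> (real ^ 'n). dist (fst z) (snd z) < r k \<and> snd z \<in> U}" for k
    proof -
      have "open {z :: (real ^ 'n) \<times> (real ^ 'n). dist (fst z) (snd z) < r k}"
        by (intro open_Collect_less continuous_intros)
      moreover have "open {z :: (real ^ 'n) \<times> (real ^ 'n). snd z \<in> U}"
        using open_vimage_snd[OF U(1)] by (simp add: vimage_def)
      ultimately show ?thesis by (auto simp: Collect_conj_eq)
    qed
    have sets_pair: "sets (\<mu> t \<Otimes>\<^sub>M (lborel :: (real ^ 'n) measure)) = sets borel"
    proof -
      have "sets (\<mu> t \<Otimes>\<^sub>M (lborel :: (real ^ 'n) measure)) = sets (borel \<Otimes>\<^sub>M borel)"
        by (intro sets_pair_measure_cong) (simp_all add: mu(2)[OF t])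
      also have "\<dots> = sets borel" unfolding borel_prod ..
      finally show ?thesis .
    qed
    have meas_ind: "indicator {z. dist (fst z) (snd z) < r k \<and> snd z \<in> U} \<in> borel_measurable (\<mu> t \<Otimes>\<^sub>M (lborel :: (real ^ 'n) measure))" for k
      unfolding measurable_cong_sets[OF sets_pair refl] using oz[of k] by simp
    have fm: "f k \<in> borel_measurable (\<mu> t)" for k
      unfolding f_def using lborel.borel_measurable_nn_integral_fst[OF meas_ind[of k]]
      by (intro borel_measurable_times_ennreal) auto
    have "\<integral>\<^sup>+ x. f k x \<partial>\<mu> t \<le> ennreal (C / \<omega>) * emeasure lborel U" for k
    proof -
      have "(\<integral>\<^sup>+ x. f k x \<partial>\<mu> t) = ennreal (1 / v k) * (\<integral>\<^sup>+ x. (\<integral>\<^sup>+ y. indicator {z. dist (fst z) (snd z) < r k \<and> snd z \<in> U} (x, y) \<partial>lborel) \<partial>\<mu> t)"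
        unfolding f_def using lborel.borel_measurable_nn_integral_fst[OF meas_ind[of k]]
        by (intro nn_integral_cmult) auto
      also have "(\<integral>\<^sup>+ x. (\<integral>\<^sup>+ y. indicator {z. dist (fst z) (snd z) < r k \<and> snd z \<in> U} (x, y) \<partial>lborel) \<partial>\<mu> t)
         = (\<integral>\<^sup>+ y. (\<integral>\<^sup>+ x. indicator {z. dist (fst z) (snd z) < r k \<and> snd z \<in> U} (x, y) \<partial>\<mu> t) \<partial>lborel)"
        using meas_ind[of k] by (intro P.Fubini'[symmetric]) simp
      also have "\<dots> \<le> (\<integral>\<^sup>+ y. ennreal (C * r k ^ ?n) * indicator U y \<partial>lborel)"
      proof (rule nn_integral_mono)
        fix y :: "real ^ 'n"
        have eq: "indicator {z. dist (fst z) (snd z) < r k \<and> snd z \<in> U} (x, y) = (indicator U y :: ennreal) * indicator (ball y (r k)) x" for x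
          by (auto simp: indicator_def dist_commute)
        have "(\<integral>\<^sup>+ x. indicator {z. dist (fst z) (snd z) < r k \<and> snd z \<in> U} (x, y) \<partial>\<mu> t) = indicator U y * emeasure (\<mu> t) (ball y (r k))"
          unfolding eq using mu(2)[OF t] by (simp add: nn_integral_cmult_indicator)
        also have "\<dots> \<le> ennreal (C * r k ^ ?n) * indicator U y"
        proof (cases "y \<in> U")
          case True
          then have "norm y \<le> R" using U(2) by auto
          then have "emeasure (\<mu> t) (ball y (r k)) \<le> ennreal (C * r k ^ ?n)"
            using main[OF r] by (simp add: Mt.emeasure_eq_measure ennreal_leI)
          then show ?thesis using True by simp
        qed simp
        finally show "(\<integral>\<^sup>+ x. indicator {z. dist (fst z) (snd z) < r k \<and> snd z \<in> U} (x, y) \<partial>\<mu> t) \<le> ennreal (C * r k ^ ?n) * indicator U y" .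
      qed
      also have "\<dots> = ennreal (C * r k ^ ?n) * emeasure lborel U"
        using U(1) by (simp add: nn_integral_cmult_indicator)
      finally have "(\<integral>\<^sup>+ x. f k x \<partial>\<mu> t) \<le> ennreal (1 / v k) * (ennreal (C * r k ^ ?n) * emeasure lborel U)"
        by (simp add: mult_left_mono)
      also have "\<dots> = ennreal (C / \<omega>) * emeasure lborel U"
      proof -
        have "1 / v k * (C * r k ^ ?n) = C / \<omega>" unfolding v_def using r[of k] by simp
        then show ?thesis using v[of k] C r[of k]
          by (simp add: mult.assoc[symmetric] ennreal_mult[symmetric] less_imp_le)
      qed
      finally show ?thesis .
    qed
    then have "liminf (\<lambda>k. \<integral>\<^sup>+ x. f k x \<partial>\<mu> t) \<le> ennreal (C / \<omega>) * emeasure lborel U"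
      by (intro Liminf_le) auto
    \<comment> \<open>On the open set the fraction is eventually equal to 1, so its lower limit
      dominates the indicator function; Fatou's lemma then finishes the estimate.\<close>
    moreover have "emeasure (\<mu> t) U \<le> (\<integral>\<^sup>+ x. liminf (\<lambda>k. f k x) \<partial>\<mu> t)"
    proof -
      have "indicator U x \<le> liminf (\<lambda>k. f k x)" for x
      proof (cases "x \<in> U")
        case True
        then obtain e where e: "e > 0" "ball x e \<subseteq> U" using U(1) open_contains_ball by blast
        have "eventually (\<lambda>k. r k < e) sequentially" using order_tendstoD(2)[OF r0 e(1)] .
        then have "eventually (\<lambda>k. 1 \<le> f k x) sequentially"
        proof eventually_elim
          case (elim k)
          have "(\<integral>\<^sup>+ y. indicator {z. dist (fst z) (snd z) < r k \<and> snd z \<in> U} (x, y) \<partial>lborel) = (\<integral>\<^sup>+ y. indicator (ball x (r k)) y \<partial>lborel)"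
          proof (rule nn_integral_cong)
            fix y
            have "y \<in> U" if "dist x y < r k" using e(2) elim that by (auto simp: subset_iff)
            then show "indicator {z. dist (fst z) (snd z) < r k \<and> snd z \<in> U} (x, y) = (indicator (ball x (r k)) y :: ennreal)"
              by (auto simp: indicator_def)
          qed
          also have "\<dots> = ennreal (v k)"
            using r[of k] by (simp add: emeasure_ball v_def \<omega>_def)
          finally show ?case unfolding f_def using v[of k] by (simp add: ennreal_mult[symmetric])
        qed
        then show ?thesis using True by (simp add: Liminf_bounded)
      qed simp
      then have "(\<integral>\<^sup>+ x. indicator U x \<partial>\<mu> t) \<le> (\<integral>\<^sup>+ x. liminf (\<lambda>k. f k x) \<partial>\<mu> t)" by (intro nn_integral_mono)
      then show ?thesis using U(1) mu(2)[OF t] by simp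
    qed
    ultimately show ?thesis using nn_integral_liminf[OF fm] by (meson order_trans)
  qed
  then show ?thesis using C \<omega> by (intro exI[of _ "C / \<omega>"]) auto
qed

text \<open>Outer regularity of Lebesgue measure carries the inequality for open sets over to null
  sets. The null set is first cut down to balls because the constant depends on the radius.\<close>

lemma mu_absolutely_continuous:
  assumes t: "t \<in> I"
  shows "absolutely_continuous lborel (\<mu> t)"
  unfolding absolutely_continuous_def
proof
  fix N :: "(real ^ 'n) set" assume "N \<in> null_sets lborel"
  then have N: "N \<in> sets borel" "emeasure lborel N = 0" by auto
  have "emeasure (\<mu> t) (N \<inter> ball 0 (real k)) = 0" for k :: nat
  proof -
    obtain K :: real where K: "0 \<le> K" "\<And>U. open U \<Longrightarrow> U \<subseteq> ball 0 (real k) \<Longrightarrow> emeasure (\<mu> t) U \<le> ennreal K * emeasure lborel U"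
      using mu_open[OF t, of "real k"] by auto
    have "emeasure (\<mu> t) (N \<inter> ball 0 (real k)) \<le> ennreal e" if e: "0 < e" for e :: real
    proof -
      have e': "0 < e / (K + 1)" using e K(1) by simp
      obtain U where U: "open U" "N \<subseteq> U" "emeasure lborel (U - N) < ennreal (e / (K + 1))"
        using outer_regular_lborel[OF N(1) e'] by blast
      have "emeasure lborel (U \<inter> ball 0 (real k)) \<le> emeasure lborel ((U - N) \<union> N)"
        using U N by (intro emeasure_mono) auto
      also have "\<dots> \<le> emeasure lborel (U - N) + emeasure lborel N"
        using U N by (intro emeasure_subadditive) auto
      also have "\<dots> \<le> ennreal (e / (K + 1))" using U(3) N(2) by simp
      finally have small: "emeasure lborel (U \<inter> ball 0 (real k)) \<le> ennreal (e / (K + 1))" .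
      have "emeasure (\<mu> t) (N \<inter> ball 0 (real k)) \<le> emeasure (\<mu> t) (U \<inter> ball 0 (real k))"
        using U mu(2)[OF t] by (intro emeasure_mono) auto
      also have "\<dots> \<le> ennreal K * emeasure lborel (U \<inter> ball 0 (real k))" using U(1) by (intro K(2)) auto
      also have "\<dots> \<le> ennreal K * ennreal (e / (K + 1))" by (intro mult_left_mono small) auto
      also have "\<dots> = ennreal (K * (e / (K + 1)))" using K(1) e' by (intro ennreal_mult[symmetric]) auto
      also have "\<dots> \<le> ennreal e" using K e by (intro ennreal_leI) (simp add: field_simps)
      finally show ?thesis .
    qed
    then have "emeasure (\<mu> t) (N \<inter> ball 0 (real k)) \<le> 0" by - (rule ennreal_le_epsilon, simp)
    then show ?thesis by simp
  qed
  then have "N \<inter> ball 0 (real k) \<in> null_sets (\<mu> t)" for k :: nat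
    using N mu(2)[OF t] by (intro null_setsI) auto
  then have "(\<Union>k::nat. N \<inter> ball 0 (real k)) \<in> null_sets (\<mu> t)" by (intro null_sets_UN) auto
  moreover have "(\<Union>k::nat. N \<inter> ball 0 (real k)) = N"
    by (auto simp: reals_Archimedean2)
  ultimately show "N \<in> null_sets (\<mu> t)" by simp
qed

lemma AE_lborel_mu:
  assumes "t \<in> I" "AE x in lborel. P x"
  shows "AE x in \<mu> t. P x"
  by (rule absolutely_continuous_AE[OF _ mu_absolutely_continuous[OF assms(1)] assms(2)])
    (simp add: mu(2)[OF assms(1)])

end

section \<open>The evolution operator on \<open>L\<^sup>p\<close>\<close>

lemma powr_convex:
  fixes u v \<theta> p :: real
  assumes p: "1 < p" and \<theta>: "0 \<le> \<theta>" "\<theta> \<le> 1"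
  shows "\<bar>\<theta> * u + (1 - \<theta>) * v\<bar> powr p \<le> \<theta> * \<bar>u\<bar> powr p + (1 - \<theta>) * \<bar>v\<bar> powr p"
proof -
  define X where "X = \<theta> * u + (1 - \<theta>) * v"
  obtain l where l: "\<And>y. \<bar>y\<bar> powr p \<ge> \<bar>X\<bar> powr p + l * (y - X)"
    using powr_tangent[OF p] by blast
  have "\<theta> * (\<bar>X\<bar> powr p + l * (u - X)) + (1 - \<theta>) * (\<bar>X\<bar> powr p + l * (v - X))
      \<le> \<theta> * \<bar>u\<bar> powr p + (1 - \<theta>) * \<bar>v\<bar> powr p"
    using \<theta> by (intro add_mono mult_left_mono l) auto
  moreover have "\<theta> * (\<bar>X\<bar> powr p + l * (u - X)) + (1 - \<theta>) * (\<bar>X\<bar> powr p + l * (v - X)) = \<bar>X\<bar> powr p"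
    unfolding X_def by (simp add: algebra_simps)
  ultimately show ?thesis unfolding X_def by simp
qed

lemma powr_add_bound:
  fixes u v p :: real
  assumes p: "1 < p"
  shows "\<bar>u + v\<bar> powr p \<le> 2 powr p * (\<bar>u\<bar> powr p + \<bar>v\<bar> powr p)"
proof -
  have "u + v = 2 * ((1 / 2) * u + (1 - 1 / 2) * v)" by (simp add: algebra_simps)
  then have "\<bar>u + v\<bar> powr p = (2 * \<bar>(1 / 2) * u + (1 - 1 / 2) * v\<bar>) powr p"
    by (metis abs_mult abs_numeral)
  also have "\<dots> = 2 powr p * \<bar>(1 / 2) * u + (1 - 1 / 2) * v\<bar> powr p" by (simp add: powr_mult)
  also have "\<dots> \<le> 2 powr p * ((1 / 2) * \<bar>u\<bar> powr p + (1 - 1 / 2) * \<bar>v\<bar> powr p)"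
    by (intro mult_left_mono powr_convex p) auto
  also have "\<dots> \<le> 2 powr p * (\<bar>u\<bar> powr p + \<bar>v\<bar> powr p)"
  proof (rule mult_left_mono)
    show "(1 / 2) * \<bar>u\<bar> powr p + (1 - 1 / 2) * \<bar>v\<bar> powr p \<le> \<bar>u\<bar> powr p + \<bar>v\<bar> powr p"
    proof -
      have "1 - 1 / 2 = (1 / 2 :: real)" by simp
      then show ?thesis using powr_ge_zero[of "\<bar>u\<bar>" p] powr_ge_zero[of "\<bar>v\<bar>" p] by (simp only:)
    qed
  qed simp
  finally show ?thesis .
qed

lemma Lp_norm_nonneg: "0 \<le> Lp_norm p M f"
  unfolding Lp_norm_def by simp

lemma Lp_norm_powr:
  assumes "0 < p"
  shows "Lp_norm p M f powr p = (\<integral>x. \<bar>f x\<bar> powr p \<partial>completion M)"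
  unfolding Lp_norm_def using assms by (simp add: powr_powr)

lemma Lp_norm_leI:
  assumes "0 < p" "0 \<le> c" "(\<integral>x. \<bar>f x\<bar> powr p \<partial>completion M) \<le> c powr p"
  shows "Lp_norm p M f \<le> c"
proof -
  have "Lp_norm p M f \<le> (c powr p) powr (1 / p)"
    unfolding Lp_norm_def using assms by (intro powr_mono2) auto
  then show ?thesis using assms by (simp add: powr_powr)
qed

text \<open>Here the completion matters: \<open>g\<close> may differ from \<open>f\<close> on an
  arbitrary subset of a null set and is still measurable for the completion.\<close>

lemma Lp_space_cong:
  assumes "f \<in> Lp_space p M" "AE x in M. f x = g x"
  shows "g \<in> Lp_space p M" "Lp_norm p M g = Lp_norm p M f"
proof -
  have ae: "AE x in completion M. f x = g x" using AE_completion[OF assms(2)] .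
  have fm: "f \<in> borel_measurable (completion M)" using assms(1) unfolding Lp_space_def by simp
  have gm: "g \<in> borel_measurable (completion M)"
  proof (rule measurableI)
    fix A :: "real set" assume A: "A \<in> sets borel"
    show "g -` A \<inter> space (completion M) \<in> sets (completion M)"
      by (rule completion.in_sets_AE[of "f -` A \<inter> space (completion M)"])
        (use ae measurable_sets[OF fm A] in auto)
  qed simp
  have fp: "(\<lambda>x. \<bar>f x\<bar> powr p) \<in> borel_measurable (completion M)" using fm by measurable
  have gp: "(\<lambda>x. \<bar>g x\<bar> powr p) \<in> borel_measurable (completion M)" using gm by measurable
  have aep: "AE x in completion M. \<bar>f x\<bar> powr p = \<bar>g x\<bar> powr p" using ae by eventually_elim simp
  show "g \<in> Lp_space p M"
    using assms(1) gm integrable_cong_AE[OF fp gp aep] unfolding Lp_space_def by simp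
  show "Lp_norm p M g = Lp_norm p M f"
    unfolding Lp_norm_def using integral_cong_AE[OF fp gp aep] by simp
qed

lemma Lp_spaceI:
  assumes "f \<in> borel_measurable M" "(\<integral>\<^sup>+ x. ennreal (\<bar>f x\<bar> powr p) \<partial>M) < \<infinity>"
  shows "f \<in> Lp_space p M"
proof -
  have f: "f \<in> borel_measurable (completion M)" using assms(1) by (rule measurable_completion)
  then have "(\<lambda>x. \<bar>f x\<bar> powr p) \<in> borel_measurable (completion M)" by measurable
  then have "integrable (completion M) (\<lambda>x. \<bar>f x\<bar> powr p)"
    using assms(2) by (intro integrableI_nonneg) (auto simp: nn_integral_completion)
  then show ?thesis unfolding Lp_space_def using f by simp
qed

lemma Lp_norm_nn:
  assumes "f \<in> Lp_space p M" "0 < p"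
  shows "ennreal (Lp_norm p M f powr p) = (\<integral>\<^sup>+ x. ennreal (\<bar>f x\<bar> powr p) \<partial>M)"
proof -
  have "(\<integral>\<^sup>+ x. ennreal (\<bar>f x\<bar> powr p) \<partial>completion M) = ennreal (\<integral>x. \<bar>f x\<bar> powr p \<partial>completion M)"
    using assms(1) unfolding Lp_space_def by (intro nn_integral_eq_integral) auto
  then show ?thesis unfolding Lp_norm_powr[OF assms(2)] nn_integral_completion by simp
qed

lemma Lp_space_version:
  assumes "f \<in> Lp_space p M"
  obtains g where "g \<in> borel_measurable M" "AE x in M. f x = g x"
proof -
  have "f \<in> borel_measurable (completion M)" using assms unfolding Lp_space_def by simp
  from completion_ex_borel_measurable_real[OF this] show ?thesis using that by blast
qed

lemma Lp_space_lincomb: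
  assumes p: "1 < p" and f: "f \<in> Lp_space p M" and g: "g \<in> Lp_space p M"
  shows "(\<lambda>x. f x + c * g x) \<in> Lp_space p M"
proof -
  have m: "f \<in> borel_measurable (completion M)" "g \<in> borel_measurable (completion M)"
    and i: "integrable (completion M) (\<lambda>x. \<bar>f x\<bar> powr p)" "integrable (completion M) (\<lambda>x. \<bar>g x\<bar> powr p)"
    using f g unfolding Lp_space_def by auto
  have m': "(\<lambda>x. f x + c * g x) \<in> borel_measurable (completion M)" using m by measurable
  then have mp: "(\<lambda>x. \<bar>f x + c * g x\<bar> powr p) \<in> borel_measurable (completion M)" by measurable
  have "integrable (completion M) (\<lambda>x. \<bar>f x + c * g x\<bar> powr p)"
  proof (rule Bochner_Integration.integrable_bound[OF _ mp])
    show "integrable (completion M) (\<lambda>x. 2 powr p * (\<bar>f x\<bar> powr p + \<bar>c\<bar> powr p * \<bar>g x\<bar> powr p))"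
      using i by (intro integrable_mult_right integrable_add) auto
    have "\<bar>f x + c * g x\<bar> powr p \<le> 2 powr p * (\<bar>f x\<bar> powr p + \<bar>c\<bar> powr p * \<bar>g x\<bar> powr p)" for x
      using powr_add_bound[OF p, of "f x" "c * g x"] by (simp add: abs_mult powr_mult)
    then show "AE x in completion M. norm (\<bar>f x + c * g x\<bar> powr p) \<le> norm (2 powr p * (\<bar>f x\<bar> powr p + \<bar>c\<bar> powr p * \<bar>g x\<bar> powr p))"
      by (auto intro: order_trans[OF _ abs_ge_self])
  qed
  then show ?thesis unfolding Lp_space_def using m' by simp
qed

lemma Lp_space_diff:
  assumes "1 < p" "f \<in> Lp_space p M" "g \<in> Lp_space p M"
  shows "(\<lambda>x. f x - g x) \<in> Lp_space p M"
  using Lp_space_lincomb[OF assms, of "-1"] by simp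

lemma Lp_norm_scale:
  assumes "0 < p"
  shows "Lp_norm p M (\<lambda>x. c * f x) = \<bar>c\<bar> * Lp_norm p M f"
  unfolding Lp_norm_def using assms
  by (simp add: abs_mult powr_mult powr_powr integral_nonneg_AE)

text \<open>Minkowski's inequality by convexity: with \<open>a\<close> and \<open>c\<close> slightly
  above the two norms, \<open>(f + g) / (a + c)\<close> is a convex combination of
  \<open>f / a\<close> and \<open>g / c\<close>. The added \<open>e / 2\<close> keeps both divisors
  positive even if a norm vanishes.\<close>

lemma Lp_norm_triangle:
  assumes p: "1 < p" and f: "f \<in> Lp_space p M" and g: "g \<in> Lp_space p M"
  shows "Lp_norm p M (\<lambda>x. f x + g x) \<le> Lp_norm p M f + Lp_norm p M g"
proof (rule field_le_epsilon)
  fix e :: real assume e: "0 < e"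
  define a where "a = Lp_norm p M f + e / 2"
  define c where "c = Lp_norm p M g + e / 2"
  have a: "0 < a" and c: "0 < c" unfolding a_def c_def using e Lp_norm_nonneg[of p M] by (auto intro: add_nonneg_pos)
  have p0: "0 < p" using p by simp
  have i: "integrable (completion M) (\<lambda>x. \<bar>f x\<bar> powr p)" "integrable (completion M) (\<lambda>x. \<bar>g x\<bar> powr p)"
    using f g unfolding Lp_space_def by auto
  have ifg: "integrable (completion M) (\<lambda>x. \<bar>f x + g x\<bar> powr p)"
    using Lp_space_lincomb[OF p f g, of 1] unfolding Lp_space_def by simp
  have fa: "(\<integral>x. \<bar>f x\<bar> powr p \<partial>completion M) \<le> a powr p"
    unfolding Lp_norm_powr[OF p0, symmetric] a_def using e p Lp_norm_nonneg by (intro powr_mono2) auto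
  have gc: "(\<integral>x. \<bar>g x\<bar> powr p \<partial>completion M) \<le> c powr p"
    unfolding Lp_norm_powr[OF p0, symmetric] c_def using e p Lp_norm_nonneg by (intro powr_mono2) auto
  define \<theta> where "\<theta> = a / (a + c)"
  have \<theta>: "0 \<le> \<theta>" "\<theta> \<le> 1" "1 - \<theta> = c / (a + c)" unfolding \<theta>_def using a c by (auto simp: field_simps)
  have pt: "\<bar>f x + g x\<bar> powr p \<le> (a + c) powr p * (\<theta> / a powr p * \<bar>f x\<bar> powr p + (1 - \<theta>) / c powr p * \<bar>g x\<bar> powr p)" for x
  proof -
    have "f x + g x = (a + c) * (\<theta> * (f x / a) + (1 - \<theta>) * (g x / c))"
    proof -
      have "a + c \<noteq> 0" using a c by simp
      then show ?thesis unfolding \<theta>(3) unfolding \<theta>_def using a c by (simp add: distrib_left)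
    qed
    then have "\<bar>f x + g x\<bar> powr p = (a + c) powr p * \<bar>\<theta> * (f x / a) + (1 - \<theta>) * (g x / c)\<bar> powr p"
      using a c by (simp add: abs_mult powr_mult)
    also have "\<dots> \<le> (a + c) powr p * (\<theta> * \<bar>f x / a\<bar> powr p + (1 - \<theta>) * \<bar>g x / c\<bar> powr p)"
      by (intro mult_left_mono powr_convex p \<theta>) auto
    also have "\<dots> = (a + c) powr p * (\<theta> / a powr p * \<bar>f x\<bar> powr p + (1 - \<theta>) / c powr p * \<bar>g x\<bar> powr p)"
      using a c by (simp add: powr_divide)
    finally show ?thesis .
  qed
  have "(\<integral>x. \<bar>f x + g x\<bar> powr p \<partial>completion M) \<le>
      (\<integral>x. (a + c) powr p * (\<theta> / a powr p * \<bar>f x\<bar> powr p + (1 - \<theta>) / c powr p * \<bar>g x\<bar> powr p) \<partial>completion M)"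
    using i by (intro integral_mono ifg pt integrable_mult_right integrable_add) auto
  also have "\<dots> = (a + c) powr p * (\<theta> / a powr p * (\<integral>x. \<bar>f x\<bar> powr p \<partial>completion M) + (1 - \<theta>) / c powr p * (\<integral>x. \<bar>g x\<bar> powr p \<partial>completion M))"
    using i by simp
  also have "\<dots> \<le> (a + c) powr p * (\<theta> / a powr p * a powr p + (1 - \<theta>) / c powr p * c powr p)"
    using \<theta> fa gc a c by (intro mult_left_mono add_mono) auto
  also have "\<dots> = (a + c) powr p" using a c by simp
  finally have "Lp_norm p M (\<lambda>x. f x + g x) \<le> a + c" using a c p0 by (intro Lp_norm_leI) auto
  then show "Lp_norm p M (\<lambda>x. f x + g x) \<le> Lp_norm p M f + Lp_norm p M g + e"
    unfolding a_def c_def by simp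
qed

lemma Lp_norm_triangle_diff:
  assumes p: "1 < p" and f: "f \<in> Lp_space p M" and g: "g \<in> Lp_space p M" and h: "h \<in> Lp_space p M"
  shows "Lp_norm p M (\<lambda>x. f x - h x) \<le> Lp_norm p M (\<lambda>x. f x - g x) + Lp_norm p M (\<lambda>x. g x - h x)"
  using Lp_norm_triangle[OF p Lp_space_diff[OF p f g] Lp_space_diff[OF p g h]] by simp

lemma Lp_norm_minus: "Lp_norm p M (\<lambda>x. f x - g x) = Lp_norm p M (\<lambda>x. g x - f x)"
  unfolding Lp_norm_def by (simp add: abs_minus_commute)

lemma Lp_norm_le_diff:
  assumes p: "1 < p" and f: "f \<in> Lp_space p M" and g: "g \<in> Lp_space p M"
  shows "Lp_norm p M f \<le> Lp_norm p M (\<lambda>x. f x - g x) + Lp_norm p M g"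
  using Lp_norm_triangle[OF p Lp_space_diff[OF p f g] g] by simp

section \<open>Contractivity and algebra of the extended evolution operator\<close>

context evolution
begin

lemma mu_measurable: "t \<in> I \<Longrightarrow> borel_measurable (\<mu> t) = borel_measurable borel"
  by (rule measurable_cong_sets[OF mu(2) refl])

lemma bcontfun_borel: "f \<in> bcontfun \<Longrightarrow> f \<in> borel_measurable borel" for f :: "real ^ 'n \<Rightarrow> real"
  unfolding bcontfun_iff by (simp add: borel_measurable_continuous_onI)

lemma bcontfun_Lp:
  fixes h :: "real ^ 'n \<Rightarrow> real"
  assumes "1 < p" "t \<in> I" "h \<in> bcontfun"
  shows "h \<in> Lp_space p (\<mu> t)"
proof -
  have m: "h \<in> borel_measurable (\<mu> t)" unfolding mu_measurable[OF assms(2)] by (rule bcontfun_borel[OF assms(3)])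
  have "integrable (\<mu> t) (\<lambda>x. \<bar>h x\<bar> powr p)"
    using assms by (intro bcontfun_integrable bcontfun_powr) auto
  then have "(\<integral>\<^sup>+ x. ennreal (\<bar>h x\<bar> powr p) \<partial>\<mu> t) < \<infinity>"
    by (simp add: nn_integral_eq_integral)
  with m show ?thesis by (rule Lp_spaceI)
qed

text \<open>Jensen's inequality for \<open>G t s\<close>, integrated against \<open>\<mu> t\<close>
  and combined with invariance.\<close>

lemma G_contraction:
  assumes p: "1 < p" and s: "s \<in> I" and t: "s \<le> t" and h: "h \<in> bcontfun"
  shows "Lp_norm p (\<mu> t) (G t s h) \<le> Lp_norm p (\<mu> s) h"
proof (rule Lp_norm_leI)
  have tI: "t \<in> I" using I_upward[OF s t] .
  have hp: "(\<lambda>x. \<bar>h x\<bar> powr p) \<in> bcontfun" using bcontfun_powr[OF h] p by simp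
  have Gb: "G t s h \<in> bcontfun" by (intro G_bcontfun s h t)
  have Gp: "(\<lambda>x. \<bar>G t s h x\<bar> powr p) \<in> bcontfun" using bcontfun_powr[OF Gb] p by simp
  have comp: "(\<integral>x. f x \<partial>completion (\<mu> r)) = (\<integral>x. f x \<partial>\<mu> r)" if "r \<in> I" "f \<in> bcontfun" for r and f :: "real ^ 'n \<Rightarrow> real"
    by (rule integral_completion) (unfold mu_measurable[OF that(1)], rule bcontfun_borel[OF that(2)])
  have "(\<integral>x. \<bar>G t s h x\<bar> powr p \<partial>\<mu> t) \<le> (\<integral>x. G t s (\<lambda>x. \<bar>h x\<bar> powr p) x \<partial>\<mu> t)"
    by (intro integral_mono bcontfun_integrable tI Gp G_bcontfun s t hp G_Jensen h p)
  also have "\<dots> = (\<integral>x. \<bar>h x\<bar> powr p \<partial>\<mu> s)" by (rule G_invariant[OF s hp t])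
  finally show "(\<integral>x. \<bar>G t s h x\<bar> powr p \<partial>completion (\<mu> t)) \<le> Lp_norm p (\<mu> s) h powr p"
    unfolding comp[OF tI Gp] using comp[OF s hp] p by (simp add: Lp_norm_powr)
qed (use p Lp_norm_nonneg in auto)

lemma Lp_extensionD:
  assumes "Lp_extension p G \<mu> t s f g"
  shows "f \<in> Lp_space p (\<mu> s)" "g \<in> Lp_space p (\<mu> t)"
    and "0 < e \<Longrightarrow> \<exists>h\<in>bcontfun. Lp_norm p (\<mu> s) (\<lambda>x. f x - h x) \<le> e \<and> Lp_norm p (\<mu> t) (\<lambda>x. g x - G t s h x) \<le> e"
  using assms unfolding Lp_extension_def by auto

lemma Lp_extension_contraction:
  assumes p: "1 < p" and s: "s \<in> I" and t: "s \<le> t" and ext: "Lp_extension p G \<mu> t s f g"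
  shows "Lp_norm p (\<mu> t) g \<le> Lp_norm p (\<mu> s) f"
proof (rule field_le_epsilon)
  fix e :: real assume e: "0 < e"
  note E = Lp_extensionD[OF ext]
  obtain h where h: "h \<in> bcontfun" "Lp_norm p (\<mu> s) (\<lambda>x. f x - h x) \<le> e / 2" "Lp_norm p (\<mu> t) (\<lambda>x. g x - G t s h x) \<le> e / 2"
    using E(3)[of "e / 2"] e by auto
  have tI: "t \<in> I" using I_upward[OF s t] .
  have hL: "h \<in> Lp_space p (\<mu> s)" by (intro bcontfun_Lp p s h)
  have GL: "G t s h \<in> Lp_space p (\<mu> t)" by (intro bcontfun_Lp p tI G_bcontfun s t h)
  have "Lp_norm p (\<mu> t) g \<le> Lp_norm p (\<mu> t) (\<lambda>x. g x - G t s h x) + Lp_norm p (\<mu> t) (G t s h)"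
    by (rule Lp_norm_le_diff[OF p E(2) GL])
  also have "\<dots> \<le> e / 2 + Lp_norm p (\<mu> s) h" by (intro add_mono h(3) G_contraction p s t h(1))
  also have "Lp_norm p (\<mu> s) h \<le> Lp_norm p (\<mu> s) (\<lambda>x. h x - f x) + Lp_norm p (\<mu> s) f"
    by (rule Lp_norm_le_diff[OF p hL E(1)])
  also have "Lp_norm p (\<mu> s) (\<lambda>x. h x - f x) \<le> e / 2" using h(2) by (subst Lp_norm_minus)
  finally show "Lp_norm p (\<mu> t) g \<le> Lp_norm p (\<mu> s) f + e" by simp
qed

lemma Lp_extension_lincomb:
  assumes p: "1 < p" and s: "s \<in> I" and t: "s \<le> t"
    and 1: "Lp_extension p G \<mu> t s f1 g1" and 2: "Lp_extension p G \<mu> t s f2 g2"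
  shows "Lp_extension p G \<mu> t s (\<lambda>x. f1 x + c * f2 x) (\<lambda>x. g1 x + c * g2 x)"
  unfolding Lp_extension_def
proof (intro conjI allI impI)
  note E1 = Lp_extensionD[OF 1] and E2 = Lp_extensionD[OF 2]
  have tI: "t \<in> I" using I_upward[OF s t] .
  show "(\<lambda>x. f1 x + c * f2 x) \<in> Lp_space p (\<mu> s)" by (intro Lp_space_lincomb p E1 E2)
  show "(\<lambda>x. g1 x + c * g2 x) \<in> Lp_space p (\<mu> t)" by (intro Lp_space_lincomb p E1 E2)
  have est: "Lp_norm p M (\<lambda>x. (k1 x + c * k2 x) - (l1 x + c * l2 x)) \<le> e"
    if k: "k1 \<in> Lp_space p M" "k2 \<in> Lp_space p M" "l1 \<in> Lp_space p M" "l2 \<in> Lp_space p M"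
      and n: "Lp_norm p M (\<lambda>x. k1 x - l1 x) \<le> d" "Lp_norm p M (\<lambda>x. k2 x - l2 x) \<le> d" and d: "(1 + \<bar>c\<bar>) * d \<le> e"
    for M :: "(real ^ 'n) measure" and k1 k2 l1 l2 d e
  proof -
    have L: "(\<lambda>x. k1 x - l1 x) \<in> Lp_space p M" "(\<lambda>x. k2 x - l2 x) \<in> Lp_space p M"
      by (intro Lp_space_diff p k)+
    have L2: "(\<lambda>x. c * (k2 x - l2 x)) \<in> Lp_space p M"
      using Lp_space_lincomb[OF p Lp_space_diff[OF p L(2) L(2)] L(2), of c] by simp
    have "Lp_norm p M (\<lambda>x. (k1 x + c * k2 x) - (l1 x + c * l2 x)) = Lp_norm p M (\<lambda>x. (k1 x - l1 x) + c * (k2 x - l2 x))"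
      by (simp add: algebra_simps)
    also have "\<dots> \<le> Lp_norm p M (\<lambda>x. k1 x - l1 x) + \<bar>c\<bar> * Lp_norm p M (\<lambda>x. k2 x - l2 x)"
      using Lp_norm_triangle[OF p L(1) L2] Lp_norm_scale[of p M c "\<lambda>x. k2 x - l2 x"] p by simp
    also have "\<dots> \<le> d + \<bar>c\<bar> * d" by (intro add_mono n mult_left_mono) auto
    finally show ?thesis using d by (simp add: distrib_right)
  qed
  fix e :: real assume e: "0 < e"
  define d where "d = e / (1 + \<bar>c\<bar>)"
  have d: "0 < d" "(1 + \<bar>c\<bar>) * d \<le> e" unfolding d_def using e by (auto simp: add_pos_nonneg)
  obtain h1 where h1: "h1 \<in> bcontfun" "Lp_norm p (\<mu> s) (\<lambda>x. f1 x - h1 x) \<le> d" "Lp_norm p (\<mu> t) (\<lambda>x. g1 x - G t s h1 x) \<le> d"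
    using E1(3)[OF d(1)] by auto
  obtain h2 where h2: "h2 \<in> bcontfun" "Lp_norm p (\<mu> s) (\<lambda>x. f2 x - h2 x) \<le> d" "Lp_norm p (\<mu> t) (\<lambda>x. g2 x - G t s h2 x) \<le> d"
    using E2(3)[OF d(1)] by auto
  show "\<exists>h\<in>bcontfun. Lp_norm p (\<mu> s) (\<lambda>x. f1 x + c * f2 x - h x) \<le> e \<and> Lp_norm p (\<mu> t) (\<lambda>x. g1 x + c * g2 x - G t s h x) \<le> e"
  proof (intro bexI conjI)
    show "(\<lambda>x. h1 x + c * h2 x) \<in> bcontfun" by (intro bcontfun_lincomb h1 h2)
    show "Lp_norm p (\<mu> s) (\<lambda>x. f1 x + c * f2 x - (h1 x + c * h2 x)) \<le> e"
      by (rule est[OF E1(1) E2(1) _ _ h1(2) h2(2) d(2)]; intro bcontfun_Lp p s h1 h2)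
    show "Lp_norm p (\<mu> t) (\<lambda>x. g1 x + c * g2 x - G t s (\<lambda>x. h1 x + c * h2 x) x) \<le> e"
      unfolding G_lincomb[OF s h1(1) h2(1) t]
      by (rule est[OF E1(2) E2(2) _ _ h1(3) h2(3) d(2)]; intro bcontfun_Lp p tI G_bcontfun s t h1 h2)
  qed
qed

lemma Lp_extension_cong:
  assumes p: "1 < p" and s: "s \<in> I" and t: "s \<le> t"
    and ext: "Lp_extension p G \<mu> t s f g" and f: "AE x in \<mu> s. f x = f' x" and g: "AE x in \<mu> t. g x = g' x"
  shows "Lp_extension p G \<mu> t s f' g'"
  unfolding Lp_extension_def
proof (intro conjI allI impI)
  note E = Lp_extensionD[OF ext]
  show "f' \<in> Lp_space p (\<mu> s)" by (rule Lp_space_cong(1)[OF E(1) f])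
  show "g' \<in> Lp_space p (\<mu> t)" by (rule Lp_space_cong(1)[OF E(2) g])
  fix e :: real assume "0 < e"
  then obtain h where h: "h \<in> bcontfun" "Lp_norm p (\<mu> s) (\<lambda>x. f x - h x) \<le> e" "Lp_norm p (\<mu> t) (\<lambda>x. g x - G t s h x) \<le> e"
    using E(3) by blast
  have hL: "(\<lambda>x. f x - h x) \<in> Lp_space p (\<mu> s)" "(\<lambda>x. g x - G t s h x) \<in> Lp_space p (\<mu> t)"
    by (intro Lp_space_diff p E bcontfun_Lp G_bcontfun h(1) s t I_upward[OF s t])+
  have "Lp_norm p (\<mu> s) (\<lambda>x. f' x - h x) = Lp_norm p (\<mu> s) (\<lambda>x. f x - h x)"
    by (rule Lp_space_cong(2)[OF hL(1)]) (use f in eventually_elim, simp)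
  moreover have "Lp_norm p (\<mu> t) (\<lambda>x. g' x - G t s h x) = Lp_norm p (\<mu> t) (\<lambda>x. g x - G t s h x)"
    by (rule Lp_space_cong(2)[OF hL(2)]) (use g in eventually_elim, simp)
  ultimately show "\<exists>h\<in>bcontfun. Lp_norm p (\<mu> s) (\<lambda>x. f' x - h x) \<le> e \<and> Lp_norm p (\<mu> t) (\<lambda>x. g' x - G t s h x) \<le> e"
    using h by (intro bexI[of _ h]) auto
qed

text \<open>The evolution law at the level of graph closures. The hypotheses provide two unrelated
  approximants \<open>h\<close> and \<open>k\<close> of \<open>f\<close>; as \<open>G t s\<close>
  contracts \<open>k - h\<close>, the function \<open>h\<close> serves for both, and
  \<open>G r s h\<close> is the approximant of \<open>g1\<close>.\<close>

lemma Lp_extension_flow: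
  assumes p: "1 < p" and s: "s \<in> I" and r: "s \<le> r" "r \<le> t"
    and 1: "Lp_extension p G \<mu> r s f g1" and 2: "Lp_extension p G \<mu> t s f g2"
  shows "Lp_extension p G \<mu> t r g1 g2"
  unfolding Lp_extension_def
proof (intro conjI allI impI)
  note E1 = Lp_extensionD[OF 1] and E2 = Lp_extensionD[OF 2]
  have tI: "t \<in> I" using I_upward[OF s] r by auto
  show "g1 \<in> Lp_space p (\<mu> r)" "g2 \<in> Lp_space p (\<mu> t)" by (fact E1, fact E2)
  fix e :: real assume e: "0 < e"
  obtain h where h: "h \<in> bcontfun" "Lp_norm p (\<mu> s) (\<lambda>x. f x - h x) \<le> e / 3" "Lp_norm p (\<mu> r) (\<lambda>x. g1 x - G r s h x) \<le> e / 3"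
    using E1(3)[of "e / 3"] e by auto
  obtain k where k: "k \<in> bcontfun" "Lp_norm p (\<mu> s) (\<lambda>x. f x - k x) \<le> e / 3" "Lp_norm p (\<mu> t) (\<lambda>x. g2 x - G t s k x) \<le> e / 3"
    using E2(3)[of "e / 3"] e by auto
  have hL: "h \<in> Lp_space p (\<mu> s)" "k \<in> Lp_space p (\<mu> s)" by (intro bcontfun_Lp p s h k)+
  have GL: "G t s h \<in> Lp_space p (\<mu> t)" "G t s k \<in> Lp_space p (\<mu> t)" using r by (intro bcontfun_Lp p tI G_bcontfun s h k; simp)+
  have kh: "Lp_norm p (\<mu> s) (\<lambda>x. k x - h x) \<le> e / 3 + e / 3"
    using Lp_norm_triangle_diff[OF p hL(2) E1(1) hL(1)] h(2) k(2) Lp_norm_minus[of p "\<mu> s" k f] by simp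
  have "Lp_norm p (\<mu> t) (\<lambda>x. g2 x - G t s h x) \<le> Lp_norm p (\<mu> t) (\<lambda>x. g2 x - G t s k x) + Lp_norm p (\<mu> t) (\<lambda>x. G t s k x - G t s h x)"
    by (rule Lp_norm_triangle_diff[OF p E2(2) GL(2) GL(1)])
  also have "(\<lambda>x. G t s k x - G t s h x) = G t s (\<lambda>x. k x - h x)" using G_diff[OF s k(1) h(1)] r by simp
  also have "Lp_norm p (\<mu> t) (\<lambda>x. g2 x - G t s k x) + Lp_norm p (\<mu> t) (G t s (\<lambda>x. k x - h x)) \<le> e / 3 + (e / 3 + e / 3)"
    using r by (intro add_mono k(3) order_trans[OF G_contraction kh] p s bcontfun_diff k(1) h(1)) auto
  finally have "Lp_norm p (\<mu> t) (\<lambda>x. g2 x - G t s h x) \<le> e" by simp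
  moreover have "G t r (G r s h) = G t s h" by (rule G_semigroup[OF s h(1) r])
  moreover have "Lp_norm p (\<mu> r) (\<lambda>x. g1 x - G r s h x) \<le> e" using h(3) e by simp
  ultimately show "\<exists>h\<in>bcontfun. Lp_norm p (\<mu> r) (\<lambda>x. g1 x - h x) \<le> e \<and> Lp_norm p (\<mu> t) (\<lambda>x. g2 x - G t r h x) \<le> e"
    by (intro bexI[of _ "G r s h"] conjI G_bcontfun s h r) simp_all
qed

end

section \<open>Approximation by step functions of time\<close>

text \<open>Jensen's inequality at the mean value of \<open>k\<close>. No integrability is assumed,
  so that the estimate can be integrated over a parameter without a case distinction there.\<close>

lemma (in finite_measure) powr_integral_le:
  fixes k :: "'a \<Rightarrow> real"
  assumes p: "1 < p" and k: "k \<in> borel_measurable M"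
  shows "ennreal (\<bar>\<integral>x. k x \<partial>M\<bar> powr p) \<le> ennreal (measure M (space M) powr (p - 1)) * (\<integral>\<^sup>+ x. ennreal (\<bar>k x\<bar> powr p) \<partial>M)"
proof (cases "integrable M k \<and> integrable M (\<lambda>x. \<bar>k x\<bar> powr p) \<and> measure M (space M) > 0")
  case True
  define T where "T = measure M (space M)"
  have T: "T > 0" using True unfolding T_def by simp
  define m where "m = (\<integral>x. k x \<partial>M) / T"
  obtain l where l: "\<And>y. \<bar>y\<bar> powr p \<ge> \<bar>m\<bar> powr p + l * (y - m)"
    using powr_tangent[OF p] by blast
  have "(\<integral>x. \<bar>m\<bar> powr p + l * (k x - m) \<partial>M) \<le> (\<integral>x. \<bar>k x\<bar> powr p \<partial>M)"
    using True by (intro integral_mono l) auto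
  moreover have "(\<integral>x. \<bar>m\<bar> powr p + l * (k x - m) \<partial>M) = T * \<bar>m\<bar> powr p"
    using True T unfolding m_def T_def by (simp add: field_simps)
  ultimately have "T powr (p - 1) * (T * \<bar>m\<bar> powr p) \<le> T powr (p - 1) * (\<integral>x. \<bar>k x\<bar> powr p \<partial>M)"
    by (intro mult_left_mono) auto
  moreover have "T powr (p - 1) * (T * \<bar>m\<bar> powr p) = \<bar>\<integral>x. k x \<partial>M\<bar> powr p"
  proof -
    have "T powr (p - 1) * T = T powr p" using T by (simp add: powr_diff)
    then have "T powr (p - 1) * (T * \<bar>m\<bar> powr p) = T powr p * \<bar>m\<bar> powr p" by (simp add: mult.assoc[symmetric])
    also have "\<dots> = (T * \<bar>m\<bar>) powr p" using T by (simp add: powr_mult)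
    also have "T * \<bar>m\<bar> = \<bar>\<integral>x. k x \<partial>M\<bar>" using T unfolding m_def by (simp add: abs_divide)
    finally show ?thesis .
  qed
  ultimately have "ennreal (\<bar>\<integral>x. k x \<partial>M\<bar> powr p) \<le> ennreal (T powr (p - 1) * (\<integral>x. \<bar>k x\<bar> powr p \<partial>M))"
    by (intro ennreal_leI) simp
  also have "\<dots> = ennreal (T powr (p - 1)) * ennreal (\<integral>x. \<bar>k x\<bar> powr p \<partial>M)"
    by (intro ennreal_mult) auto
  also have "ennreal (\<integral>x. \<bar>k x\<bar> powr p \<partial>M) = (\<integral>\<^sup>+ x. ennreal (\<bar>k x\<bar> powr p) \<partial>M)"
    using True by (intro nn_integral_eq_integral[symmetric]) auto
  finally show ?thesis unfolding T_def .
next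
  case False
  \<comment> \<open>The degenerate cases hold for different reasons: a divergent integral has the
    default value 0, a non-integrable power makes the right side infinite, and for a null measure
    the left side is 0.\<close>
  then consider "\<not> integrable M k" | "\<not> integrable M (\<lambda>x. \<bar>k x\<bar> powr p)" "measure M (space M) > 0" | "measure M (space M) = 0"
    using measure_nonneg[of M "space M"] by linarith
  then show ?thesis
  proof cases
    case 1
    then show ?thesis using p by (simp add: not_integrable_integral_eq)
  next
    case 2
    have kp: "(\<lambda>x. \<bar>k x\<bar> powr p) \<in> borel_measurable M" using k by measurable
    have "\<not> (\<integral>\<^sup>+ x. ennreal (\<bar>k x\<bar> powr p) \<partial>M) < \<infinity>"
    proof
      assume "(\<integral>\<^sup>+ x. ennreal (\<bar>k x\<bar> powr p) \<partial>M) < \<infinity>"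
      then have "integrable M (\<lambda>x. \<bar>k x\<bar> powr p)" by (intro integrableI_nonneg kp AE_I2) auto
      with 2(1) show False ..
    qed
    then have "(\<integral>\<^sup>+ x. ennreal (\<bar>k x\<bar> powr p) \<partial>M) = \<infinity>" by (simp add: not_less top_unique)
    then show ?thesis using 2(2) by (simp add: ennreal_mult_top)
  next
    case 3
    then have "AE x in M. k x = 0"
      by (intro AE_I[of _ _ "space M"]) (auto simp: emeasure_eq_measure)
    then have "(\<integral>x. k x \<partial>M) = 0" by (rule integral_eq_zero_AE)
    then show ?thesis using p by simp
  qed
qed

lemma (in finite_measure) integrable_of_powr:
  fixes k :: "'a \<Rightarrow> real"
  assumes p: "1 < p" and k: "k \<in> borel_measurable M" and fin: "(\<integral>\<^sup>+ x. ennreal (\<bar>k x\<bar> powr p) \<partial>M) < \<infinity>"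
  shows "integrable M k"
proof (rule Bochner_Integration.integrable_bound[OF _ k])
  have "(\<lambda>x. \<bar>k x\<bar> powr p) \<in> borel_measurable M" using k by measurable
  then have "integrable M (\<lambda>x. \<bar>k x\<bar> powr p)"
    using fin by (intro integrableI_nonneg) auto
  then show "integrable M (\<lambda>x. 1 + \<bar>k x\<bar> powr p)"
    by (rule Bochner_Integration.integrable_add[OF integrable_const])
  have "\<bar>y\<bar> \<le> 1 + \<bar>y\<bar> powr p" for y
  proof (cases "\<bar>y\<bar> \<le> 1")
    case False
    then have "\<bar>y\<bar> powr 1 \<le> \<bar>y\<bar> powr p" using p by (intro powr_mono) auto
    then show ?thesis using False by simp
  next
    case True
    then show ?thesis using powr_ge_zero[of "\<bar>y\<bar>" p] by linarith
  qed
  then show "AE x in M. norm (k x) \<le> norm (1 + \<bar>k x\<bar> powr p)"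
    by (auto intro!: AE_I2 intro: order_trans[OF _ abs_ge_self])
qed

lemma closed_indicator_limit:
  fixes B :: "'b::metric_space set"
  assumes B: "closed B"
  obtains h :: "nat \<Rightarrow> 'b \<Rightarrow> real" where "\<And>k. h k \<in> bcontfun" "\<And>k x. 0 \<le> h k x" "\<And>k x. h k x \<le> 1"
    "\<And>x. (\<lambda>k. h k x) \<longlonglongrightarrow> indicator B x"
\<comment> \<open>\<open>infdist\<close> to the empty set is 0 by convention, so the formula for the
  cutoff functions would give 1 instead of 0.\<close>
proof (cases "B = {}")
  case True
  show ?thesis by (rule that[of "\<lambda>k x. 0"]) (use True bcontfun_const[of 0] in auto)
next
  case False
  define h where "h k x = max 0 (1 - real k * infdist x B)" for k :: nat and x
  have h01: "0 \<le> h k x" "h k x \<le> 1" for k x unfolding h_def using infdist_nonneg[of x B] by auto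
  have hb: "h k \<in> bcontfun" for k
    unfolding bcontfun_iff using h01
    by (auto intro!: exI[of _ 1] continuous_intros simp: h_def[abs_def] abs_le_iff intro: order_trans[of _ 0])
  have hlim: "(\<lambda>k. h k x) \<longlonglongrightarrow> indicator B x" for x
  proof (cases "x \<in> B")
    case True
    then show ?thesis unfolding h_def by simp
  next
    case out: False
    then have pos: "0 < infdist x B" using in_closed_iff_infdist_zero[OF B False, of x] infdist_nonneg[of x B] by auto
    obtain k0 :: nat where k0: "1 / infdist x B \<le> real k0" using real_arch_simple by blast
    have "h k x = 0" if "k \<ge> k0" for k
    proof -
      have "1 / infdist x B \<le> real k" using k0 that by (meson of_nat_mono order_trans)
      then have "1 \<le> real k * infdist x B" using pos by (simp add: field_simps)
      then show ?thesis unfolding h_def by simp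
    qed
    then have "eventually (\<lambda>k. h k x = indicator B x) sequentially"
      using out by (auto simp: eventually_sequentially)
    then show ?thesis by (rule tendsto_eventually)
  qed
  show ?thesis by (rule that[of h]) (use hb h01 hlim in auto)
qed

lemma sets_pair_borel:
  fixes M1 :: "'a::second_countable_topology measure" and M2 :: "'b::second_countable_topology measure"
  assumes "sets M1 = sets borel" "sets M2 = sets borel"
  shows "sets (M1 \<Otimes>\<^sub>M M2) = sets borel"
proof -
  have "sets (M1 \<Otimes>\<^sub>M M2) = sets (borel \<Otimes>\<^sub>M borel)" by (intro sets_pair_measure_cong assms)
  also have "\<dots> = sets borel" unfolding borel_prod ..
  finally show ?thesis .
qed

text \<open>\<open>L\<close> stands for Lebesgue measure on a bounded time interval and
  \<open>N\<close> for one of the measures \<open>\<mu> t\<close>. The locale is interpreted at both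
  ends of a propagator with the same \<open>L\<close>.\<close>

locale finite_pair = L: finite_measure L + N: finite_measure N
  for L :: "'a measure" and N :: "'b::metric_space measure" +
  fixes p :: real
  assumes sets_N: "sets N = sets borel" and space_L: "space L = UNIV" and p: "1 < p"
begin

lemma space_N: "space N = UNIV"
  using sets_eq_imp_space_eq[OF sets_N] by simp

sublocale pair_sigma_finite L N ..

sublocale P: finite_measure "L \<Otimes>\<^sub>M N"
  by (rule finite_measure_pair_measure) unfold_locales

definition step_fun :: "nat \<Rightarrow> (nat \<Rightarrow> 'a set) \<Rightarrow> (nat \<Rightarrow> 'b \<Rightarrow> real) \<Rightarrow> 'a \<times> 'b \<Rightarrow> real" where
  "step_fun n A h z = (\<Sum>i<n. indicator (A i) (fst z) * h i (snd z))"

text \<open>A closure of step functions of time. Their values are bounded continuous functions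
  because there \<open>G\<close> is given as an actual map, linear and pointwise defined.\<close>

definition step_approx :: "('a \<times> 'b \<Rightarrow> real) \<Rightarrow> bool" where
  "step_approx F \<longleftrightarrow> F \<in> borel_measurable (L \<Otimes>\<^sub>M N) \<and>
    (\<forall>e>0. \<exists>n A h. (\<forall>i<n. A i \<in> sets L \<and> h i \<in> bcontfun) \<and>
      (\<integral>\<^sup>+ z. ennreal (\<bar>F z - step_fun n A h z\<bar> powr p) \<partial>(L \<Otimes>\<^sub>M N)) \<le> ennreal e)"

lemma step_fun_measurable:
  assumes "\<forall>i<n. A i \<in> sets L \<and> h i \<in> bcontfun"
  shows "step_fun n A h \<in> borel_measurable (L \<Otimes>\<^sub>M N)"
proof -
  have 1: "(\<lambda>z. indicator (A i) (fst z) * h i (snd z) :: real) \<in> borel_measurable (L \<Otimes>\<^sub>M N)" if "i < n" for i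
  proof -
    have [measurable]: "A i \<in> sets L" using assms that by simp
    have "h i \<in> borel_measurable borel"
      using assms that unfolding bcontfun_iff by (simp add: borel_measurable_continuous_onI)
    then have [measurable]: "h i \<in> borel_measurable N" unfolding measurable_cong_sets[OF sets_N refl] .
    show ?thesis by measurable
  qed
  show ?thesis unfolding step_fun_def by (intro borel_measurable_sum 1) auto
qed

lemma step_approx_exact:
  assumes "\<forall>i<n. A i \<in> sets L \<and> h i \<in> bcontfun"
  shows "step_approx (step_fun n A h)"
  unfolding step_approx_def using step_fun_measurable[OF assms] assms p
  by (intro conjI allI impI exI[of _ n] exI[of _ A] exI[of _ h]) auto

lemma step_approx_lincomb:
  assumes F: "step_approx F" and H: "step_approx H"
  shows "step_approx (\<lambda>z. F z + c * H z)"
  unfolding step_approx_def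
proof (intro conjI allI impI)
  have [measurable]: "F \<in> borel_measurable (L \<Otimes>\<^sub>M N)" "H \<in> borel_measurable (L \<Otimes>\<^sub>M N)"
    using F H unfolding step_approx_def by auto
  show "(\<lambda>z. F z + c * H z) \<in> borel_measurable (L \<Otimes>\<^sub>M N)" by measurable
  fix e :: real assume e: "0 < e"
  \<comment> \<open>Chosen so that the two errors, weighted by the constants of
    \<open>powr_add_bound\<close>, add up to \<open>e\<close>.\<close>
  define d where "d = e / (2 powr p * (1 + \<bar>c\<bar> powr p))"
  have den: "2 powr p * (1 + \<bar>c\<bar> powr p) > 0" by (simp add: add_pos_nonneg)
  have d: "0 < d" "2 powr p * (d + \<bar>c\<bar> powr p * d) = e"
  proof -
    show "0 < d" unfolding d_def using e den by simp
    have "2 powr p * (d + \<bar>c\<bar> powr p * d) = (2 powr p * (1 + \<bar>c\<bar> powr p)) * d" by (simp add: algebra_simps)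
    also have "\<dots> = e"
    proof -
      have "X * (e / X) = e" if "0 < X" for X :: real using that by simp
      from this[OF den] show ?thesis unfolding d_def .
    qed
    finally show "2 powr p * (d + \<bar>c\<bar> powr p * d) = e" .
  qed
  obtain n A h where 1: "\<forall>i<n. A i \<in> sets L \<and> h i \<in> bcontfun"
    "(\<integral>\<^sup>+ z. ennreal (\<bar>F z - step_fun n A h z\<bar> powr p) \<partial>(L \<Otimes>\<^sub>M N)) \<le> ennreal d"
    using F d(1) unfolding step_approx_def by blast
  obtain m B k where 2: "\<forall>i<m. B i \<in> sets L \<and> k i \<in> bcontfun"
    "(\<integral>\<^sup>+ z. ennreal (\<bar>H z - step_fun m B k z\<bar> powr p) \<partial>(L \<Otimes>\<^sub>M N)) \<le> ennreal d"
    using H d(1) unfolding step_approx_def by blast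
  \<comment> \<open>Concatenation of the two families of sets and functions; the factor
    \<open>c\<close> goes into the functions.\<close>
  define A' where "A' i = (if i < n then A i else B (i - n))" for i
  define h' where "h' i = (if i < n then h i else (\<lambda>x. c * k (i - n) x))" for i
  have A': "\<forall>i<n + m. A' i \<in> sets L \<and> h' i \<in> bcontfun"
  proof (intro allI impI)
    fix i assume "i < n + m"
    then show "A' i \<in> sets L \<and> h' i \<in> bcontfun"
      using 1(1) 2(1) bcontfun_lincomb[OF bcontfun_const[of 0], of "k (i - n)" c]
      unfolding A'_def h'_def by auto
  qed
  have sf: "step_fun (n + m) A' h' z = step_fun n A h z + c * step_fun m B k z" for z
  proof -
    have "step_fun (n + m) A' h' z = step_fun n A h z + (\<Sum>i=n..<n+m. indicator (A' i) (fst z) * h' i (snd z))"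
      unfolding step_fun_def
      by (subst sum.atLeastLessThan_concat[of 0 n "n + m", symmetric, unfolded atLeast0LessThan]) (auto simp: A'_def h'_def)
    also have "(\<Sum>i=n..<n+m. indicator (A' i) (fst z) * h' i (snd z)) = (\<Sum>i<m. indicator (B i) (fst z) * (c * k i (snd z)))"
      using sum.shift_bounds_nat_ivl[of "\<lambda>i. indicator (A' i) (fst z) * h' i (snd z)" 0 n m]
      by (simp add: atLeast0LessThan add.commute A'_def h'_def)
    also have "(\<Sum>i<m. indicator (B i) (fst z) * (c * k i (snd z))) = c * step_fun m B k z"
      unfolding step_fun_def sum_distrib_left by (intro sum.cong refl) simp
    finally show ?thesis .
  qed
  note [measurable] = step_fun_measurable[OF 1(1)] step_fun_measurable[OF 2(1)]
  have "(\<integral>\<^sup>+ z. ennreal (\<bar>F z + c * H z - step_fun (n + m) A' h' z\<bar> powr p) \<partial>(L \<Otimes>\<^sub>M N))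
      \<le> (\<integral>\<^sup>+ z. ennreal (2 powr p) * (ennreal (\<bar>F z - step_fun n A h z\<bar> powr p) + ennreal (\<bar>c\<bar> powr p) * ennreal (\<bar>H z - step_fun m B k z\<bar> powr p)) \<partial>(L \<Otimes>\<^sub>M N))"
  proof (rule nn_integral_mono)
    fix z
    have "\<bar>F z + c * H z - step_fun (n + m) A' h' z\<bar> powr p = \<bar>(F z - step_fun n A h z) + c * (H z - step_fun m B k z)\<bar> powr p"
      unfolding sf by (simp add: algebra_simps)
    also have "\<dots> \<le> 2 powr p * (\<bar>F z - step_fun n A h z\<bar> powr p + \<bar>c * (H z - step_fun m B k z)\<bar> powr p)"
      by (rule powr_add_bound[OF p])
    also have "\<dots> = 2 powr p * (\<bar>F z - step_fun n A h z\<bar> powr p + \<bar>c\<bar> powr p * \<bar>H z - step_fun m B k z\<bar> powr p)"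
      by (simp add: abs_mult powr_mult)
    finally show "ennreal (\<bar>F z + c * H z - step_fun (n + m) A' h' z\<bar> powr p) \<le> ennreal (2 powr p) * (ennreal (\<bar>F z - step_fun n A h z\<bar> powr p) + ennreal (\<bar>c\<bar> powr p) * ennreal (\<bar>H z - step_fun m B k z\<bar> powr p))"
      by (simp add: ennreal_mult[symmetric] ennreal_plus[symmetric] ennreal_leI del: ennreal_plus)
  qed
  also have "\<dots> = ennreal (2 powr p) * ((\<integral>\<^sup>+ z. ennreal (\<bar>F z - step_fun n A h z\<bar> powr p) \<partial>(L \<Otimes>\<^sub>M N))
      + ennreal (\<bar>c\<bar> powr p) * (\<integral>\<^sup>+ z. ennreal (\<bar>H z - step_fun m B k z\<bar> powr p) \<partial>(L \<Otimes>\<^sub>M N)))"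
    by (simp add: nn_integral_cmult nn_integral_add)
  also have "\<dots> \<le> ennreal (2 powr p) * (ennreal d + ennreal (\<bar>c\<bar> powr p) * ennreal d)"
    by (intro mult_left_mono add_mono 1(2) 2(2)) auto
  also have "\<dots> = ennreal e"
    using d by (simp add: ennreal_mult[symmetric] ennreal_plus[symmetric] del: ennreal_plus)
  finally show "\<exists>n A h. (\<forall>i<n. A i \<in> sets L \<and> h i \<in> bcontfun) \<and>
      (\<integral>\<^sup>+ z. ennreal (\<bar>F z + c * H z - step_fun n A h z\<bar> powr p) \<partial>(L \<Otimes>\<^sub>M N)) \<le> ennreal e"
    using A' by blast
qed

lemma step_approx_const: "step_approx (\<lambda>z. c)"
proof -
  have "step_approx (step_fun 1 (\<lambda>i. UNIV) (\<lambda>i x. c))"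
    using sets.top[of L] by (intro step_approx_exact) (auto simp: bcontfun_const space_L)
  moreover have "step_fun 1 (\<lambda>i. UNIV) (\<lambda>i x. c) = (\<lambda>z. c)" by (auto simp: step_fun_def)
  ultimately show ?thesis by simp
qed

lemma step_approx_sum:
  "(\<And>i. i \<in> S \<Longrightarrow> step_approx (F i)) \<Longrightarrow> step_approx (\<lambda>z. \<Sum>i\<in>S. c i * F i z)"
proof (induction S rule: infinite_finite_induct)
  case (insert i S)
  then have "step_approx (\<lambda>z. (\<Sum>i\<in>S. c i * F i z) + c i * F i z)"
    by (intro step_approx_lincomb) auto
  then show ?case using insert.hyps by (simp add: add.commute)
qed (auto intro: step_approx_const)

text \<open>Dominated convergence. The dominating function is left free since indicators need the
  constant 1 and general functions a multiple of their own power.\<close>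

lemma step_approx_limit:
  assumes F: "\<And>k::nat. step_approx (F k)" and lim: "\<And>z. (\<lambda>k. F k z) \<longlonglongrightarrow> H z"
    and W: "W \<in> borel_measurable (L \<Otimes>\<^sub>M N)" "(\<integral>\<^sup>+ z. W z \<partial>(L \<Otimes>\<^sub>M N)) < \<infinity>"
    and bound: "\<And>k z. ennreal (\<bar>F k z - H z\<bar> powr p) \<le> W z"
  shows "step_approx H"
proof -
  have Fm: "F k \<in> borel_measurable (L \<Otimes>\<^sub>M N)" for k using F unfolding step_approx_def by auto
  have Hm: "H \<in> borel_measurable (L \<Otimes>\<^sub>M N)" by (rule borel_measurable_LIMSEQ_metric[OF Fm lim])
  note [measurable] = Fm Hm
  have "(\<lambda>k. \<integral>\<^sup>+ z. ennreal (\<bar>F k z - H z\<bar> powr p) \<partial>(L \<Otimes>\<^sub>M N)) \<longlonglongrightarrow> (\<integral>\<^sup>+ z. 0 \<partial>(L \<Otimes>\<^sub>M N))"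
  proof (rule nn_integral_dominated_convergence[where w=W])
    show "AE z in L \<Otimes>\<^sub>M N. (\<lambda>k. ennreal (\<bar>F k z - H z\<bar> powr p)) \<longlonglongrightarrow> 0"
    proof (rule AE_I2)
      fix z
      have "(\<lambda>k. \<bar>F k z - H z\<bar>) \<longlonglongrightarrow> 0" using lim[of z] by (simp add: LIM_zero_iff tendsto_rabs_zero_iff)
      then have "(\<lambda>k. \<bar>F k z - H z\<bar> powr p) \<longlonglongrightarrow> 0 powr p"
        using p by (intro tendsto_powr'[OF _ tendsto_const]) auto
      then show "(\<lambda>k. ennreal (\<bar>F k z - H z\<bar> powr p)) \<longlonglongrightarrow> 0" using p by (simp add: tendsto_ennreal_iff[where x=0, simplified] flip: ennreal_0)
    qed
  qed (use W bound in auto)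
  then have lim0: "(\<lambda>k. \<integral>\<^sup>+ z. ennreal (\<bar>F k z - H z\<bar> powr p) \<partial>(L \<Otimes>\<^sub>M N)) \<longlonglongrightarrow> 0" by simp
  show ?thesis unfolding step_approx_def
  proof (intro conjI allI impI Hm)
    fix e :: real assume e: "0 < e"
    define d where "d = e / (2 * 2 powr p)"
    have d: "0 < d" "2 powr p * (d + d) = e" unfolding d_def using e by auto
    obtain k where k: "(\<integral>\<^sup>+ z. ennreal (\<bar>F k z - H z\<bar> powr p) \<partial>(L \<Otimes>\<^sub>M N)) < ennreal d"
      using order_tendstoD(2)[OF lim0, of "ennreal d"] d(1) by (auto simp: eventually_sequentially)
    obtain n A h where 1: "\<forall>i<n. A i \<in> sets L \<and> h i \<in> bcontfun"
      "(\<integral>\<^sup>+ z. ennreal (\<bar>F k z - step_fun n A h z\<bar> powr p) \<partial>(L \<Otimes>\<^sub>M N)) \<le> ennreal d"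
      using F[of k] d(1) unfolding step_approx_def by blast
    note [measurable] = step_fun_measurable[OF 1(1)]
    have "(\<integral>\<^sup>+ z. ennreal (\<bar>H z - step_fun n A h z\<bar> powr p) \<partial>(L \<Otimes>\<^sub>M N))
        \<le> (\<integral>\<^sup>+ z. ennreal (2 powr p) * (ennreal (\<bar>F k z - H z\<bar> powr p) + ennreal (\<bar>F k z - step_fun n A h z\<bar> powr p)) \<partial>(L \<Otimes>\<^sub>M N))"
    proof (rule nn_integral_mono)
      fix z
      have "\<bar>H z - step_fun n A h z\<bar> powr p = \<bar>(H z - F k z) + (F k z - step_fun n A h z)\<bar> powr p" by simp
      also have "\<dots> \<le> 2 powr p * (\<bar>F k z - H z\<bar> powr p + \<bar>F k z - step_fun n A h z\<bar> powr p)"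
        using powr_add_bound[OF p, of "H z - F k z" "F k z - step_fun n A h z"] by (simp add: abs_minus_commute)
      finally show "ennreal (\<bar>H z - step_fun n A h z\<bar> powr p) \<le> ennreal (2 powr p) * (ennreal (\<bar>F k z - H z\<bar> powr p) + ennreal (\<bar>F k z - step_fun n A h z\<bar> powr p))"
        by (simp add: ennreal_mult[symmetric] ennreal_plus[symmetric] ennreal_leI del: ennreal_plus)
    qed
    also have "\<dots> = ennreal (2 powr p) * ((\<integral>\<^sup>+ z. ennreal (\<bar>F k z - H z\<bar> powr p) \<partial>(L \<Otimes>\<^sub>M N))
        + (\<integral>\<^sup>+ z. ennreal (\<bar>F k z - step_fun n A h z\<bar> powr p) \<partial>(L \<Otimes>\<^sub>M N)))"
      by (simp add: nn_integral_cmult nn_integral_add)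
    also have "\<dots> \<le> ennreal (2 powr p) * (ennreal d + ennreal d)"
      using k by (intro mult_left_mono add_mono 1(2)) auto
    also have "\<dots> = ennreal e"
      using d by (simp add: ennreal_mult[symmetric] ennreal_plus[symmetric] del: ennreal_plus)
    finally show "\<exists>n A h. (\<forall>i<n. A i \<in> sets L \<and> h i \<in> bcontfun) \<and>
        (\<integral>\<^sup>+ z. ennreal (\<bar>H z - step_fun n A h z\<bar> powr p) \<partial>(L \<Otimes>\<^sub>M N)) \<le> ennreal e"
      using 1(1) by blast
  qed
qed

lemma step_approx_bounded_limit:
  assumes F: "\<And>k::nat. step_approx (F k)" and lim: "\<And>z. (\<lambda>k. F k z) \<longlonglongrightarrow> H z"
    and bound: "\<And>k z. \<bar>F k z - H z\<bar> \<le> 1"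
  shows "step_approx H"
proof (rule step_approx_limit[OF F lim, where W="\<lambda>z. 1"])
  show "(\<integral>\<^sup>+ z. 1 \<partial>(L \<Otimes>\<^sub>M N)) < \<infinity>" by (simp add: less_top[symmetric])
  show "ennreal (\<bar>F k z - H z\<bar> powr p) \<le> 1" for k z
  proof -
    have "\<bar>F k z - H z\<bar> powr p \<le> 1 powr p" using bound p by (intro powr_mono2) auto
    then show ?thesis by simp
  qed
qed simp

lemma step_approx_closed:
  assumes A: "A \<in> sets L" and B: "closed B"
  shows "step_approx (indicator (A \<times> B))"
proof -
  obtain h :: "nat \<Rightarrow> 'b \<Rightarrow> real" where hb: "\<And>k. h k \<in> bcontfun" and h01: "\<And>k x. 0 \<le> h k x" "\<And>k x. h k x \<le> 1"
    and hlim: "\<And>x. (\<lambda>k. h k x) \<longlonglongrightarrow> indicator B x"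
    using closed_indicator_limit[OF B] by blast
  show ?thesis
  proof (rule step_approx_bounded_limit[of "\<lambda>k. step_fun 1 (\<lambda>i. A) (\<lambda>i. h k)"])
    show "step_approx (step_fun 1 (\<lambda>i. A) (\<lambda>i. h k))" for k by (rule step_approx_exact) (use A hb in auto)
    show "(\<lambda>k. step_fun 1 (\<lambda>i. A) (\<lambda>i. h k) z) \<longlonglongrightarrow> indicator (A \<times> B) z" for z
      using tendsto_mult_left[OF hlim[of "snd z"], of "indicator A (fst z)"]
      by (cases z) (simp add: step_fun_def indicator_times)
    show "\<bar>step_fun 1 (\<lambda>i. A) (\<lambda>i. h k) z - indicator (A \<times> B) z\<bar> \<le> 1" for k z
      using h01[of k "snd z"] by (cases z) (auto simp: step_fun_def indicator_def abs_le_iff)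
  qed
qed

lemma step_approx_compl:
  assumes "step_approx (indicator S)"
  shows "step_approx (indicator (- S))"
proof -
  have "indicator (- S) = (\<lambda>z. 1 + (-1) * (indicator S z :: real))" by (auto simp: indicator_def)
  then show ?thesis using step_approx_lincomb[OF step_approx_const[of 1] assms, of "-1"] by simp
qed

lemma step_approx_Union:
  assumes S: "\<And>i::nat. step_approx (indicator (S i))" and disj: "disjoint_family S"
  shows "step_approx (indicator (\<Union>i. S i))"
proof (rule step_approx_bounded_limit[of "\<lambda>k z. \<Sum>i<k. 1 * indicator (S i) z"])
  show "step_approx (\<lambda>z. \<Sum>i<k. 1 * indicator (S i) z)" for k by (intro step_approx_sum S)
  show "(\<lambda>k. \<Sum>i<k. 1 * indicator (S i) z :: real) \<longlonglongrightarrow> indicator (\<Union>i. S i) z" for z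
    using indicator_sums[of S z] disj unfolding sums_def disjoint_family_on_def by auto
  show "\<bar>(\<Sum>i<k. 1 * indicator (S i) z) - indicator (\<Union>i. S i) z\<bar> \<le> (1 :: real)" for k z
  proof -
    have "(\<Sum>i<k. 1 * indicator (S i) z) = (indicator (\<Union>i<k. S i) z :: real)"
      by (subst indicator_UN_disjoint) (use disj in \<open>auto simp: disjoint_family_on_def\<close>)
    then show ?thesis by (auto simp: indicator_def)
  qed
qed

text \<open>The first of two applications of Dynkin's lemma: here from closed to Borel sets in the
  second factor, afterwards from rectangles to all measurable sets of the product.\<close>

lemma step_approx_rectangle:
  assumes A: "A \<in> sets L" and B: "B \<in> sets borel"
  shows "step_approx (indicator (A \<times> B))"
proof -
  have gen: "B \<in> sigma_sets UNIV (Collect closed)"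
    using B unfolding borel_eq_closed by simp
  show ?thesis
  proof (rule sigma_sets_induct_disjoint[OF _ _ gen, of "\<lambda>B. step_approx (indicator (A \<times> B))"])
    show "Int_stable (Collect closed :: 'b set set)" by (auto simp: Int_stable_def)
    show "step_approx (indicator (A \<times> S))" if "S \<in> Collect closed" for S
      using step_approx_closed[OF A, of S] that by simp
    show "step_approx (indicator (A \<times> {}))" using step_approx_closed[OF A, of "{}"] by simp
    show "step_approx (indicator (A \<times> (UNIV - S)))" if "step_approx (indicator (A \<times> S))" for S
    proof -
      have "indicator (A \<times> (UNIV - S)) = (\<lambda>z. indicator (A \<times> UNIV) z + (-1) * (indicator (A \<times> S) z :: real))"
        by (auto simp: indicator_def)
      then show ?thesis using step_approx_lincomb[OF step_approx_closed[OF A closed_UNIV] that, of "-1"] by simp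
    qed
    show "step_approx (indicator (A \<times> (\<Union>i. S i)))" if "disjoint_family S" "\<And>i. step_approx (indicator (A \<times> S i))" for S :: "nat \<Rightarrow> 'b set"
    proof -
      have "disjoint_family (\<lambda>i. A \<times> S i)" using that(1) by (auto simp: disjoint_family_on_def)
      from step_approx_Union[OF that(2) this] have "step_approx (indicator (\<Union>i. A \<times> S i))" .
      moreover have "(\<Union>i. A \<times> S i) = A \<times> (\<Union>i. S i)" by auto
      ultimately show ?thesis by simp
    qed
  qed auto
qed

lemma step_approx_set:
  assumes S: "S \<in> sets (L \<Otimes>\<^sub>M N)"
  shows "step_approx (indicator S)"
proof -
  have gen: "S \<in> sigma_sets (space L \<times> space N) {a \<times> b | a b. a \<in> sets L \<and> b \<in> sets N}"
    using S unfolding sets_pair_measure .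
  show ?thesis
  proof (rule sigma_sets_induct_disjoint[OF Int_stable_pair_measure_generator _ gen, of "\<lambda>S. step_approx (indicator S)"])
    show "{a \<times> b | a b. a \<in> sets L \<and> b \<in> sets N} \<subseteq> Pow (space L \<times> space N)"
      using pair_measure_closed by blast
    show "step_approx (indicator R)" if "R \<in> {a \<times> b | a b. a \<in> sets L \<and> b \<in> sets N}" for R
      using that step_approx_rectangle unfolding sets_N by auto
    show "step_approx (indicator {})" using step_approx_const[of 0] by (simp add: indicator_def[abs_def])
    show "step_approx (indicator (space L \<times> space N - R))" if "step_approx (indicator R)" for R
      using step_approx_compl[OF that] by (simp add: space_L space_N Compl_eq_Diff_UNIV)
    show "step_approx (indicator (\<Union>i. R i))" if "disjoint_family R" "\<And>i. step_approx (indicator (R i))" for R :: "nat \<Rightarrow> ('a \<times> 'b) set"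
      by (rule step_approx_Union[OF that(2,1)])
  qed
qed

lemma step_approx_powr_integrable:
  assumes F: "F \<in> borel_measurable (L \<Otimes>\<^sub>M N)" and fin: "(\<integral>\<^sup>+ z. ennreal (\<bar>F z\<bar> powr p) \<partial>(L \<Otimes>\<^sub>M N)) < \<infinity>"
  shows "step_approx F"
proof -
  have sp: "space (L \<Otimes>\<^sub>M N) = UNIV" by (simp add: space_pair_measure space_L space_N)
  obtain s where s: "\<And>i. simple_function (L \<Otimes>\<^sub>M N) (s i)" "\<And>z. (\<lambda>i. s i z) \<longlonglongrightarrow> F z"
    "\<And>i z. \<bar>s i z\<bar> \<le> 2 * \<bar>F z\<bar>"
    using borel_measurable_implies_sequence_metric[OF F, of 0] unfolding sp by (auto simp: dist_norm)
  have sa: "step_approx (s i)" for i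
  proof -
    have fin: "finite (range (s i))" using simple_functionD(1)[OF s(1), of i] unfolding sp .
    have eq: "s i = (\<lambda>z. \<Sum>y\<in>range (s i). y * indicator (s i -` {y}) z)"
    proof
      fix z
      have "(\<Sum>y\<in>range (s i). y * indicator (s i -` {y}) z) = (\<Sum>y\<in>range (s i). if y = s i z then y else 0)"
        by (intro sum.cong) (auto simp: indicator_def)
      then show "s i z = (\<Sum>y\<in>range (s i). y * indicator (s i -` {y}) z)" using fin by simp
    qed
    have "step_approx (\<lambda>z. \<Sum>y\<in>range (s i). y * indicator (s i -` {y}) z)"
      using simple_functionD(2)[OF s(1), of i] unfolding sp by (intro step_approx_sum step_approx_set) simp
    then show ?thesis by (rule arg_cong[OF eq, of step_approx, THEN iffD2])
  qed
  \<comment> \<open>The simple functions are bounded by \<open>2 * \<bar>F z\<bar>\<close>, hence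
    differ from \<open>F\<close> by at most three times its absolute value.\<close>
  have Wm: "(\<lambda>z. ennreal (3 powr p) * ennreal (\<bar>F z\<bar> powr p)) \<in> borel_measurable (L \<Otimes>\<^sub>M N)" using F by measurable
  show ?thesis
  proof (rule step_approx_limit[OF sa s(2) Wm])
    have "(\<lambda>z. ennreal (\<bar>F z\<bar> powr p)) \<in> borel_measurable (L \<Otimes>\<^sub>M N)" using F by measurable
    then show "(\<integral>\<^sup>+ z. ennreal (3 powr p) * ennreal (\<bar>F z\<bar> powr p) \<partial>(L \<Otimes>\<^sub>M N)) < \<infinity>"
      using fin by (simp add: nn_integral_cmult ennreal_mult_less_top)
    show "ennreal (\<bar>s k z - F z\<bar> powr p) \<le> ennreal (3 powr p) * ennreal (\<bar>F z\<bar> powr p)" for k z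
    proof -
      have "\<bar>s k z - F z\<bar> powr p \<le> (3 * \<bar>F z\<bar>) powr p" using s(3)[of k z] p by (intro powr_mono2) auto
      also have "\<dots> = 3 powr p * \<bar>F z\<bar> powr p" by (simp add: powr_mult)
      finally show ?thesis by (simp add: ennreal_mult[symmetric] ennreal_leI)
    qed
  qed
qed

text \<open>A weak form of Minkowski's integral inequality: Jensen for each fixed \<open>x\<close>,
  then Fubini.\<close>

lemma powr_integral_fst_le:
  fixes k :: "'a \<Rightarrow> 'b \<Rightarrow> real"
  assumes k: "(\<lambda>(\<rho>, x). k \<rho> x) \<in> borel_measurable (L \<Otimes>\<^sub>M N)"
  shows "(\<integral>\<^sup>+ x. ennreal (\<bar>\<integral>\<rho>. k \<rho> x \<partial>L\<bar> powr p) \<partial>N)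
    \<le> ennreal (measure L UNIV powr (p - 1)) * (\<integral>\<^sup>+ \<rho>. \<integral>\<^sup>+ x. ennreal (\<bar>k \<rho> x\<bar> powr p) \<partial>N \<partial>L)"
proof -
  have kx: "(\<lambda>\<rho>. k \<rho> x) \<in> borel_measurable L" for x
    using measurable_compose[OF measurable_Pair2'[of x N L] k] space_N by simp
  have kp: "(\<lambda>(\<rho>, x). ennreal (\<bar>k \<rho> x\<bar> powr p)) \<in> borel_measurable (L \<Otimes>\<^sub>M N)"
    using k by (simp add: split_def)
  have "(\<integral>\<^sup>+ x. ennreal (\<bar>\<integral>\<rho>. k \<rho> x \<partial>L\<bar> powr p) \<partial>N)
      \<le> (\<integral>\<^sup>+ x. ennreal (measure L UNIV powr (p - 1)) * (\<integral>\<^sup>+ \<rho>. ennreal (\<bar>k \<rho> x\<bar> powr p) \<partial>L) \<partial>N)"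
    using L.powr_integral_le[OF p kx] unfolding space_L by (intro nn_integral_mono)
  also have "\<dots> = ennreal (measure L UNIV powr (p - 1)) * (\<integral>\<^sup>+ x. \<integral>\<^sup>+ \<rho>. ennreal (\<bar>k \<rho> x\<bar> powr p) \<partial>L \<partial>N)"
  proof (rule nn_integral_cmult)
    show "(\<lambda>x. \<integral>\<^sup>+ \<rho>. ennreal (\<bar>k \<rho> x\<bar> powr p) \<partial>L) \<in> borel_measurable N"
      using L.borel_measurable_nn_integral[of "\<lambda>x \<rho>. ennreal (\<bar>k \<rho> x\<bar> powr p)" N] measurable_pair_swap[OF kp]
      by simp
  qed
  also have "(\<integral>\<^sup>+ x. \<integral>\<^sup>+ \<rho>. ennreal (\<bar>k \<rho> x\<bar> powr p) \<partial>L \<partial>N) = (\<integral>\<^sup>+ \<rho>. \<integral>\<^sup>+ x. ennreal (\<bar>k \<rho> x\<bar> powr p) \<partial>N \<partial>L)"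
    by (rule Fubini'[OF kp])
  finally show ?thesis .
qed

lemma integral_in_Lp:
  fixes k :: "'a \<Rightarrow> 'b \<Rightarrow> real"
  assumes k: "(\<lambda>(\<rho>, x). k \<rho> x) \<in> borel_measurable (L \<Otimes>\<^sub>M N)"
    and fin: "(\<integral>\<^sup>+ \<rho>. \<integral>\<^sup>+ x. ennreal (\<bar>k \<rho> x\<bar> powr p) \<partial>N \<partial>L) < \<infinity>"
  shows "(\<lambda>x. \<integral>\<rho>. k \<rho> x \<partial>L) \<in> Lp_space p N"
proof (rule Lp_spaceI)
  show "(\<lambda>x. \<integral>\<rho>. k \<rho> x \<partial>L) \<in> borel_measurable N"
    using L.borel_measurable_lebesgue_integral[of "\<lambda>x \<rho>. k \<rho> x" N] measurable_pair_swap[OF k] by simp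
  show "(\<integral>\<^sup>+ x. ennreal (\<bar>\<integral>\<rho>. k \<rho> x \<partial>L\<bar> powr p) \<partial>N) < \<infinity>"
    by (rule le_less_trans[OF powr_integral_fst_le[OF k]]) (use fin in \<open>simp add: ennreal_mult_less_top\<close>)
qed

text \<open>Integration over time turns a step function into a finite combination of the
  \<open>h i\<close>, hence into a bounded continuous function, and preserves closeness by the
  integral inequality. This produces the approximants that \<open>Lp_extension\<close> asks
  for.\<close>

lemma integral_step_close:
  fixes k :: "'a \<Rightarrow> 'b \<Rightarrow> real"
  assumes k: "(\<lambda>(\<rho>, x). k \<rho> x) \<in> borel_measurable (L \<Otimes>\<^sub>M N)"
    and fin: "(\<integral>\<^sup>+ \<rho>. \<integral>\<^sup>+ x. ennreal (\<bar>k \<rho> x\<bar> powr p) \<partial>N \<partial>L) < \<infinity>"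
    and Ah: "\<forall>i<n. A i \<in> sets L \<and> h i \<in> bcontfun"
    and close: "(\<integral>\<^sup>+ \<rho>. \<integral>\<^sup>+ x. ennreal (\<bar>k \<rho> x - step_fun n A h (\<rho>, x)\<bar> powr p) \<partial>N \<partial>L) \<le> ennreal d"
    and e: "0 \<le> d" "0 \<le> e" "measure L UNIV powr (p - 1) * d \<le> e powr p"
  shows "Lp_norm p N (\<lambda>x. (\<integral>\<rho>. k \<rho> x \<partial>L) - (\<Sum>i<n. measure L (A i) * h i x)) \<le> e"
proof -
  have kp: "(\<lambda>(\<rho>, x). ennreal (\<bar>k \<rho> x\<bar> powr p)) \<in> borel_measurable (L \<Otimes>\<^sub>M N)"
    using k by (simp add: split_def)
  have kx: "(\<lambda>\<rho>. k \<rho> x) \<in> borel_measurable L" for x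
    using measurable_compose[OF measurable_Pair2'[of x N L] k] space_N by simp
  have kpm: "(\<lambda>x. \<integral>\<^sup>+ \<rho>. ennreal (\<bar>k \<rho> x\<bar> powr p) \<partial>L) \<in> borel_measurable N"
    using L.borel_measurable_nn_integral[of "\<lambda>x \<rho>. ennreal (\<bar>k \<rho> x\<bar> powr p)" N] measurable_pair_swap[OF kp] by simp
  have "(\<integral>\<^sup>+ x. \<integral>\<^sup>+ \<rho>. ennreal (\<bar>k \<rho> x\<bar> powr p) \<partial>L \<partial>N) \<noteq> \<infinity>"
    unfolding Fubini'[OF kp] using fin by simp
  from nn_integral_PInf_AE[OF kpm this] have int: "AE x in N. integrable L (\<lambda>\<rho>. k \<rho> x)"
    by eventually_elim (rule L.integrable_of_powr[OF p kx], simp add: less_top)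
  have vint: "integrable L (\<lambda>\<rho>. step_fun n A h (\<rho>, x))" "(\<integral>\<rho>. step_fun n A h (\<rho>, x) \<partial>L) = (\<Sum>i<n. measure L (A i) * h i x)" for x
  proof -
    have i: "integrable L (\<lambda>\<rho>. indicator (A i) \<rho> * h i x)" if "i < n" for i
      using Ah that by (intro integrable_mult_left integrable_real_indicator) (auto simp: L.emeasure_eq_measure)
    show "integrable L (\<lambda>\<rho>. step_fun n A h (\<rho>, x))"
      unfolding step_fun_def fst_conv snd_conv using i by (intro Bochner_Integration.integrable_sum) auto
    have "(\<integral>\<rho>. step_fun n A h (\<rho>, x) \<partial>L) = (\<Sum>i<n. \<integral>\<rho>. indicator (A i) \<rho> * h i x \<partial>L)"
      unfolding step_fun_def fst_conv snd_conv using i by (intro Bochner_Integration.integral_sum) auto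
    also have "\<dots> = (\<Sum>i<n. measure L (A i) * h i x)"
      using Ah by (intro sum.cong) auto
    finally show "(\<integral>\<rho>. step_fun n A h (\<rho>, x) \<partial>L) = (\<Sum>i<n. measure L (A i) * h i x)" .
  qed
  have km: "(\<lambda>(\<rho>, x). k \<rho> x - step_fun n A h (\<rho>, x)) \<in> borel_measurable (L \<Otimes>\<^sub>M N)"
    using borel_measurable_diff[OF k step_fun_measurable[OF Ah]] by (simp add: split_def)
  have fin': "(\<integral>\<^sup>+ \<rho>. \<integral>\<^sup>+ x. ennreal (\<bar>k \<rho> x - step_fun n A h (\<rho>, x)\<bar> powr p) \<partial>N \<partial>L) < \<infinity>"
    by (rule le_less_trans[OF close]) simp
  \<comment> \<open>The difference of the integrals equals the integral of the difference only where
    \<open>k\<close> is integrable in time, that is, for almost every \<open>x\<close>; hence the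
    detour through \<open>D\<close> and almost everywhere equality.\<close>
  define D where "D x = (\<integral>\<rho>. k \<rho> x - step_fun n A h (\<rho>, x) \<partial>L)" for x
  have DL: "D \<in> Lp_space p N" unfolding D_def[abs_def] by (rule integral_in_Lp[OF km fin'])
  have p0: "0 < p" using p by simp
  have "AE x in N. D x = (\<integral>\<rho>. k \<rho> x \<partial>L) - (\<Sum>i<n. measure L (A i) * h i x)"
    using int by eventually_elim (simp add: D_def vint)
  from Lp_space_cong(2)[OF DL this]
  have "Lp_norm p N (\<lambda>x. (\<integral>\<rho>. k \<rho> x \<partial>L) - (\<Sum>i<n. measure L (A i) * h i x)) = Lp_norm p N D" .
  moreover have "Lp_norm p N D \<le> e"
  proof -
    have "ennreal (Lp_norm p N D powr p) \<le> ennreal (measure L UNIV powr (p - 1)) * ennreal d"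
      unfolding Lp_norm_nn[OF DL p0] unfolding D_def
      by (rule order_trans[OF powr_integral_fst_le[OF km]]) (intro mult_left_mono close, simp)
    also have "\<dots> = ennreal (measure L UNIV powr (p - 1) * d)" using e by (intro ennreal_mult[symmetric]) auto
    also have "\<dots> \<le> ennreal (e powr p)" by (intro ennreal_leI e)
    finally have "Lp_norm p N D powr p \<le> e powr p" by simp
    then show ?thesis unfolding Lp_norm_powr[OF p0] using e by (intro Lp_norm_leI p0) auto
  qed
  ultimately show ?thesis by simp
qed

end

section \<open>Time integrals under the evolution operator and weak right continuity of the
  measures\<close>

context evolution
begin

lemma Lp_extension_nn:
  assumes p: "1 < p" and s: "s \<in> I" and t: "s \<le> t" and ext: "Lp_extension p G \<mu> t s f g"
  shows "(\<integral>\<^sup>+ x. ennreal (\<bar>g x\<bar> powr p) \<partial>\<mu> t) \<le> (\<integral>\<^sup>+ x. ennreal (\<bar>f x\<bar> powr p) \<partial>\<mu> s)"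
proof -
  have p0: "0 < p" using p by simp
  show ?thesis
    unfolding Lp_norm_nn[OF Lp_extensionD(1)[OF ext] p0, symmetric] Lp_norm_nn[OF Lp_extensionD(2)[OF ext] p0, symmetric]
    using Lp_extension_contraction[OF assms] p0 Lp_norm_nonneg by (intro ennreal_leI powr_mono2) auto
qed

lemma Lp_extension_bcontfun:
  assumes p: "1 < p" and s: "s \<in> I" and t: "s \<le> t" and h: "h \<in> bcontfun"
  shows "Lp_extension p G \<mu> t s h (G t s h)"
  unfolding Lp_extension_def
proof (intro conjI allI impI)
  show "h \<in> Lp_space p (\<mu> s)" by (intro bcontfun_Lp p s h)
  show "G t s h \<in> Lp_space p (\<mu> t)" by (intro bcontfun_Lp p G_bcontfun I_upward[OF s t] s h t)
  have z: "Lp_norm p M (\<lambda>x. 0) = 0" for M :: "(real ^ 'n) measure" unfolding Lp_norm_def by simp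
  fix e :: real assume "0 < e"
  then show "\<exists>k\<in>bcontfun. Lp_norm p (\<mu> s) (\<lambda>x. h x - k x) \<le> e \<and> Lp_norm p (\<mu> t) (\<lambda>x. G t s h x - G t s k x) \<le> e"
    using h z by (intro bexI[of _ h]) auto
qed

text \<open>G(t,r) passes under the time integral. If a step function approximates
  \<open>w1\<close>, then its image under \<open>G t r\<close> approximates \<open>w2\<close> with
  at most the same error, and for step functions the claim is the linearity of
  \<open>G\<close>.\<close>

lemma Lp_extension_integral:
  fixes w1 w2 :: "real \<Rightarrow> real ^ 'n \<Rightarrow> real" and a c :: real
  assumes p: "1 < p" and r: "r \<in> I" and t: "r \<le> t"
    and w1: "(\<lambda>(\<rho>, x). w1 \<rho> x) \<in> borel_measurable borel" and w2: "(\<lambda>(\<rho>, x). w2 \<rho> x) \<in> borel_measurable borel"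
    and ext: "AE \<rho> in lborel. \<rho> \<in> {a<..<c} \<longrightarrow> Lp_extension p G \<mu> t r (w1 \<rho>) (w2 \<rho>)"
    and fin: "(\<integral>\<^sup>+ \<rho>\<in>{a<..<c}. (\<integral>\<^sup>+ x. ennreal (\<bar>w1 \<rho> x\<bar> powr p) \<partial>\<mu> r) \<partial>lborel) < \<infinity>"
  shows "Lp_extension p G \<mu> t r (\<lambda>x. LINT \<rho>:{a<..<c}|lborel. w1 \<rho> x) (\<lambda>x. LINT \<rho>:{a<..<c}|lborel. w2 \<rho> x)"
proof -
  let ?S = "{a<..<c}"
  have tI: "t \<in> I" using I_upward[OF r t] .
  \<comment> \<open>Lebesgue measure on the interval, written as a density so that the underlying
    space remains the whole line.\<close>
  define L where "L = density lborel (\<lambda>\<rho>. ennreal (indicator ?S \<rho>))"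
  have sL: "sets L = sets borel" "space L = UNIV" unfolding L_def by auto
  have Lfin: "finite_measure L"
  proof
    have "emeasure L (space L) = (\<integral>\<^sup>+ \<rho>. ennreal (indicator ?S \<rho>) * indicator UNIV \<rho> \<partial>lborel)"
      unfolding sL(2) unfolding L_def by (intro emeasure_density) auto
    also have "\<dots> = emeasure lborel ?S" by (simp add: ennreal_indicator)
    also have "\<dots> \<noteq> \<infinity>" by (cases "a \<le> c") auto
    finally show "emeasure L (space L) \<noteq> \<infinity>" .
  qed
  interpret Mr: prob_space "\<mu> r" by (rule mu[OF r])
  interpret Mt: prob_space "\<mu> t" by (rule mu[OF tI])
  interpret L: finite_measure L by (rule Lfin)
  interpret A: finite_pair L "\<mu> r" p by unfold_locales (auto simp: sL mu(2)[OF r] p)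
  interpret B: finite_pair L "\<mu> t" p by unfold_locales (auto simp: sL mu(2)[OF tI] p)
  have mA: "borel_measurable (L \<Otimes>\<^sub>M \<mu> r) = (borel_measurable borel :: (real \<times> (real ^ 'n) \<Rightarrow> real) set)"
    by (rule measurable_cong_sets[OF sets_pair_borel[OF sL(1) mu(2)[OF r]] refl])
  have mB: "borel_measurable (L \<Otimes>\<^sub>M \<mu> t) = (borel_measurable borel :: (real \<times> (real ^ 'n) \<Rightarrow> real) set)"
    by (rule measurable_cong_sets[OF sets_pair_borel[OF sL(1) mu(2)[OF tI]] refl])
  note w1A = w1[folded mA] and w2B = w2[folded mB]
  have set_int: "(LINT \<rho>:?S|lborel. w \<rho> x) = (\<integral>\<rho>. w \<rho> x \<partial>L)" if "(\<lambda>(\<rho>, x). w \<rho> x) \<in> borel_measurable borel" for w :: "real \<Rightarrow> real ^ 'n \<Rightarrow> real" and x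
  proof -
    have "(\<lambda>\<rho>. (\<lambda>(\<rho>, x). w \<rho> x) (\<rho>, x)) \<in> borel_measurable borel"
      by (rule measurable_compose[OF _ that]) (simp add: borel_prod[symmetric])
    then have "(\<lambda>\<rho>. w \<rho> x) \<in> borel_measurable lborel" by simp
    then show ?thesis unfolding L_def set_lebesgue_integral_def by (subst integral_density) auto
  qed
  have nnL: "(\<integral>\<^sup>+ \<rho>. f \<rho> \<partial>L) = (\<integral>\<^sup>+ \<rho>\<in>?S. f \<rho> \<partial>lborel)" if "f \<in> borel_measurable borel" for f
    unfolding L_def using that by (subst nn_integral_density) (auto simp: ennreal_indicator mult.commute)
  have extL: "AE \<rho> in L. Lp_extension p G \<mu> t r (w1 \<rho>) (w2 \<rho>)"
    unfolding L_def using ext by (subst AE_density) (auto simp: indicator_def)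
  have w1p: "(\<lambda>(\<rho>, x). ennreal (\<bar>w1 \<rho> x\<bar> powr p)) \<in> borel_measurable (L \<Otimes>\<^sub>M \<mu> r)"
    using w1A by (simp add: split_def)
  have "(\<lambda>\<rho>. \<integral>\<^sup>+ x. ennreal (\<bar>w1 \<rho> x\<bar> powr p) \<partial>\<mu> r) \<in> borel_measurable L"
    using Mr.borel_measurable_nn_integral[OF w1p] .
  then have "(\<lambda>\<rho>. \<integral>\<^sup>+ x. ennreal (\<bar>w1 \<rho> x\<bar> powr p) \<partial>\<mu> r) \<in> borel_measurable borel"
    by (simp add: measurable_cong_sets[OF sL(1) refl])
  from nnL[OF this] have fin1: "(\<integral>\<^sup>+ \<rho>. \<integral>\<^sup>+ x. ennreal (\<bar>w1 \<rho> x\<bar> powr p) \<partial>\<mu> r \<partial>L) < \<infinity>" using fin by simp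
  have fin2: "(\<integral>\<^sup>+ \<rho>. \<integral>\<^sup>+ x. ennreal (\<bar>w2 \<rho> x\<bar> powr p) \<partial>\<mu> t \<partial>L) < \<infinity>"
  proof (rule le_less_trans[OF nn_integral_mono_AE fin1])
    show "AE \<rho> in L. (\<integral>\<^sup>+ x. ennreal (\<bar>w2 \<rho> x\<bar> powr p) \<partial>\<mu> t) \<le> (\<integral>\<^sup>+ x. ennreal (\<bar>w1 \<rho> x\<bar> powr p) \<partial>\<mu> r)"
      using extL by eventually_elim (rule Lp_extension_nn[OF p r t])
  qed
  have approx: "A.step_approx (\<lambda>(\<rho>, x). w1 \<rho> x)"
  proof (rule A.step_approx_powr_integrable[OF w1A])
    have "(\<integral>\<^sup>+ z. ennreal (\<bar>(\<lambda>(\<rho>, x). w1 \<rho> x) z\<bar> powr p) \<partial>(L \<Otimes>\<^sub>M \<mu> r)) = (\<integral>\<^sup>+ \<rho>. \<integral>\<^sup>+ x. ennreal (\<bar>w1 \<rho> x\<bar> powr p) \<partial>\<mu> r \<partial>L)"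
      using Mr.nn_integral_fst[OF w1p] by (simp add: split_def)
    then show "(\<integral>\<^sup>+ z. ennreal (\<bar>(\<lambda>(\<rho>, x). w1 \<rho> x) z\<bar> powr p) \<partial>(L \<Otimes>\<^sub>M \<mu> r)) < \<infinity>" using fin1 by simp
  qed
  define T where "T = measure L UNIV powr (p - 1)"
  show ?thesis
    unfolding set_int[OF w1] set_int[OF w2] Lp_extension_def
  proof (intro conjI allI impI)
    show "(\<lambda>x. \<integral>\<rho>. w1 \<rho> x \<partial>L) \<in> Lp_space p (\<mu> r)" by (rule A.integral_in_Lp[OF w1A fin1])
    show "(\<lambda>x. \<integral>\<rho>. w2 \<rho> x \<partial>L) \<in> Lp_space p (\<mu> t)" by (rule B.integral_in_Lp[OF w2B fin2])
    fix e :: real assume e: "0 < e"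
    define d where "d = e powr p / (T + 1)"
    have T0: "0 \<le> T" unfolding T_def by simp
    have d: "0 < d" "T * d \<le> e powr p"
    proof -
      show "0 < d" unfolding d_def using e T0 by simp
      have "T * d = e powr p * (T / (T + 1))" unfolding d_def by simp
      also have "\<dots> \<le> e powr p * 1" using T0 by (intro mult_left_mono) auto
      finally show "T * d \<le> e powr p" by simp
    qed
    obtain n S h where Sh: "\<forall>i<n. S i \<in> sets L \<and> h i \<in> bcontfun"
      and cl: "(\<integral>\<^sup>+ z. ennreal (\<bar>(\<lambda>(\<rho>, x). w1 \<rho> x) z - A.step_fun n S h z\<bar> powr p) \<partial>(L \<Otimes>\<^sub>M \<mu> r)) \<le> ennreal d"
      using approx d(1) unfolding A.step_approx_def by blast
    have Sh2: "\<forall>i<n. S i \<in> sets L \<and> G t r (h i) \<in> bcontfun" using Sh G_bcontfun[OF r _ t] by auto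
    have hb: "\<And>i. i \<in> {..<n} \<Longrightarrow> h i \<in> bcontfun" using Sh by auto
    have km: "(\<lambda>(\<rho>, x). ennreal (\<bar>w1 \<rho> x - A.step_fun n S h (\<rho>, x)\<bar> powr p)) \<in> borel_measurable (L \<Otimes>\<^sub>M \<mu> r)"
      using borel_measurable_diff[OF w1A A.step_fun_measurable[OF Sh]] by (simp add: split_def)
    have cl1: "(\<integral>\<^sup>+ \<rho>. \<integral>\<^sup>+ x. ennreal (\<bar>w1 \<rho> x - A.step_fun n S h (\<rho>, x)\<bar> powr p) \<partial>\<mu> r \<partial>L) \<le> ennreal d"
      using Mr.nn_integral_fst[OF km] cl by (simp add: split_def)
    \<comment> \<open>At a fixed time the step function is a single bounded continuous function
      \<open>v\<close>, so contractivity applies to the pair of differences, one time slice after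
      another.\<close>
    have cl2: "(\<integral>\<^sup>+ \<rho>. \<integral>\<^sup>+ x. ennreal (\<bar>w2 \<rho> x - B.step_fun n S (\<lambda>i. G t r (h i)) (\<rho>, x)\<bar> powr p) \<partial>\<mu> t \<partial>L) \<le> ennreal d"
    proof (rule order_trans[OF nn_integral_mono_AE cl1])
      show "AE \<rho> in L. (\<integral>\<^sup>+ x. ennreal (\<bar>w2 \<rho> x - B.step_fun n S (\<lambda>i. G t r (h i)) (\<rho>, x)\<bar> powr p) \<partial>\<mu> t)
          \<le> (\<integral>\<^sup>+ x. ennreal (\<bar>w1 \<rho> x - A.step_fun n S h (\<rho>, x)\<bar> powr p) \<partial>\<mu> r)"
        using extL
      proof eventually_elim
        case (elim \<rho>)
        define v where "v x = (\<Sum>i<n. indicator (S i) \<rho> * h i x)" for x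
        have vb: "v \<in> bcontfun" unfolding v_def[abs_def] by (rule bcontfun_sum[OF hb])
        have Gv: "G t r v = (\<lambda>x. \<Sum>i<n. indicator (S i) \<rho> * G t r (h i) x)"
          unfolding v_def[abs_def] by (rule G_sum[OF r t hb])
        from Lp_extension_lincomb[OF p r t elim Lp_extension_bcontfun[OF p r t vb], of "-1"]
        have "Lp_extension p G \<mu> t r (\<lambda>x. w1 \<rho> x - v x) (\<lambda>x. w2 \<rho> x - G t r v x)" by simp
        from Lp_extension_nn[OF p r t this]
        show ?case unfolding Gv v_def A.step_fun_def B.step_fun_def fst_conv snd_conv .
      qed
    qed
    define H where "H x = (\<Sum>i<n. measure L (S i) * h i x)" for x
    have Hb: "H \<in> bcontfun" unfolding H_def[abs_def] by (rule bcontfun_sum[OF hb])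
    have GH: "G t r H = (\<lambda>x. \<Sum>i<n. measure L (S i) * G t r (h i) x)"
      unfolding H_def[abs_def] by (rule G_sum[OF r t hb])
    show "\<exists>h\<in>bcontfun. Lp_norm p (\<mu> r) (\<lambda>x. (\<integral>\<rho>. w1 \<rho> x \<partial>L) - h x) \<le> e \<and> Lp_norm p (\<mu> t) (\<lambda>x. (\<integral>\<rho>. w2 \<rho> x \<partial>L) - G t r h x) \<le> e"
    proof (intro bexI[OF _ Hb] conjI)
      show "Lp_norm p (\<mu> r) (\<lambda>x. (\<integral>\<rho>. w1 \<rho> x \<partial>L) - H x) \<le> e"
        unfolding H_def using d e unfolding T_def by (intro A.integral_step_close[OF w1A fin1 Sh cl1]) auto
      show "Lp_norm p (\<mu> t) (\<lambda>x. (\<integral>\<rho>. w2 \<rho> x \<partial>L) - G t r H x) \<le> e"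
        unfolding GH using d e unfolding T_def by (intro B.integral_step_close[OF w2B fin2 Sh2 cl2]) auto
    qed
  qed
qed

text \<open>For \<open>r > s\<close> invariance rewrites the integral against \<open>\<mu> s\<close>
  as the integral of \<open>G r s f\<close> against \<open>\<mu> r\<close>. The difference is thus
  the integral of \<open>f - G r s f\<close> against \<open>\<mu> r\<close>: on a compact set it is
  small by continuity of the classical solution at its initial time, elsewhere by tightness and
  boundedness.\<close>

lemma mu_right_continuous:
  fixes f :: "real ^ 'n \<Rightarrow> real"
  assumes s: "s \<in> I" and f: "f \<in> bcontfun"
  shows "((\<lambda>r. \<integral>x. f x \<partial>\<mu> r) \<longlongrightarrow> (\<integral>x. f x \<partial>\<mu> s)) (at_right s)"
proof (rule tendstoI)
  fix e :: real assume e: "0 < e"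
  obtain B0 where B0: "\<And>x. \<bar>f x\<bar> \<le> B0" using f unfolding bcontfun_iff by blast
  define B where "B = \<bar>B0\<bar> + 1"
  have B: "B > 0" "\<And>x. \<bar>f x\<bar> \<le> B"
    unfolding B_def using B0 by (auto intro: order_trans[OF B0])
  define u where "u r = G r s f" for r
  have uB: "\<bar>u r x\<bar> \<le> B" if "s \<le> r" for r x
  proof -
    have "G r s f x \<le> G r s (\<lambda>x. B) x" using B(2) by (intro G_mono s f bcontfun_const that) (auto simp: abs_le_iff)
    moreover have "G r s (\<lambda>x. - B) x \<le> G r s f x"
      using B(2) by (intro G_mono s f bcontfun_const that) (simp add: abs_le_iff minus_le_iff)
    ultimately show ?thesis unfolding u_def G_const[OF s that] by (simp add: abs_le_iff)
  qed
  have us: "u s = f" unfolding u_def by (rule G_solution(2)[OF s f])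
  define \<epsilon> where "\<epsilon> = e / (8 * B)"
  have \<epsilon>: "\<epsilon> > 0" unfolding \<epsilon>_def using e B by simp
  obtain K where K: "compact K" "\<And>t. t \<in> I \<Longrightarrow> measure (\<mu> t) (- K) \<le> \<epsilon>"
  proof -
    have "\<forall>\<epsilon>>0. \<exists>K. compact K \<and> (\<forall>t\<in>I. measure (\<mu> t) (- K) \<le> \<epsilon>)"
      using meas unfolding tight_evolution_system_def by (elim conjE)
    then show ?thesis using \<epsilon> that by blast
  qed
  have uc: "continuous_on ({s..} \<times> UNIV) (\<lambda>(r, x). u r x)"
    using G_solution(1)[OF s f] unfolding solution_def Cb_from_iff u_def by blast
  have "uniformly_continuous_on ({s..s+1} \<times> K) (\<lambda>(r, x). u r x)"
    using K(1) by (intro compact_uniformly_continuous continuous_on_subset[OF uc] compact_Times) auto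
  then obtain \<delta> where \<delta>: "\<delta> > 0" "\<And>z z'. z \<in> {s..s+1} \<times> K \<Longrightarrow> z' \<in> {s..s+1} \<times> K \<Longrightarrow> dist z' z < \<delta> \<Longrightarrow>
      dist ((\<lambda>(r, x). u r x) z') ((\<lambda>(r, x). u r x) z) < e / 4"
    using e unfolding uniformly_continuous_on_def by (metis zero_less_divide_iff zero_less_numeral)
  have "dist (\<integral>x. f x \<partial>\<mu> r) (\<integral>x. f x \<partial>\<mu> s) < e" if r: "s < r" "r < s + min \<delta> 1" for r
  proof -
    have rI: "r \<in> I" using I_upward[OF s] r by simp
    interpret M: prob_space "\<mu> r" by (rule mu[OF rI])
    have ub: "u r \<in> bcontfun" unfolding u_def using r by (intro G_bcontfun s f) auto
    have Km: "- K \<in> sets (\<mu> r)" using mu(2)[OF rI] compact_imp_closed[OF K(1)] by simp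
    have "(\<integral>x. f x \<partial>\<mu> s) = (\<integral>x. u r x \<partial>\<mu> r)" unfolding u_def using G_invariant[OF s f] r by simp
    then have "\<bar>(\<integral>x. f x \<partial>\<mu> r) - (\<integral>x. f x \<partial>\<mu> s)\<bar> = \<bar>\<integral>x. f x - u r x \<partial>\<mu> r\<bar>"
      using bcontfun_integrable[OF rI f] bcontfun_integrable[OF rI ub] by simp
    also have "\<dots> \<le> (\<integral>x. \<bar>f x - u r x\<bar> \<partial>\<mu> r)" by (rule integral_abs_bound)
    also have "\<dots> \<le> (\<integral>x. e / 4 + 2 * B * indicator (- K) x \<partial>\<mu> r)"
    proof (rule integral_mono)
      show "integrable (\<mu> r) (\<lambda>x. \<bar>f x - u r x\<bar>)"
        using bcontfun_integrable[OF rI f] bcontfun_integrable[OF rI ub] by simp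
      show "integrable (\<mu> r) (\<lambda>x. e / 4 + 2 * B * indicator (- K) x)"
        using Km by (intro Bochner_Integration.integrable_add M.integrable_const integrable_mult_right integrable_real_indicator) (auto simp: M.emeasure_eq_measure)
      show "\<bar>f x - u r x\<bar> \<le> e / 4 + 2 * B * indicator (- K) x" for x
      proof (cases "x \<in> K")
        case True
        have "dist ((\<lambda>(r, x). u r x) (r, x)) ((\<lambda>(r, x). u r x) (s, x)) < e / 4"
          using r True by (intro \<delta>(2)) (auto simp: dist_Pair_Pair dist_real_def)
        then show ?thesis using True by (simp add: us dist_real_def abs_minus_commute)
      next
        case False
        have "\<bar>f x - u r x\<bar> \<le> B + B" using B(2)[of x] uB[of r x] r by linarith
        then show ?thesis using False e by simp
      qed
    qed
    also have "\<dots> = e / 4 + 2 * B * measure (\<mu> r) (- K)"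
      using Km by (simp add: M.prob_space M.emeasure_eq_measure)
    also have "\<dots> \<le> e / 4 + 2 * B * \<epsilon>" using K(2)[OF rI] B by simp
    also have "\<dots> < e" unfolding \<epsilon>_def using B e by simp
    finally show ?thesis by (simp add: dist_real_def)
  qed
  then show "\<forall>\<^sub>F r in at_right s. dist (\<integral>x. f x \<partial>\<mu> r) (\<integral>x. f x \<partial>\<mu> s) < e"
    using \<delta>(1) by (intro eventually_at_rightI[of s "s + min \<delta> 1"]) auto
qed

end

text \<open>Rounding the argument up to a grid of mesh \<open>1 / Suc k\<close> gives functions of
  an integer part, measurable without any assumption on \<open>g\<close>; right continuity makes
  them converge to \<open>g\<close>.\<close>

lemma borel_measurable_right_continuous:
  fixes g :: "real \<Rightarrow> real"
  assumes rc: "\<And>r. (g \<longlongrightarrow> g r) (at_right r)"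
  shows "g \<in> borel_measurable borel"
proof (rule borel_measurable_LIMSEQ_metric)
  \<comment> \<open>The \<open>+ 1\<close> makes the rounded value strictly larger than
    \<open>r\<close> even at grid points, as the filter \<open>at_right\<close> demands.\<close>
  define \<rho> where "\<rho> k r = (of_int \<lfloor>real (Suc k) * r\<rfloor> + 1) / real (Suc k)" for k :: nat and r :: real
  show "(\<lambda>r. g (\<rho> k r)) \<in> borel_measurable borel" for k
  proof -
    have "(\<lambda>r::real. \<lfloor>real (Suc k) * r\<rfloor>) \<in> borel \<rightarrow>\<^sub>M count_space UNIV" by measurable
    from measurable_compose[OF this, of "\<lambda>i. g ((of_int i + 1) / real (Suc k))" borel]
    show ?thesis unfolding \<rho>_def by simp
  qed
  fix r :: real
  have gt: "r < \<rho> k r" and le: "\<rho> k r \<le> r + 1 / real (Suc k)" for k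
  proof -
    have "real (Suc k) * r < of_int \<lfloor>real (Suc k) * r\<rfloor> + 1" by linarith
    then show "r < \<rho> k r" unfolding \<rho>_def by (simp add: pos_less_divide_eq mult.commute del: of_nat_Suc)
    have "of_int \<lfloor>real (Suc k) * r\<rfloor> + 1 \<le> real (Suc k) * r + 1" by linarith
    then show "\<rho> k r \<le> r + 1 / real (Suc k)" unfolding \<rho>_def by (simp add: field_simps del: of_nat_Suc)
  qed
  have lim: "(\<lambda>k. \<rho> k r) \<longlonglongrightarrow> r"
  proof (rule tendsto_sandwich[of "\<lambda>k. r" _ _ "\<lambda>k. r + 1 / real (Suc k)"])
    have "(\<lambda>k. r + 1 / real (Suc k)) \<longlonglongrightarrow> r + 0"
      by (intro tendsto_add tendsto_const) (use LIMSEQ_inverse_real_of_nat in \<open>simp add: inverse_eq_divide\<close>)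
    then show "(\<lambda>k. r + 1 / real (Suc k)) \<longlonglongrightarrow> r" by simp
  qed (intro always_eventually allI le less_imp_le[OF gt] tendsto_const)+
  have "filterlim (\<lambda>k. \<rho> k r) (at_right r) sequentially"
    unfolding filterlim_at using lim gt gt[THEN less_imp_neq, THEN not_sym] by (auto intro!: always_eventually)
  then show "(\<lambda>k. g (\<rho> k r)) \<longlonglongrightarrow> g r" by (rule filterlim_compose[OF rc])
qed

section \<open>Measurability of the measures in time\<close>

context evolution
begin

text \<open>The clamped family \<open>\<mu> (max s r)\<close> avoids restricting the time parameter to \<open>I\<close>.\<close>

lemma mu_kernel:
  assumes s: "s \<in> I"
  shows "(\<lambda>r. \<mu> (max s r)) \<in> borel \<rightarrow>\<^sub>M prob_algebra borel"
proof (rule measurable_prob_algebra_generated[where \<Omega>=UNIV and G="Collect closed"])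
  have mI: "max s r \<in> I" for r by (rule I_upward[OF s]) simp
  have int_meas: "(\<lambda>r. \<integral>x. f x \<partial>\<mu> (max s r)) \<in> borel_measurable borel" if f: "f \<in> bcontfun" for f :: "real ^ 'n \<Rightarrow> real"
  proof (rule borel_measurable_right_continuous)
    fix r
    show "((\<lambda>r. \<integral>x. f x \<partial>\<mu> (max s r)) \<longlongrightarrow> (\<integral>x. f x \<partial>\<mu> (max s r))) (at_right r)"
    proof (cases "s \<le> r")
      case True
      have "((\<lambda>r. \<integral>x. f x \<partial>\<mu> r) \<longlongrightarrow> (\<integral>x. f x \<partial>\<mu> r)) (at_right r)"
        using mu_right_continuous[OF I_upward[OF s True] f] .
      moreover have "\<forall>\<^sub>F r' in at_right r. (\<integral>x. f x \<partial>\<mu> r') = (\<integral>x. f x \<partial>\<mu> (max s r'))"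
        using True by (intro eventually_at_rightI[of r "r + 1"]) (auto simp: max_def)
      ultimately show ?thesis using True by (simp add: max_absorb2 tendsto_cong)
    next
      case False
      have "\<forall>\<^sub>F r' in at_right r. (\<integral>x. f x \<partial>\<mu> (max s r')) = (\<integral>x. f x \<partial>\<mu> (max s r))"
        using False by (intro eventually_at_rightI[of r s]) (auto simp: max_def)
      then show ?thesis by (rule tendsto_eventually)
    qed
  qed
  show "sets (borel :: (real ^ 'n) measure) = sigma_sets UNIV (Collect closed)"
    by (simp add: borel_eq_closed)
  show "Int_stable (Collect closed :: (real ^ 'n) set set)" by (auto simp: Int_stable_def)
  \<comment> \<open>Closed sets generate, and their indicators are limits of bounded continuous
    functions, whose integrals are right continuous in time and therefore measurable.\<close>
  show "(\<lambda>r. emeasure (\<mu> (max s r)) A) \<in> borel_measurable borel" if "A \<in> Collect closed" for A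
  proof -
    have A: "closed A" using that by simp
    obtain h :: "nat \<Rightarrow> real ^ 'n \<Rightarrow> real" where h: "\<And>k. h k \<in> bcontfun" "\<And>k x. 0 \<le> h k x" "\<And>k x. h k x \<le> 1"
      "\<And>x. (\<lambda>k. h k x) \<longlonglongrightarrow> indicator A x"
      using closed_indicator_limit[OF A] by blast
    have "(\<lambda>r. measure (\<mu> (max s r)) A) \<in> borel_measurable borel"
    proof (rule borel_measurable_LIMSEQ_metric[OF int_meas[OF h(1)]])
      fix r
      interpret M: prob_space "\<mu> (max s r)" by (rule mu[OF mI])
      have As: "A \<in> sets (\<mu> (max s r))" using A mu(2)[OF mI] by simp
      have "(\<lambda>k. \<integral>x. h k x \<partial>\<mu> (max s r)) \<longlonglongrightarrow> (\<integral>x. indicator A x \<partial>\<mu> (max s r))"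
      proof (rule integral_dominated_convergence[where w="\<lambda>x. 1"])
        show "indicator A \<in> borel_measurable (\<mu> (max s r))" using As by simp
        show "h k \<in> borel_measurable (\<mu> (max s r))" for k
          unfolding mu_measurable[OF mI] by (rule bcontfun_borel[OF h(1)])
      qed (use h in auto)
      then show "(\<lambda>k. \<integral>x. h k x \<partial>\<mu> (max s r)) \<longlonglongrightarrow> measure (\<mu> (max s r)) A" using As by simp
    qed
    then have "(\<lambda>r. ennreal (measure (\<mu> (max s r)) A)) \<in> borel_measurable borel" by measurable
    moreover have "emeasure (\<mu> (max s r)) A = ennreal (measure (\<mu> (max s r)) A)" for r
    proof -
      interpret M: prob_space "\<mu> (max s r)" by (rule mu[OF mI])
      show ?thesis by (rule M.emeasure_eq_measure)
    qed
    ultimately show ?thesis by simp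
  qed
  show "prob_space (\<mu> (max s r))" "sets (\<mu> (max s r)) = sets borel" for r by (fact mu[OF mI])+
qed auto

end

section \<open>Variation of constants and Gronwall inequality\<close>

lemma exp_weight_integral:
  fixes \<kappa> a t :: real
  assumes l: "0 < \<kappa>" and t: "a \<le> t"
  shows "has_bochner_integral lborel (\<lambda>r. indicator {a<..<t} r * (\<kappa> * exp (- \<kappa> * (t - r)))) (1 - exp (- \<kappa> * (t - a)))"
proof -
  have "has_bochner_integral lborel (\<lambda>r. (\<kappa> * exp (- \<kappa> * (t - r))) * indicator {a..t} r)
      (exp (- \<kappa> * (t - t)) - exp (- \<kappa> * (t - a)))"
  proof (rule has_bochner_integral_FTC_Icc_real[OF t])
    show "((\<lambda>r. exp (- \<kappa> * (t - r))) has_real_derivative \<kappa> * exp (- \<kappa> * (t - r))) (at r)" for r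
      by (auto intro!: derivative_eq_intros)
    show "isCont (\<lambda>r. \<kappa> * exp (- \<kappa> * (t - r))) r" for r by (intro continuous_intros)
  qed
  moreover have "AE r in lborel. (\<kappa> * exp (- \<kappa> * (t - r))) * indicator {a..t} r = indicator {a<..<t} r * (\<kappa> * exp (- \<kappa> * (t - r)))"
    using AE_lborel_singleton[of a] AE_lborel_singleton[of t] by eventually_elim (auto simp: indicator_def)
  ultimately show ?thesis by (subst has_bochner_integral_cong_AE[symmetric]) auto
qed

text \<open>Adding \<open>\<kappa> y\<close> to the inhomogeneity of \<open>y' = h\<close> replaces the trivial propagator by
  \<open>exp (- \<kappa> (t - r))\<close>; this is the variation of constants formula in integrated form.\<close>

lemma exp_shift:
  fixes h :: "real \<Rightarrow> real" and c \<kappa> s t :: real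
  assumes l: "0 < \<kappa>" and st: "s < t" and h: "set_integrable lborel {s<..<t} h"
  defines "Y \<equiv> \<lambda>r. c + (LINT \<rho>:{s<..<r}|lborel. h \<rho>)"
  shows "set_integrable lborel {s<..<t} (\<lambda>r. exp (- \<kappa> * (t - r)) * (h r + \<kappa> * Y r))"
    and "exp (- \<kappa> * (t - s)) * c + (LINT r:{s<..<t}|lborel. exp (- \<kappa> * (t - r)) * (h r + \<kappa> * Y r)) = Y t"
proof -
  define e where "e r = exp (- \<kappa> * (t - r))" for r
  define W where "W r = indicator {s<..<t} r * (\<kappa> * e r)" for r
  define k where "k \<rho> = indicator {s<..<t} \<rho> * h \<rho>" for \<rho>
  define J where "J r = (\<integral>\<rho>. (if \<rho> < r then k \<rho> else 0) \<partial>lborel)" for r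
  \<comment> \<open>Fubini on the triangle: integrating over \<open>\<rho>\<close> first gives the
    weighted running integral \<open>W r * J r\<close>, integrating over \<open>r\<close> first
    gives \<open>(1 - e \<rho>) * k \<rho>\<close>.\<close>
  define \<Phi> where "\<Phi> r \<rho> = W r * (if \<rho> < r then k \<rho> else 0)" for r \<rho>
  have k: "integrable lborel k" using h unfolding set_integrable_def k_def by simp
  then have km: "k \<in> borel_measurable borel" by simp
  have Wm: "W \<in> borel_measurable borel" unfolding W_def e_def by measurable
  have Wi: "integrable lborel W" "(\<integral>r. W r \<partial>lborel) = 1 - e s"
    using exp_weight_integral[OF l, of s t] st unfolding W_def e_def has_bochner_integral_iff by auto
  have e1: "e r \<le> 1" if "r < t" for r unfolding e_def using l that by simp
  have eki: "integrable lborel (\<lambda>r. e r * k r)"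
  proof (rule Bochner_Integration.integrable_bound[OF k])
    show "(\<lambda>r. e r * k r) \<in> borel_measurable lborel" unfolding e_def using km by measurable
    have "\<bar>e r * k r\<bar> \<le> \<bar>k r\<bar>" for r
    proof (cases "r \<in> {s<..<t}")
      case True
      then have "\<bar>e r\<bar> \<le> 1" using e1[of r] by (simp add: e_def)
      then have "\<bar>e r\<bar> * \<bar>k r\<bar> \<le> 1 * \<bar>k r\<bar>" by (intro mult_right_mono) auto
      then show ?thesis by (simp add: abs_mult)
    qed (simp add: k_def)
    then show "AE r in lborel. norm (e r * k r) \<le> norm (k r)" by simp
  qed
  have trunc: "integrable lborel (\<lambda>\<rho>. if \<rho> < r then k \<rho> else 0)" for r
  proof (rule Bochner_Integration.integrable_bound[OF k])
    show "(\<lambda>\<rho>. if \<rho> < r then k \<rho> else 0) \<in> borel_measurable lborel" using km by measurable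
  qed auto
  have \<Phi>m: "(\<lambda>(r, \<rho>). \<Phi> r \<rho>) \<in> borel_measurable (lborel \<Otimes>\<^sub>M lborel)"
    unfolding \<Phi>_def split_def using km Wm by measurable
  have \<Phi>i: "integrable (lborel \<Otimes>\<^sub>M lborel) (\<lambda>(r, \<rho>). \<Phi> r \<rho>)"
  proof (rule lborel_pair.Fubini_integrable[OF \<Phi>m])
    show "AE r in lborel. integrable lborel (\<lambda>\<rho>. (\<lambda>(r, \<rho>). \<Phi> r \<rho>) (r, \<rho>))"
      unfolding \<Phi>_def by (intro AE_I2) (auto intro: integrable_mult_right trunc)
    show "integrable lborel (\<lambda>r. \<integral>\<rho>. norm ((\<lambda>(r, \<rho>). \<Phi> r \<rho>) (r, \<rho>)) \<partial>lborel)"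
    proof (rule Bochner_Integration.integrable_bound)
      show "integrable lborel (\<lambda>r. W r * (\<integral>\<rho>. \<bar>k \<rho>\<bar> \<partial>lborel))" by (intro integrable_mult_left Wi(1))
      have "(\<lambda>(r, \<rho>). norm (\<Phi> r \<rho>)) \<in> borel_measurable (lborel \<Otimes>\<^sub>M lborel)" using \<Phi>m by (simp add: split_def)
      from lborel.borel_measurable_lebesgue_integral[OF this]
      show "(\<lambda>r. \<integral>\<rho>. norm ((\<lambda>(r, \<rho>). \<Phi> r \<rho>) (r, \<rho>)) \<partial>lborel) \<in> borel_measurable lborel" by simp
      have "(\<integral>\<rho>. \<bar>\<Phi> r \<rho>\<bar> \<partial>lborel) \<le> W r * (\<integral>\<rho>. \<bar>k \<rho>\<bar> \<partial>lborel)" for r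
      proof -
        have W0: "W r \<ge> 0" unfolding W_def e_def using l by simp
        have "(\<integral>\<rho>. \<bar>\<Phi> r \<rho>\<bar> \<partial>lborel) \<le> (\<integral>\<rho>. W r * \<bar>k \<rho>\<bar> \<partial>lborel)"
          unfolding \<Phi>_def using W0 k
          by (intro integral_mono integrable_abs integrable_mult_right trunc) (auto simp: abs_mult)
        then show ?thesis by simp
      qed
      then show "AE r in lborel. norm (\<integral>\<rho>. norm ((\<lambda>(r, \<rho>). \<Phi> r \<rho>) (r, \<rho>)) \<partial>lborel) \<le> norm (W r * (\<integral>\<rho>. \<bar>k \<rho>\<bar> \<partial>lborel))"
        by (intro AE_I2) (auto intro: order_trans[OF _ abs_ge_self])
    qed
  qed
  have \<Phi>fst: "(\<integral>\<rho>. \<Phi> r \<rho> \<partial>lborel) = W r * J r" for r unfolding \<Phi>_def J_def by simp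
  have WJi: "integrable lborel (\<lambda>r. W r * J r)"
    using lborel_pair.integrable_fst[OF \<Phi>i] unfolding \<Phi>fst .
  have \<Phi>snd: "(\<integral>r. \<Phi> r \<rho> \<partial>lborel) = k \<rho> - e \<rho> * k \<rho>" for \<rho>
  proof (cases "\<rho> \<in> {s<..<t}")
    case True
    have "(\<integral>r. \<Phi> r \<rho> \<partial>lborel) = (\<integral>r. k \<rho> * (indicator {\<rho><..<t} r * (\<kappa> * exp (- \<kappa> * (t - r)))) \<partial>lborel)"
      unfolding \<Phi>_def W_def e_def using True by (intro Bochner_Integration.integral_cong) (auto simp: indicator_def)
    also have "\<dots> = k \<rho> * (1 - exp (- \<kappa> * (t - \<rho>)))"
      using exp_weight_integral[OF l, of \<rho> t] True by (simp add: has_bochner_integral_iff)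
    finally show ?thesis unfolding e_def by (simp add: algebra_simps)
  next
    case False
    then have "k \<rho> = 0" unfolding k_def by simp
    then have "\<Phi> r \<rho> = 0" for r unfolding \<Phi>_def by auto
    then show ?thesis using \<open>k \<rho> = 0\<close> by simp
  qed
  have WJ: "(\<integral>r. W r * J r \<partial>lborel) = (\<integral>\<rho>. k \<rho> \<partial>lborel) - (\<integral>\<rho>. e \<rho> * k \<rho> \<partial>lborel)"
    using lborel_pair.Fubini_integral[OF \<Phi>i] unfolding \<Phi>fst \<Phi>snd using k eki by simp
  have YJ: "Y r = c + J r" if "r \<le> t" for r
  proof -
    have "(LINT \<rho>:{s<..<r}|lborel. h \<rho>) = J r"
      unfolding set_lebesgue_integral_def J_def k_def using that
      by (intro Bochner_Integration.integral_cong) (auto simp: indicator_def)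
    then show ?thesis unfolding Y_def by simp
  qed
  have eq: "indicator {s<..<t} r *\<^sub>R (exp (- \<kappa> * (t - r)) * (h r + \<kappa> * Y r)) = e r * k r + c * W r + W r * J r" for r
    using YJ[of r] unfolding W_def k_def e_def by (auto simp: indicator_def algebra_simps)
  show "set_integrable lborel {s<..<t} (\<lambda>r. exp (- \<kappa> * (t - r)) * (h r + \<kappa> * Y r))"
    unfolding set_integrable_def eq
    by (intro Bochner_Integration.integrable_add eki integrable_mult_right Wi(1) WJi)
  have "(LINT r:{s<..<t}|lborel. exp (- \<kappa> * (t - r)) * (h r + \<kappa> * Y r)) =
      (\<integral>r. e r * k r \<partial>lborel) + c * (1 - e s) + ((\<integral>\<rho>. k \<rho> \<partial>lborel) - (\<integral>\<rho>. e \<rho> * k \<rho> \<partial>lborel))"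
    unfolding set_lebesgue_integral_def eq using eki Wi WJi WJ by simp
  moreover have "Y t = c + (\<integral>\<rho>. k \<rho> \<partial>lborel)"
    unfolding Y_def set_lebesgue_integral_def k_def by simp
  ultimately show "exp (- \<kappa> * (t - s)) * c + (LINT r:{s<..<t}|lborel. exp (- \<kappa> * (t - r)) * (h r + \<kappa> * Y r)) = Y t"
    unfolding e_def by (simp add: algebra_simps)
qed

text \<open>The mass \<open>exp (- \<kappa> * (t - s))\<close> at \<open>c\<close> and the density
  \<open>\<kappa> * exp (- \<kappa> * (t - r))\<close> add up to one, so the left side is the power
  of an average of \<open>c\<close> and \<open>v r / \<kappa>\<close>. The tangent is taken at this
  average; if the integral on the right diverges, nothing has to be shown.\<close>

lemma exp_jensen:
  fixes v :: "real \<Rightarrow> real" and c \<kappa> s t p :: real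
  assumes p: "1 < p" and l: "0 < \<kappa>" and st: "s < t" and vm: "v \<in> borel_measurable borel"
    and v: "set_integrable lborel {s<..<t} (\<lambda>r. exp (- \<kappa> * (t - r)) * v r)"
  shows "ennreal (\<bar>exp (- \<kappa> * (t - s)) * c + (LINT r:{s<..<t}|lborel. exp (- \<kappa> * (t - r)) * v r)\<bar> powr p)
    \<le> ennreal (exp (- \<kappa> * (t - s)) * \<bar>c\<bar> powr p)
      + (\<integral>\<^sup>+ r. ennreal (indicator {s<..<t} r * (\<kappa> * exp (- \<kappa> * (t - r))) * \<bar>v r / \<kappa>\<bar> powr p) \<partial>lborel)"
proof -
  define a where "a = exp (- \<kappa> * (t - s))"
  define W where "W r = indicator {s<..<t} r * (\<kappa> * exp (- \<kappa> * (t - r)))" for r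
  have Wm: "W \<in> borel_measurable borel" unfolding W_def by measurable
  have W0: "0 \<le> W r" for r unfolding W_def using l by simp
  have Wi: "integrable lborel W" "(\<integral>r. W r \<partial>lborel) = 1 - a"
    using exp_weight_integral[OF l, of s t] st unfolding W_def a_def has_bochner_integral_iff by auto
  have Wv: "W r * (v r / \<kappa>) = indicator {s<..<t} r *\<^sub>R (exp (- \<kappa> * (t - r)) * v r)" for r
    unfolding W_def using l by simp
  have Wvi: "integrable lborel (\<lambda>r. W r * (v r / \<kappa>))" using v unfolding set_integrable_def Wv .
  define m where "m = a * c + (\<integral>r. W r * (v r / \<kappa>) \<partial>lborel)"
  have m: "m = exp (- \<kappa> * (t - s)) * c + (LINT r:{s<..<t}|lborel. exp (- \<kappa> * (t - r)) * v r)"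
    unfolding m_def a_def set_lebesgue_integral_def Wv ..
  have Wpm: "(\<lambda>r. W r * \<bar>v r / \<kappa>\<bar> powr p) \<in> borel_measurable borel" using Wm vm by measurable
  show ?thesis
  proof (cases "integrable lborel (\<lambda>r. W r * \<bar>v r / \<kappa>\<bar> powr p)")
    case True
    obtain l' where l': "\<And>y. \<bar>y\<bar> powr p \<ge> \<bar>m\<bar> powr p + l' * (y - m)"
      using powr_tangent[OF p] by blast
    have "a * (\<bar>m\<bar> powr p + l' * (c - m)) \<le> a * \<bar>c\<bar> powr p" unfolding a_def by (intro mult_left_mono l') auto
    moreover have "(\<integral>r. W r * (\<bar>m\<bar> powr p - l' * m) + l' * (W r * (v r / \<kappa>)) \<partial>lborel) \<le> (\<integral>r. W r * \<bar>v r / \<kappa>\<bar> powr p \<partial>lborel)"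
    proof (rule integral_mono[OF _ True])
      show "integrable lborel (\<lambda>r. W r * (\<bar>m\<bar> powr p - l' * m) + l' * (W r * (v r / \<kappa>)))"
        by (intro Bochner_Integration.integrable_add integrable_mult_left integrable_mult_right Wi(1) Wvi)
      have "W r * (\<bar>m\<bar> powr p + l' * (v r / \<kappa> - m)) \<le> W r * \<bar>v r / \<kappa>\<bar> powr p" for r
        by (intro mult_left_mono l' W0)
      then show "W r * (\<bar>m\<bar> powr p - l' * m) + l' * (W r * (v r / \<kappa>)) \<le> W r * \<bar>v r / \<kappa>\<bar> powr p" for r
        by (simp add: algebra_simps)
    qed
    moreover have "(\<integral>r. W r * (\<bar>m\<bar> powr p - l' * m) + l' * (W r * (v r / \<kappa>)) \<partial>lborel)
        = (1 - a) * (\<bar>m\<bar> powr p - l' * m) + l' * (m - a * c)"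
    proof -
      have "(\<integral>r. W r * (\<bar>m\<bar> powr p - l' * m) + l' * (W r * (v r / \<kappa>)) \<partial>lborel)
          = (\<integral>r. W r * (\<bar>m\<bar> powr p - l' * m) \<partial>lborel) + (\<integral>r. l' * (W r * (v r / \<kappa>)) \<partial>lborel)"
        by (intro Bochner_Integration.integral_add integrable_mult_left integrable_mult_right Wi(1) Wvi)
      also have "\<dots> = (1 - a) * (\<bar>m\<bar> powr p - l' * m) + l' * (\<integral>r. W r * (v r / \<kappa>) \<partial>lborel)"
        by (simp only: integral_mult_left_zero integral_mult_right_zero Wi(2))
      also have "(\<integral>r. W r * (v r / \<kappa>) \<partial>lborel) = m - a * c" unfolding m_def by simp
      finally show ?thesis .
    qed
    moreover have "a * (\<bar>m\<bar> powr p + l' * (c - m)) + ((1 - a) * (\<bar>m\<bar> powr p - l' * m) + l' * (m - a * c)) = \<bar>m\<bar> powr p"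
      by (simp add: algebra_simps)
    ultimately have "\<bar>m\<bar> powr p \<le> a * \<bar>c\<bar> powr p + (\<integral>r. W r * \<bar>v r / \<kappa>\<bar> powr p \<partial>lborel)" by linarith
    then have "ennreal (\<bar>m\<bar> powr p) \<le> ennreal (a * \<bar>c\<bar> powr p + (\<integral>r. W r * \<bar>v r / \<kappa>\<bar> powr p \<partial>lborel))"
      by (rule ennreal_leI)
    also have "\<dots> = ennreal (a * \<bar>c\<bar> powr p) + ennreal (\<integral>r. W r * \<bar>v r / \<kappa>\<bar> powr p \<partial>lborel)"
      using W0 by (intro ennreal_plus integral_nonneg_AE) (auto simp: a_def)
    also have "ennreal (\<integral>r. W r * \<bar>v r / \<kappa>\<bar> powr p \<partial>lborel) = (\<integral>\<^sup>+ r. ennreal (W r * \<bar>v r / \<kappa>\<bar> powr p) \<partial>lborel)"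
      using W0 by (intro nn_integral_eq_integral[symmetric] True) auto
    finally show ?thesis unfolding m a_def W_def .
  next
    case False
    have "\<not> (\<integral>\<^sup>+ r. ennreal (W r * \<bar>v r / \<kappa>\<bar> powr p) \<partial>lborel) < \<infinity>"
    proof
      assume "(\<integral>\<^sup>+ r. ennreal (W r * \<bar>v r / \<kappa>\<bar> powr p) \<partial>lborel) < \<infinity>"
      then have "integrable lborel (\<lambda>r. W r * \<bar>v r / \<kappa>\<bar> powr p)"
        using W0 Wpm by (intro integrableI_nonneg AE_I2) auto
      with False show False ..
    qed
    then have "(\<integral>\<^sup>+ r. ennreal (W r * \<bar>v r / \<kappa>\<bar> powr p) \<partial>lborel) = \<infinity>" by (simp add: not_less top_unique)
    then show ?thesis unfolding W_def by simp
  qed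
qed

text \<open>A Gronwall inequality without any continuity of \<open>N\<close>: the best constant \<open>M\<close> in
  \<open>N t \<le> M * exp (\<beta> * (t - s))\<close> reproduces itself with a factor smaller than 1.\<close>

lemma gronwall_exp:
  fixes N N' :: "real \<Rightarrow> ennreal" and n0 K \<kappa> \<beta> s \<tau> :: real
  assumes n0: "0 \<le> n0" and K: "0 \<le> K" and l: "0 < \<kappa>" and \<beta>: "K < \<kappa> + \<beta>"
    and step: "\<And>t. s \<le> t \<Longrightarrow> t \<le> \<tau> \<Longrightarrow> N t \<le> ennreal (exp (- \<kappa> * (t - s)) * n0)
      + ennreal K * (\<integral>\<^sup>+ r. ennreal (indicator {s<..<t} r * exp (- \<kappa> * (t - r))) * N' r \<partial>lborel)"
    and ae: "AE r in lborel. r \<in> {s..\<tau>} \<longrightarrow> N' r = N r"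
    and fin: "(\<integral>\<^sup>+ r\<in>{s..\<tau>}. N' r \<partial>lborel) < \<infinity>"
    and t: "s \<le> t" "t \<le> \<tau>"
  shows "N t \<le> ennreal (n0 * exp (\<beta> * (t - s)))"
proof -
  let ?T = "{s..\<tau>}"
  \<comment> \<open>A crude bound from dropping the exponential weights. It makes \<open>N\<close>
    finite, so that real arithmetic is available and the best constant exists.\<close>
  define B where "B = ennreal n0 + ennreal K * (\<integral>\<^sup>+ r\<in>?T. N' r \<partial>lborel)"
  have Bfin: "B < \<infinity>" unfolding B_def using fin by (simp add: ennreal_mult_less_top)
  have NB: "N r \<le> B" if "r \<in> ?T" for r
  proof -
    have "N r \<le> ennreal (exp (- \<kappa> * (r - s)) * n0) + ennreal K * (\<integral>\<^sup>+ \<rho>. ennreal (indicator {s<..<r} \<rho> * exp (- \<kappa> * (r - \<rho>))) * N' \<rho> \<partial>lborel)"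
      using that by (intro step) auto
    also have "\<dots> \<le> B" unfolding B_def
    proof (intro add_mono mult_left_mono nn_integral_mono)
      have "exp (- \<kappa> * (r - s)) * n0 \<le> 1 * n0" using l that n0 by (intro mult_right_mono) auto
      then show "ennreal (exp (- \<kappa> * (r - s)) * n0) \<le> ennreal n0" by (intro ennreal_leI) simp
      fix \<rho>
      show "ennreal (indicator {s<..<r} \<rho> * exp (- \<kappa> * (r - \<rho>))) * N' \<rho> \<le> N' \<rho> * indicator ?T \<rho>"
      proof (cases "\<rho> \<in> {s<..<r}")
        case True
        then have "exp (- \<kappa> * (r - \<rho>)) \<le> 1" using l by simp
        then have "ennreal (exp (- \<kappa> * (r - \<rho>))) * N' \<rho> \<le> 1 * N' \<rho>" by (intro mult_right_mono) (auto simp: ennreal_le_1)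
        then show ?thesis using True that by simp
      qed simp
    qed auto
    finally show ?thesis .
  qed
  define n where "n r = enn2real (N r)" for r
  have Nn: "N r = ennreal (n r)" if "r \<in> ?T" for r
    unfolding n_def using le_less_trans[OF NB[OF that] Bfin] by simp
  have n_nonneg: "0 \<le> n r" for r unfolding n_def by simp
  define b where "b = enn2real B"
  have nb: "n r \<le> b" if "r \<in> ?T" for r
    unfolding n_def b_def using NB[OF that] Bfin by (intro enn2real_mono) auto
  have lb: "0 < \<kappa> + \<beta>" using K \<beta> by linarith
  define \<theta> where "\<theta> t = exp (- (\<kappa> + \<beta>) * (t - s))" for t
  define \<gamma> where "\<gamma> = K / (\<kappa> + \<beta>)"
  have \<gamma>: "0 \<le> \<gamma>" "\<gamma> < 1" unfolding \<gamma>_def using K \<beta> lb by auto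
  \<comment> \<open>After division by \<open>exp (\<beta> * (t - s))\<close> the initial value has
    weight \<open>\<theta> t\<close> and the integral has weight \<open>1 - \<theta> t\<close> with
    \<open>\<gamma> * M\<close>: a convex combination, hence at most the maximum.\<close>
  have improve: "n t * exp (- \<beta> * (t - s)) \<le> max n0 (\<gamma> * M)"
    if M: "\<And>r. r \<in> ?T \<Longrightarrow> n r \<le> M * exp (\<beta> * (r - s))" and tT: "t \<in> ?T" for M t
  proof -
    have "s \<in> ?T" using tT by auto
    then have M0: "0 \<le> M" using M[of s] n_nonneg[of s] by simp
    have "(\<integral>\<^sup>+ r. ennreal (indicator {s<..<t} r * exp (- \<kappa> * (t - r))) * N' r \<partial>lborel)
        \<le> (\<integral>\<^sup>+ r. ennreal (exp (\<beta> * (t - s)) * M / (\<kappa> + \<beta>) * (indicator {s<..<t} r * ((\<kappa> + \<beta>) * exp (- (\<kappa> + \<beta>) * (t - r))))) \<partial>lborel)"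
    proof (rule nn_integral_mono_AE)
      show "AE r in lborel. ennreal (indicator {s<..<t} r * exp (- \<kappa> * (t - r))) * N' r
          \<le> ennreal (exp (\<beta> * (t - s)) * M / (\<kappa> + \<beta>) * (indicator {s<..<t} r * ((\<kappa> + \<beta>) * exp (- (\<kappa> + \<beta>) * (t - r)))))"
        using ae
      proof eventually_elim
        case (elim r)
        show ?case
        proof (cases "r \<in> {s<..<t}")
          case True
          then have rT: "r \<in> ?T" using tT by auto
          have N'r: "N' r = ennreal (n r)" using elim rT Nn[OF rT] by simp
          have "exp (- \<kappa> * (t - r)) * n r \<le> exp (- \<kappa> * (t - r)) * (M * exp (\<beta> * (r - s)))"
            by (intro mult_left_mono M rT) auto
          also have "\<dots> = M * (exp (- \<kappa> * (t - r)) * exp (\<beta> * (r - s)))" by simp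
          also have "exp (- \<kappa> * (t - r)) * exp (\<beta> * (r - s)) = exp (\<beta> * (t - s)) * exp (- (\<kappa> + \<beta>) * (t - r))"
            unfolding exp_add[symmetric] by (simp add: algebra_simps)
          also have "M * (exp (\<beta> * (t - s)) * exp (- (\<kappa> + \<beta>) * (t - r))) = exp (\<beta> * (t - s)) * M / (\<kappa> + \<beta>) * ((\<kappa> + \<beta>) * exp (- (\<kappa> + \<beta>) * (t - r)))"
            using lb by simp
          finally show ?thesis using True unfolding N'r by (simp add: ennreal_mult[symmetric] n_nonneg ennreal_leI)
        qed simp
      qed
    qed
    also have "\<dots> = ennreal (exp (\<beta> * (t - s)) * M / (\<kappa> + \<beta>) * (1 - exp (- (\<kappa> + \<beta>) * (t - s))))"
    proof -
      define g where "g r = indicator {s<..<t} r * ((\<kappa> + \<beta>) * exp (- (\<kappa> + \<beta>) * (t - r)))" for r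
      define C where "C = exp (\<beta> * (t - s)) * M / (\<kappa> + \<beta>)"
      have w: "integrable lborel g" "(\<integral>r. g r \<partial>lborel) = 1 - exp (- (\<kappa> + \<beta>) * (t - s))"
        using exp_weight_integral[OF lb, of s t] tT unfolding has_bochner_integral_iff g_def by auto
      have g0: "0 \<le> g r" for r unfolding g_def using lb by simp
      have C0: "0 \<le> C" unfolding C_def using lb M0 by simp
      have "(\<integral>\<^sup>+ r. ennreal (C * g r) \<partial>lborel) = ennreal (\<integral>r. C * g r \<partial>lborel)"
        using g0 C0 by (intro nn_integral_eq_integral integrable_mult_right w(1)) auto
      then show ?thesis unfolding integral_mult_right_zero w(2) unfolding C_def g_def .
    qed
    finally have int: "(\<integral>\<^sup>+ r. ennreal (indicator {s<..<t} r * exp (- \<kappa> * (t - r))) * N' r \<partial>lborel)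
        \<le> ennreal (exp (\<beta> * (t - s)) * M / (\<kappa> + \<beta>) * (1 - \<theta> t))" unfolding \<theta>_def .
    have \<theta>: "0 \<le> \<theta> t" "\<theta> t \<le> 1"
    proof -
      have "0 \<le> (\<kappa> + \<beta>) * (t - s)" using lb tT by (intro mult_nonneg_nonneg) auto
      then show "\<theta> t \<le> 1" unfolding \<theta>_def by (simp only: mult_minus_left exp_le_one_iff neg_le_0_iff_le)
    qed (simp add: \<theta>_def)
    have "ennreal (n t) \<le> ennreal (exp (- \<kappa> * (t - s)) * n0) + ennreal K * ennreal (exp (\<beta> * (t - s)) * M / (\<kappa> + \<beta>) * (1 - \<theta> t))"
      unfolding Nn[OF tT, symmetric] using tT by (intro order_trans[OF step] add_left_mono mult_left_mono int) auto
    also have "\<dots> = ennreal (exp (- \<kappa> * (t - s)) * n0 + K * (exp (\<beta> * (t - s)) * M / (\<kappa> + \<beta>) * (1 - \<theta> t)))"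
      using n0 K M0 lb \<theta> by (simp add: ennreal_mult[symmetric] ennreal_plus[symmetric] del: ennreal_plus)
    finally have "n t \<le> exp (- \<kappa> * (t - s)) * n0 + K * (exp (\<beta> * (t - s)) * M / (\<kappa> + \<beta>) * (1 - \<theta> t))"
      using n0 K M0 lb \<theta> by (subst (asm) ennreal_le_iff) auto
    then have "n t * exp (- \<beta> * (t - s)) \<le> (exp (- \<kappa> * (t - s)) * n0 + K * (exp (\<beta> * (t - s)) * M / (\<kappa> + \<beta>) * (1 - \<theta> t))) * exp (- \<beta> * (t - s))"
      by (intro mult_right_mono) auto
    also have "\<dots> = \<theta> t * n0 + (1 - \<theta> t) * (\<gamma> * M)"
    proof -
      have 1: "exp (- \<kappa> * (t - s)) * exp (- \<beta> * (t - s)) = \<theta> t"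
        unfolding \<theta>_def exp_add[symmetric] by (simp add: algebra_simps)
      have 2: "exp (\<beta> * (t - s)) * exp (- \<beta> * (t - s)) = 1" unfolding exp_add[symmetric] by simp
      have "(exp (- \<kappa> * (t - s)) * n0 + K * (exp (\<beta> * (t - s)) * M / (\<kappa> + \<beta>) * (1 - \<theta> t))) * exp (- \<beta> * (t - s))
          = (exp (- \<kappa> * (t - s)) * exp (- \<beta> * (t - s))) * n0 + (exp (\<beta> * (t - s)) * exp (- \<beta> * (t - s))) * ((1 - \<theta> t) * (K / (\<kappa> + \<beta>) * M))"
        by (simp add: algebra_simps)
      then show ?thesis unfolding 1 2 \<gamma>_def by simp
    qed
    also have "\<dots> \<le> \<theta> t * max n0 (\<gamma> * M) + (1 - \<theta> t) * max n0 (\<gamma> * M)"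
      using \<theta> by (intro add_mono mult_left_mono) auto
    also have "\<dots> = max n0 (\<gamma> * M)" by (simp add: algebra_simps)
    finally show ?thesis .
  qed
  define X where "X = (\<lambda>r. n r * exp (- \<beta> * (r - s))) ` ?T"
  have tT: "t \<in> ?T" using t by simp
  have bdd: "bdd_above X"
  proof (rule bdd_aboveI)
    fix x assume "x \<in> X"
    then obtain r where r: "r \<in> ?T" "x = n r * exp (- \<beta> * (r - s))" unfolding X_def by auto
    have "- \<beta> * (r - s) \<le> \<bar>\<beta>\<bar> * (\<tau> - s)"
      using r(1) mult_mono[of "- \<beta>" "\<bar>\<beta>\<bar>" "r - s" "\<tau> - s"] by auto
    then have "n r * exp (- \<beta> * (r - s)) \<le> b * exp (\<bar>\<beta>\<bar> * (\<tau> - s))"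
      using nb[OF r(1)] n_nonneg[of r] by (intro mult_mono) auto
    then show "x \<le> b * exp (\<bar>\<beta>\<bar> * (\<tau> - s))" using r(2) by simp
  qed
  define M where "M = Sup X"
  have nM: "n r \<le> M * exp (\<beta> * (r - s))" if "r \<in> ?T" for r
  proof -
    have "n r * exp (- \<beta> * (r - s)) \<le> M" unfolding M_def using that by (intro cSup_upper bdd) (auto simp: X_def)
    then have "n r * exp (- \<beta> * (r - s)) * exp (\<beta> * (r - s)) \<le> M * exp (\<beta> * (r - s))" by (intro mult_right_mono) auto
    then show ?thesis by (simp add: mult.assoc flip: exp_add)
  qed
  have "M \<le> max n0 (\<gamma> * M)" unfolding M_def
  proof (rule cSup_least)
    show "X \<noteq> {}" unfolding X_def using tT by auto
    fix x assume "x \<in> X"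
    then obtain r where r: "r \<in> ?T" "x = n r * exp (- \<beta> * (r - s))" unfolding X_def by auto
    show "x \<le> max n0 (\<gamma> * Sup X)" using improve[OF nM r(1)] unfolding r(2) M_def .
  qed
  then have "M \<le> n0"
  proof (cases "M \<le> n0")
    case False
    then have "M \<le> \<gamma> * M" using \<open>M \<le> max n0 (\<gamma> * M)\<close> by (simp add: le_max_iff_disj)
    moreover have "0 < M" using False n0 by simp
    ultimately show ?thesis using \<gamma>(2) by (simp add: mult_le_cancel_right1)
  qed
  then have "M * exp (\<beta> * (t - s)) \<le> n0 * exp (\<beta> * (t - s))" by (intro mult_right_mono) auto
  with nM[OF tT] have "n t \<le> n0 * exp (\<beta> * (t - s))" by (rule order_trans)
  then show ?thesis unfolding Nn[OF tT] by (rule ennreal_leI)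
qed

text \<open>With \<open>h = 1 / \<kappa>\<close> the inequality says that the difference quotient of
  \<open>(1 + a * h) powr p\<close> at 0 lies below \<beta>, and this quotient tends to the
  derivative \<open>p * a\<close>.\<close>

lemma powr_difference_quotient:
  fixes p a \<beta> l0 :: real
  assumes "p * a < \<beta>"
  shows "\<exists>\<kappa>>l0. 0 < \<kappa> \<and> \<kappa> * (1 + a / \<kappa>) powr p < \<kappa> + \<beta>"
proof -
  have "((\<lambda>h. (1 + a * h) powr p) has_real_derivative p * (1 + a * 0) powr (p - 1) * a) (at 0)"
    by (rule DERIV_chain2[OF has_real_derivative_powr]) (auto intro!: derivative_eq_intros)
  then have "((\<lambda>h. ((1 + a * h) powr p - 1) / h) \<longlongrightarrow> p * a) (at 0)"
    by (simp add: has_field_derivative_iff)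
  then have "((\<lambda>h. ((1 + a * h) powr p - 1) / h) \<longlongrightarrow> p * a) (at_right 0)"
    by (rule filterlim_mono) (auto simp: at_within_le_at)
  from order_tendstoD(2)[OF this assms] have 1: "\<forall>\<^sub>F h in at_right 0. ((1 + a * h) powr p - 1) / h < \<beta>" .
  have 2: "\<forall>\<^sub>F h in at_right (0::real). 0 < h \<and> h < 1 / (\<bar>l0\<bar> + 1)"
    by (intro eventually_at_rightI[of 0 "1 / (\<bar>l0\<bar> + 1)"]) (auto simp: add_nonneg_pos)
  obtain h where h: "((1 + a * h) powr p - 1) / h < \<beta>" "0 < h" "h < 1 / (\<bar>l0\<bar> + 1)"
    using eventually_happens[OF eventually_conj[OF 1 2]] by auto
  have "\<bar>l0\<bar> + 1 < 1 / h" using h by (simp add: field_simps)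
  moreover have "1 / h * (1 + a / (1 / h)) powr p < 1 / h + \<beta>" using h by (simp add: field_simps)
  ultimately show ?thesis using h by (intro exI[of _ "1 / h"]) auto
qed

section \<open>Disintegration of the space-time measure\<close>

context evolution
begin

text \<open>\<open>\<nu>\<close> is known on rectangles only and lives on
  \<open>I \<times> UNIV\<close>. Both sides are rewritten as integrals against finite Borel
  measures on the whole space-time, which agree on the intersection-stable class of
  rectangles.\<close>

lemma nu_disintegration:
  fixes F :: "real \<times> (real ^ 'n) \<Rightarrow> ennreal"
  assumes nu: "space_time_measure I \<mu> \<nu>" and s: "s \<in> I" and F: "F \<in> borel_measurable borel"
  shows "(\<integral>\<^sup>+ z. F z \<partial>restrict_space \<nu> ({s..\<tau>} \<times> UNIV))
    = (\<integral>\<^sup>+ r\<in>{s..\<tau>}. (\<integral>\<^sup>+ x. F (r, x) \<partial>\<mu> (max s r)) \<partial>lborel)"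
proof -
  let ?T = "{s..\<tau>}" and ?S = "{s..\<tau>} \<times> (UNIV :: (real ^ 'n) set)"
  have TI: "?T \<subseteq> I" using I_upward[OF s] by auto
  have setsnu: "sets \<nu> = sets (restrict_space borel (I \<times> UNIV))"
    and nuval: "\<And>J A. J \<in> sets borel \<Longrightarrow> A \<in> sets borel \<Longrightarrow> J \<subseteq> I \<Longrightarrow> emeasure \<nu> (J \<times> A) = (\<integral>\<^sup>+ t\<in>J. emeasure (\<mu> t) A \<partial>lborel)"
    using nu unfolding space_time_measure_def by auto
  have subnu: "B \<in> sets \<nu>" if "B \<in> sets borel" "B \<subseteq> I \<times> UNIV" for B
    using that unfolding setsnu sets_restrict_space by (auto intro!: image_eqI[of _ _ B])
  have S: "?S \<in> sets borel" "?S \<in> sets \<nu>"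
    using borel_Times[of ?T "UNIV :: (real ^ 'n) set"] TI by (auto intro!: subnu)
  have spnu: "space (restrict_space \<nu> ?S) = ?S"
    using sets.sets_into_space[OF S(2)] by (auto simp: space_restrict_space)
  have idm: "(\<lambda>z. z) \<in> restrict_space \<nu> ?S \<rightarrow>\<^sub>M borel"
  proof (rule measurableI)
    fix B :: "(real \<times> (real ^ 'n)) set" assume B: "B \<in> sets borel"
    have "B \<inter> ?S \<in> sets \<nu>" using B S TI by (intro subnu) auto
    then show "(\<lambda>z. z) -` B \<inter> space (restrict_space \<nu> ?S) \<in> sets (restrict_space \<nu> ?S)"
      unfolding spnu sets_restrict_space by (auto intro!: image_eqI[of _ _ "B \<inter> ?S"])
  qed simp
  define M1 where "M1 = distr (restrict_space \<nu> ?S) borel (\<lambda>z. z)"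
  define D where "D = density lborel (\<lambda>r. ennreal (indicator ?T r))"
  \<comment> \<open>The copy of \<open>\<mu> (max s r)\<close> on the slice at time
    \<open>r\<close>; binding with this kernel glues the slices together.\<close>
  define k where "k r = distr (\<mu> (max s r)) borel (Pair r)" for r
  define M2 where "M2 = D \<bind> k"
  have mI: "max s r \<in> I" for r by (rule I_upward[OF s]) simp
  have Pm: "Pair r \<in> \<mu> (max s r) \<rightarrow>\<^sub>M borel" for r
  proof -
    have "Pair r \<in> borel_measurable (borel :: (real ^ 'n) measure)" by (intro borel_measurable_continuous_onI continuous_intros)
    then show ?thesis unfolding measurable_cong_sets[OF mu(2)[OF mI] refl] .
  qed
  have km: "k \<in> D \<rightarrow>\<^sub>M subprob_algebra borel"
  proof -
    have "k \<in> borel \<rightarrow>\<^sub>M subprob_algebra borel"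
      unfolding k_def[abs_def]
    proof (rule measurable_distr2)
      show "case_prod Pair \<in> borel \<Otimes>\<^sub>M borel \<rightarrow>\<^sub>M (borel :: (real \<times> (real ^ 'n)) measure)"
        unfolding borel_prod by simp
      show "(\<lambda>r. \<mu> (max s r)) \<in> borel \<rightarrow>\<^sub>M subprob_algebra borel"
        by (rule measurable_prob_algebraD[OF mu_kernel[OF s]])
    qed
    then show ?thesis unfolding D_def by simp
  qed
  have Dne: "space D \<noteq> {}" unfolding D_def by simp
  have e1: "emeasure M1 B = emeasure \<nu> (B \<inter> ?S)" if B: "B \<in> sets borel" for B
  proof -
    have "emeasure M1 B = emeasure (restrict_space \<nu> ?S) (B \<inter> ?S)"
      unfolding M1_def emeasure_distr[OF idm B] spnu by simp
    also have "\<dots> = emeasure \<nu> (B \<inter> ?S)"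
      using sets.sets_into_space[OF S(2)] S(2) by (intro emeasure_restrict_space) (auto simp: Int_absorb2)
    finally show ?thesis .
  qed
  have kmeas: "(\<lambda>r. emeasure (\<mu> (max s r)) A) \<in> borel_measurable borel" if "A \<in> sets borel" for A
    using measurable_compose[OF measurable_prob_algebraD[OF mu_kernel[OF s]] measurable_emeasure_subprob_algebra[OF that]] .
  have e2: "emeasure M2 (J \<times> A) = (\<integral>\<^sup>+ r\<in>J \<inter> ?T. emeasure (\<mu> r) A \<partial>lborel)"
    if J: "J \<in> sets borel" and A: "A \<in> sets borel" for J A
  proof -
    have ek: "emeasure (k r) (J \<times> A) = indicator J r * emeasure (\<mu> (max s r)) A" for r
    proof -
      have "Pair r -` (J \<times> A) = (if r \<in> J then A else {})" by auto
      then show ?thesis unfolding k_def emeasure_distr[OF Pm borel_Times[OF J A]]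
        using mu(3)[OF mI[of r]] by (simp add: indicator_def)
    qed
    have "emeasure M2 (J \<times> A) = (\<integral>\<^sup>+ r. emeasure (k r) (J \<times> A) \<partial>D)"
      unfolding M2_def by (rule emeasure_bind[OF Dne km borel_Times[OF J A]])
    also have "\<dots> = (\<integral>\<^sup>+ r. ennreal (indicator ?T r) * (indicator J r * emeasure (\<mu> (max s r)) A) \<partial>lborel)"
      unfolding D_def ek using J kmeas[OF A] by (intro nn_integral_density) auto
    also have "\<dots> = (\<integral>\<^sup>+ r\<in>J \<inter> ?T. emeasure (\<mu> r) A \<partial>lborel)"
      by (intro nn_integral_cong) (auto simp: indicator_def max_def)
    finally show ?thesis .
  qed
  have "M1 = M2"
  proof (rule measure_eqI_generator_eq[where \<Omega>=UNIV and E="{J \<times> A | J A. J \<in> sets borel \<and> A \<in> sets borel}" and A="\<lambda>i. UNIV"])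
    have gen: "sets (borel :: (real \<times> (real ^ 'n)) measure) = sigma_sets UNIV {J \<times> A | J A. J \<in> sets borel \<and> A \<in> sets borel}"
      unfolding borel_prod[symmetric] sets_pair_measure by simp
    show "Int_stable {J \<times> A | J A. J \<in> sets (borel :: real measure) \<and> A \<in> sets (borel :: (real ^ 'n) measure)}"
      by (rule Int_stable_pair_measure_generator)
    show "sets M1 = sigma_sets UNIV {J \<times> A | J A. J \<in> sets borel \<and> A \<in> sets borel}"
      unfolding gen[symmetric] M1_def by simp
    show "sets M2 = sigma_sets UNIV {J \<times> A | J A. J \<in> sets borel \<and> A \<in> sets borel}"
      unfolding gen[symmetric] M2_def by (rule sets_bind[OF sets_kernel[OF km] Dne])
    fix X assume "X \<in> {J \<times> A | J A. J \<in> sets (borel :: real measure) \<and> A \<in> sets (borel :: (real ^ 'n) measure)}"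
    then obtain J A where X: "X = J \<times> A" "J \<in> sets borel" "A \<in> sets borel" by auto
    have "(J \<times> A) \<inter> ?S = (J \<inter> ?T) \<times> A" by auto
    then have "emeasure M1 X = emeasure \<nu> ((J \<inter> ?T) \<times> A)" unfolding X(1) e1[OF borel_Times[OF X(2,3)]] by simp
    also have "\<dots> = (\<integral>\<^sup>+ r\<in>J \<inter> ?T. emeasure (\<mu> r) A \<partial>lborel)" using X TI by (intro nuval) auto
    finally show "emeasure M1 X = emeasure M2 X" unfolding X(1) e2[OF X(2,3)] .
  next
    show "range (\<lambda>i::nat. UNIV) \<subseteq> {J \<times> A | J A. J \<in> sets (borel :: real measure) \<and> A \<in> sets (borel :: (real ^ 'n) measure)}"
      by (auto intro!: exI[of _ UNIV])
    have "UNIV \<inter> ?S = ?T \<times> UNIV" by auto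
    then have "emeasure M1 UNIV = emeasure \<nu> (?T \<times> UNIV)" using e1[of UNIV] by simp
    also have "\<dots> = (\<integral>\<^sup>+ r\<in>?T. emeasure (\<mu> r) UNIV \<partial>lborel)" using TI by (intro nuval) auto
    also have "\<dots> = (\<integral>\<^sup>+ r. indicator ?T r \<partial>lborel)"
    proof (rule nn_integral_cong)
      fix r
      show "emeasure (\<mu> r) UNIV * indicator ?T r = indicator ?T r"
      proof (cases "r \<in> ?T")
        case True
        then have rI: "r \<in> I" using TI by auto
        interpret M: prob_space "\<mu> r" by (rule mu[OF rI])
        show ?thesis using M.emeasure_space_1 mu(3)[OF rI] by simp
      qed simp
    qed
    also have "\<dots> = emeasure lborel ?T" by simp
    also have "\<dots> \<noteq> \<infinity>" by (cases "s \<le> \<tau>") auto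
    finally show "emeasure M1 UNIV \<noteq> \<infinity>" .
  qed auto
  then have "(\<integral>\<^sup>+ z. F z \<partial>M1) = (\<integral>\<^sup>+ z. F z \<partial>M2)" by simp
  moreover have "(\<integral>\<^sup>+ z. F z \<partial>M1) = (\<integral>\<^sup>+ z. F z \<partial>restrict_space \<nu> ?S)"
    unfolding M1_def by (rule nn_integral_distr[OF idm]) (use F in simp)
  moreover have "(\<integral>\<^sup>+ z. F z \<partial>M2) = (\<integral>\<^sup>+ r. (\<integral>\<^sup>+ x. F (r, x) \<partial>\<mu> (max s r)) \<partial>D)"
  proof -
    have "(\<integral>\<^sup>+ z. F z \<partial>M2) = (\<integral>\<^sup>+ r. (\<integral>\<^sup>+ z. F z \<partial>k r) \<partial>D)"
      unfolding M2_def by (rule nn_integral_bind[OF F km])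
    also have "\<dots> = (\<integral>\<^sup>+ r. (\<integral>\<^sup>+ x. F (r, x) \<partial>\<mu> (max s r)) \<partial>D)"
      unfolding k_def using F by (intro nn_integral_cong nn_integral_distr[OF Pm]) simp
    finally show ?thesis .
  qed
  moreover have "(\<integral>\<^sup>+ r. (\<integral>\<^sup>+ x. F (r, x) \<partial>\<mu> (max s r)) \<partial>D) = (\<integral>\<^sup>+ r\<in>?T. (\<integral>\<^sup>+ x. F (r, x) \<partial>\<mu> (max s r)) \<partial>lborel)"
  proof -
    have "(\<lambda>r. \<integral>\<^sup>+ x. F (r, x) \<partial>\<mu> (max s r)) \<in> borel_measurable borel"
      by (rule nn_integral_measurable_subprob_algebra2[OF _ measurable_prob_algebraD[OF mu_kernel[OF s]]])
        (use F in \<open>simp add: borel_prod\<close>)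
    then have "(\<integral>\<^sup>+ r. (\<integral>\<^sup>+ x. F (r, x) \<partial>\<mu> (max s r)) \<partial>D) = (\<integral>\<^sup>+ r. ennreal (indicator ?T r) * (\<integral>\<^sup>+ x. F (r, x) \<partial>\<mu> (max s r)) \<partial>lborel)"
      unfolding D_def by (intro nn_integral_density) auto
    then show ?thesis by (simp add: ennreal_indicator mult.commute)
  qed
  ultimately show ?thesis by simp
qed

text \<open>Measurability for the completion is too weak for slicing and for Fubini. The Borel
  function \<open>U\<close> replaces \<open>f\<close>; the two agree on almost every time slice,
  almost everywhere with respect to the measure of that slice.\<close>

lemma Lp_nu_version:
  assumes p: "1 < p" and nu: "space_time_measure I \<mu> \<nu>" and s: "s \<in> I"
    and f: "f \<in> Lp_space p (restrict_space \<nu> ({s..\<tau>} \<times> UNIV))"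
  obtains U :: "real \<times> (real ^ 'n) \<Rightarrow> real" where "U \<in> borel_measurable borel"
    "AE r in lborel. r \<in> {s..\<tau>} \<longrightarrow> (AE x in \<mu> r. f (r, x) = U (r, x))"
    "(\<integral>\<^sup>+ r\<in>{s..\<tau>}. (\<integral>\<^sup>+ x. ennreal (\<bar>U (r, x)\<bar> powr p) \<partial>\<mu> (max s r)) \<partial>lborel) < \<infinity>"
proof -
  let ?T = "{s..\<tau>}" and ?S = "{s..\<tau>} \<times> (UNIV :: (real ^ 'n) set)"
  let ?R = "restrict_space \<nu> ?S"
  have TI: "?T \<subseteq> I" using I_upward[OF s] by auto
  have p0: "0 < p" using p by simp
  obtain U0 where U0: "U0 \<in> borel_measurable ?R" "AE z in ?R. f z = U0 z"
    using Lp_space_version[OF f] by blast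
  have setsnu: "sets \<nu> = sets (restrict_space borel (I \<times> UNIV))"
    using nu unfolding space_time_measure_def by auto
  have spnu: "space \<nu> = I \<times> UNIV" using sets_eq_imp_space_eq[OF setsnu] by (simp add: space_restrict_space)
  have Sb: "?S \<in> sets borel" by (rule borel_Times) auto
  have setsR: "sets ?R = sets (restrict_space borel ?S)"
  proof -
    have "sets ?R = sets (restrict_space (restrict_space borel (I \<times> UNIV)) ?S)"
      by (rule sets_restrict_space_cong[OF setsnu])
    also have "\<dots> = sets (restrict_space borel ((I \<times> UNIV) \<inter> ?S))" by (rule sets_restrict_restrict_space)
    also have "(I \<times> UNIV) \<inter> ?S = ?S" using TI by auto
    finally show ?thesis .
  qed
  have spR: "space ?R = ?S" using spnu TI by (auto simp: space_restrict_space)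
  define U where "U z = indicator ?S z *\<^sub>R U0 z" for z
  have Um: "U \<in> borel_measurable borel"
  proof -
    have "U0 \<in> borel_measurable (restrict_space borel ?S)"
      using U0(1) unfolding measurable_cong_sets[OF setsR refl] .
    then show ?thesis unfolding U_def[abs_def] using Sb by (subst (asm) borel_measurable_restrict_space_iff) auto
  qed
  have UU0: "U z = U0 z" if "z \<in> ?S" for z using that unfolding U_def by simp
  have "AE z in ?R. z \<in> space ?R" by (rule AE_space)
  with U0(2) have fU: "AE z in ?R. f z = U z" by eventually_elim (simp add: spR UU0)
  \<comment> \<open>A null set of \<open>\<nu>\<close> has null slices for almost every time, by
    disintegration of its indicator function.\<close>
  obtain N where N: "N \<in> null_sets ?R" "{z \<in> space ?R. \<not> f z = U z} \<subseteq> N"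
    using fU unfolding eventually_ae_filter by auto
  have Nb: "N \<in> sets borel"
  proof -
    have "N \<in> sets (restrict_space borel ?S)" using N(1) setsR by auto
    then show ?thesis using Sb by (auto simp: sets_restrict_space)
  qed
  have meas: "(\<lambda>r. \<integral>\<^sup>+ x. indicator N (r, x) \<partial>\<mu> (max s r)) \<in> borel_measurable borel"
    by (rule nn_integral_measurable_subprob_algebra2[OF _ measurable_prob_algebraD[OF mu_kernel[OF s]]])
      (use Nb in \<open>simp add: borel_prod\<close>)
  have "(\<integral>\<^sup>+ r\<in>?T. (\<integral>\<^sup>+ x. indicator N (r, x) \<partial>\<mu> (max s r)) \<partial>lborel) = (\<integral>\<^sup>+ z. indicator N z \<partial>?R)"
    using Nb by (intro nu_disintegration[OF nu s, symmetric]) simp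
  also have "\<dots> = 0" using N(1) by (simp add: null_sets_def)
  finally have "AE r in lborel. (\<integral>\<^sup>+ x. indicator N (r, x) \<partial>\<mu> (max s r)) * indicator ?T r = 0"
    using meas by (subst (asm) nn_integral_0_iff_AE) auto
  then have ae: "AE r in lborel. r \<in> ?T \<longrightarrow> (AE x in \<mu> r. f (r, x) = U (r, x))"
  proof eventually_elim
    case (elim r)
    show ?case
    proof
      assume r: "r \<in> ?T"
      then have rI: "r \<in> I" and mr: "max s r = r" using TI by (auto simp: max_def)
      have "(\<lambda>x. indicator N (r, x) :: ennreal) \<in> borel_measurable borel"
        using measurable_compose[of "Pair r" borel borel "indicator N :: _ \<Rightarrow> ennreal" borel] Nb
        by (simp add: borel_measurable_continuous_onI continuous_on_Pair continuous_on_const continuous_on_id)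
      then have im: "(\<lambda>x. indicator N (r, x) :: ennreal) \<in> borel_measurable (\<mu> r)"
        unfolding measurable_cong_sets[OF mu(2)[OF rI] refl] .
      have "(\<integral>\<^sup>+ x. indicator N (r, x) \<partial>\<mu> r) = 0" using elim r unfolding mr by simp
      then have "AE x in \<mu> r. (indicator N (r, x) :: ennreal) = 0" using nn_integral_0_iff_AE[OF im] by simp
      then show "AE x in \<mu> r. f (r, x) = U (r, x)"
      proof eventually_elim
        case (elim x)
        then have "(r, x) \<notin> N" by (simp add: indicator_def split: if_splits)
        moreover have "(r, x) \<in> space ?R" using r unfolding spR by simp
        ultimately show ?case using N(2) by blast
      qed
    qed
  qed
  have "(\<integral>\<^sup>+ r\<in>?T. (\<integral>\<^sup>+ x. ennreal (\<bar>U (r, x)\<bar> powr p) \<partial>\<mu> (max s r)) \<partial>lborel) = (\<integral>\<^sup>+ z. ennreal (\<bar>U z\<bar> powr p) \<partial>?R)"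
    using Um by (intro nu_disintegration[OF nu s, symmetric]) simp
  also have "\<dots> = (\<integral>\<^sup>+ z. ennreal (\<bar>f z\<bar> powr p) \<partial>?R)"
  proof (rule nn_integral_cong_AE)
    show "AE z in ?R. ennreal (\<bar>U z\<bar> powr p) = ennreal (\<bar>f z\<bar> powr p)" using fU by eventually_elim simp
  qed
  also have "\<dots> < \<infinity>" unfolding Lp_norm_nn[OF f p0, symmetric] by simp
  finally show ?thesis by (intro that[OF Um ae])
qed

end

section \<open>Mild solutions\<close>

text \<open>Dissipativity bounds \<open>F a\<close> on one side only, from above for positive and
  from below for negative \<open>a\<close>. Adding \<open>\<kappa> * a\<close> with
  \<open>\<kappa>\<close> above the Lipschitz constant gives the sum the sign of \<open>a\<close>,
  so the one-sided bound becomes a bound for the absolute value.\<close>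

lemma dissipative_shift_bound:
  fixes F :: "real \<Rightarrow> real" and \<kappa> l c :: real
  assumes lip: "\<And>a b. \<bar>F a - F b\<bar> \<le> l * \<bar>a - b\<bar>" and diss: "\<And>a. a * F a \<le> c * a\<^sup>2" and l: "l \<le> \<kappa>"
  shows "\<bar>F a\<bar> \<le> l * \<bar>a\<bar>" "0 \<le> \<kappa> + c" "\<bar>F a + \<kappa> * a\<bar> \<le> (\<kappa> + c) * \<bar>a\<bar>"
proof -
  have pos: "F a \<le> c * a" if "0 < a" for a
    using diss[of a] that by (simp add: power2_eq_square field_simps)
  have neg: "c * a \<le> F a" if "a < 0" for a
    using diss[of a] that by (simp add: power2_eq_square field_simps mult_le_cancel_left)
  have l0: "0 \<le> l" using lip[of 1 0] by (simp add: order_trans[OF abs_ge_zero])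
  have F0: "F 0 = 0"
  proof (rule ccontr)
    assume nz: "F 0 \<noteq> 0"
    \<comment> \<open>A point with the sign of \<open>F 0\<close>, so close to 0 that the Lipschitz
      condition still makes \<open>F a\<close> larger in absolute value than
      \<open>\<bar>c\<bar> * \<bar>a\<bar>\<close>, against dissipativity.\<close>
    define a where "a = F 0 / (2 * (\<bar>c\<bar> + l + 1))"
    have d: "0 < 2 * (\<bar>c\<bar> + l + 1)" using l0 by simp
    have Fa: "F 0 = 2 * (\<bar>c\<bar> + l + 1) * a" unfolding a_def using d by simp
    show False
    proof (cases "0 < a")
      case True
      have "F 0 \<le> F a + l * a" using lip[of a 0] True by simp
      also have "\<dots> \<le> \<bar>c\<bar> * a + l * a" using pos[OF True] mult_right_mono[OF abs_ge_self[of c], of a] True by linarith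
      finally have "2 * (\<bar>c\<bar> + l + 1) * a \<le> (\<bar>c\<bar> + l) * a" unfolding Fa by (simp add: algebra_simps)
      then show False using True l0 by (simp add: mult_le_cancel_right)
    next
      case False
      with nz Fa have a: "a < 0" by (cases "a = 0") auto
      have "\<bar>c\<bar> * a + l * a \<le> F a + l * a" using neg[OF a] mult_right_mono_neg[OF abs_ge_self[of c], of a] a by linarith
      also have "\<dots> \<le> F 0" using lip[of a 0] a by simp
      finally have "(\<bar>c\<bar> + l) * a \<le> 2 * (\<bar>c\<bar> + l + 1) * a" unfolding Fa by (simp add: algebra_simps)
      then show False using a l0 by (simp add: mult_le_cancel_right)
    qed
  qed
  show b: "\<bar>F a\<bar> \<le> l * \<bar>a\<bar>" for a using lip[of a 0] F0 by simp
  show "0 \<le> \<kappa> + c" using pos[of 1] b[of 1] l by simp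
  have lk: "l * \<bar>a\<bar> \<le> \<kappa> * \<bar>a\<bar>" using l by (intro mult_right_mono) auto
  show "\<bar>F a + \<kappa> * a\<bar> \<le> (\<kappa> + c) * \<bar>a\<bar>"
  proof (cases a "0 :: real" rule: linorder_cases)
    case less
    have "F a + \<kappa> * a \<le> 0" using abs_ge_self[of "F a"] b[of a] lk unfolding abs_of_neg[OF less] by linarith
    then show ?thesis using neg[OF less] less by (simp add: algebra_simps)
  next
    case equal
    then show ?thesis using F0 by simp
  next
    case greater
    have "0 \<le> F a + \<kappa> * a" using abs_ge_minus_self[of "F a"] b[of a] lk unfolding abs_of_pos[OF greater] by linarith
    then show ?thesis using pos[OF greater] greater by (simp add: algebra_simps)
  qed
qed

text \<open>One mild solution on a bounded time interval, with the functions \<open>g\<close> and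
  \<open>w\<close> hidden in the definition made explicit, together with a Borel version
  \<open>U\<close> of the solution.\<close>

locale mild_data = evolution I q b \<alpha> \<eta> \<phi> G \<mu>
  for I :: "real set"
    and q :: "real \<Rightarrow> real ^ 'n::finite \<Rightarrow> real ^ 'n ^ 'n"
    and b :: "real \<Rightarrow> real ^ 'n \<Rightarrow> real ^ 'n"
    and \<alpha> :: real
    and \<eta> :: "real \<Rightarrow> real ^ 'n \<Rightarrow> real"
    and \<phi> :: "real ^ 'n \<Rightarrow> real"
    and G :: "real \<Rightarrow> real \<Rightarrow> (real ^ 'n \<Rightarrow> real) \<Rightarrow> real ^ 'n \<Rightarrow> real"
    and \<mu> :: "real \<Rightarrow> (real ^ 'n) measure" +
  fixes p s \<tau> l c :: real and \<psi> :: "real \<Rightarrow> real \<Rightarrow> real"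
    and f :: "real ^ 'n \<Rightarrow> real" and u g :: "real \<Rightarrow> real ^ 'n \<Rightarrow> real"
    and w :: "real \<Rightarrow> real \<Rightarrow> real ^ 'n \<Rightarrow> real" and U :: "real \<times> (real ^ 'n) \<Rightarrow> real"
  assumes p: "1 < p" and s: "s \<in> I"
    and lip: "\<And>t \<xi> \<xi>'. t \<in> {s..\<tau>} \<Longrightarrow> \<bar>\<psi> t \<xi> - \<psi> t \<xi>'\<bar> \<le> l * \<bar>\<xi> - \<xi>'\<bar>"
    and diss: "\<And>t \<xi>. t \<in> I \<Longrightarrow> \<xi> * \<psi> t \<xi> \<le> c * \<xi>\<^sup>2"
    and gext: "\<And>t. t \<in> {s..\<tau>} \<Longrightarrow> Lp_extension p G \<mu> t s f (g t)"
    and wm: "\<And>t. t \<in> {s<..\<tau>} \<Longrightarrow> (\<lambda>(r, x). w t r x) \<in> borel_measurable borel"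
    and wext: "\<And>t. t \<in> {s<..\<tau>} \<Longrightarrow> AE r in lborel. r \<in> {s<..<t} \<longrightarrow> Lp_extension p G \<mu> t r (\<lambda>x. \<psi> r (u r x)) (w t r)"
    and wint: "\<And>t. t \<in> {s<..\<tau>} \<Longrightarrow> AE x in lborel. set_integrable lborel {s<..<t} (\<lambda>r. w t r x)"
    and ueq: "\<And>t. t \<in> {s..\<tau>} \<Longrightarrow> AE x in lborel. u t x = g t x + (LINT r:{s<..<t}|lborel. w t r x)"
    and Um: "U \<in> borel_measurable borel"
    and uU: "AE r in lborel. r \<in> {s..\<tau>} \<longrightarrow> (AE x in \<mu> r. u r x = U (r, x))"
    and Ufin: "(\<integral>\<^sup>+ r\<in>{s..\<tau>}. (\<integral>\<^sup>+ x. ennreal (\<bar>U (r, x)\<bar> powr p) \<partial>\<mu> (max s r)) \<partial>lborel) < \<infinity>"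
begin

text \<open>Measurable in time because \<open>U\<close> is Borel; the corresponding quantity for
  \<open>u\<close> agrees with it for almost every time only.\<close>

definition N' :: "real \<Rightarrow> ennreal" where
  "N' r = (\<integral>\<^sup>+ x. ennreal (\<bar>U (r, x)\<bar> powr p) \<partial>\<mu> (max s r))"

lemma N'_measurable: "N' \<in> borel_measurable borel"
  unfolding N'_def[abs_def]
  by (rule nn_integral_measurable_subprob_algebra2[OF _ measurable_prob_algebraD[OF mu_kernel[OF s]]])
    (use Um in \<open>simp add: borel_prod case_prod_unfold\<close>)

lemma times_I: "r \<in> {s..\<tau>} \<Longrightarrow> r \<in> I"
  using I_upward[OF s] by auto

lemma U_slice: "(\<lambda>x. U (r, x)) \<in> borel_measurable borel"
  by (rule measurable_compose[OF _ Um]) (intro borel_measurable_continuous_onI continuous_intros)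

lemma power_bound:
  assumes r: "r \<in> {s..\<tau>}" and ae: "AE x in \<mu> r. u r x = U (r, x)" and C: "0 \<le> C"
    and F: "\<And>x. \<bar>F x\<bar> \<le> C * \<bar>u r x\<bar>"
  shows "(\<integral>\<^sup>+ x. ennreal (\<bar>F x\<bar> powr p) \<partial>\<mu> r) \<le> ennreal (C powr p) * N' r"
proof -
  have mr: "max s r = r" using r by simp
  have "(\<integral>\<^sup>+ x. ennreal (\<bar>F x\<bar> powr p) \<partial>\<mu> r) \<le> (\<integral>\<^sup>+ x. ennreal (C powr p) * ennreal (\<bar>U (r, x)\<bar> powr p) \<partial>\<mu> r)"
  proof (rule nn_integral_mono_AE)
    show "AE x in \<mu> r. ennreal (\<bar>F x\<bar> powr p) \<le> ennreal (C powr p) * ennreal (\<bar>U (r, x)\<bar> powr p)"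
      using ae
    proof eventually_elim
      case (elim x)
      have "\<bar>F x\<bar> powr p \<le> (C * \<bar>U (r, x)\<bar>) powr p" using F[of x] elim p by (intro powr_mono2) auto
      also have "\<dots> = C powr p * \<bar>U (r, x)\<bar> powr p" using C by (simp add: powr_mult)
      finally show ?case by (simp add: ennreal_mult[symmetric] ennreal_leI)
    qed
  qed
  also have "\<dots> = ennreal (C powr p) * (\<integral>\<^sup>+ x. ennreal (\<bar>U (r, x)\<bar> powr p) \<partial>\<mu> r)"
  proof (rule nn_integral_cmult)
    show "(\<lambda>x. ennreal (\<bar>U (r, x)\<bar> powr p)) \<in> borel_measurable (\<mu> r)"
      unfolding mu_measurable[OF times_I[OF r]] using U_slice[of r] by measurable
  qed
  finally show ?thesis unfolding N'_def mr .
qed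

text \<open>Contractivity and
  \<open>\<bar>\<psi> \<rho> \<xi>\<bar> \<le> l * \<bar>\<xi>\<bar>\<close> reduce this to the
  finite space-time norm of the solution. It is the integrability required for passing the
  propagator under the time integral.\<close>

lemma w_integral_finite:
  assumes r: "r \<in> {s<..\<tau>}"
  shows "(\<integral>\<^sup>+ \<rho>\<in>{s<..<r}. (\<integral>\<^sup>+ x. ennreal (\<bar>w r \<rho> x\<bar> powr p) \<partial>\<mu> r) \<partial>lborel) < \<infinity>"
proof -
  have "(\<integral>\<^sup>+ \<rho>\<in>{s<..<r}. (\<integral>\<^sup>+ x. ennreal (\<bar>w r \<rho> x\<bar> powr p) \<partial>\<mu> r) \<partial>lborel)
      \<le> (\<integral>\<^sup>+ \<rho>. ennreal (l powr p) * (N' \<rho> * indicator {s..\<tau>} \<rho>) \<partial>lborel)"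
  proof (rule nn_integral_mono_AE)
    show "AE \<rho> in lborel. (\<integral>\<^sup>+ x. ennreal (\<bar>w r \<rho> x\<bar> powr p) \<partial>\<mu> r) * indicator {s<..<r} \<rho>
        \<le> ennreal (l powr p) * (N' \<rho> * indicator {s..\<tau>} \<rho>)"
      using wext[OF r] uU
    proof eventually_elim
      case (elim \<rho>)
      show ?case
      proof (cases "\<rho> \<in> {s<..<r}")
        case True
        then have \<rho>: "\<rho> \<in> {s..\<tau>}" "\<rho> \<le> r" using r by auto
        note lp = lip[OF \<rho>(1)]
        have l0: "0 \<le> l" using lp[of 1 0] by (simp add: order_trans[OF abs_ge_zero])
        have "(\<integral>\<^sup>+ x. ennreal (\<bar>w r \<rho> x\<bar> powr p) \<partial>\<mu> r) \<le> (\<integral>\<^sup>+ x. ennreal (\<bar>\<psi> \<rho> (u \<rho> x)\<bar> powr p) \<partial>\<mu> \<rho>)"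
          using elim(1) True by (intro Lp_extension_nn p times_I \<rho>) auto
        also have "\<dots> \<le> ennreal (l powr p) * N' \<rho>"
          using elim(2) \<rho>(1) dissipative_shift_bound(1)[OF lp diss[OF times_I[OF \<rho>(1)]] order_refl]
          by (intro power_bound l0) auto
        finally show ?thesis using True \<rho> by simp
      qed simp
    qed
  qed
  also have "\<dots> = ennreal (l powr p) * (\<integral>\<^sup>+ \<rho>. N' \<rho> * indicator {s..\<tau>} \<rho> \<partial>lborel)"
    using N'_measurable by (intro nn_integral_cmult) auto
  also have "\<dots> < \<infinity>" using Ufin unfolding N'_def by (simp add: ennreal_mult_less_top)
  finally show ?thesis .
qed

text \<open>G(t,r) is applied to the mild formula at time \<open>r\<close>: the evolution law turns
  \<open>g r\<close> into \<open>g t\<close> and \<open>w r \<rho>\<close> into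
  \<open>w t \<rho>\<close>. The result contains versions chosen at the single time
  \<open>t\<close>, as the shift of the formula at time \<open>t\<close> requires.\<close>

lemma mild_evolve:
  assumes r: "r \<in> {s<..\<tau>}" and t: "r \<le> t" "t \<le> \<tau>"
  shows "Lp_extension p G \<mu> t r (u r) (\<lambda>x. g t x + (LINT \<rho>:{s<..<r}|lborel. w t \<rho> x))"
proof -
  have r': "r \<in> {s..\<tau>}" and t': "t \<in> {s..\<tau>}" "t \<in> {s<..\<tau>}" using r t by auto
  have rI: "r \<in> I" using times_I[OF r'] .
  have ext: "AE \<rho> in lborel. \<rho> \<in> {s<..<r} \<longrightarrow> Lp_extension p G \<mu> t r (w r \<rho>) (w t \<rho>)"
    using wext[OF r] wext[OF t'(2)]
  proof eventually_elim
    case (elim \<rho>)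
    show ?case
    proof
      assume \<rho>: "\<rho> \<in> {s<..<r}"
      then have \<rho>': "\<rho> \<in> {s..\<tau>}" "\<rho> \<le> r" "\<rho> \<in> {s<..<t}" using r t by auto
      show "Lp_extension p G \<mu> t r (w r \<rho>) (w t \<rho>)"
        by (rule Lp_extension_flow[OF p times_I[OF \<rho>'(1)] \<rho>'(2) t(1) elim(1)[rule_format, OF \<rho>] elim(2)[rule_format, OF \<rho>'(3)]])
    qed
  qed
  have gg: "Lp_extension p G \<mu> t r (g r) (g t)"
    by (rule Lp_extension_flow[OF p s _ t(1) gext[OF r'] gext[OF t'(1)]]) (use r in simp)
  have "Lp_extension p G \<mu> t r (\<lambda>x. g r x + 1 * (LINT \<rho>:{s<..<r}|lborel. w r \<rho> x))
      (\<lambda>x. g t x + 1 * (LINT \<rho>:{s<..<r}|lborel. w t \<rho> x))"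
    by (intro Lp_extension_lincomb[OF p rI t(1) gg] Lp_extension_integral p rI t(1) wm r t'(2) ext w_integral_finite)
  then show ?thesis
  proof (rule Lp_extension_cong[OF p rI t(1)])
    \<comment> \<open>The mild formula holds almost everywhere for Lebesgue measure; absolute
      continuity gives it almost everywhere for \<open>\<mu> r\<close>.\<close>
    show "AE x in \<mu> r. g r x + 1 * (LINT \<rho>:{s<..<r}|lborel. w r \<rho> x) = u r x"
      using AE_lborel_mu[OF rI ueq[OF r']] by eventually_elim simp
  qed simp
qed

text \<open>The integral is over an empty interval. The time \<open>s\<close> is always treated
  separately because the data \<open>w t\<close> are given for \<open>t > s\<close> only.\<close>

lemma mild_initial: "s \<le> \<tau> \<Longrightarrow> Lp_extension p G \<mu> s s f (u s)"
  using AE_lborel_mu[OF s ueq[of s]]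
  by (intro Lp_extension_cong[OF p s order_refl gext[of s]]) (auto simp: set_lebesgue_integral_def elim: eventually_mono)

lemma mild_Lp:
  assumes "t \<in> {s..\<tau>}"
  shows "u t \<in> Lp_space p (\<mu> t)"
proof (cases "t = s")
  case True
  then show ?thesis using mild_initial Lp_extensionD(2) assms by auto
next
  case False
  then show ?thesis using assms by (intro Lp_extensionD(1)[OF mild_evolve[of t t]]) auto
qed

text \<open>The variable upper limit is moved into the indicator of an open set, which makes the
  integrand jointly measurable in limit, integration variable and space.\<close>

lemma partial_integral_measurable:
  assumes t: "t \<in> {s<..\<tau>}"
  shows "(\<lambda>(r, x). LINT \<rho>:{s<..<r}|lborel. w t \<rho> x) \<in> borel_measurable borel"
proof -
  have S: "sets ((borel :: (real \<times> (real ^ 'n)) measure) \<Otimes>\<^sub>M (lborel :: real measure)) = sets borel"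
    using sets_pair_measure_cong[OF refl sets_lborel, of "borel :: (real \<times> (real ^ 'n)) measure"] unfolding borel_prod .
  have "(\<lambda>z :: (real \<times> (real ^ 'n)) \<times> real. w t (snd z) (snd (fst z))) \<in> borel_measurable borel"
  proof -
    have "(\<lambda>z :: (real \<times> (real ^ 'n)) \<times> real. (snd z, snd (fst z))) \<in> borel_measurable borel"
      by (intro borel_measurable_continuous_onI continuous_intros)
    from measurable_compose[OF this wm[OF t]] show ?thesis by simp
  qed
  moreover have "{z :: (real \<times> (real ^ 'n)) \<times> real. s < snd z \<and> snd z < fst (fst z)} \<in> sets borel"
    by (intro borel_open open_Collect_conj open_Collect_less continuous_intros)
  ultimately have "(\<lambda>z :: (real \<times> (real ^ 'n)) \<times> real. indicator {z. s < snd z \<and> snd z < fst (fst z)} z *\<^sub>R w t (snd z) (snd (fst z)))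
      \<in> borel_measurable borel"
    by (intro borel_measurable_scaleR borel_measurable_indicator)
  then have "(\<lambda>(y, \<rho>). indicator {s<..<fst y} \<rho> *\<^sub>R w t \<rho> (snd y)) \<in> borel_measurable ((borel :: (real \<times> (real ^ 'n)) measure) \<Otimes>\<^sub>M lborel)"
    unfolding measurable_cong_sets[OF S refl] by (rule measurable_cong[THEN iffD1, rotated]) (auto simp: indicator_def)
  from lborel.borel_measurable_lebesgue_integral[OF this]
  show ?thesis unfolding set_lebesgue_integral_def by (simp add: case_prod_beta)
qed

lemma Lp_norm_power_nn:
  assumes "f' \<in> Lp_space p M"
  shows "(\<integral>\<^sup>+ x. ennreal (\<bar>f' x\<bar> powr p) \<partial>M) = ennreal (Lp_norm p M f' powr p)"
  using Lp_norm_nn[OF assms] p by simp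

text \<open>For fixed \<open>x\<close> the shifted formula and Jensen's inequality give a pointwise
  bound, which is integrated against \<open>\<mu> t\<close> using Fubini. The bound inside the time
  integral comes from contractivity of G(t,r) and from the estimate of the shifted nonlinearity by
  \<open>\<kappa> + c\<close>.\<close>

lemma mild_step:
  assumes t: "t \<in> {s<..\<tau>}" and \<kappa>: "l \<le> \<kappa>" "0 < \<kappa>"
  shows "(\<integral>\<^sup>+ x. ennreal (\<bar>u t x\<bar> powr p) \<partial>\<mu> t)
    \<le> ennreal (exp (- \<kappa> * (t - s)) * Lp_norm p (\<mu> s) f powr p)
      + ennreal (\<kappa> * (1 + c / \<kappa>) powr p)
        * (\<integral>\<^sup>+ r. ennreal (indicator {s<..<t} r * exp (- \<kappa> * (t - r))) * N' r \<partial>lborel)"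
proof -
  have t': "t \<in> {s..\<tau>}" and st: "s < t" using t by auto
  have tI: "t \<in> I" using times_I[OF t'] .
  interpret M: prob_space "\<mu> t" by (rule mu(1)[OF tI])
  have gE: "Lp_extension p G \<mu> t s f (g t)" by (rule gext[OF t'])
  have kc: "0 \<le> \<kappa> + c"
    using dissipative_shift_bound(2)[OF lip[OF t'] diss[OF tI] \<kappa>(1)] .
  define J where "J r x = (LINT \<rho>:{s<..<r}|lborel. w t \<rho> x)" for r x
  \<comment> \<open>\<open>g t\<close> is measurable for the completion only; Fubini needs a Borel
    version.\<close>
  obtain g0 where g0: "g0 \<in> borel_measurable (\<mu> t)" "AE x in \<mu> t. g t x = g0 x"
    using Lp_space_version[OF Lp_extensionD(2)[OF gE]] by blast
  have g0m: "g0 \<in> borel_measurable borel" using g0(1) unfolding mu_measurable[OF tI] .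
  \<comment> \<open>By \<open>mild_evolve\<close> the sum \<open>g t + J r\<close> is a version of
    G(t,r)u(r), so \<open>v r\<close> is a version of G(t,r) applied to the shifted nonlinearity at
    time \<open>r\<close>.\<close>
  define v where "v r x = w t r x + \<kappa> * (g0 x + J r x)" for r x
  have Jm: "(\<lambda>z. J (fst z) (snd z)) \<in> borel_measurable borel"
    using partial_integral_measurable[OF t] unfolding J_def by (simp add: case_prod_unfold)
  have wm': "(\<lambda>z. w t (fst z) (snd z)) \<in> borel_measurable borel"
    using wm[OF t] by (simp add: case_prod_unfold)
  have sndm: "(snd :: real \<times> (real ^ 'n) \<Rightarrow> _) \<in> borel_measurable borel"
    by (intro borel_measurable_continuous_onI continuous_intros)
  have fstm: "(fst :: real \<times> (real ^ 'n) \<Rightarrow> _) \<in> borel_measurable borel"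
    by (intro borel_measurable_continuous_onI continuous_intros)
  have vm: "(\<lambda>z. v (fst z) (snd z)) \<in> borel_measurable borel"
    unfolding v_def using wm' Jm measurable_compose[OF sndm g0m] by (intro borel_measurable_add borel_measurable_times) auto
  have vx: "(\<lambda>r. v r x) \<in> borel_measurable borel" for x
  proof -
    have "(\<lambda>r::real. (r, x)) \<in> borel_measurable borel"
      by (intro borel_measurable_continuous_onI continuous_intros)
    from measurable_compose[OF this vm] show ?thesis by simp
  qed
  have vr: "(\<lambda>x. v r x) \<in> borel_measurable (\<mu> t)" for r
  proof -
    have "(\<lambda>x :: real ^ 'n. (r, x)) \<in> borel_measurable borel"
      by (intro borel_measurable_continuous_onI continuous_intros)
    from measurable_compose[OF this vm] show ?thesis unfolding mu_measurable[OF tI] by simp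
  qed
  define E where "E r = indicator {s<..<t} r * (\<kappa> * exp (- \<kappa> * (t - r)))" for r
  have E0: "0 \<le> E r" for r unfolding E_def using \<kappa> by simp
  have Em: "E \<in> borel_measurable borel" unfolding E_def[abs_def] by measurable
  define H where "H r x = ennreal (E r * \<bar>v r x / \<kappa>\<bar> powr p)" for r x
  have Hm: "(\<lambda>(r, x). H r x) \<in> borel_measurable (lborel \<Otimes>\<^sub>M \<mu> t)"
  proof -
    have "(\<lambda>z. H (fst z) (snd z)) \<in> borel_measurable borel"
      unfolding H_def using vm measurable_compose[OF fstm Em] by measurable
    moreover have "sets ((lborel :: real measure) \<Otimes>\<^sub>M \<mu> t) = sets borel"
      using sets_pair_measure_cong[OF sets_lborel mu(2)[OF tI]] unfolding borel_prod .
    ultimately show ?thesis by (subst measurable_cong_sets[OF _ refl]) (simp_all add: case_prod_unfold)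
  qed
  have pw: "AE x in \<mu> t. ennreal (\<bar>u t x\<bar> powr p)
      \<le> ennreal (exp (- \<kappa> * (t - s))) * ennreal (\<bar>g0 x\<bar> powr p) + (\<integral>\<^sup>+ r. H r x \<partial>lborel)"
    using AE_lborel_mu[OF tI ueq[OF t']] AE_lborel_mu[OF tI wint[OF t]] g0(2)
  proof eventually_elim
    case (elim x)
    note sh = exp_shift[OF \<kappa>(2) st elim(2), of "g0 x", folded J_def v_def]
    have ut: "u t x = exp (- \<kappa> * (t - s)) * g0 x + (LINT r:{s<..<t}|lborel. exp (- \<kappa> * (t - r)) * v r x)"
      using elim(1,3) sh(2) unfolding J_def by simp
    have "ennreal (\<bar>u t x\<bar> powr p) \<le> ennreal (exp (- \<kappa> * (t - s)) * \<bar>g0 x\<bar> powr p)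
      + (\<integral>\<^sup>+ r. ennreal (indicator {s<..<t} r * (\<kappa> * exp (- \<kappa> * (t - r))) * \<bar>v r x / \<kappa>\<bar> powr p) \<partial>lborel)"
      unfolding ut by (rule exp_jensen[OF p \<kappa>(2) st vx sh(1)])
    then show ?case unfolding H_def E_def by (simp add: ennreal_mult)
  qed
  have vb: "AE r in lborel. (\<integral>\<^sup>+ x. H r x \<partial>\<mu> t)
      \<le> ennreal (\<kappa> * (1 + c / \<kappa>) powr p) * (ennreal (indicator {s<..<t} r * exp (- \<kappa> * (t - r))) * N' r)"
    using wext[OF t] uU
  proof eventually_elim
    case (elim r)
    show ?case
    proof (cases "r \<in> {s<..<t}")
      case False
      then show ?thesis unfolding H_def E_def by simp
    next
      case True
      then have r: "r \<in> {s<..\<tau>}" "r \<in> {s..\<tau>}" "r \<le> t" "t \<le> \<tau>" using t by auto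
      have rI: "r \<in> I" using times_I[OF r(2)] .
      have ext: "Lp_extension p G \<mu> t r (\<lambda>x. \<psi> r (u r x) + \<kappa> * u r x) (\<lambda>x. w t r x + \<kappa> * (g t x + J r x))"
        unfolding J_def
        by (rule Lp_extension_lincomb[OF p rI r(3) elim(1)[rule_format, OF True] mild_evolve[OF r(1,3,4)]])
      have "(\<integral>\<^sup>+ x. ennreal (\<bar>v r x\<bar> powr p) \<partial>\<mu> t) = (\<integral>\<^sup>+ x. ennreal (\<bar>w t r x + \<kappa> * (g t x + J r x)\<bar> powr p) \<partial>\<mu> t)"
      proof (rule nn_integral_cong_AE)
        show "AE x in \<mu> t. ennreal (\<bar>v r x\<bar> powr p) = ennreal (\<bar>w t r x + \<kappa> * (g t x + J r x)\<bar> powr p)"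
          using g0(2) by eventually_elim (simp add: v_def)
      qed
      also have "\<dots> \<le> (\<integral>\<^sup>+ x. ennreal (\<bar>\<psi> r (u r x) + \<kappa> * u r x\<bar> powr p) \<partial>\<mu> r)"
        by (rule Lp_extension_nn[OF p rI r(3) ext])
      also have "\<dots> \<le> ennreal ((\<kappa> + c) powr p) * N' r"
        by (rule power_bound[OF r(2) elim(2)[rule_format, OF r(2)] kc])
          (rule dissipative_shift_bound(3)[OF lip[OF r(2)] diss[OF rI] \<kappa>(1)])
      finally have b: "(\<integral>\<^sup>+ x. ennreal (\<bar>v r x\<bar> powr p) \<partial>\<mu> t) \<le> ennreal ((\<kappa> + c) powr p) * N' r" .
      have Hv: "H r x = ennreal (E r / \<kappa> powr p) * ennreal (\<bar>v r x\<bar> powr p)" for x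
      proof -
        have "\<bar>v r x / \<kappa>\<bar> powr p = \<bar>v r x\<bar> powr p / \<kappa> powr p"
          using \<kappa> by (simp add: powr_divide)
        then show ?thesis unfolding H_def using E0[of r] \<kappa> by (simp add: ennreal_mult[symmetric])
      qed
      have "(\<integral>\<^sup>+ x. H r x \<partial>\<mu> t) = ennreal (E r / \<kappa> powr p) * (\<integral>\<^sup>+ x. ennreal (\<bar>v r x\<bar> powr p) \<partial>\<mu> t)"
        unfolding Hv using vr[of r] by (intro nn_integral_cmult) measurable
      also have "\<dots> \<le> ennreal (E r / \<kappa> powr p) * (ennreal ((\<kappa> + c) powr p) * N' r)"
        by (intro mult_left_mono b) simp
      also have "\<dots> = ennreal (E r / \<kappa> powr p * (\<kappa> + c) powr p) * N' r"
        by (subst ennreal_mult) (use E0[of r] in \<open>auto simp only: mult.assoc intro!: divide_nonneg_nonneg powr_ge_zero\<close>)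
      also have "E r / \<kappa> powr p * (\<kappa> + c) powr p = \<kappa> * (1 + c / \<kappa>) powr p * (indicator {s<..<t} r * exp (- \<kappa> * (t - r)))"
      proof -
        have "1 + c / \<kappa> = (\<kappa> + c) / \<kappa>" using \<kappa> by (simp add: field_simps)
        then have "(1 + c / \<kappa>) powr p = (\<kappa> + c) powr p / \<kappa> powr p" using \<kappa> kc by (simp add: powr_divide)
        then show ?thesis unfolding E_def by simp
      qed
      also have "ennreal (\<kappa> * (1 + c / \<kappa>) powr p * (indicator {s<..<t} r * exp (- \<kappa> * (t - r)))) * N' r
          = ennreal (\<kappa> * (1 + c / \<kappa>) powr p) * (ennreal (indicator {s<..<t} r * exp (- \<kappa> * (t - r))) * N' r)"
        using \<kappa> by (subst ennreal_mult) (auto simp: mult.assoc)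
      finally show ?thesis .
    qed
  qed
  have sf: "pair_sigma_finite (lborel :: real measure) (\<mu> t)"
    by (intro pair_sigma_finite.intro sigma_finite_lborel M.sigma_finite_measure_axioms)
  have g0p: "(\<lambda>x. ennreal (\<bar>g0 x\<bar> powr p)) \<in> borel_measurable (\<mu> t)" using g0(1) by measurable
  have iHm: "(\<lambda>x. \<integral>\<^sup>+ r. H r x \<partial>lborel) \<in> borel_measurable (\<mu> t)"
    using lborel.borel_measurable_nn_integral[of "\<lambda>x r. H r x" "\<mu> t"] measurable_pair_swap[OF Hm]
    by (simp add: case_prod_unfold)
  have "(\<integral>\<^sup>+ x. ennreal (\<bar>u t x\<bar> powr p) \<partial>\<mu> t)
      \<le> (\<integral>\<^sup>+ x. ennreal (exp (- \<kappa> * (t - s))) * ennreal (\<bar>g0 x\<bar> powr p) + (\<integral>\<^sup>+ r. H r x \<partial>lborel) \<partial>\<mu> t)"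
    by (rule nn_integral_mono_AE[OF pw])
  also have "\<dots> = (\<integral>\<^sup>+ x. ennreal (exp (- \<kappa> * (t - s))) * ennreal (\<bar>g0 x\<bar> powr p) \<partial>\<mu> t) + (\<integral>\<^sup>+ x. (\<integral>\<^sup>+ r. H r x \<partial>lborel) \<partial>\<mu> t)"
    by (rule nn_integral_add[OF _ iHm]) (use g0p in measurable)
  also have "(\<integral>\<^sup>+ x. ennreal (exp (- \<kappa> * (t - s))) * ennreal (\<bar>g0 x\<bar> powr p) \<partial>\<mu> t)
      = ennreal (exp (- \<kappa> * (t - s))) * (\<integral>\<^sup>+ x. ennreal (\<bar>g0 x\<bar> powr p) \<partial>\<mu> t)"
    by (rule nn_integral_cmult[OF g0p])
  also have "(\<integral>\<^sup>+ x. ennreal (\<bar>g0 x\<bar> powr p) \<partial>\<mu> t) = (\<integral>\<^sup>+ x. ennreal (\<bar>g t x\<bar> powr p) \<partial>\<mu> t)"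
  proof (rule nn_integral_cong_AE)
    show "AE x in \<mu> t. ennreal (\<bar>g0 x\<bar> powr p) = ennreal (\<bar>g t x\<bar> powr p)" using g0(2) by eventually_elim simp
  qed
  also have "(\<integral>\<^sup>+ x. (\<integral>\<^sup>+ r. H r x \<partial>lborel) \<partial>\<mu> t) = (\<integral>\<^sup>+ r. (\<integral>\<^sup>+ x. H r x \<partial>\<mu> t) \<partial>lborel)"
    by (rule pair_sigma_finite.Fubini'[OF sf Hm])
  finally have "(\<integral>\<^sup>+ x. ennreal (\<bar>u t x\<bar> powr p) \<partial>\<mu> t)
      \<le> ennreal (exp (- \<kappa> * (t - s))) * (\<integral>\<^sup>+ x. ennreal (\<bar>g t x\<bar> powr p) \<partial>\<mu> t) + (\<integral>\<^sup>+ r. (\<integral>\<^sup>+ x. H r x \<partial>\<mu> t) \<partial>lborel)" .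
  also have "\<dots> \<le> ennreal (exp (- \<kappa> * (t - s))) * ennreal (Lp_norm p (\<mu> s) f powr p)
      + (\<integral>\<^sup>+ r. ennreal (\<kappa> * (1 + c / \<kappa>) powr p) * (ennreal (indicator {s<..<t} r * exp (- \<kappa> * (t - r))) * N' r) \<partial>lborel)"
  proof (intro add_mono mult_left_mono nn_integral_mono_AE vb)
    show "(\<integral>\<^sup>+ x. ennreal (\<bar>g t x\<bar> powr p) \<partial>\<mu> t) \<le> ennreal (Lp_norm p (\<mu> s) f powr p)"
      using Lp_extension_nn[OF p s less_imp_le[OF st] gE] unfolding Lp_norm_power_nn[OF Lp_extensionD(1)[OF gE]] .
  qed simp
  also have "(\<integral>\<^sup>+ r. ennreal (\<kappa> * (1 + c / \<kappa>) powr p) * (ennreal (indicator {s<..<t} r * exp (- \<kappa> * (t - r))) * N' r) \<partial>lborel)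
      = ennreal (\<kappa> * (1 + c / \<kappa>) powr p) * (\<integral>\<^sup>+ r. ennreal (indicator {s<..<t} r * exp (- \<kappa> * (t - r))) * N' r \<partial>lborel)"
  proof (rule nn_integral_cmult)
    have "(\<lambda>r. ennreal (indicator {s<..<t} r * exp (- \<kappa> * (t - r)))) \<in> borel_measurable lborel" by measurable
    then show "(\<lambda>r. ennreal (indicator {s<..<t} r * exp (- \<kappa> * (t - r))) * N' r) \<in> borel_measurable lborel"
      using N'_measurable by (intro borel_measurable_times_ennreal) auto
  qed
  finally show ?thesis by (simp add: ennreal_mult)
qed

text \<open>For each \<open>\<beta>\<close> above \<open>p * c\<close> a shift
  \<open>\<kappa>\<close> is chosen that meets the hypothesis of the Gronwall inequality; the
  resulting bound for the \<open>p\<close>-th power no longer contains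
  \<open>\<kappa>\<close>.\<close>

lemma mild_norm_bound:
  assumes t: "t \<in> {s..\<tau>}"
  shows "Lp_norm p (\<mu> t) (u t) \<le> exp (c * (t - s)) * Lp_norm p (\<mu> s) f"
proof -
  define n0 where "n0 = Lp_norm p (\<mu> s) f powr p"
  define N where "N t = (\<integral>\<^sup>+ x. ennreal (\<bar>u t x\<bar> powr p) \<partial>\<mu> t)" for t
  have p0: "0 < p" using p by simp
  have st: "s \<le> \<tau>" "s \<le> t" "t \<le> \<tau>" using t by auto
  have init: "N s \<le> ennreal n0"
    using Lp_extension_nn[OF p s order_refl mild_initial[OF st(1)]]
    unfolding N_def n0_def Lp_norm_power_nn[OF Lp_extensionD(1)[OF mild_initial[OF st(1)]]] .
  have ae: "AE r in lborel. r \<in> {s..\<tau>} \<longrightarrow> N' r = N r"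
    using uU
  proof eventually_elim
    case (elim r)
    show ?case
    proof
      assume r: "r \<in> {s..\<tau>}"
      then have mr: "max s r = r" by simp
      have "AE x in \<mu> r. ennreal (\<bar>U (r, x)\<bar> powr p) = ennreal (\<bar>u r x\<bar> powr p)"
        using elim[rule_format, OF r] by eventually_elim simp
      then show "N' r = N r" unfolding N'_def N_def mr by (rule nn_integral_cong_AE)
    qed
  qed
  have bound: "Lp_norm p (\<mu> t) (u t) powr p \<le> n0 * exp (\<beta> * (t - s))" if \<beta>: "p * c < \<beta>" for \<beta>
  proof -
    obtain \<kappa> where \<kappa>: "l < \<kappa>" "0 < \<kappa>" "\<kappa> * (1 + c / \<kappa>) powr p < \<kappa> + \<beta>"
      using powr_difference_quotient[OF \<beta>] by blast
    have "N t \<le> ennreal (n0 * exp (\<beta> * (t - s)))"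
    proof (rule gronwall_exp[OF _ _ \<kappa>(2,3) _ ae _ st(2,3)])
      fix t assume t: "s \<le> t" "t \<le> \<tau>"
      show "N t \<le> ennreal (exp (- \<kappa> * (t - s)) * n0)
          + ennreal (\<kappa> * (1 + c / \<kappa>) powr p) * (\<integral>\<^sup>+ r. ennreal (indicator {s<..<t} r * exp (- \<kappa> * (t - r))) * N' r \<partial>lborel)"
      proof (cases "t = s")
        case True
        then show ?thesis using init by simp
      next
        case False
        then show ?thesis unfolding N_def n0_def using t \<kappa> by (intro mild_step) auto
      qed
    qed (use \<kappa> Ufin in \<open>auto simp: n0_def N'_def\<close>)
    then show ?thesis unfolding N_def Lp_norm_power_nn[OF mild_Lp[OF t]]
      by (simp add: n0_def ennreal_le_iff)
  qed
  \<comment> \<open>Letting \<open>\<beta>\<close> decrease to \<open>p * c\<close> removes the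
    loss; the \<open>p\<close>-th root then yields the rate \<open>c\<close>.\<close>
  have "Lp_norm p (\<mu> t) (u t) powr p \<le> n0 * exp (p * c * (t - s))"
  proof (rule tendsto_lowerbound)
    show "((\<lambda>\<beta>. n0 * exp (\<beta> * (t - s))) \<longlongrightarrow> n0 * exp (p * c * (t - s))) (at_right (p * c))"
      by (intro tendsto_intros)
    show "\<forall>\<^sub>F \<beta> in at_right (p * c). Lp_norm p (\<mu> t) (u t) powr p \<le> n0 * exp (\<beta> * (t - s))"
      by (intro eventually_at_rightI[of _ "p * c + 1"] bound) auto
  qed simp
  also have "\<dots> = (exp (c * (t - s)) * Lp_norm p (\<mu> s) f) powr p"
    unfolding n0_def using Lp_norm_nonneg[of p "\<mu> s" f]
    by (simp add: powr_mult powr_def[of "exp _"] mult_ac)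
  finally show ?thesis unfolding Lp_norm_powr[OF p0]
    using Lp_norm_nonneg[of p "\<mu> s" f] by (intro Lp_norm_leI p0) auto
qed

end

section \<open>The norm estimate and exponential stability\<close>

context evolution
begin

lemma mild_solution_estimate:
  assumes p: "1 < p" and nu: "space_time_measure I \<mu> \<nu>" and s: "s \<in> I"
    and lip: "\<And>\<tau>. s < \<tau> \<Longrightarrow> \<exists>l>0. \<forall>t\<in>{s..\<tau>}. \<forall>\<xi> \<xi>'. \<bar>\<psi> t \<xi> - \<psi> t \<xi>'\<bar> \<le> l * \<bar>\<xi> - \<xi>'\<bar>"
    and diss: "\<And>t \<xi>. t \<in> I \<Longrightarrow> \<xi> * \<psi> t \<xi> \<le> c * \<xi>\<^sup>2"
    and u: "Lp_mild_solution p G \<mu> \<nu> \<psi> s f u" and t: "s \<le> t"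
  shows "u t \<in> Lp_space p (\<mu> t)"
    and "Lp_norm p (\<mu> t) (u t) \<le> exp (c * (t - s)) * Lp_norm p (\<mu> s) f"
proof -
  \<comment> \<open>Mild solutions are given on intervals ending strictly after \<open>s\<close>;
    the end point \<open>t + 1\<close> covers \<open>t = s\<close> as well.\<close>
  let ?\<tau> = "t + 1"
  have st: "s < ?\<tau>" using t by simp
  obtain l where l: "\<forall>t\<in>{s..?\<tau>}. \<forall>\<xi> \<xi>'. \<bar>\<psi> t \<xi> - \<psi> t \<xi>'\<bar> \<le> l * \<bar>\<xi> - \<xi>'\<bar>"
    using lip[OF st] by (elim exE conjE)
  have mild: "mild_solution p G \<mu> \<psi> s ?\<tau> f u"
    and Lp: "(\<lambda>(t, x). u t x) \<in> Lp_space p (restrict_space \<nu> ({s..?\<tau>} \<times> UNIV))"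
    using u st unfolding Lp_mild_solution_def by auto
  obtain g w where gw: "\<forall>t\<in>{s..?\<tau>}. Lp_extension p G \<mu> t s f (g t)"
     "\<forall>t\<in>{s<..?\<tau>}. (\<lambda>(r, x). w t r x) \<in> borel_measurable borel \<and>
        (AE r in lborel. r \<in> {s<..<t} \<longrightarrow> Lp_extension p G \<mu> t r (\<lambda>x. \<psi> r (u r x)) (w t r))"
     "AE x in lborel. \<forall>t\<in>{s<..?\<tau>}. set_integrable lborel {s<..<t} (\<lambda>r. w t r x)"
     "\<forall>t\<in>{s..?\<tau>}. AE x in lborel. u t x = g t x + (LINT r:{s<..<t}|lborel. w t r x)"
    using mild unfolding mild_solution_def by (elim exE conjE)
  obtain U where U: "U \<in> borel_measurable borel"
    "AE r in lborel. r \<in> {s..?\<tau>} \<longrightarrow> (AE x in \<mu> r. (\<lambda>(t, x). u t x) (r, x) = U (r, x))"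
    "(\<integral>\<^sup>+ r\<in>{s..?\<tau>}. (\<integral>\<^sup>+ x. ennreal (\<bar>U (r, x)\<bar> powr p) \<partial>\<mu> (max s r)) \<partial>lborel) < \<infinity>"
    by (rule Lp_nu_version[OF p nu s Lp])
  interpret mild_data I q b \<alpha> \<eta> \<phi> G \<mu> p s ?\<tau> l c \<psi> f u g w U
  proof unfold_locales
    show "AE x in lborel. set_integrable lborel {s<..<t} (\<lambda>r. w t r x)" if "t \<in> {s<..?\<tau>}" for t
      using gw(3) by eventually_elim (rule bspec[OF _ that])
    show "AE r in lborel. r \<in> {s..?\<tau>} \<longrightarrow> (AE x in \<mu> r. u r x = U (r, x))"
      using U(2) by simp
    show "\<bar>\<psi> t \<xi> - \<psi> t \<xi>'\<bar> \<le> l * \<bar>\<xi> - \<xi>'\<bar>" if "t \<in> {s..?\<tau>}" for t \<xi> \<xi>'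
      using l that by blast
    show "\<xi> * \<psi> t \<xi> \<le> c * \<xi>\<^sup>2" if "t \<in> I" for t \<xi> by (rule diss[OF that])
  qed (use p s U(1,3) gw(1,2,4) in \<open>fast+\<close>)
  show "u t \<in> Lp_space p (\<mu> t)" using t by (intro mild_Lp) simp
  show "Lp_norm p (\<mu> t) (u t) \<le> exp (c * (t - s)) * Lp_norm p (\<mu> s) f" using t by (intro mild_norm_bound) simp
qed

text \<open>The estimate is proportional to the norm of the datum, so
  \<open>\<delta> = \<epsilon>\<close> gives stability, and the threshold 1 with
  \<open>M = 1\<close> and \<open>\<omega> = - c\<close> gives the exponential rate.\<close>

lemma exponential_stability:
  assumes est: "\<And>s f u t. s \<in> I \<Longrightarrow> f \<in> Lp_space p (\<mu> s) \<Longrightarrow> Lp_mild_solution p G \<mu> \<nu> \<psi> s f u \<Longrightarrow> s \<le> t \<Longrightarrow>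
      u t \<in> Lp_space p (\<mu> t) \<and> Lp_norm p (\<mu> t) (u t) \<le> exp (c * (t - s)) * Lp_norm p (\<mu> s) f"
    and c: "c < 0"
  shows "exponentially_asymptotically_stable I p G \<mu> \<nu> \<psi>"
proof -
  have small: "u t \<in> Lp_space p (\<mu> t) \<and> Lp_norm p (\<mu> t) (u t) \<le> e * exp (c * (t - s))"
    if "s \<in> I" "f \<in> Lp_space p (\<mu> s)" "Lp_norm p (\<mu> s) f \<le> e" "Lp_mild_solution p G \<mu> \<nu> \<psi> s f u" "s \<le> t" for s f u t e
  proof -
    have "exp (c * (t - s)) * Lp_norm p (\<mu> s) f \<le> e * exp (c * (t - s))"
      using that(3) by (simp add: mult.commute[of e])
    with est[OF that(1,2,4,5)] show ?thesis by (blast intro: order_trans)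
  qed
  have decay: "((\<lambda>t. Lp_norm p (\<mu> t) (u t)) \<longlongrightarrow> 0) at_top"
    if "s \<in> I" "f \<in> Lp_space p (\<mu> s)" "Lp_norm p (\<mu> s) f \<le> 1" "Lp_mild_solution p G \<mu> \<nu> \<psi> s f u" for s f u
  proof (rule tendsto_sandwich[of "\<lambda>_. 0"])
    show "\<forall>\<^sub>F t in at_top. 0 \<le> Lp_norm p (\<mu> t) (u t)" by (simp add: Lp_norm_nonneg)
    show "\<forall>\<^sub>F t in at_top. Lp_norm p (\<mu> t) (u t) \<le> 1 * exp (c * (t - s))"
      using small[OF that] by (intro eventually_at_top_linorderI[of s]) simp
    show "((\<lambda>t. 1 * exp (c * (t - s))) \<longlongrightarrow> 0) at_top"
      using c by real_asymp
  qed simp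
  have contr: "e * exp (c * (t - s)) \<le> e" if "0 < e" "s \<le> t" for e t s :: real
    using that c by (simp add: mult_le_0_iff)
  show ?thesis
    unfolding exponentially_asymptotically_stable_def asymptotically_stable_def
  proof (intro conjI allI ballI impI)
    fix e s :: real assume e: "0 < e" and s: "s \<in> I"
    show "\<exists>\<delta>>0. \<forall>f\<in>Lp_space p (\<mu> s). Lp_norm p (\<mu> s) f \<le> \<delta> \<longrightarrow>
        (\<forall>u. Lp_mild_solution p G \<mu> \<nu> \<psi> s f u \<longrightarrow>
           (\<forall>t\<ge>s. u t \<in> Lp_space p (\<mu> t) \<and> Lp_norm p (\<mu> t) (u t) \<le> e))"
      using e small[OF s] contr[OF e] by (intro exI[of _ e]) (meson order_trans)
  next
    fix s assume s: "s \<in> I"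
    show "\<exists>\<delta>>0. \<forall>f\<in>Lp_space p (\<mu> s). Lp_norm p (\<mu> s) f \<le> \<delta> \<longrightarrow>
        (\<forall>u. Lp_mild_solution p G \<mu> \<nu> \<psi> s f u \<longrightarrow>
           (\<forall>t\<ge>s. u t \<in> Lp_space p (\<mu> t)) \<and> ((\<lambda>t. Lp_norm p (\<mu> t) (u t)) \<longlongrightarrow> 0) at_top)"
      using small[OF s] decay[OF s] by (intro exI[of _ 1]) simp
    show "\<exists>\<delta>>0. \<exists>M>0. \<exists>\<omega>>0. \<forall>f\<in>Lp_space p (\<mu> s). Lp_norm p (\<mu> s) f \<le> \<delta> \<longrightarrow>
        (\<forall>u. Lp_mild_solution p G \<mu> \<nu> \<psi> s f u \<longrightarrow>
           (\<forall>t\<ge>s. u t \<in> Lp_space p (\<mu> t) \<and> Lp_norm p (\<mu> t) (u t) \<le> M * exp (- \<omega> * (t - s))))"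
      by (rule exI[of _ 1], rule conjI, simp, rule exI[of _ 1], rule conjI, simp, rule exI[of _ "- c"], rule conjI)
        (use c small[OF s, where e = 1] in simp_all)
  qed
qed

end

theorem theorem5p9:
  fixes I :: "real set"
    and q :: "real \<Rightarrow> real ^ 'n::finite \<Rightarrow> real ^ 'n ^ 'n"
    and b :: "real \<Rightarrow> real ^ 'n \<Rightarrow> real ^ 'n"
    and \<alpha> :: real
    and \<eta> :: "real \<Rightarrow> real ^ 'n \<Rightarrow> real"
    and \<phi> :: "real ^ 'n \<Rightarrow> real"
    and G :: "real \<Rightarrow> real \<Rightarrow> (real ^ 'n \<Rightarrow> real) \<Rightarrow> real ^ 'n \<Rightarrow> real"
    and \<mu> :: "real \<Rightarrow> (real ^ 'n) measure"
    and \<nu> :: "(real \<times> (real ^ 'n)) measure"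
    and p :: real
    and k m :: "real \<Rightarrow> real"
    and \<psi> :: "real \<Rightarrow> real \<Rightarrow> real"
    and \<psi>\<^sub>0 :: real
  assumes standing: "standing_assumptions I q b \<alpha> \<eta> \<phi>"
    and evol: "evolution_operator I q b G"
    and meas: "tight_evolution_system I G \<phi> \<mu>"
    and nu: "space_time_measure I \<mu> \<nu>"
    and p: "1 < p"
    and a_diff_q: "\<And>i j l t x. t \<in> I \<Longrightarrow> has_pD l (\<lambda>y. q t y $ i $ j) x"
    and a_holder_q: "\<And>i j l. holder_loc \<alpha> I (\<lambda>t. pD l (\<lambda>y. q t y $ i $ j))"
    and a_diff_b: "\<And>i l t x. t \<in> I \<Longrightarrow> has_pD l (\<lambda>y. b t y $ i) x"
    and a_holder_b: "\<And>i l. holder_loc \<alpha> I (\<lambda>t. pD l (\<lambda>y. b t y $ i))"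
    and a_k: "continuous_on I k" "\<And>t. t \<in> I \<Longrightarrow> 0 \<le> k t"
    and a_grad_q: "\<And>i j t x. t \<in> I \<Longrightarrow> norm (grad (\<lambda>y. q t y $ i $ j) x) \<le> k t * \<eta> t x"
    and a_m: "continuous_on I m"
    and a_diss_b: "\<And>t x \<xi>. t \<in> I \<Longrightarrow> (jacobi (b t) x *v \<xi>) \<bullet> \<xi> \<le> m t * (norm \<xi>)\<^sup>2"
    and b_L1loc: "\<And>J. compact J \<Longrightarrow> J \<subseteq> I \<Longrightarrow> (\<lambda>t. \<psi> t 0) absolutely_integrable_on J"
    and b_lip: "\<And>s \<tau>. s \<in> I \<Longrightarrow> s < \<tau> \<Longrightarrow>
      \<exists>L>0. \<forall>t\<in>{s..\<tau>}. \<forall>\<xi> \<xi>'. \<bar>\<psi> t \<xi> - \<psi> t \<xi>'\<bar> \<le> L * \<bar>\<xi> - \<xi>'\<bar>"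
    and c: "\<And>s \<tau>. s \<in> I \<Longrightarrow> s < \<tau> \<Longrightarrow>
      \<exists>C\<^sub>0>0. \<exists>C\<^sub>1>0. \<exists>C\<^sub>2>0. \<forall>t\<in>{s..\<tau>}. \<forall>x.
        norm (q t x *v x) \<le> C\<^sub>0 * norm x * \<phi> x \<and>
        trace (q t x) \<le> C\<^sub>1 * (1 + norm x) * \<phi> x \<and>
        b t x \<bullet> x \<le> C\<^sub>2 * norm x * \<phi> x"
    and d: "\<And>t \<xi>. t \<in> I \<Longrightarrow> \<xi> * \<psi> t \<xi> \<le> \<psi>\<^sub>0 * \<xi>\<^sup>2"
  shows "(\<forall>s\<in>I. \<forall>f\<in>Lp_space p (\<mu> s). \<forall>u. Lp_mild_solution p G \<mu> \<nu> \<psi> s f u \<longrightarrow>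
            (\<forall>t\<ge>s. u t \<in> Lp_space p (\<mu> t) \<and>
               Lp_norm p (\<mu> t) (u t) \<le> exp (\<psi>\<^sub>0 * (t - s)) * Lp_norm p (\<mu> s) f)) \<and>
         (\<psi>\<^sub>0 < 0 \<longrightarrow> exponentially_asymptotically_stable I p G \<mu> \<nu> \<psi>)"
proof -
  interpret evolution I q b \<alpha> \<eta> \<phi> G \<mu>
    by unfold_locales (fact standing, fact evol, fact meas)
  have est: "u t \<in> Lp_space p (\<mu> t) \<and> Lp_norm p (\<mu> t) (u t) \<le> exp (\<psi>\<^sub>0 * (t - s)) * Lp_norm p (\<mu> s) f"
    if "s \<in> I" "Lp_mild_solution p G \<mu> \<nu> \<psi> s f u" "s \<le> t" for s f u t
    using mild_solution_estimate[OF p nu that(1) b_lip[OF that(1)] d that(2,3)] by (intro conjI)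
  show ?thesis
  proof (intro conjI impI)
    show "exponentially_asymptotically_stable I p G \<mu> \<nu> \<psi>" if "\<psi>\<^sub>0 < 0"
    proof (rule exponential_stability[OF _ that])
      fix s f u t
      assume "s \<in> I" "Lp_mild_solution p G \<mu> \<nu> \<psi> s f u" "s \<le> t"
      then show "u t \<in> Lp_space p (\<mu> t) \<and> Lp_norm p (\<mu> t) (u t) \<le> exp (\<psi>\<^sub>0 * (t - s)) * Lp_norm p (\<mu> s) f"
        by (rule est[where s = s and f = f and u = u and t = t])
    qed
  qed (use est in blast)
qed

end
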